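(* Let $s\ge 1$ be an integer, let $k(x,\alpha)=(1-x\cdot\alpha)^{s}\log(1-x\cdot\alpha)$ for $x,\alpha\in\mathbb{S}^2$ be the restricted surface spline of order $s+1$, and let $\rho>0$ be a fixed bound on the mesh ratio. There are $\tau_0>0$ and $0<\gamma_1\le\gamma_2<\infty$ such that for every $\tau\ge\tau_0$ there exist a number $J=J(\tau)$ with $\gamma_1\sqrt{\tau}\le J\le\gamma_2\sqrt{\tau}$, a threshold $H>0$, a constant $C>0$ and, for each $1\le p\le\infty$, constants $0<c_1\le c_2<\infty$ (depending on $\tau$), such that the following holds. For every finite set $\Xi\subset\mathbb{S}^2$ with $N=\#\Xi$, fill distance $h\le H$, separation radius $q$, and mesh ratio $h/q\le\rho$, there is a basis $(b_\xi)_{\xi\in\Xi}$ for the space $S(k,\Xi)$ with the following properties. (1) Each $b_\xi$ has the form $b_\xi=\sum_{\zeta\in\Xi}A_{\xi,\zeta}\,k(\cdot,\zeta)+p_\xi$ with $p_\xi\in\Pi$, and is composed of at most $\tau(\log N)^2$ kernels, that is, $\#\{\zeta\in\Xi: A_{\xi,\zeta}\neq 0\}\le\tau(\log N)^2$. (2) For all $\xi\in\Xi$ and $x\in\mathbb{S}^2$, $$|b_\xi(x)|\le C\left(1+\frac{\mathrm{dist}(x,\xi)}{h}\right)^{-J}.$$ (3) For each $1\le p\le\infty$ and all $\mathbf{a}=(a_\xi)_{\xi\in\Xi}\in\mathbb{R}^{\Xi}$, $$c_1\,q^{2/p}\,\|\mathbf{a}\|_{\ell_p(\Xi)}\le\Big\|\sum_{\xi\in\Xi}a_\xi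 b_\xi\Big\|_{L_p(\mathbb{S}^2)}\le c_2\,q^{2/p}\,\|\mathbf{a}\|_{\ell_p(\Xi)}.$$
   Context: $\mathbb{S}^2$ is the unit sphere in $\mathbb{R}^3$ with geodesic distance $\mathrm{dist}$ and its usual surface measure; $k(x,x)$ is understood as its limit value $0$. For a finite set $\Xi\subset\mathbb{S}^2$: the fill distance (mesh norm) is $h=\sup_{x\in\mathbb{S}^2}\mathrm{dist}(x,\Xi)$, the separation radius is $q=\frac12\min_{\xi\ne\zeta\in\Xi}\mathrm{dist}(\xi,\zeta)$, and the mesh ratio is $h/q$. $\Pi$ denotes the space of spherical harmonics of degree at most $s$ on $\mathbb{S}^2$. The kernel $k$ is (up to sign) conditionally positive definite with respect to $\Pi$, and the associated kernel space is $$S(k,\Xi)=\Big\{\sum_{\xi\in\Xi}a_\xi k(\cdot,\xi)+p\;:\;p\in\Pi,\ a_\xi\in\mathbb{R},\ \sum_{\xi\in\Xi}a_\xi r(\xi)=0\text{ for all }r\in\Pi\Big\}.$$ For $p=\infty$ the factor $q^{2/p}$ is $1$ and the norms are sup norms. *)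

theory Defs
  imports "HOL-Analysis.Analysis" "HOL-Library.Function_Algebras"
begin

section \<open>Functions on the sphere\<close>

abbreviation S2 :: "(real^3) set" where
  "S2 \<equiv> sphere 0 1"

text \<open>
  A function on the sphere is represented by its extension by \<open>0\<close> to the whole of \<open>real^3\<close>.
  Functions of this form are closed under the pointwise operations and are determined by their
  values on the sphere, so that span and linear independence in the space of all functions
  \<open>real^3 \<Rightarrow> real\<close> coincide with the corresponding notions for functions on the sphere.
\<close>

definition sphere_restrict :: "(real^3 \<Rightarrow> real) \<Rightarrow> real^3 \<Rightarrow> real" where
  "sphere_restrict f = (\<lambda>x. if x \<in> S2 then f x else 0)"

interpretation fun_vs: vector_space "\<lambda>(c::real) (f::real^3 \<Rightarrow> real) x. c * f x"
  by unfold_locales (auto simp: fun_eq_iff algebra_simps)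

definition is_basis_family :: "'i set \<Rightarrow> ('i \<Rightarrow> real^3 \<Rightarrow> real) \<Rightarrow> (real^3 \<Rightarrow> real) set \<Rightarrow> bool" where
  "is_basis_family I b V \<longleftrightarrow>
     inj_on b I \<and> fun_vs.independent (b ` I) \<and> fun_vs.span (b ` I) = V"


section \<open>Geometry of the sphere\<close>

definition geo_dist :: "real^3 \<Rightarrow> real^3 \<Rightarrow> real" where
  "geo_dist x y = arccos (x \<bullet> y)"

text \<open>The next two notions are only meaningful for finite sets \<open>\<Xi> \<subseteq> S2\<close> with at least
  one, respectively two, elements.\<close>

definition fill_distance :: "(real^3) set \<Rightarrow> real" where
  "fill_distance \<Xi> = (SUP x\<in>S2. INF \<xi>\<in>\<Xi>. geo_dist x \<xi>)"

definition separation_radius :: "(real^3) set \<Rightarrow> real" where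
  "separation_radius \<Xi> = 1/2 * Min {geo_dist \<xi> \<zeta> | \<xi> \<zeta>. \<xi> \<in> \<Xi> \<and> \<zeta> \<in> \<Xi> \<and> \<xi> \<noteq> \<zeta>}"

text \<open>
  Surface measure as cone measure: the measure of \<open>A\<close> is three times the volume of the cone
  \<open>{x. 0 < norm x < 1 \<and> x / norm x \<in> A}\<close>; note that \<open>sgn x = x /\<^sub>R norm x\<close>. The factor \<open>3\<close> gives
  the total mass \<open>4 * pi\<close>.
\<close>

definition surface_measure :: "(real^3) measure" where
  "surface_measure =
     scale_measure 3 (distr (restrict_space lborel (ball 0 1 - {0})) (restrict_space borel S2) sgn)"


section \<open>Norms\<close>

text \<open>The exponent ranges over the elements of \<open>ennreal\<close> that are at least \<open>1\<close>, with \<open>top\<close> for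
  infinity.\<close>

definition Lp_norm :: "ennreal \<Rightarrow> (real^3 \<Rightarrow> real) \<Rightarrow> real" where
  "Lp_norm p f =
     (if p = top then (SUP x\<in>S2. \<bar>f x\<bar>)
      else (\<integral>x. \<bar>f x\<bar> powr enn2real p \<partial>surface_measure) powr (1 / enn2real p))"

definition lp_norm :: "ennreal \<Rightarrow> 'i set \<Rightarrow> ('i \<Rightarrow> real) \<Rightarrow> real" where
  "lp_norm p I a =
     (if p = top then (SUP i\<in>I. \<bar>a i\<bar>)
      else (\<Sum>i\<in>I. \<bar>a i\<bar> powr enn2real p) powr (1 / enn2real p))"

definition scale_factor :: "real \<Rightarrow> ennreal \<Rightarrow> real" where
  "scale_factor q p = (if p = top then 1 else q powr (2 / enn2real p))"


section \<open>Spherical harmonics\<close>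

definition partial_deriv :: "3 \<Rightarrow> (real^3 \<Rightarrow> real) \<Rightarrow> real^3 \<Rightarrow> real" where
  "partial_deriv i f x = deriv (\<lambda>t. f (x + t *\<^sub>R axis i 1)) 0"

definition laplacian :: "(real^3 \<Rightarrow> real) \<Rightarrow> real^3 \<Rightarrow> real" where
  "laplacian f x = (\<Sum>i\<in>UNIV. partial_deriv i (partial_deriv i f) x)"

definition homogeneous_polynomial :: "nat \<Rightarrow> (real^3 \<Rightarrow> real) \<Rightarrow> bool" where
  "homogeneous_polynomial l f \<longleftrightarrow>
     real_polynomial_function f \<and> (\<forall>t x. f (t *\<^sub>R x) = t ^ l * f x)"

definition solid_harmonic :: "nat \<Rightarrow> (real^3 \<Rightarrow> real) \<Rightarrow> bool" where
  "solid_harmonic l f \<longleftrightarrow> homogeneous_polynomial l f \<and> (\<forall>x. laplacian f x = 0)"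

definition spherical_harmonics :: "nat \<Rightarrow> (real^3 \<Rightarrow> real) set" where
  "spherical_harmonics s =
     fun_vs.span {sphere_restrict f | l f. l \<le> s \<and> solid_harmonic l f}"


section \<open>Restricted surface splines and kernel spaces\<close>

text \<open>On the diagonal of the sphere, \<open>ln 0 = 0\<close> and \<open>s \<ge> 1\<close> give the limit value \<open>0\<close>.\<close>

definition surface_spline :: "nat \<Rightarrow> real^3 \<Rightarrow> real^3 \<Rightarrow> real" where
  "surface_spline s x \<alpha> = (1 - x \<bullet> \<alpha>) ^ s * ln (1 - x \<bullet> \<alpha>)"

definition kernel_space ::
  "nat \<Rightarrow> (real^3 \<Rightarrow> real^3 \<Rightarrow> real) \<Rightarrow> (real^3) set \<Rightarrow> (real^3 \<Rightarrow> real) set" where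
  "kernel_space s k \<Xi> =
     {sphere_restrict (\<lambda>x. \<Sum>\<xi>\<in>\<Xi>. a \<xi> * k x \<xi>) + p | a p.
        p \<in> spherical_harmonics s \<and>
        (\<forall>r\<in>spherical_harmonics s. (\<Sum>\<xi>\<in>\<Xi>. a \<xi> * r \<xi>) = 0)}"

end

(* With L = product over j <= s of (- Laplacian - j (j + 1)), the kernel k is a multiple of the
   Green function of L modulo Pi.  For a smooth function f vanishing on an h-dense set, the form
   of L is equivalent to the homogeneous Sobolev form of order s + 1 (the lower order terms are
   absorbed by a zeros lemma), and this survives conjugation by exponential weights varying on the
   scale h.  Testing the equation of a Lagrange function minus a bump with a weighted copy of
   itself shows that Lagrange functions and their coefficients decay exponentially on the scale h.
   Cutting the coefficients at distance K h |log h| and restoring the moment conditions with a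
   fixed number of extra nodes perturbs them by a power of h, of exponent proportional to K.
   Near its own node each basis function stays close to a bump, the bumps having disjoint
   supports, so the lower norm bound is diagonal dominance; the upper one is Schur's test. *)
theory Submission
  imports Defs "HOL-Computational_Algebra.Polynomial"
begin

section \<open>The surface measure\<close>

text \<open>No charts are used: derivatives are taken along the three rotation fields, and the
  Laplacian is the sum of their squares. Explicit integrals come from one source, the Laplacian of
  ln (1 + d - x . z), which yields a Dirac family, the measures of caps, Green's identity and a
  pointwise Sobolev estimate.

  The obstacle is that kernel sums are not smooth at their nodes, so neither the form of L nor the
  zeros lemma applies to them. Every energy estimate is made for a smooth approximation of the error
  that vanishes exactly on the nodes; the approximation parameter tends to 0 afterwards.

  The Sobolev estimate carries a factor |x - y| with y a zero. It makes a Lagrange function close to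
  its bump near every node, and the lower norm bound rests on this, with constants that do not
  involve tau.

  J is proportional to sqrt tau because a cap of radius K h |log h| contains about K^2 (log h)^2
  nodes, while the discarded coefficients are of size h to a power proportional to K.\<close>

abbreviation "sgm \<equiv> surface_measure"

abbreviation sint :: "(real^3 => real) => real" (binder "SI " 10) where
 "sint f \<equiv> integral\<^sup>L sgm f"

lemma space_surface_measure [simp]: "space sgm = S2"
 by (simp add: surface_measure_def space_scale_measure space_restrict_space)

lemma sets_surface_measure [simp, measurable_cong]: "sets sgm = sets (restrict_space borel S2)"
 by (simp add: surface_measure_def)

lemma sgn_in_S2: "x ~= 0 ==> sgn x : S2" for x :: "real^3"
 by (simp add: norm_sgn)

lemma sgn_measurable_S2:
 "sgn : restrict_space lborel (ball 0 1 - {0}) \<rightarrow>\<^sub>M restrict_space borel (S2)"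
proof (rule measurable_restrict_space2)
 show "sgn : space (restrict_space lborel (ball 0 1 - {0})) \<rightarrow> S2"
  by (auto simp: space_restrict_space norm_sgn)
 have "continuous_on (ball 0 1 - {0}) (sgn :: real^3 => real^3)"
  unfolding sgn_div_norm by (intro continuous_intros) auto
 then have "sgn : borel_measurable (restrict_space borel (ball 0 1 - {0::real^3}))"
  by (rule borel_measurable_continuous_on_restrict)
 then show "sgn : restrict_space lborel (ball 0 1 - {0}) \<rightarrow>\<^sub>M (borel :: (real^3) measure)"
  using measurable_cong_sets[OF sets_restrict_space_cong[OF sets_lborel] refl] by blast
qed

lemma emeasure_surface_measure:
 assumes "A : sets sgm"
 shows "emeasure sgm A = 3 * emeasure lborel {x : ball 0 1 - {0}. sgn x : A}"
proof -
 have "A \<subseteq> S2" using assms sets.sets_into_space by fastforce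
 have "emeasure sgm A = 3 * emeasure (restrict_space lborel (ball 0 1 - {0}))
   (sgn -` A \<inter> (ball 0 1 - {0}))"
  using assms unfolding surface_measure_def
  by (simp add: emeasure_distr[OF sgn_measurable_S2] space_restrict_space)
 also have "emeasure (restrict_space lborel (ball 0 1 - {0})) (sgn -` A \<inter> (ball 0 1 - {0}))
   = emeasure lborel (sgn -` A \<inter> (ball 0 1 - {0 :: real^3}))"
  by (rule emeasure_restrict_space) auto
 also have "sgn -` A \<inter> (ball 0 1 - {0}) = {x : ball 0 1 - {0}. sgn x : A}" by auto
 finally show ?thesis .
qed

lemma cone_sets:
 assumes "A : sets sgm"
 shows "{x : ball 0 1 - {0}. sgn x : A} : sets lborel"
proof -
 have "sgn -` A \<inter> space (restrict_space lborel (ball 0 1 - {0})) : sets (restrict_space lborel (ball 0 1 - {0}))"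
  using measurable_sets[OF sgn_measurable_S2] assms by simp
 moreover have "sgn -` A \<inter> space (restrict_space lborel (ball 0 1 - {0})) = {x : ball 0 1 - {0}. sgn x : A}"
  by (auto simp: space_restrict_space)
 ultimately show ?thesis
  by (simp add: sets_restrict_space_iff)
qed

lemma finite_measure_surface: "finite_measure sgm"
proof (rule finite_measureI)
 have "emeasure lborel {x : ball 0 1 - {0 :: real^3}. sgn x : S2} <= emeasure lborel (ball (0::real^3) 1)"
 proof (rule emeasure_mono)
  show "{x : ball 0 1 - {0 :: real^3}. sgn x : S2} \<subseteq> ball 0 1"
   by (rule subsetI, drule CollectD, elim conjE DiffD1)
 qed simp
 also have "... < \<infinity>" by (rule emeasure_lborel_ball_finite)
 finally show "emeasure sgm (space sgm) ~= \<infinity>"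
  using emeasure_surface_measure[OF sets.top]
  by (simp add: ennreal_mult_eq_top_iff)
qed

interpretation surf: finite_measure sgm
 by (rule finite_measure_surface)

definition area :: real where "area = measure sgm (S2)"

lemma area_pos: "area > 0"
proof -
 have eq: "{x : ball 0 1 - {0 :: real^3}. sgn x : S2} = ball 0 1 - {0}"
  using sgn_in_S2 by blast
 have "emeasure lborel (ball 0 1 - {0 :: real^3}) = emeasure lborel (ball (0::real^3) 1)"
  by (subst emeasure_Diff) auto
 moreover have "emeasure lborel (ball (0::real^3) 1) ~= 0"
  using content_ball_pos[of 1 "0::real^3"] by (auto simp: measure_def)
 ultimately have "emeasure sgm (S2) ~= 0"
  using emeasure_surface_measure[OF sets.top] eq by simp
 then show ?thesis
  unfolding area_def by (simp add: surf.emeasure_eq_measure zero_less_measure_iff)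
qed

lemma emeasure_lborel_orthogonal_vimage:
 fixes g :: "real^3 => real^3"
 assumes g: "orthogonal_transformation g" and B: "B : sets lborel" "bounded B"
 shows "emeasure lborel (g -` B) = emeasure lborel B"
proof -
 have gi: "orthogonal_transformation (inv g)" using g orthogonal_transformation_inv by blast
 have im: "g -` B = inv g ` B"
  using g by (simp add: bij_vimage_eq_inv_image orthogonal_transformation_bij)
 have lm: "B : lmeasurable" using B by (simp add: bounded_set_imp_lmeasurable)
 have "g -` B : sets borel"
  using measurable_sets_borel[OF borel_measurable_continuous_onI, of g B] g B(1)
  by (simp add: linear_continuous_on linear_linear orthogonal_transformation_linear)
 moreover have "inv g ` B : lmeasurable" "measure lebesgue (inv g ` B) = measure lebesgue B"
  using measurable_orthogonal_image[OF gi lm] measure_orthogonal_image[OF gi lm] by auto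
 ultimately have "emeasure lebesgue (g -` B) = emeasure lebesgue B"
  unfolding im using lm emeasure_eq_measure2 by metis
 then show ?thesis
  using \<open>g -` B : sets borel\<close> B by (simp add: emeasure_completion)
qed

lemma orthogonal_measurable_surface:
 assumes g: "orthogonal_transformation g"
 shows "g : sgm \<rightarrow>\<^sub>M sgm"
proof -
 have "g : restrict_space borel (S2) \<rightarrow>\<^sub>M restrict_space borel (S2)"
 proof (rule measurable_restrict_space2)
  show "g : space (restrict_space borel (S2)) \<rightarrow> S2"
   unfolding space_restrict_space using orthogonal_transformation_norm[OF g] by fastforce
  show "g : borel_measurable (restrict_space borel (S2))"
   by (intro borel_measurable_continuous_on_restrict linear_continuous_on)
    (use g orthogonal_transformation_linear linear_conv_bounded_linear in blast)
 qed
 then show ?thesis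
  using measurable_cong_sets[OF sets_surface_measure sets_surface_measure] by blast
qed

text \<open>\<open>sgn\<close> commutes with g, so the cone over a preimage is the preimage of the
  cone, and the invariance of volume applies.\<close>

lemma distr_orthogonal_surface:
 assumes g: "orthogonal_transformation g"
 shows "distr sgm sgm g = sgm"
proof (rule measure_eqI)
 fix A assume "A : sets (distr sgm sgm g)"
 then have A: "A : sets sgm" by simp
 have lin: "linear g" using g orthogonal_transformation_linear by blast
 have sg: "sgn (g x) = g (sgn x)" for x
  using g by (simp add: sgn_div_norm orthogonal_transformation_norm linear_cmul[OF lin])
 have nz: "g x = 0 \<longleftrightarrow> x = 0" for x
  using g by (metis norm_eq_zero orthogonal_transformation_norm)
 have A2: "g -` A \<inter> S2 : sets sgm"
  using measurable_sets[OF orthogonal_measurable_surface[OF g] A] by simp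
 have "emeasure (distr sgm sgm g) A = emeasure sgm (g -` A \<inter> S2)"
  using A by (simp add: emeasure_distr[OF orthogonal_measurable_surface[OF g]])
 also have "... = 3 * emeasure lborel {x : ball 0 1 - {0}. sgn x : g -` A \<inter> S2}"
  by (rule emeasure_surface_measure[OF A2])
 also have "{x : ball 0 1 - {0}. sgn x : g -` A \<inter> S2} = g -` {x : ball 0 1 - {0}. sgn x : A}"
  using g sgn_in_S2 by (auto simp: sg nz orthogonal_transformation_norm norm_sgn)
 also have "emeasure lborel ... = emeasure lborel {x : ball 0 1 - {0}. sgn x : A}"
  by (rule emeasure_lborel_orthogonal_vimage[OF g cone_sets[OF A]])
   (rule bounded_subset[of "ball 0 1"], auto)
 finally show "emeasure (distr sgm sgm g) A = emeasure sgm A"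
  using emeasure_surface_measure[OF A] by simp
qed simp

lemma S2_inner_bounds:
 assumes "x : S2" "y : S2" shows "- 1 <= x \<bullet> y" "x \<bullet> y <= 1"
 using Cauchy_Schwarz_ineq2[of x y] assms by auto

lemma S2_norm_diff: "x : S2 ==> y : S2 ==> (norm (x - y))^2 = 2 * (1 - x \<bullet> y)"
 by (simp add: power2_norm_eq_inner inner_diff_left inner_diff_right inner_commute norm_eq_1)

lemma meas_cont [intro]: "continuous_on S2 f ==> f : borel_measurable sgm"
 for f :: "real^3 => real"
 using borel_measurable_continuous_on_restrict[of S2 f] measurable_cong_sets[OF sets_surface_measure refl] by blast

lemma bounded_cont_S2:
 fixes f :: "real^3 => real"
 assumes "continuous_on S2 f" obtains B where "B > 0" "!!x. x : S2 ==> \<bar>f x\<bar> <= B"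
proof -
 have "compact (f ` S2)" using assms compact_continuous_image compact_sphere by blast
 then have "bounded (f ` S2)" by (rule compact_imp_bounded)
 then obtain B where "B > 0" "ALL y:f ` S2. norm y <= B" using bounded_pos by blast
 then show ?thesis using that by auto
qed

lemma integrable_bounded_surface:
 fixes f :: "real^3 => real"
 assumes "f : borel_measurable sgm" "!!x. x : S2 ==> \<bar>f x\<bar> <= B"
 shows "integrable sgm f"
 using assms by (intro surf.integrable_const_bound[of _ B]) auto

lemma int_cont [intro]:
 fixes f :: "real^3 => real"
 assumes "continuous_on S2 f" shows "integrable sgm f"
 using assms bounded_cont_S2 integrable_bounded_surface meas_cont by metis

lemma integral_orthogonal_surface:
 fixes f :: "real^3 => real"
 assumes "orthogonal_transformation g" "continuous_on S2 f"
 shows "(SI x. f (g x)) = (SI x. f x)"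
proof -
 have "(SI x. f x) = (\<integral>x. f x \<partial>(distr sgm sgm g))" by (simp add: distr_orthogonal_surface assms)
 also have "... = (SI x. f (g x))"
  by (intro integral_distr orthogonal_measurable_surface assms meas_cont)
 finally show ?thesis ..
qed

section \<open>Rotations\<close>

text \<open>Rodrigues' formula for the rotation by the angle t about the i-th axis. Its velocity at
  t = 0 is the cross product of the axis with x, and the three fields so obtained span every tangent
  plane of the sphere.\<close>

definition rot :: "3 => real => real^3 => real^3" where
 "rot i t x = cos t *\<^sub>R x + sin t *\<^sub>R cross3 (axis i 1) x + ((1 - cos t) * (x $ i)) *\<^sub>R axis i 1"

lemma rot_0 [simp]: "rot i 0 x = x" by (simp add: rot_def)

lemma rot_components:
 "rot 1 t x $ 1 = x $ 1" "rot 1 t x $ 2 = cos t * x $ 2 - sin t * x $ 3" "rot 1 t x $ 3 = cos t * x $ 3 + sin t * x $ 2"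
 "rot 2 t x $ 2 = x $ 2" "rot 2 t x $ 3 = cos t * x $ 3 - sin t * x $ 1" "rot 2 t x $ 1 = cos t * x $ 1 + sin t * x $ 3"
 "rot 3 t x $ 3 = x $ 3" "rot 3 t x $ 1 = cos t * x $ 1 - sin t * x $ 2" "rot 3 t x $ 2 = cos t * x $ 2 + sin t * x $ 1"
 by (simp_all add: rot_def cross_components axis_def algebra_simps)

lemma rot_add: "rot i (s + t) x = rot i s (rot i t x)"
 using exhaust_3[of i]
 by (auto simp: vec_eq_iff forall_3 rot_components cos_add sin_add algebra_simps)

lemma rot_minus [simp]: "rot i (- t) (rot i t x) = x" "rot i t (rot i (- t) x) = x"
 using rot_add[of i "-t" t x] rot_add[of i t "-t" x] by simp_all

lemma inner_rot: "rot i t x \<bullet> rot i t y = x \<bullet> y"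
proof -
 have *: "(cos t * a - sin t * b) * (cos t * a' - sin t * b') + (cos t * b + sin t * a) * (cos t * b' + sin t * a')
   = a * a' + b * b'" for a b a' b' :: real
 proof -
  have "(cos t * a - sin t * b) * (cos t * a' - sin t * b') + (cos t * b + sin t * a) * (cos t * b' + sin t * a')
    = ((cos t)^2 + (sin t)^2) * (a * a' + b * b')"
   by (simp only: power2_eq_square algebra_simps)
  then show ?thesis by simp
 qed
 show ?thesis
  using exhaust_3[of i] *[of "x$2" "x$3" "y$2" "y$3"] *[of "x$3" "x$1" "y$3" "y$1"] *[of "x$1" "x$2" "y$1" "y$2"]
  by (elim disjE) (simp_all add: inner_vec_def sum_3 rot_components)
qed

lemma linear_rot: "linear (rot i t)"
 by (rule linearI) (simp_all add: rot_def cross_add_right cross_mult_right algebra_simps)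

lemma orthogonal_rot: "orthogonal_transformation (rot i t)"
 by (simp add: orthogonal_transformation_def linear_rot inner_rot)

lemma norm_rot [simp]: "norm (rot i t x) = norm x"
 using orthogonal_rot orthogonal_transformation_norm by blast

lemma rot_S2 [simp]: "rot i t x : S2 \<longleftrightarrow> x : S2" by simp

lemma continuous_rot_t: "continuous_on UNIV (%t. rot i t x)"
 unfolding rot_def by (intro continuous_intros)

lemma continuous_rot: "continuous_on A (rot i t)"
 by (simp add: linear_continuous_on linear_linear linear_rot)

lemma S2_norm [simp]: "x : S2 ==> norm x = 1" by simp

lemma S2_inner_self [simp]: "x : S2 ==> x \<bullet> x = 1" by (simp add: norm_eq_1)

declare mem_sphere [simp del] mem_sphere_0 [simp del]

section \<open>Derivatives along rotations\<close>

definition hasX :: "3 => (real^3 => real) => (real^3 => real) => bool" where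
 "hasX i f g \<longleftrightarrow> (ALL x:S2. ((%t. f (rot i t x)) has_real_derivative g x) (at 0))"

definition Xd :: "3 => (real^3 => real) => real^3 => real" where
 "Xd i f x = deriv (%t. f (rot i t x)) 0"

text \<open>Differentiability of order n along the rotation fields, in any order of composition. The
  witness g records that the derivative exists, which the total function \<open>Xd\<close> cannot
  express.\<close>

primrec smoothn :: "nat => (real^3 => real) => bool" where
 "smoothn 0 f = continuous_on S2 f"
| "smoothn (Suc n) f = (continuous_on S2 f & (ALL i. EX g. hasX i f g & smoothn n g))"

definition smooth :: "(real^3 => real) => bool" where
 "smooth f \<longleftrightarrow> (ALL n. smoothn n f)"

lemma hasX_Xd: "hasX i f g ==> x : S2 ==> Xd i f x = g x"
 by (simp add: hasX_def Xd_def DERIV_imp_deriv)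

lemma hasX_cong:
 assumes "!!x. x : S2 ==> f x = f' x" "!!x. x : S2 ==> g x = g' x"
 shows "hasX i f g \<longleftrightarrow> hasX i f' g'"
proof -
 have "f (rot i t x) = f' (rot i t x)" if "x : S2" for t x
  using assms(1) that rot_S2 by blast
 then show ?thesis unfolding hasX_def using assms(2) by (simp cong: ball_cong)
qed

text \<open>Rotations about one axis form a one-parameter group, so the derivative at time 0 from
  the rotated point is the derivative at time t.\<close>

lemma hasX_at:
 assumes "hasX i f g" "x : S2"
 shows "((%t. f (rot i t x)) has_real_derivative g (rot i t x)) (at t)"
proof -
 have "((%s. f (rot i s (rot i t x))) has_real_derivative g (rot i t x)) (at 0)"
  using assms rot_S2 unfolding hasX_def by blast
 then have "((%s. f (rot i (s + t) x)) has_real_derivative g (rot i t x)) (at (t - t))"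
  by (simp add: rot_add)
 then show ?thesis using DERIV_shift[of "%s. f (rot i s x)" "g (rot i t x)" "t - t" t] by simp
qed

lemma smoothn_cong:
 "(!!x. x : S2 ==> f x = g x) ==> smoothn n f \<longleftrightarrow> smoothn n g"
proof (induction n)
 case 0 then show ?case using continuous_on_cong[OF refl] by (metis smoothn.simps(1))
next
 case (Suc n)
 have "continuous_on S2 f \<longleftrightarrow> continuous_on S2 g"
  using Suc.prems continuous_on_cong[OF refl] by metis
 moreover have "hasX i f k \<longleftrightarrow> hasX i g k" for i k
  using Suc.prems hasX_cong[of f g k k] by simp
 ultimately show ?case by simp
qed

lemma smooth_cong: "(!!x. x : S2 ==> f x = g x) ==> smooth f \<longleftrightarrow> smooth g"
 using smoothn_cong unfolding smooth_def by metis

lemma smoothn_continuous: "smoothn n f ==> continuous_on S2 f"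
 by (cases n) auto

lemma smoothn_SucD: "smoothn (Suc n) f ==> smoothn n f"
 by (induction n arbitrary: f) (auto, metis)

lemma smooth_continuous [intro]: "smooth f ==> continuous_on S2 f"
 using smoothn_continuous unfolding smooth_def by blast

lemma smooth_hasX: "smooth f ==> hasX i f (Xd i f)"
proof -
 assume "smooth f"
 then have "smoothn (Suc 0) f" unfolding smooth_def by blast
 then obtain g where g: "hasX i f g" by auto
 then show ?thesis using hasX_Xd[OF g] hasX_cong[of f f g "Xd i f"] by simp
qed

lemma smooth_Xd [intro]: "smooth f ==> smooth (Xd i f)"
 unfolding smooth_def
proof
 fix n assume "ALL n. smoothn n f"
 then have "smoothn (Suc n) f" by blast
 then obtain g where g: "hasX i f g" "smoothn n g" by auto
 then show "smoothn n (Xd i f)" using hasX_Xd[OF g(1)] smoothn_cong[of "Xd i f" g] by simp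
qed

lemma Xd_cong:
 assumes "!!x. x : S2 ==> f x = g x" "x : S2" shows "Xd i f x = Xd i g x"
proof -
 have "(%t. f (rot i t x)) = (%t. g (rot i t x))" using assms rot_S2 by blast
 then show ?thesis by (simp add: Xd_def)
qed

lemma smoothn_const: "smoothn n (%x. c)"
 by (induction n arbitrary: c) (auto simp: hasX_def intro!: exI[of _ "%x. 0"])

lemma hasX_inner: "hasX i (%x. x \<bullet> a) (%x. x \<bullet> cross3 a (axis i 1))"
proof -
 have "((%t. rot i t x \<bullet> a) has_real_derivative cross3 (axis i 1) x \<bullet> a) (at 0)" for x
  unfolding rot_def inner_add_left inner_scaleR_left
  by (auto intro!: derivative_eq_intros)
 moreover have "cross3 (axis i 1) x \<bullet> a = x \<bullet> cross3 a (axis i 1)" for x :: "real^3"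
  by (metis cross_triple inner_commute)
 ultimately show ?thesis by (simp add: hasX_def)
qed

lemma smoothn_inner: "smoothn n (%x. x \<bullet> a)"
proof (induction n arbitrary: a)
 case 0 show ?case by (auto intro!: continuous_intros)
next
 case (Suc n) then show ?case using hasX_inner by (auto intro!: continuous_intros) 
qed

lemma hasX_add: "hasX i f f' ==> hasX i g g' ==> hasX i (%x. f x + g x) (%x. f' x + g' x)"
 unfolding hasX_def by (auto intro!: derivative_eq_intros)

lemma hasX_mult:
 "hasX i f f' ==> hasX i g g' ==> hasX i (%x. f x * g x) (%x. f' x * g x + f x * g' x)"
 unfolding hasX_def by (auto intro!: derivative_eq_intros)

lemma hasX_compose:
 assumes "hasX i f f'" "!!x. x : S2 ==> (F has_real_derivative F' (f x)) (at (f x))"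
 shows "hasX i (%x. F (f x)) (%x. F' (f x) * f' x)"
 unfolding hasX_def
proof
 fix x assume x: "x : S2"
 have 1: "((%t. f (rot i t x)) has_real_derivative f' x) (at 0)" using assms x by (simp add: hasX_def)
 have 2: "(F has_real_derivative F' (f x)) (at (f (rot i 0 x)))" using assms x by simp
 show "((%t. F (f (rot i t x))) has_real_derivative F' (f x) * f' x) (at 0)"
  using DERIV_chain2[OF 2 1] by simp
qed

lemma smoothn_add: "smoothn n f ==> smoothn n g ==> smoothn n (%x. f x + g x)"
proof (induction n arbitrary: f g)
 case 0 then show ?case by (auto intro!: continuous_intros)
next
 case (Suc n)
 show ?case
  using Suc.prems Suc.IH hasX_add
  by (simp add: continuous_on_add) blast
qed

lemma smoothn_mult: "smoothn n f ==> smoothn n g ==> smoothn n (%x. f x * g x)"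
proof (induction n arbitrary: f g)
 case 0 then show ?case by (auto intro!: continuous_intros)
next
 case (Suc n)
 have "EX h. hasX i (%x. f x * g x) h & smoothn n h" for i
 proof -
  obtain f' where f': "hasX i f f'" "smoothn n f'" using Suc.prems(1) unfolding smoothn.simps by blast
  obtain g' where g': "hasX i g g'" "smoothn n g'" using Suc.prems(2) unfolding smoothn.simps by blast
  have "smoothn n f" "smoothn n g" using Suc.prems by (auto dest: smoothn_SucD simp del: smoothn.simps)
  then have "smoothn n (%x. f' x * g x + f x * g' x)"
   by (intro smoothn_add Suc.IH f' g')
  then show ?thesis using hasX_mult[OF f'(1) g'(1)] by blast
 qed
 then show ?case using Suc.prems by (simp add: continuous_on_mult)
qed

text \<open>F lists a scalar function and its successive derivatives; keeping k general lets the
  induction pass from \<open>F k\<close> to \<open>F (Suc k)\<close>.\<close>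

lemma smoothn_compose:
 fixes F :: "nat => real => real"
 assumes F: "!!n y. y : U ==> (F n has_real_derivative F (Suc n) y) (at y)" and f: "f ` S2 \<subseteq> U"
 shows "smoothn n f ==> smoothn n (%x. F k (f x))"
proof (induction n arbitrary: k)
 case 0
 have "continuous_on U (F k)" using F by (meson DERIV_isCont continuous_at_imp_continuous_on)
 then show ?case using 0 f by (auto intro: continuous_on_compose2)
next
 case (Suc n)
 have "continuous_on U (F k)" using F by (meson DERIV_isCont continuous_at_imp_continuous_on)
 then have c: "continuous_on S2 (%x. F k (f x))" using Suc.prems f by (auto intro: continuous_on_compose2)
 have "EX h. hasX i (%x. F k (f x)) h & smoothn n h" for i
 proof -
  obtain f' where f': "hasX i f f'" "smoothn n f'" using Suc.prems unfolding smoothn.simps by blast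
  have "hasX i (%x. F k (f x)) (%x. F (Suc k) (f x) * f' x)"
   by (rule hasX_compose[where F = "F k" and F' = "F (Suc k)", OF f'(1) F]) (use f in blast)
  moreover have "smoothn n (%x. F (Suc k) (f x) * f' x)"
   by (rule smoothn_mult[OF Suc.IH f'(2)]) (rule smoothn_SucD[OF Suc.prems])
  ultimately show ?thesis by (intro exI conjI)
 qed
 then show ?case using c by simp
qed

lemma smooth_const [simp, intro]: "smooth (%x. c)"
 and smooth_inner [simp, intro]: "smooth (%x. x \<bullet> a)"
 and smooth_add [intro]: "smooth f ==> smooth g ==> smooth (%x. f x + g x)"
 and smooth_mult [intro]: "smooth f ==> smooth g ==> smooth (%x. f x * g x)"
 by (simp_all add: smooth_def smoothn_const smoothn_inner smoothn_add smoothn_mult)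

lemma smooth_compose:
 fixes F :: "nat => real => real"
 assumes "!!n y. y : U ==> (F n has_real_derivative F (Suc n) y) (at y)" "f ` S2 \<subseteq> U" "smooth f"
 shows "smooth (%x. F k (f x))"
 using smoothn_compose[where F = F and U = U and f = f, OF assms(1,2)] assms(3) by (simp add: smooth_def)

lemma smooth_uminus [intro]: "smooth f ==> smooth (%x. - f x)"
 using smooth_mult[of "%x. -1" f] by simp

lemma smooth_diff [intro]: "smooth f ==> smooth g ==> smooth (%x. f x - g x)"
 using smooth_add[of f "%x. - g x"] smooth_uminus by simp

lemma smooth_power [intro]: "smooth f ==> smooth (%x. f x ^ n)"
 by (induction n) auto

lemma smooth_sum [intro]: "(!!a. a : A ==> smooth (f a)) ==> smooth (%x. SUM a:A. f a x)"
 by (induction A rule: infinite_finite_induct) auto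

lemma smooth_exp [intro]: "smooth f ==> smooth (%x. exp (f x))"
 by (rule smooth_compose[of UNIV "%n. exp" f 0]) auto

lemma smooth_powr [intro]:
 assumes "smooth f" "!!x. x : S2 ==> f x > 0" shows "smooth (%x. f x powr a)"
proof -
 define F where "F n y = (PROD i<n. a - real i) * y powr (a - real n)" for n y
 have "(F n has_real_derivative F (Suc n) y) (at y)" if "y : {0<..}" for n y
  unfolding F_def
  using DERIV_cmult[OF has_real_derivative_powr[of y "a - real n"], of "PROD i<n. a - real i"] that
  by (simp add: lessThan_Suc mult.assoc mult.left_commute diff_diff_eq add.commute)
 then have "smooth (%x. F 0 (f x))"
  using assms by (intro smooth_compose[where U = "{0<..}" and F = F and k = 0 and f = f]) auto
 then show ?thesis by (simp add: F_def)
qed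

lemma smooth_ln [intro]:
 assumes "smooth f" "!!x. x : S2 ==> f x > 0" shows "smooth (%x. ln (f x))"
proof -
 define F where "F n y = (case n of 0 => ln y | Suc m => (PROD i<m. - 1 - real i) * y powr (- 1 - real m))" for n y
 have "(F n has_real_derivative F (Suc n) y) (at y)" if "y : {0<..}" for n y
 proof (cases n)
  case 0
  then show ?thesis using that DERIV_ln[of y] by (simp add: F_def[abs_def] powr_minus)
 next
  case (Suc m)
  then show ?thesis
   unfolding F_def
   using DERIV_cmult[OF has_real_derivative_powr[of y "- 1 - real m"], of "PROD i<m. - 1 - real i"] that
   by (simp add: lessThan_Suc mult.assoc mult.left_commute diff_diff_eq add.commute)
 qed
 then have "smooth (%x. F 0 (f x))"
  using assms by (intro smooth_compose[where U = "{0<..}" and F = F and k = 0 and f = f]) auto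
 then show ?thesis by (simp add: F_def)
qed

lemma smooth_divide [intro]:
 assumes "smooth g" "smooth f" "!!x. x : S2 ==> f x > 0" shows "smooth (%x. g x / f x)"
proof -
 have "smooth (%x. g x * f x powr (-1))" by (intro smooth_mult smooth_powr assms)
 then show ?thesis
  using smooth_cong[of "%x. g x * f x powr (-1)" "%x. g x / f x"] assms(3)
  by (simp add: powr_minus_divide less_imp_le)
qed

lemma Xd_const [simp]: "Xd i (%x. c) x = 0" by (simp add: Xd_def)

lemma Xd_inner: "x : S2 ==> Xd i (%x. x \<bullet> a) x = x \<bullet> cross3 a (axis i 1)"
 using hasX_Xd[OF hasX_inner] by simp

lemma Xd_add: "smooth f ==> smooth g ==> x : S2 ==> Xd i (%x. f x + g x) x = Xd i f x + Xd i g x"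
 using hasX_Xd[OF hasX_add] smooth_hasX by blast

lemma Xd_mult:
 "smooth f ==> smooth g ==> x : S2 ==> Xd i (%x. f x * g x) x = Xd i f x * g x + f x * Xd i g x"
 using hasX_Xd[OF hasX_mult] smooth_hasX by blast

lemma Xd_cmult: "smooth f ==> x : S2 ==> Xd i (%x. c * f x) x = c * Xd i f x"
 using Xd_mult[of "%x. c" f] by simp

lemma Xd_sum:
 "(!!a. a : A ==> smooth (f a)) ==> x : S2 ==> Xd i (%x. SUM a:A. f a x) x = (SUM a:A. Xd i (f a) x)"
 by (induction A rule: infinite_finite_induct) (auto simp: Xd_add smooth_sum)

lemma Xd_compose:
 assumes "smooth f" "x : S2" "!!x. x : S2 ==> (F has_real_derivative F' (f x)) (at (f x))"
 shows "Xd i (%x. F (f x)) x = F' (f x) * Xd i f x"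
 using hasX_Xd[OF hasX_compose[OF smooth_hasX[OF assms(1)] assms(3)]] assms(2) by blast

section \<open>Integration by parts\<close>

text \<open>The integral of f is invariant under rotation, so every difference quotient integrates
  to 0. Dominated convergence passes to the derivative; the mean value theorem bounds the quotients
  by the supremum of \<open>Xd i f\<close>.\<close>

lemma integral_Xd:
 assumes f: "smooth f" shows "(SI x. Xd i f x) = 0"
proof -
 let ?D = "%n x. (f (rot i (1 / real (Suc n)) x) - f x) / (1 / real (Suc n))"
 obtain B where B: "B > 0" "!!x. x : S2 ==> \<bar>Xd i f x\<bar> <= B"
  using bounded_cont_S2[OF smooth_continuous[OF smooth_Xd[OF f]]] by blast
 have cont: "continuous_on S2 (%x. f (rot i t x))" for t
  by (rule continuous_on_compose2[OF smooth_continuous[OF f] continuous_rot]) auto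
 have "(%n. (SI x. ?D n x)) \<longlonglongrightarrow> (SI x. Xd i f x)"
 proof (rule integral_dominated_convergence[where w = "%x. B"])
  show "Xd i f : borel_measurable sgm" using f by (intro meas_cont smooth_continuous smooth_Xd)
  show "?D n : borel_measurable sgm" for n
   by (intro meas_cont continuous_intros cont smooth_continuous f) auto
  show "integrable sgm (%x. B)" by simp
  show "AE x in sgm. (%n. ?D n x) \<longlonglongrightarrow> Xd i f x"
  proof (rule AE_I2)
   fix x assume "x : space sgm"
   then have x: "x : S2" by simp
   have "((%t. f (rot i t x)) has_real_derivative Xd i f x) (at 0)"
    using smooth_hasX[OF f] x by (simp add: hasX_def)
   then have "((%t. (f (rot i t x) - f x) / t) \<longlongrightarrow> Xd i f x) (at 0)"
    by (simp add: has_field_derivative_iff)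
   moreover have "filterlim (%n. 1 / real (Suc n)) (at 0) sequentially"
    unfolding filterlim_at using LIMSEQ_Suc[OF lim_1_over_n] by auto
   ultimately show "(%n. ?D n x) \<longlonglongrightarrow> Xd i f x"
    by (rule filterlim_compose)
  qed
  show "AE x in sgm. norm (?D n x) <= B" for n
  proof (rule AE_I2)
   fix x assume "x : space sgm"
   then have x: "x : S2" by simp
   have "EX z. 0 < z & z < 1 / real (Suc n) &
    f (rot i (1 / real (Suc n)) x) - f (rot i 0 x) = (1 / real (Suc n) - 0) * Xd i f (rot i z x)"
    by (rule MVT2) (use hasX_at[OF smooth_hasX[OF f] x] in auto)
   then obtain z where "f (rot i (1 / real (Suc n)) x) - f x = (1 / real (Suc n)) * Xd i f (rot i z x)"
    by auto
   then show "norm (?D n x) <= B" using B(2)[of "rot i z x"] x by simp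
  qed
 qed
 moreover have "(SI x. ?D n x) = 0" for n
 proof -
  have "(SI x. f (rot i (1 / real (Suc n)) x)) = (SI x. f x)"
   by (rule integral_orthogonal_surface[OF orthogonal_rot smooth_continuous[OF f]])
  then show ?thesis
   using int_cont[OF cont] int_cont[OF smooth_continuous[OF f]] by simp
 qed
 ultimately show ?thesis using LIMSEQ_unique[OF _ tendsto_const] by simp
qed

lemma int_smooth [intro]: "smooth f ==> integrable sgm f"
 by (rule int_cont[OF smooth_continuous])

lemma integral_parts:
 assumes "smooth f" "smooth g"
 shows "(SI x. Xd i f x * g x) = - (SI x. f x * Xd i g x)"
proof -
 have "(SI x. Xd i f x * g x) + (SI x. f x * Xd i g x) = (SI x. Xd i f x * g x + f x * Xd i g x)"
  by (intro Bochner_Integration.integral_add[symmetric] int_smooth smooth_mult smooth_Xd assms)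
 also have "... = (SI x. Xd i (%x. f x * g x) x)"
  by (rule Bochner_Integration.integral_cong) (simp_all add: Xd_mult assms)
 also have "... = 0" using assms by (intro integral_Xd) blast
 finally show ?thesis by simp
qed

text \<open>The Laplace-Beltrami operator, written as the Casimir element of the rotation
  group.\<close>

definition lap :: "(real^3 => real) => real^3 => real" where
 "lap f x = (SUM i:UNIV. Xd i (Xd i f) x)"

lemma smooth_lap [intro]: "smooth f ==> smooth (lap f)"
 unfolding lap_def[abs_def] by (intro smooth_sum smooth_Xd)

lemma lap_cong:
 assumes "!!x. x : S2 ==> f x = g x" "x : S2" shows "lap f x = lap g x"
 unfolding lap_def using Xd_cong[OF Xd_cong[OF assms(1)]] assms(2) by (simp cong: sum.cong)

lemma lap_add: "smooth f ==> smooth g ==> x : S2 ==> lap (%x. f x + g x) x = lap f x + lap g x"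
proof -
 assume a: "smooth f" "smooth g" "x : S2"
 have "Xd i (Xd i (%x. f x + g x)) x = Xd i (Xd i f) x + Xd i (Xd i g) x" for i
  using a Xd_cong[of "Xd i (%x. f x + g x)" "%x. Xd i f x + Xd i g x" x i]
  by (simp add: Xd_add smooth_Xd)
 then show ?thesis by (simp add: lap_def sum.distrib)
qed

lemma lap_cmult: "smooth f ==> x : S2 ==> lap (%x. c * f x) x = c * lap f x"
proof -
 assume a: "smooth f" "x : S2"
 have "Xd i (Xd i (%x. c * f x)) x = c * Xd i (Xd i f) x" for i
  using a Xd_cong[of "Xd i (%x. c * f x)" "%x. c * Xd i f x" x i]
  by (simp add: Xd_cmult smooth_Xd)
 then show ?thesis by (simp add: lap_def sum_distrib_left)
qed

lemma lap_const [simp]: "lap (%x. c) x = 0"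
proof -
 have "Xd i (%x. c) = (%x. 0)" for i by (simp add: fun_eq_iff)
 then show ?thesis by (simp add: lap_def)
qed

lemma lap_mult:
 assumes "smooth f" "smooth g" "x : S2"
 shows "lap (%x. f x * g x) x = lap f x * g x + 2 * (SUM i:UNIV. Xd i f x * Xd i g x) + f x * lap g x"
proof -
 have "Xd i (Xd i (%x. f x * g x)) x = Xd i (Xd i f) x * g x + 2 * (Xd i f x * Xd i g x) + f x * Xd i (Xd i g) x" for i
 proof -
  have "Xd i (Xd i (%x. f x * g x)) x = Xd i (%x. Xd i f x * g x + f x * Xd i g x) x"
   using assms by (intro Xd_cong) (auto simp: Xd_mult)
  also have "... = Xd i (Xd i f) x * g x + Xd i f x * Xd i g x + (Xd i f x * Xd i g x + f x * Xd i (Xd i g) x)"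
   using assms by (simp add: Xd_add Xd_mult smooth_Xd smooth_mult)
  finally show ?thesis by simp
 qed
 then show ?thesis
  by (simp add: lap_def sum.distrib sum_distrib_left sum_distrib_right)
qed

lemma lap_symmetric:
 assumes "smooth f" "smooth g"
 shows "(SI x. lap f x * g x) = (SI x. f x * lap g x)"
proof -
 have "(SI x. lap f x * g x) = (SUM i:UNIV. (SI x. Xd i (Xd i f) x * g x))"
  unfolding lap_def sum_distrib_right
  by (intro Bochner_Integration.integral_sum int_smooth smooth_mult smooth_Xd assms)
 also have "... = (SUM i:UNIV. (SI x. f x * Xd i (Xd i g) x))"
  by (intro sum.cong refl) (simp add: integral_parts assms smooth_Xd)
 also have "... = (SI x. f x * lap g x)"
  unfolding lap_def sum_distrib_left
  by (intro Bochner_Integration.integral_sum[symmetric] int_smooth smooth_mult smooth_Xd assms)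
 finally show ?thesis .
qed

lemma integral_lap: "smooth f ==> (SI x. lap f x) = 0"
 using lap_symmetric[of f "%x. 1"] by simp

section \<open>Zonal functions\<close>

lemma axis_sum_inner_cross:
 fixes x a :: "real^3"
 shows "(SUM i:UNIV. (x \<bullet> cross3 a (axis i 1))^2) = (norm (cross3 x a))^2"
proof -
 have "x \<bullet> cross3 a (axis i 1) = cross3 x a \<bullet> axis i 1" for i
  by (simp add: inner_vec_def sum_3 cross_components algebra_simps)
 then have "(SUM i:UNIV. (x \<bullet> cross3 a (axis i 1))^2) = (SUM i:UNIV. (cross3 x a $ i)^2)"
  by (simp add: inner_axis)
 also have "... = (norm (cross3 x a))^2"
  unfolding power2_norm_eq_inner inner_vec_def by (simp add: power2_eq_square)
 finally show ?thesis .
qed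

lemma sum_Xd_inner_sq:
 assumes "x : S2" "a : S2"
 shows "(SUM i:UNIV. (Xd i (%x. x \<bullet> a) x)^2) = 1 - (x \<bullet> a)^2"
 using assms axis_sum_inner_cross[of x a] norm_cross_dot[of x a] by (simp add: Xd_inner)

lemma lap_inner:
 assumes "x : S2" shows "lap (%x. x \<bullet> a) x = - 2 * (x \<bullet> a)"
proof -
 have "Xd i (Xd i (%x. x \<bullet> a)) x = x \<bullet> cross3 (cross3 a (axis i 1)) (axis i 1)" for i
  using Xd_cong[of "Xd i (%x. x \<bullet> a)" "%x. x \<bullet> cross3 a (axis i 1)" x i] assms by (simp add: Xd_inner)
 then have "lap (%x. x \<bullet> a) x = (SUM i:UNIV. x \<bullet> cross3 (cross3 a (axis i 1)) (axis i 1))"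
  by (simp add: lap_def)
 also have "... = - 2 * (x \<bullet> a)"
  by (simp add: sum_3 inner_vec_def cross_components axis_def algebra_simps)
 finally show ?thesis .
qed

text \<open>The squared derivatives of t = x . z sum to 1 - t^2 and t is an eigenfunction for -2,
  which leaves the Legendre operator (1 - t^2) F'' - 2 t F'.\<close>

lemma lap_zonal:
 assumes z: "z : S2" and x: "x : S2"
  and F: "!!y. y : {-1..1} ==> (F has_real_derivative F' y) (at y)"
  and F': "!!y. y : {-1..1} ==> (F' has_real_derivative F'' y) (at y)"
  and sm: "smooth (%x. F' (x \<bullet> z))"
 shows "lap (%x. F (x \<bullet> z)) x = F'' (x \<bullet> z) * (1 - (x \<bullet> z)^2) - 2 * (x \<bullet> z) * F' (x \<bullet> z)"
proof -
 have r: "x \<bullet> z : {-1..1}" if "x : S2" for x using S2_inner_bounds[OF that z] by simp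
 have X: "Xd i (%x. F (x \<bullet> z)) x = F' (x \<bullet> z) * Xd i (%x. x \<bullet> z) x" if "x : S2" for i x
  by (rule Xd_compose[OF smooth_inner that]) (use F r in blast)
 have X': "Xd i (%x. F' (x \<bullet> z)) x = F'' (x \<bullet> z) * Xd i (%x. x \<bullet> z) x" if "x : S2" for i x
  by (rule Xd_compose[OF smooth_inner that]) (use F' r in blast)
 have "Xd i (Xd i (%x. F (x \<bullet> z))) x
   = F'' (x \<bullet> z) * (Xd i (%x. x \<bullet> z) x)^2 + F' (x \<bullet> z) * Xd i (Xd i (%x. x \<bullet> z)) x" for i
 proof -
  have "Xd i (Xd i (%x. F (x \<bullet> z))) x = Xd i (%x. F' (x \<bullet> z) * Xd i (%x. x \<bullet> z) x) x"
   by (rule Xd_cong[OF X x])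
  then show ?thesis
   using Xd_mult[OF sm smooth_Xd[OF smooth_inner] x] X'[OF x] by (simp add: power2_eq_square)
 qed
 then have "lap (%x. F (x \<bullet> z)) x
   = F'' (x \<bullet> z) * (SUM i:UNIV. (Xd i (%x. x \<bullet> z) x)^2) + F' (x \<bullet> z) * lap (%x. x \<bullet> z) x"
  by (simp add: lap_def sum.distrib sum_distrib_left)
 then show ?thesis using sum_Xd_inner_sq[OF x z] lap_inner[OF x] by simp
qed

section \<open>An approximate identity\<close>

lemma v_nonneg: "x : S2 ==> z : S2 ==> 0 <= 1 - x \<bullet> z" and v_le: "x : S2 ==> z : S2 ==> 1 - x \<bullet> z <= 2"
 using S2_inner_bounds[of x z] by auto

lemma vd_pos: "x : S2 ==> z : S2 ==> d > 0 ==> 0 < 1 + d - x \<bullet> z"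
 using v_nonneg[of x z] by linarith

lemma smooth_vd [intro]: "smooth (%x. c - x \<bullet> z)"
 by (intro smooth_diff smooth_const smooth_inner)

text \<open>Chosen so that \<open>area * bker d z - 1\<close> is the Laplacian of a regularized
  logarithm (\<open>lap_ln\<close>). Total mass 1 is then a consequence of integration by parts, and
  the family tends to the Dirac measure at z as d tends to 0.\<close>

definition bker :: "real => real^3 => real^3 => real" where
 "bker d z x = ((2 * d + d^2) / (1 + d - x \<bullet> z)^2) / area"

lemma lap_ln:
 assumes "z : S2" "x : S2" "d > 0"
 shows "lap (%x. ln (1 + d - x \<bullet> z)) x = area * bker d z x - 1"
proof -
 let ?w = "1 + d - x \<bullet> z"
 have w: "?w > 0" by (rule vd_pos[OF assms(2,1,3)])
 have "lap (%x. ln (1 + d - x \<bullet> z)) x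
   = (- 1 / ?w^2) * (1 - (x \<bullet> z)^2) - 2 * (x \<bullet> z) * (- 1 / ?w)"
 proof (rule lap_zonal[where F = "%y. ln (1 + d - y)" and F' = "%y. - 1 / (1 + d - y)" and F'' = "%y. - 1 / (1 + d - y)^2"])
  show "((%y. ln (1 + d - y)) has_real_derivative - 1 / (1 + d - y)) (at y)" if "y : {-1..1}" for y
   using that assms by (auto intro!: derivative_eq_intros)
  show "((%y. - 1 / (1 + d - y)) has_real_derivative - 1 / (1 + d - y)^2) (at y)" if "y : {-1..1}" for y
   using that assms by (auto intro!: derivative_eq_intros simp: power2_eq_square)
  show "smooth (%x. - 1 / (1 + d - x \<bullet> z))"
   by (intro smooth_divide smooth_const smooth_vd vd_pos assms)
 qed (use assms in auto)
 also have "... = (2 * (x \<bullet> z) * ?w - (1 - (x \<bullet> z)^2)) / ?w^2"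
  using w by (simp add: divide_simps power2_eq_square)
 also have "2 * (x \<bullet> z) * ?w - (1 - (x \<bullet> z)^2) = (2 * d + d^2) - ?w^2"
  by (simp add: power2_eq_square algebra_simps)
 also have "... / ?w^2 = area * bker d z x - 1"
  using w area_pos by (simp add: bker_def diff_divide_distrib)
 finally show ?thesis .
qed

lemma smooth_ln_vd: "z : S2 ==> d > 0 ==> smooth (%x. ln (1 + d - x \<bullet> z))"
 by (intro smooth_ln smooth_vd vd_pos)

lemma smooth_bker [intro]: "z : S2 ==> d > 0 ==> smooth (bker d z)"
 unfolding bker_def[abs_def]
 by (intro smooth_divide smooth_power smooth_const smooth_vd zero_less_power vd_pos) (simp_all add: area_pos)

lemma bker_nonneg: "d > 0 ==> 0 <= bker d z x"
 using area_pos by (simp add: bker_def)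

lemma integral_bker: assumes "z : S2" "d > 0" shows "(SI x. bker d z x) = 1"
proof -
 have "0 = (SI x. lap (%x. ln (1 + d - x \<bullet> z)) x)"
  by (rule integral_lap[symmetric]) (rule smooth_ln_vd[OF assms])
 also have "... = (SI x. area * bker d z x - 1)"
  by (rule Bochner_Integration.integral_cong) (simp_all add: lap_ln assms)
 also have "... = area * (SI x. bker d z x) - area"
  using int_smooth[OF smooth_bker[OF assms]] by (simp add: area_def)
 finally show ?thesis using area_pos by simp
qed

lemma bker_average_le:
 assumes z: "z : S2" "d > 0" and f: "f : borel_measurable sgm" "!!x. x : S2 ==> \<bar>f x\<bar> <= B"
 shows "\<bar>SI x. bker d z x * f x\<bar> <= B"
proof -
 have i: "integrable sgm (%x. bker d z x * B)"
  using int_smooth[OF smooth_bker[OF z]] by simp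
 have B0: "0 <= B" using f(2)[OF z(1)] by linarith
 have "\<bar>SI x. bker d z x * f x\<bar> <= (SI x. \<bar>bker d z x * f x\<bar>)"
  by (rule integral_abs_bound)
 also have "... <= (SI x. bker d z x * B)"
  by (rule integral_mono')
   (use i f B0 bker_nonneg[OF z(2)] in \<open>auto simp: abs_mult intro!: mult_left_mono\<close>)
 also have "... = B" using integral_bker[OF z] by simp
 finally show ?thesis .
qed

text \<open>The usual argument for approximate identities, stated for a whole family with a common
  modulus because kernel sums are approximated uniformly in the evaluation point.\<close>

lemma bker_approx_uniform:
 assumes z: "z : S2" and e: "e > 0" and B: "!!a x. a : A ==> x : S2 ==> \<bar>f a x\<bar> <= B"
  and meas: "!!a. a : A ==> f a : borel_measurable sgm"
  and eq: "!!e. e > 0 ==> EX et>0. ALL a:A. ALL x:S2. 1 - x \<bullet> z < et --> \<bar>f a x - f a z\<bar> <= e"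
 shows "EX d0>0. ALL d:{0<..<d0}. ALL a:A. \<bar>(SI x. bker d z x * f a x) - f a z\<bar> <= e"
proof -
 obtain et where et: "et > 0" "!!a x. a : A ==> x : S2 ==> 1 - x \<bullet> z < et ==> \<bar>f a x - f a z\<bar> <= e / 2"
  using eq[of "e / 2"] e by auto
 define B' where "B' = max B 1"
 have B': "B' > 0" "!!a x. a : A ==> x : S2 ==> \<bar>f a x\<bar> <= B'"
  using B unfolding B'_def by fastforce+
 \<comment> \<open>Away from z the kernel is at most (2 d + d^2) / (et^2 area), and d < 1 bounds the
   numerator by 3 d; the constant 12 makes the resulting error 6 B' d / et^2 at most e / 2.\<close>
 define d0 where "d0 = min 1 (e * et^2 / (12 * B'))"
 have "d0 > 0" using e et B' by (simp add: d0_def)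
 moreover have "\<bar>(SI x. bker d z x * f a x) - f a z\<bar> <= e" if d: "d : {0<..<d0}" and a: "a : A" for d a
 proof -
  have d': "d > 0" "d < 1" "d < e * et^2 / (12 * B')" using d by (auto simp: d0_def)
  let ?M = "2 * B' * ((2 * d + d^2) / et^2 / area)"
  have ib: "integrable sgm (bker d z)" by (rule int_smooth[OF smooth_bker[OF z d'(1)]])
  have mb: "bker d z : borel_measurable sgm" by (intro meas_cont smooth_continuous smooth_bker z d'(1))
  obtain Bb where Bb: "Bb > 0" "!!x. x : S2 ==> \<bar>bker d z x\<bar> <= Bb"
   using bounded_cont_S2[OF smooth_continuous[OF smooth_bker[OF z d'(1)]]] by blast
  have ibf: "integrable sgm (%x. bker d z x * f a x)"
  proof (rule integrable_bounded_surface[where B = "Bb * B'"])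
   show "(%x. bker d z x * f a x) : borel_measurable sgm" using mb meas[OF a] by simp
   show "\<bar>bker d z x * f a x\<bar> <= Bb * B'" if "x : S2" for x
    unfolding abs_mult using Bb(2)[OF that] B'(2)[OF a that] by (intro mult_mono) auto
  qed
  have "(SI x. bker d z x * f a x) - f a z = (SI x. bker d z x * f a x) - (SI x. bker d z x * f a z)"
   using integral_bker[OF z d'(1)] by simp
  also have "... = (SI x. bker d z x * f a x - bker d z x * f a z)"
   by (rule Bochner_Integration.integral_diff[symmetric]) (use ibf ib in auto)
  finally have "\<bar>(SI x. bker d z x * f a x) - f a z\<bar> <= (SI x. \<bar>bker d z x * f a x - bker d z x * f a z\<bar>)"
   using integral_abs_bound by simp
  also have "... <= (SI x. bker d z x * (e / 2) + ?M)"
  proof (rule integral_mono')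
   show "integrable sgm (%x. bker d z x * (e / 2) + ?M)" using ib by simp
   fix x assume "x : space sgm"
   then have x: "x : S2" by simp
   have M0: "0 <= ?M" using d' B' area_pos by simp
   have "\<bar>bker d z x * f a x - bker d z x * f a z\<bar> = bker d z x * \<bar>f a x - f a z\<bar>"
    using bker_nonneg[OF d'(1)] by (simp add: abs_mult flip: right_diff_distrib)
   also have "... <= bker d z x * (e / 2) + ?M"
   proof (cases "1 - x \<bullet> z < et")
    case True
    then have "bker d z x * \<bar>f a x - f a z\<bar> <= bker d z x * (e / 2)"
     using et(2)[OF a x] bker_nonneg[OF d'(1)] by (intro mult_left_mono) auto
    then show ?thesis using M0 by linarith
   next
    case False
    have "et^2 <= (1 + d - x \<bullet> z)^2" using False d' et by (intro power_mono) auto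
    then have "bker d z x <= (2 * d + d^2) / et^2 / area"
     unfolding bker_def using d' et(1) area_pos False
     by (intro divide_right_mono divide_left_mono mult_pos_pos zero_less_power) auto
    moreover have "\<bar>f a x - f a z\<bar> <= 2 * B'"
     using B'(2)[OF a x] B'(2)[OF a z] by linarith
    ultimately have "bker d z x * \<bar>f a x - f a z\<bar> <= ((2 * d + d^2) / et^2 / area) * (2 * B')"
     using d' area_pos by (intro mult_mono) auto
    then have "bker d z x * \<bar>f a x - f a z\<bar> <= ?M" by (simp only: mult.commute)
    moreover have "0 <= bker d z x * (e / 2)" using bker_nonneg[OF d'(1), of z x] e by simp
    ultimately show ?thesis by linarith
   qed
   finally show "\<bar>bker d z x * f a x - bker d z x * f a z\<bar> <= bker d z x * (e / 2) + ?M" .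
  qed (use bker_nonneg[OF d'(1)] d' e B' area_pos in auto)
  also have "... = e / 2 + ?M * area"
   using ib integral_bker[OF z d'(1)] by (simp add: area_def)
  also have "?M * area = 2 * B' * (2 * d + d^2) / et^2" using area_pos by simp
  also have "... <= 2 * B' * (3 * d) / et^2"
   using d' B' by (intro divide_right_mono mult_left_mono) (auto simp: power2_eq_square)
  also have "... <= e / 2" using d'(3) et B' by (simp add: field_simps)
  finally show ?thesis by simp
 qed
 ultimately show ?thesis by blast
qed

lemma cont_zonal_modulus:
 fixes f :: "real^3 => real"
 assumes f: "continuous_on S2 f" and z: "z : S2" and e: "e > 0"
 shows "EX et>0. ALL x:S2. 1 - x \<bullet> z < et --> \<bar>f x - f z\<bar> <= e"
proof -
 obtain k where k: "k > 0" "!!x. x : S2 ==> dist x z < k ==> dist (f x) (f z) < e"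
  using f z e unfolding continuous_on_iff by metis
 have "\<bar>f x - f z\<bar> <= e" if x: "x : S2" "1 - x \<bullet> z < k^2 / 2" for x
 proof -
  have "(norm (x - z))^2 < k^2" using S2_norm_diff[OF x(1) z] x(2) by simp
  then have "dist x z < k" using k(1) by (simp add: dist_norm power_less_imp_less_base)
  then show ?thesis using k(2)[OF x(1)] by (simp add: dist_real_def less_imp_le)
 qed
 then show ?thesis using k(1) by (intro exI[of _ "k^2 / 2"]) auto
qed

lemma bker_tendsto:
 assumes f: "continuous_on S2 f" and z: "z : S2"
 shows "((%d. (SI x. bker d z x * f x)) \<longlongrightarrow> f z) (at_right 0)"
proof (rule tendstoI)
 fix e :: real assume e: "e > 0"
 obtain B where "B > 0" "!!x. x : S2 ==> \<bar>f x\<bar> <= B" using bounded_cont_S2[OF f] by blast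
 then have "EX d0>0. ALL d:{0<..<d0}. ALL a:{()}. \<bar>(SI x. bker d z x * f x) - f z\<bar> <= e / 2"
  using cont_zonal_modulus[OF f z] e
  by (intro bker_approx_uniform[OF z]) (auto intro: meas_cont f)
 then obtain d0 where "d0 > 0" "!!d. d : {0<..<d0} ==> \<bar>(SI x. bker d z x * f x) - f z\<bar> <= e / 2" by blast
 then show "\<forall>\<^sub>F d in at_right 0. dist (SI x. bker d z x * f x) (f z) < e"
  unfolding eventually_at_right_field using e
  by (intro exI[of _ d0]) (force simp: dist_real_def)
qed

section \<open>Commutation relations\<close>

lemma integral_smooth_add: "smooth f ==> smooth g ==> (SI x. f x + g x) = (SI x. f x) + (SI x. g x)"
 and integral_smooth_diff: "smooth f ==> smooth g ==> (SI x. f x - g x) = (SI x. f x) - (SI x. g x)"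
 by (intro Bochner_Integration.integral_add Bochner_Integration.integral_diff int_smooth; assumption)+

lemma integral_smooth_sum:
 "(!!a. a : A ==> smooth (f a)) ==> (SI x. (SUM a:A. f a x)) = (SUM a:A. (SI x. f a x))"
 by (rule Bochner_Integration.integral_sum) blast

lemma DERIV_inverse_power:
 fixes a c y :: real
 assumes "y < a"
 shows "((%y. c / (a - y) ^ n) has_real_derivative real n * c / (a - y) ^ Suc n) (at y)"
proof (cases n)
 case (Suc m)
 have "((%y. c / (a - y) ^ Suc m) has_real_derivative
   - (c * (real (Suc m) * (a - y) ^ m * (- 1))) / ((a - y) ^ Suc m * (a - y) ^ Suc m)) (at y)"
  using assms by (auto intro!: derivative_eq_intros simp del: power_Suc)
 moreover have "- (c * (real (Suc m) * (a - y) ^ m * (- 1))) / ((a - y) ^ Suc m * (a - y) ^ Suc m)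
   = real (Suc m) * c / (a - y) ^ Suc (Suc m)"
  using assms by simp
 ultimately show ?thesis unfolding Suc by (simp del: power_Suc)
qed simp

lemma Xd_comm_zonal:
 assumes x: "x : S2" and z: "z : S2"
  and F: "!!y. y : {-1..1} ==> (F has_real_derivative F' y) (at y)"
  and F': "!!y. y : {-1..1} ==> (F' has_real_derivative F'' y) (at y)"
  and sm: "smooth (%x. F' (x \<bullet> z))"
 shows "Xd i (Xd j (%x. F (x \<bullet> z))) x - Xd j (Xd i (%x. F (x \<bullet> z))) x
  = (SUM k:UNIV. cross3 (axis j 1) (axis i 1) $ k * Xd k (%x. F (x \<bullet> z)) x)"
proof -
 have r: "x \<bullet> z : {-1..1}" if "x : S2" for x using S2_inner_bounds[OF that z] by simp
 have X: "Xd i (%x. F (x \<bullet> z)) x = F' (x \<bullet> z) * (x \<bullet> cross3 z (axis i 1))" if "x : S2" for i x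
  unfolding Xd_inner[OF that, symmetric] by (rule Xd_compose[OF smooth_inner that]) (use F r in blast)
 have X': "Xd i (%x. F' (x \<bullet> z)) x = F'' (x \<bullet> z) * (x \<bullet> cross3 z (axis i 1))" if "x : S2" for i x
  unfolding Xd_inner[OF that, symmetric] by (rule Xd_compose[OF smooth_inner that]) (use F' r in blast)
 have XX: "Xd i (Xd j (%x. F (x \<bullet> z))) x = F'' (x \<bullet> z) * (x \<bullet> cross3 z (axis i 1)) * (x \<bullet> cross3 z (axis j 1))
  + F' (x \<bullet> z) * (x \<bullet> cross3 (cross3 z (axis j 1)) (axis i 1))" for i j
 proof -
  have "Xd i (Xd j (%x. F (x \<bullet> z))) x = Xd i (%x. F' (x \<bullet> z) * (x \<bullet> cross3 z (axis j 1))) x"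
   by (rule Xd_cong[OF X x])
  then show ?thesis
   using Xd_mult[OF sm smooth_inner x] X'[OF x] Xd_inner[OF x] by simp
 qed
 have "x \<bullet> cross3 (cross3 z (axis j 1)) (axis i 1) - x \<bullet> cross3 (cross3 z (axis i 1)) (axis j 1)
   = x \<bullet> cross3 z (cross3 (axis j 1) (axis i 1))"
  by (simp add: inner_vec_def sum_3 cross_components algebra_simps)
 also have "... = (SUM k:UNIV. cross3 (axis j 1) (axis i 1) $ k * (x \<bullet> cross3 z (axis k 1)))"
  by (simp add: inner_vec_def sum_3 cross_components axis_def algebra_simps)
 finally show ?thesis
  unfolding XX X[OF x] by (simp add: algebra_simps sum_distrib_left flip: right_diff_distrib)
qed

text \<open>Smoothness only means repeated differentiability along orbits, so symmetry of second
  derivatives is not at hand. The relation is computed for zonal kernels, transferred to f by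
  integrating by parts against \<open>bker d z\<close>, and localized at z by letting d tend to
  0.\<close>

lemma Xd_commute:
 assumes f: "smooth f" and z: "z : S2"
 shows "Xd i (Xd j f) z - Xd j (Xd i f) z = (SUM k:UNIV. cross3 (axis j 1) (axis i 1) $ k * Xd k f z)"
proof -
 let ?c = "%k. cross3 (axis j 1) (axis i 1 :: real^3) $ k"
 define D where "D = (%x. Xd i (Xd j f) x - Xd j (Xd i f) x - (SUM k:UNIV. ?c k * Xd k f x))"
 have sD: "smooth D"
  unfolding D_def by (intro smooth_diff smooth_sum smooth_mult smooth_const smooth_Xd f)
 have zero: "(SI x. bker d z x * D x) = 0" if d: "d > 0" for d
 proof -
  let ?b = "bker d z"
  have sb: "smooth ?b" by (rule smooth_bker[OF z d])
  note sI = smooth_diff smooth_sum smooth_mult smooth_const smooth_Xd f sb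
  let ?K = "(2 * d + d^2) / area"
  have comm: "Xd i (Xd j ?b) x - Xd j (Xd i ?b) x = (SUM k:UNIV. ?c k * Xd k ?b x)" if x: "x : S2" for x
  proof -
   have "Xd i (Xd j (%x. (%y. ?K / (1 + d - y)^2) (x \<bullet> z))) x - Xd j (Xd i (%x. (%y. ?K / (1 + d - y)^2) (x \<bullet> z))) x
    = (SUM k:UNIV. ?c k * Xd k (%x. (%y. ?K / (1 + d - y)^2) (x \<bullet> z)) x)"
   proof (rule Xd_comm_zonal[OF x z, where F' = "%y. 2 * ?K / (1 + d - y)^3" and F'' = "%y. 6 * ?K / (1 + d - y)^4"])
    show "((%y. ?K / (1 + d - y)^2) has_real_derivative 2 * ?K / (1 + d - y)^3) (at y)" if "y : {-1..1}" for y
     using DERIV_inverse_power[of y "1 + d" ?K 2] that d by (simp add: numeral_3_eq_3 numeral_2_eq_2)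
    show "((%y. 2 * ?K / (1 + d - y)^3) has_real_derivative 6 * ?K / (1 + d - y)^4) (at y)" if "y : {-1..1}" for y
     using DERIV_inverse_power[of y "1 + d" "2 * ?K" 3] that d by (simp add: eval_nat_numeral)
    show "smooth (%x. 2 * ?K / (1 + d - x \<bullet> z)^3)"
     by (intro smooth_divide smooth_power smooth_const smooth_vd zero_less_power vd_pos z d)
   qed
   moreover have "?b = (%x. ?K / (1 + d - x \<bullet> z)^2)" by (simp add: bker_def fun_eq_iff)
   ultimately show ?thesis by simp
  qed
  have i1: "(SI x. Xd i (Xd j f) x * ?b x) = (SI x. f x * Xd j (Xd i ?b) x)" for i j
   using integral_parts[of "Xd j f" ?b i] integral_parts[of f "Xd i ?b" j] f sb smooth_Xd by simp
  have "(SI x. bker d z x * D x)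
   = (SI x. Xd i (Xd j f) x * ?b x - Xd j (Xd i f) x * ?b x - (SUM k:UNIV. ?c k * (Xd k f x * ?b x)))"
   by (rule Bochner_Integration.integral_cong) (simp_all add: D_def algebra_simps sum_distrib_left)
  also have "... = (SI x. Xd i (Xd j f) x * ?b x) - (SI x. Xd j (Xd i f) x * ?b x)
    - (SUM k:UNIV. ?c k * (SI x. Xd k f x * ?b x))"
   by (simp add: integral_smooth_add integral_smooth_diff integral_smooth_sum sI)
  also have "... = (SI x. f x * Xd j (Xd i ?b) x) - (SI x. f x * Xd i (Xd j ?b) x)
    + (SUM k:UNIV. ?c k * (SI x. f x * Xd k ?b x))"
   by (simp add: i1 integral_parts[OF f sb] sum_negf)
  also have "... = (SI x. f x * Xd j (Xd i ?b) x - f x * Xd i (Xd j ?b) x + (SUM k:UNIV. ?c k * (f x * Xd k ?b x)))"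
   by (simp add: integral_smooth_add integral_smooth_diff integral_smooth_sum sI)
  also have "... = (SI x. 0)"
  proof (rule Bochner_Integration.integral_cong[OF refl])
   fix x assume "x : space sgm"
   then have x: "x : S2" by simp
   have "f x * Xd j (Xd i ?b) x - f x * Xd i (Xd j ?b) x + (SUM k:UNIV. ?c k * (f x * Xd k ?b x))
    = f x * ((SUM k:UNIV. ?c k * Xd k ?b x) - (Xd i (Xd j ?b) x - Xd j (Xd i ?b) x))"
    by (simp add: algebra_simps sum_distrib_left)
   then show "f x * Xd j (Xd i ?b) x - f x * Xd i (Xd j ?b) x + (SUM k:UNIV. ?c k * (f x * Xd k ?b x)) = 0"
    using comm[OF x] by simp
  qed
  finally show ?thesis by simp
 qed
 have "((%d. (SI x. bker d z x * D x)) \<longlongrightarrow> D z) (at_right 0)"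
  by (rule bker_tendsto[OF smooth_continuous[OF sD] z])
 moreover have "((%d. (SI x. bker d z x * D x)) \<longlongrightarrow> 0) (at_right 0)"
  by (rule tendsto_eventually) (auto simp: eventually_at_right_field zero intro!: exI[of _ 1])
 ultimately have "D z = 0" using tendsto_unique trivial_limit_at_right_real by blast
 then show ?thesis by (simp add: D_def)
qed

text \<open>The Casimir element is central: the commutator terms are symmetric in j and k while the
  structure constants are antisymmetric, so they cancel in the sum.\<close>

lemma lap_Xd_commute:
 assumes f: "smooth f" and x: "x : S2"
 shows "Xd i (lap f) x = lap (Xd i f) x"
proof -
 let ?c = "%j k. cross3 (axis j 1) (axis i 1 :: real^3) $ k"
 have 1: "Xd i (Xd j (Xd j f)) x = Xd j (Xd j (Xd i f)) x + (SUM k:UNIV. ?c j k * (Xd k (Xd j f) x + Xd j (Xd k f) x))" for j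
 proof -
  have "Xd i (Xd j (Xd j f)) x = Xd j (Xd i (Xd j f)) x + (SUM k:UNIV. ?c j k * Xd k (Xd j f) x)"
   using Xd_commute[OF smooth_Xd[OF f] x, of i j j] by simp
  also have "Xd j (Xd i (Xd j f)) x = Xd j (%x. Xd j (Xd i f) x + (SUM k:UNIV. ?c j k * Xd k f x)) x"
  proof (rule Xd_cong[OF _ x])
   show "Xd i (Xd j f) y = Xd j (Xd i f) y + (SUM k:UNIV. ?c j k * Xd k f y)" if "y : S2" for y
    using Xd_commute[OF f that, of i j] by simp
  qed
  also have "... = Xd j (Xd j (Xd i f)) x + (SUM k:UNIV. ?c j k * Xd j (Xd k f) x)"
  proof -
   have "Xd j (%x. SUM k:UNIV. ?c j k * Xd k f x) x = (SUM k:UNIV. ?c j k * Xd j (Xd k f) x)"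
    by (subst Xd_sum) (auto simp: x f smooth_Xd Xd_cmult intro!: smooth_mult smooth_const sum.cong)
   then show ?thesis
    by (subst Xd_add) (auto simp: x f smooth_Xd intro!: smooth_sum smooth_mult smooth_const)
  qed
  finally show ?thesis by (simp add: sum.distrib algebra_simps)
 qed
 have c: "?c k j = - ?c j k" for j k
  using exhaust_3[of i] exhaust_3[of j] exhaust_3[of k]
  by (elim disjE) (simp_all add: cross_components axis_def)
 have 2: "(SUM j:UNIV. SUM k:UNIV. ?c j k * (Xd k (Xd j f) x + Xd j (Xd k f) x)) = 0"
 proof -
  let ?S = "SUM j:UNIV. SUM k:UNIV. ?c j k * (Xd k (Xd j f) x + Xd j (Xd k f) x)"
  have "?S = (SUM k:UNIV. SUM j:UNIV. ?c j k * (Xd k (Xd j f) x + Xd j (Xd k f) x))" by (rule sum.swap)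
  also have "... = (SUM k:UNIV. SUM j:UNIV. - (?c k j * (Xd j (Xd k f) x + Xd k (Xd j f) x)))"
   using c by (intro sum.cong refl) (metis add.commute mult_minus_left)
  also have "... = - ?S" by (simp add: sum_negf)
  finally show ?thesis by simp
 qed
 have "Xd i (lap f) x = (SUM j:UNIV. Xd i (Xd j (Xd j f)) x)"
  unfolding lap_def[abs_def] by (rule Xd_sum) (intro smooth_Xd f x)+
 also have "... = lap (Xd i f) x" by (simp add: 1 sum.distrib 2 lap_def)
 finally show ?thesis .
qed

section \<open>Sobolev inner products\<close>

text \<open>The homogeneous Sobolev form of order k: L_2 products summed over all words of length k
  in the rotation fields.\<close>

primrec ip :: "nat => (real^3 => real) => (real^3 => real) => real" where
 "ip 0 f g = (SI x. f x * g x)"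
| "ip (Suc k) f g = (SUM i:UNIV. ip k (Xd i f) (Xd i g))"

lemma ip_cong:
 "(!!x. x : S2 ==> f x = f' x) ==> (!!x. x : S2 ==> g x = g' x) ==> ip k f g = ip k f' g'"
proof (induction k arbitrary: f f' g g')
 case 0 then show ?case by (auto intro!: Bochner_Integration.integral_cong)
next
 case (Suc k)
 have "ip k (Xd i f) (Xd i g) = ip k (Xd i f') (Xd i g')" for i
  by (rule Suc.IH; rule Xd_cong; use Suc.prems in blast)
 then show ?case by simp
qed

lemma ip_commute: "ip k f g = ip k g f"
proof (induction k arbitrary: f g)
 case 0 show ?case
  unfolding ip.simps by (rule arg_cong[of _ _ "integral\<^sup>L sgm"]) (rule ext, rule mult.commute)
next
 case (Suc k) show ?case unfolding ip.simps by (intro sum.cong refl) (rule Suc.IH)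
qed

lemma ip_add_left:
 "smooth f ==> smooth g ==> smooth u ==> ip k (%x. f x + g x) u = ip k f u + ip k g u"
proof (induction k arbitrary: f g u)
 case 0
 then show ?case
  by (simp add: distrib_right) (intro Bochner_Integration.integral_add int_smooth smooth_mult)
next
 case (Suc k)
 have "ip k (Xd i (%x. f x + g x)) (Xd i u) = ip k (%x. Xd i f x + Xd i g x) (Xd i u)" for i
  by (rule ip_cong) (simp_all add: Xd_add Suc.prems)
 then show ?case using Suc by (simp add: smooth_Xd sum.distrib)
qed

lemma ip_cmult_left: "smooth f ==> smooth u ==> ip k (%x. c * f x) u = c * ip k f u"
proof (induction k arbitrary: f u)
 case 0 show ?case by (simp only: ip.simps mult.assoc integral_mult_right_zero)
next
 case (Suc k)
 have "ip k (Xd i (%x. c * f x)) (Xd i u) = ip k (%x. c * Xd i f x) (Xd i u)" for i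
  by (rule ip_cong[OF Xd_cmult[OF Suc.prems(1)] refl])
 moreover have "ip k (%x. c * Xd i f x) (Xd i u) = c * ip k (Xd i f) (Xd i u)" for i
  by (rule Suc.IH) (intro smooth_Xd Suc.prems)+
 ultimately show ?case by (simp add: sum_distrib_left)
qed

lemma ip_add_right:
 assumes "smooth f" "smooth g" "smooth u"
 shows "ip k u (%x. f x + g x) = ip k u f + ip k u g"
 using ip_add_left[OF assms, of k] ip_commute[of k u f] ip_commute[of k u g] ip_commute[of k u "%x. f x + g x"]
 by linarith

lemma ip_cmult_right:
 assumes "smooth f" "smooth u" shows "ip k u (%x. c * f x) = c * ip k u f"
 unfolding ip_commute[of k u f] ip_commute[of k u "%x. c * f x"] by (rule ip_cmult_left[OF assms])

lemma ip_nonneg: "0 <= ip k f f"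
proof (induction k arbitrary: f)
 case 0 show ?case unfolding ip.simps by (rule Bochner_Integration.integral_nonneg) simp
next
 case (Suc k) show ?case unfolding ip.simps by (intro sum_nonneg Suc.IH)
qed

lemma quadratic_nonneg_discriminant:
 fixes a b c :: real
 assumes "!!t. 0 <= a + 2 * b * t + c * t^2" shows "b^2 <= a * c"
proof (cases "c = 0")
 case True
 have "b = 0"
 proof (rule ccontr)
  assume "b ~= 0"
  then have "(- (a + 1) / (2 * b)) * (2 * b) = - (a + 1)"
   by simp
  then have "2 * b * (- (a + 1) / (2 * b)) = - (a + 1)" by (simp only: mult.commute)
  then show False using assms[of "- (a + 1) / (2 * b)"] unfolding True by linarith
 qed
 then show ?thesis using True by simp
next
 case False
 have "c >= 0"
 proof (rule ccontr)
  assume "\<not> c >= 0"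
  define t where "t = (\<bar>a\<bar> + 2 * \<bar>b\<bar> + 1) / (- c) + 1"
  have "t >= 1" using \<open>\<not> c >= 0\<close> by (simp add: t_def divide_nonneg_neg)
  have "- c * t = \<bar>a\<bar> + 2 * \<bar>b\<bar> + 1 - c" using \<open>\<not> c >= 0\<close> by (simp add: t_def field_simps)
  then have "c * t^2 = - (\<bar>a\<bar> + 2 * \<bar>b\<bar> + 1 - c) * t" by (simp add: power2_eq_square flip: mult.assoc)
  then have "a + 2 * b * t + c * t^2 = a - \<bar>a\<bar> * t + 2 * (b - \<bar>b\<bar>) * t - (1 - c) * t" by (simp add: algebra_simps)
  moreover have "\<bar>a\<bar> * 1 <= \<bar>a\<bar> * t" using \<open>t >= 1\<close> by (intro mult_left_mono) auto
  moreover have "(b - \<bar>b\<bar>) * t <= 0" using \<open>t >= 1\<close> by (intro mult_nonpos_nonneg) auto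
  moreover have "(1 - c) * t > 0" using \<open>t >= 1\<close> \<open>\<not> c >= 0\<close> by simp
  ultimately have "a + 2 * b * t + c * t^2 < 0" by linarith
  then show False using assms[of t] by linarith
 qed
 then have c: "c > 0" using False by simp
 have "0 <= a + 2 * b * (- b / c) + c * (- b / c)^2" by (rule assms)
 also have "... = a - b^2 / c" using c by (simp add: power2_eq_square field_simps)
 finally show ?thesis using c by (simp add: field_simps)
qed

lemma ip_Cauchy_Schwarz:
 assumes f: "smooth f" and g: "smooth g" shows "(ip k f g)^2 <= ip k f f * ip k g g"
proof (rule quadratic_nonneg_discriminant)
 fix t
 have s: "smooth (%x. t * g x)" by (intro smooth_mult smooth_const g)
 have "0 <= ip k (%x. f x + t * g x) (%x. f x + t * g x)" by (rule ip_nonneg)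
 also have "... = ip k f f + 2 * ip k f g * t + ip k g g * t^2"
  using f g s smooth_add[OF f s]
  by (simp add: ip_add_left ip_add_right ip_cmult_left ip_cmult_right ip_commute[of k g f] power2_eq_square algebra_simps)
 finally show "0 <= ip k f f + 2 * ip k f g * t + ip k g g * t^2" .
qed

text \<open>The Laplacian commutes with the k derivatives in front of it, so one integration by
  parts at order 0 settles every order.\<close>

lemma ip_lap: "smooth f ==> smooth g ==> ip k (lap f) g = - ip (Suc k) f g"
proof (induction k arbitrary: f g)
 case 0
 have "ip 0 (lap f) g = (SUM i:UNIV. (SI x. Xd i (Xd i f) x * g x))"
  unfolding ip.simps lap_def sum_distrib_right
  by (intro Bochner_Integration.integral_sum int_smooth smooth_mult smooth_Xd 0)
 also have "... = - ip (Suc 0) f g"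
  using 0 by (simp add: integral_parts smooth_Xd sum_negf)
 finally show ?case .
next
 case (Suc k)
 have "ip (Suc k) (lap f) g = (SUM i:UNIV. ip k (lap (Xd i f)) (Xd i g))"
  using Suc.prems by (auto intro!: sum.cong ip_cong simp: lap_Xd_commute)
 then show ?case using Suc by (simp add: smooth_Xd sum_negf)
qed

lemma ip_lap_lap: "smooth f ==> ip k (lap f) (lap f) = ip (Suc (Suc k)) f f"
proof -
 assume f: "smooth f"
 have "ip k (lap f) (lap f) = - ip (Suc k) f (lap f)" by (rule ip_lap[OF f smooth_lap[OF f]])
 also have "... = - ip (Suc k) (lap f) f" by (simp only: ip_commute[of "Suc k" f])
 also have "... = ip (Suc (Suc k)) f f" using ip_lap[OF f f, of "Suc k"] by simp
 finally show ?thesis .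
qed

text \<open>Cauchy-Schwarz for the pair \<open>lap f\<close> and f in the form of order k. This
  interpolation inequality carries the zeros lemma from one order to all others.\<close>

lemma ip_log_convex: "smooth f ==> (ip (Suc k) f f)^2 <= ip k f f * ip (Suc (Suc k)) f f"
 using ip_Cauchy_Schwarz[of "lap f" f k] ip_lap[of f f k] ip_lap_lap[of f k] smooth_lap
 by (simp add: mult.commute del: ip.simps)

section \<open>Caps\<close>

text \<open>The size is measured by 1 - x . z, half the squared chord: membership is linear in x,
  and the measure of the cap is proportional to a.\<close>

definition cap :: "real^3 => real => (real^3) set" where
 "cap z a = {x : S2. 1 - x \<bullet> z <= a}"

lemma cap_sets [measurable, simp]: "cap z a : sets sgm"
proof -
 have "closed (cap z a)"
  unfolding cap_def by (intro closed_Collect_conj closed_Collect_le continuous_intros) (auto simp: Collect_mem_eq)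
 then have "cap z a : sets borel" by simp
 moreover have "cap z a \<subseteq> S2" by (auto simp: cap_def)
 ultimately show ?thesis unfolding sets_surface_measure
  by (simp add: sets_restrict_space_iff)
qed

lemma cap_Int_S2 [simp]: "cap z a \<inter> S2 = cap z a"
 by (auto simp: cap_def)

lemma integrable_cap [simp]: "integrable sgm (indicat_real (cap z a))"
 by (rule integrable_bounded_surface[where B = 1]) (auto simp: indicator_def)

lemma integral_vd_neg2:
 assumes "z : S2" "d > 0"
 shows "(SI x. 1 / (1 + d - x \<bullet> z)^2) = area / (2 * d + d^2)"
  "integrable sgm (%x. 1 / (1 + d - x \<bullet> z)^2)"
proof -
 have p: "2 * d + d^2 > 0" using assms by (simp add: add_pos_pos)
 have eq: "1 / (1 + d - x \<bullet> z)^2 = area / (2 * d + d^2) * bker d z x" for x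
  using p area_pos by (simp add: bker_def)
 show "(SI x. 1 / (1 + d - x \<bullet> z)^2) = area / (2 * d + d^2)"
  unfolding eq using integral_bker[OF assms] by simp
 show "integrable sgm (%x. 1 / (1 + d - x \<bullet> z)^2)"
  unfolding eq using int_smooth[OF smooth_bker[OF assms]] by simp
qed

text \<open>On the cap the function 4 a^2 / (1 + a - x . z)^2 is at least 1, and its integral is
  known from the mass of \<open>bker\<close>.\<close>

lemma cap_upper:
 assumes z: "z : S2" and a: "a > 0" shows "measure sgm (cap z a) <= 2 * area * a"
proof -
 have "measure sgm (cap z a) = (SI x. indicat_real (cap z a) x)" by simp
 also have "... <= (SI x. 4 * a^2 * (1 / (1 + a - x \<bullet> z)^2))"
 proof (rule integral_mono')
  show "integrable sgm (%x. 4 * a^2 * (1 / (1 + a - x \<bullet> z)^2))"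
   by (rule integrable_mult_right[OF integral_vd_neg2(2)[OF z a]])
  fix x assume "x : space sgm"
  then have x: "x : S2" by simp
  have w: "1 + a - x \<bullet> z > 0" by (rule vd_pos[OF x z a])
  show "indicat_real (cap z a) x <= 4 * a^2 * (1 / (1 + a - x \<bullet> z)^2)"
  proof (cases "x : cap z a")
   case True
   then have "(1 + a - x \<bullet> z)^2 <= (2 * a)^2" using w by (intro power_mono) (auto simp: cap_def)
   then show ?thesis using w True by (simp add: power2_eq_square)
  qed simp
 qed simp
 also have "... = 4 * a^2 * (area / (2 * a + a^2))"
  by (simp only: integral_mult_right_zero integral_vd_neg2(1)[OF z a])
 also have "... <= 4 * a^2 * (area / (2 * a))"
  using a area_pos by (intro mult_left_mono divide_left_mono) (auto simp: add_pos_pos)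
 also have "... = 2 * area * a" using a by (simp add: power2_eq_square)
 finally show ?thesis .
qed

text \<open>The integral of (1 + d - x . z)^(-2) at d = a / 16 is large, and outside the cap its
  integrand is at most 4 times the one with d = a. The difference of the two known integrals must
  therefore come from the cap.\<close>

lemma cap_lower:
 assumes z: "z : S2" and a: "0 < a" "a <= 2" shows "area * a / 256 <= measure sgm (cap z a)"
proof -
 let ?d = "a / 16"
 have d: "?d > 0" using a by simp
 have "area / (2 * ?d + ?d^2) = (SI x. 1 / (1 + ?d - x \<bullet> z)^2)"
  using integral_vd_neg2(1)[OF z d] by simp
 also have "... <= (SI x. 256 / a^2 * indicat_real (cap z a) x + 4 * (1 / (1 + a - x \<bullet> z)^2))"
 proof (rule integral_mono')
  show "integrable sgm (%x. 256 / a^2 * indicat_real (cap z a) x + 4 * (1 / (1 + a - x \<bullet> z)^2))"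
   by (intro Bochner_Integration.integrable_add integrable_mult_right integral_vd_neg2(2) z a integrable_cap)
  fix x assume "x : space sgm"
  then have x: "x : S2" by simp
  have v: "0 <= 1 - x \<bullet> z" by (rule v_nonneg[OF x z])
  show "1 / (1 + ?d - x \<bullet> z)^2 <= 256 / a^2 * indicat_real (cap z a) x + 4 * (1 / (1 + a - x \<bullet> z)^2)"
  proof (cases "x : cap z a")
   case True
   have "?d^2 <= (1 + ?d - x \<bullet> z)^2" using v d by (intro power_mono) auto
   then have "1 / (1 + ?d - x \<bullet> z)^2 <= 1 / ?d^2" using v d a by (intro divide_left_mono) auto
   also have "... = 256 / a^2" by (simp add: power2_eq_square)
   finally show ?thesis using True by (simp add: add_increasing2)
  next
   case False
   then have va: "1 - x \<bullet> z > a" using x by (simp add: cap_def)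
   have "((1 + a - x \<bullet> z) / 2)^2 <= (1 + ?d - x \<bullet> z)^2" using va a by (intro power_mono) auto
   then have "1 / (1 + ?d - x \<bullet> z)^2 <= 1 / ((1 + a - x \<bullet> z) / 2)^2" using va a by (intro divide_left_mono) auto
   also have "... = 4 * (1 / (1 + a - x \<bullet> z)^2)" by (simp add: power2_eq_square)
   finally show ?thesis using False by simp
  qed
 qed simp
 also have "... = 256 / a^2 * measure sgm (cap z a) + 4 * (area / (2 * a + a^2))"
  by (subst Bochner_Integration.integral_add)
   (use integral_vd_neg2[OF z a(1)] in \<open>auto intro!: integrable_mult_right simp del: times_divide_eq_right times_divide_eq_left\<close>)
 finally have 1: "area / (2 * ?d + ?d^2) - 4 * (area / (2 * a + a^2)) <= 256 / a^2 * measure sgm (cap z a)" by simp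
 have "2 * ?d + ?d^2 <= a / 7" 
 proof -
  have "a * a <= 2 * a" using a by (intro mult_right_mono) auto
  moreover have "2 * ?d + ?d^2 = a / 8 + a * a / 256" by (simp add: power2_eq_square)
  ultimately show ?thesis using a(1) by linarith
 qed
 then have "area * 7 / a <= area / (2 * ?d + ?d^2)"
  using a area_pos divide_left_mono[of "2 * ?d + ?d^2" "a / 7" area] by (simp add: add_pos_pos)
 moreover have "4 * (area / (2 * a + a^2)) <= 4 * (area / (2 * a))"
  using a area_pos by (intro mult_left_mono divide_left_mono) (auto simp: add_pos_pos)
 then have "4 * (area / (2 * a + a^2)) <= 2 * area / a" by simp
 ultimately have "area * 7 / a - 2 * area / a <= area / (2 * ?d + ?d^2) - 4 * (area / (2 * a + a^2))"
  by (intro diff_mono)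
 then have "area * 7 / a - 2 * area / a <= 256 / a^2 * measure sgm (cap z a)" using 1 by (rule order_trans)
 then have "area * 5 / a <= 256 / a^2 * measure sgm (cap z a)" by (simp add: mult.commute flip: diff_divide_distrib)
 then have "area * 5 / a * (a^2 / 256) <= measure sgm (cap z a)" using a by (simp add: field_simps power2_eq_square)
 moreover have "area * 5 / a * (a^2 / 256) = 5 * (area * a / 256)" using a by (simp add: power2_eq_square)
 moreover have "area * a / 256 <= 5 * (area * a / 256)" using a area_pos by simp
 ultimately show ?thesis by (metis order_trans)
qed

lemma integrable_cap_mult:
 assumes "continuous_on S2 g" shows "integrable sgm (%x. indicat_real (cap z a) x * g x)"
 using integrable_mult_indicator[OF cap_sets int_cont[OF assms]] by simp

lemma continuous_vd: "continuous_on A (%x. c - x \<bullet> z)"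
 by (intro continuous_intros)

text \<open>Dyadic induction on the size of the cap, starting where a is at most d. Halving the cap
  costs 4 area sqrt (a / 2), and the factor 10 closes the recursion because (10 + 4) / sqrt 2 is at
  most 10. The bound is uniform in d.\<close>

lemma cap_integral_inv_sqrt:
 assumes z: "z : S2" and d: "d > 0" and a: "a > 0"
 shows "(SI x. indicat_real (cap z a) x * (1 / sqrt (1 + d - x \<bullet> z))) <= 10 * area * sqrt a"
proof -
 let ?I = "%a. (SI x. indicat_real (cap z a) x * (1 / sqrt (1 + d - x \<bullet> z)))"
 have cont: "continuous_on S2 (%x. 1 / sqrt (1 + d - x \<bullet> z))"
  using vd_pos[OF _ z d] by (intro continuous_intros) (auto simp: less_imp_neq[symmetric])
 have int: "integrable sgm (%x. indicat_real (cap z a) x * (1 / sqrt (1 + d - x \<bullet> z)))" for a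
  by (rule integrable_cap_mult[OF cont])
 have "ALL a>0. a <= 2 ^ n * d --> ?I a <= 10 * area * sqrt a" for n
 proof (induction n)
  case 0
  show ?case
  proof (intro allI impI)
   fix a :: real assume a: "a > 0" "a <= 2 ^ 0 * d"
   have "?I a <= (SI x. indicat_real (cap z a) x * (1 / sqrt d))"
   proof (rule integral_mono')
    fix x assume "x : space sgm"
    then have "0 <= 1 - x \<bullet> z" using v_nonneg z by simp
    then show "indicat_real (cap z a) x * (1 / sqrt (1 + d - x \<bullet> z)) <= indicat_real (cap z a) x * (1 / sqrt d)"
     using d by (intro mult_left_mono divide_left_mono) auto
    show "0 <= indicat_real (cap z a) x * (1 / sqrt d)" using d by simp
   qed (intro integrable_mult_left integrable_cap)
   also have "... <= 2 * area * a * (1 / sqrt d)"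
    using cap_upper[OF z a(1)] d by (simp add: divide_right_mono)
   also have "... <= 2 * area * a * (1 / sqrt a)"
    using a area_pos by (intro mult_left_mono divide_left_mono) auto
   also have "... = 2 * area * (a / sqrt a)" by simp
   also have "... = 2 * area * sqrt a" using a by (simp only: real_div_sqrt)
   also have "... <= 10 * area * sqrt a" using area_pos a by simp
   finally show "?I a <= 10 * area * sqrt a" .
  qed
 next
  case (Suc n)
  show ?case
  proof (intro allI impI)
   fix a :: real assume a: "a > 0" "a <= 2 ^ Suc n * d"
   have "?I a <= (SI x. indicat_real (cap z (a / 2)) x * (1 / sqrt (1 + d - x \<bullet> z)) + indicat_real (cap z a) x * (1 / sqrt (a / 2)))"
   proof (rule integral_mono')
    show "integrable sgm (%x. indicat_real (cap z (a / 2)) x * (1 / sqrt (1 + d - x \<bullet> z)) + indicat_real (cap z a) x * (1 / sqrt (a / 2)))"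
     using int[of "a / 2"] by simp
    fix x assume "x : space sgm"
    then have x: "x : S2" by simp
    have v: "0 <= 1 - x \<bullet> z" by (rule v_nonneg[OF x z])
    show "indicat_real (cap z a) x * (1 / sqrt (1 + d - x \<bullet> z))
     <= indicat_real (cap z (a / 2)) x * (1 / sqrt (1 + d - x \<bullet> z)) + indicat_real (cap z a) x * (1 / sqrt (a / 2))"
    proof (cases "x : cap z (a / 2)")
     case True
     then have "x : cap z a" using a by (auto simp: cap_def)
     then show ?thesis using True a by simp
    next
     case False
     then have "sqrt (a / 2) <= sqrt (1 + d - x \<bullet> z)" using x d by (auto simp: cap_def)
     then have "1 / sqrt (1 + d - x \<bullet> z) <= 1 / sqrt (a / 2)"
      using a v d by (intro divide_left_mono mult_pos_pos) auto
     then show ?thesis using False by (simp add: indicator_def)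
    qed
    show "0 <= indicat_real (cap z (a / 2)) x * (1 / sqrt (1 + d - x \<bullet> z)) + indicat_real (cap z a) x * (1 / sqrt (a / 2))"
     using v d a by simp
   qed
   also have "... = ?I (a / 2) + measure sgm (cap z a) * (1 / sqrt (a / 2))"
    using int[of "a / 2"] by (subst Bochner_Integration.integral_add) simp_all
   also have "... <= 10 * area * sqrt (a / 2) + 2 * area * a * (1 / sqrt (a / 2))"
    using Suc.IH a cap_upper[OF z a(1)] by (intro add_mono mult_right_mono) auto
   also have "... = area * (10 * sqrt (a / 2) + 4 * ((a / 2) / sqrt (a / 2)))"
    by (simp add: algebra_simps)
   also have "... = area * (10 * sqrt (a / 2) + 4 * sqrt (a / 2))"
    using a by (subst real_div_sqrt) simp_all
   also have "... = area * (14 * sqrt (a / 2))" by simp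
   also have "14 * sqrt (a / 2) = sqrt (98 * a)"
    using real_sqrt_mult[of 196 "a / 2"] by simp
   also have "... <= sqrt (100 * a)" using a by simp
   also have "... = 10 * sqrt a" using real_sqrt_mult[of 100 a] by simp
   finally show "?I a <= 10 * area * sqrt a" using area_pos by simp
  qed
 qed
 moreover obtain n :: nat where "a / d <= 2 ^ n"
  using real_arch_pow[of 2 "a / d"] by (auto intro: less_imp_le)
 then have "a <= 2 ^ n * d" using d by (simp add: field_simps)
 ultimately show ?thesis using a by blast
qed

section \<open>The differential operator\<close>

primrec Lop :: "nat => (real^3 => real) => real^3 => real" where
 "Lop 0 f = (%x. - lap f x)"
| "Lop (Suc s) f = (%x. - lap (Lop s f) x - (real s + 1) * (real s + 2) * Lop s f x)"

lemma smooth_Lop [intro]: "smooth f ==> smooth (Lop s f)"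
 by (induction s) (simp_all, intro smooth_uminus smooth_lap, assumption, intro smooth_diff smooth_uminus smooth_mult smooth_const smooth_lap, assumption+)

lemma Lop_cong: "(!!x. x : S2 ==> f x = g x) ==> x : S2 ==> Lop s f x = Lop s g x"
proof (induction s arbitrary: x)
 case 0 then show ?case using lap_cong[of f g x] by simp
next
 case (Suc s)
 then show ?case using lap_cong[of "Lop s f" "Lop s g" x] by simp
qed

lemma Lop_add: "smooth f ==> smooth g ==> x : S2 ==> Lop s (%x. f x + g x) x = Lop s f x + Lop s g x"
proof (induction s arbitrary: x)
 case 0 then show ?case by (simp add: lap_add)
next
 case (Suc s)
 have "lap (Lop s (%x. f x + g x)) x = lap (%x. Lop s f x + Lop s g x) x"
  by (rule lap_cong) (use Suc in auto)
 then show ?case using Suc by (simp add: lap_add smooth_Lop algebra_simps)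
qed

lemma Lop_cmult: "smooth f ==> x : S2 ==> Lop s (%x. c * f x) x = c * Lop s f x"
proof (induction s arbitrary: x)
 case 0 then show ?case by (simp add: lap_cmult)
next
 case (Suc s)
 have "lap (Lop s (%x. c * f x)) x = lap (%x. c * Lop s f x) x"
  by (rule lap_cong) (use Suc in auto)
 then show ?case using Suc by (simp add: lap_cmult smooth_Lop algebra_simps)
qed

lemma Lop_zero: "x : S2 ==> Lop s (%x. 0) x = 0"
 using Lop_cmult[of "%x. 0" x s 0] by simp

lemma Lop_sum:
 "(!!a. a : A ==> smooth (f a)) ==> x : S2 ==> Lop s (%x. SUM a:A. f a x) x = (SUM a:A. Lop s (f a) x)"
 by (induction A rule: infinite_finite_induct) (auto simp: Lop_add smooth_sum Lop_zero)

lemma Lop_lap: "smooth f ==> x : S2 ==> Lop s (lap f) x = lap (Lop s f) x"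
proof (induction s arbitrary: x)
 case 0
 then show ?case using lap_cmult[of "lap f" x "-1"] by (simp add: smooth_lap)
next
 case (Suc s)
 have 1: "lap (Lop s (lap f)) x = lap (lap (Lop s f)) x"
  by (rule lap_cong) (use Suc in auto)
 have sm: "smooth (lap (Lop s f))" "smooth (Lop s f)" "smooth (%x. (- 1) * lap (Lop s f) x)"
   "smooth (%x. (- ((real s + 1) * (real s + 2))) * Lop s f x)"
  using Suc.prems by (auto intro!: smooth_lap smooth_Lop smooth_mult smooth_const)
 have "lap (Lop (Suc s) f) x = lap (%x. (- 1) * lap (Lop s f) x + (- ((real s + 1) * (real s + 2))) * Lop s f x) x"
  by (rule arg_cong[where f = "%h. lap h x"]) (simp add: fun_eq_iff)
 also have "... = (- 1) * lap (lap (Lop s f)) x + (- ((real s + 1) * (real s + 2))) * lap (Lop s f) x"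
  unfolding lap_add[OF sm(3,4) Suc.prems(2)] lap_cmult[OF sm(1) Suc.prems(2)] lap_cmult[OF sm(2) Suc.prems(2)] ..
 finally show ?case using Suc 1 by simp
qed

lemma Lop_symmetric:
 "smooth f ==> smooth g ==> (SI x. Lop s f x * g x) = (SI x. f x * Lop s g x)"
proof (induction s arbitrary: f g)
 case 0 then show ?case using lap_symmetric[of f g] by simp
next
 case (Suc s)
 let ?a = "(real s + 1) * (real s + 2)"
 note I = smooth_mult smooth_Lop smooth_lap smooth_const Suc.prems
 have "(SI x. Lop (Suc s) f x * g x) = (SI x. (- 1) * (lap (Lop s f) x * g x) - ?a * (Lop s f x * g x))"
  by (rule Bochner_Integration.integral_cong) (simp_all add: algebra_simps)
 also have "... = (- 1) * (SI x. lap (Lop s f) x * g x) - ?a * (SI x. Lop s f x * g x)"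
  by (subst integral_smooth_diff) (intro I, intro I, simp)
 also have "(SI x. lap (Lop s f) x * g x) = (SI x. Lop s f x * lap g x)"
  by (rule lap_symmetric) (intro I)+
 also have "... = (SI x. f x * Lop s (lap g) x)"
  by (rule Suc.IH) (intro I)+
 also have "(SI x. f x * Lop s (lap g) x) = (SI x. f x * lap (Lop s g) x)"
  by (rule Bochner_Integration.integral_cong) (simp_all add: Lop_lap Suc.prems)
 also have "(SI x. Lop s f x * g x) = (SI x. f x * Lop s g x)"
  by (rule Suc.IH) (intro I)+
 also have "(- 1) * (SI x. f x * lap (Lop s g) x) - ?a * (SI x. f x * Lop s g x)
  = (SI x. (- 1) * (f x * lap (Lop s g) x) - ?a * (f x * Lop s g x))"
  by (subst integral_smooth_diff) (intro I, intro I, simp)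
 also have "... = (SI x. f x * Lop (Suc s) g x)"
  by (rule Bochner_Integration.integral_cong) (simp_all add: algebra_simps)
 finally show ?case .
qed

text \<open>Each Laplacian becomes one order of the form. Only the leading coefficient 1 is kept
  explicit; the lower terms are later absorbed whatever their coefficients are.\<close>

lemma Lop_ip:
 "EX c :: nat => real. ALL f g. smooth f --> smooth g -->
  (SI x. Lop s f x * g x) = ip (Suc s) f g + (SUM j<=s. c j * ip j f g)"
proof (induction s)
 case 0
 have "(SI x. Lop 0 f x * g x) = ip (Suc 0) f g" if "smooth f" "smooth g" for f g
  using ip_lap[OF that, of 0] by simp
 then show ?case by (intro exI[of _ "%_. 0"]) simp
next
 case (Suc s)
 let ?a = "(real s + 1) * (real s + 2)"
 from Suc.IH obtain c where c: "!!f g. smooth f ==> smooth g ==>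
  (SI x. Lop s f x * g x) = ip (Suc s) f g + (SUM j<=s. c j * ip j f g)" by blast
 \<comment> \<open>The factor \<open>- lap\<close> raises each order by one and the constant
   subtracts \<open>?a\<close> times the old expansion; at j = Suc s the old leading coefficient 1
   enters this second part.\<close>
 define c' where "c' j = (if j = 0 then 0 else c (j - 1)) - ?a * (if j <= s then c j else 1)" for j
 have "(SI x. Lop (Suc s) f x * g x) = ip (Suc (Suc s)) f g + (SUM j<=Suc s. c' j * ip j f g)"
  if fg: "smooth f" "smooth g" for f g
 proof -
  note I = smooth_mult smooth_Lop smooth_lap smooth_const fg
  have ipl: "ip j f (lap g) = - ip (Suc j) f g" for j
   using ip_lap[OF fg(2,1), of j] ip_commute[of j f "lap g"] ip_commute[of "Suc j" f g] by linarith
  have "(SI x. Lop (Suc s) f x * g x) = (SI x. (- 1) * (lap (Lop s f) x * g x) - ?a * (Lop s f x * g x))"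
   by (rule Bochner_Integration.integral_cong) (simp_all add: algebra_simps)
  also have "... = (- 1) * (SI x. lap (Lop s f) x * g x) - ?a * (SI x. Lop s f x * g x)"
   by (subst integral_smooth_diff) (intro I, intro I, simp)
  also have "(SI x. lap (Lop s f) x * g x) = (SI x. Lop s f x * lap g x)"
   by (rule lap_symmetric) (intro I)+
  also have "... = ip (Suc s) f (lap g) + (SUM j<=s. c j * ip j f (lap g))"
   by (rule c) (intro I)+
  also have "... = - (ip (Suc (Suc s)) f g + (SUM j<=s. c j * ip (Suc j) f g))"
   by (simp add: ipl sum_negf del: ip.simps)
  also have "(SI x. Lop s f x * g x) = ip (Suc s) f g + (SUM j<=s. c j * ip j f g)"
   by (rule c) (intro I)+
  also have "(SUM j<=s. c j * ip (Suc j) f g) = (SUM j<=Suc s. (if j = 0 then 0 else c (j - 1)) * ip j f g)"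
   by (simp add: sum.atMost_Suc_shift del: ip.simps sum.atMost_Suc)
  also have "ip (Suc s) f g + (SUM j<=s. c j * ip j f g) = (SUM j<=Suc s. (if j <= s then c j else 1) * ip j f g)"
   by (simp del: ip.simps)
  finally show ?thesis
   by (simp add: c'_def sum_subtractf sum_distrib_left left_diff_distrib mult.assoc del: ip.simps sum.atMost_Suc)
 qed
 then show ?case by blast
qed

section \<open>Green's identity for the kernel\<close>

lemma abs_mult_ln_le:
 fixes w :: real
 assumes "0 < w" "w <= 1" shows "\<bar>w * ln w\<bar> <= 2 * sqrt w"
proof -
 have "- ln w = 2 * ln (1 / sqrt w)"
  using assms by (simp add: ln_div ln_sqrt)
 also have "... <= 2 * (1 / sqrt w - 1)" using assms by (intro mult_left_mono ln_le_minus_one) auto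
 also have "... <= 2 / sqrt w" by simp
 finally have "w * (- ln w) <= w * (2 / sqrt w)" using assms by (intro mult_left_mono) auto
 also have "... = 2 * (w / sqrt w)" by simp
 also have "... = 2 * sqrt w" using assms by (subst real_div_sqrt) auto
 finally show ?thesis using assms by (simp add: abs_mult)
qed

lemma abs_mult_ln_le':
 fixes w :: real
 assumes "0 < w" "w <= 3" shows "\<bar>w * ln w\<bar> <= 9"
proof (cases "w <= 1")
 case True
 then show ?thesis using abs_mult_ln_le[of w] assms real_sqrt_le_1_iff[of w] by linarith
next
 case False
 then have "0 <= ln w" "ln w <= w" using ln_le_minus_one[of w] by auto
 then have "w * ln w <= 3 * 3" using assms by (intro mult_mono) auto
 then show ?thesis using \<open>0 <= ln w\<close> assms by (simp add: abs_mult)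
qed

lemma continuous_power_ln:
 assumes "s >= 1" shows "continuous_on {0..} (%v :: real. v ^ s * ln v)"
proof -
 have "continuous_on {0..} (%v :: real. v * ln v)"
  unfolding continuous_on_def
 proof
  fix v :: real assume v: "v : {0..}"
  show "((%v. v * ln v) \<longlongrightarrow> v * ln v) (at v within {0..})"
  proof (cases "v = 0")
   case True
   have "((%v :: real. v * ln v) \<longlongrightarrow> 0) (at 0 within {0..})"
   proof (rule Lim_null_comparison)
    show "((%v :: real. 2 * sqrt v) \<longlongrightarrow> 0) (at 0 within {0..})"
     by (auto intro!: tendsto_eq_intros)
    show "\<forall>\<^sub>F v :: real in at 0 within {0..}. norm (v * ln v) <= 2 * sqrt v"
     unfolding eventually_at using abs_mult_ln_le
     by (intro exI[of _ 1]) (auto simp: dist_real_def)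
   qed
   then show ?thesis using True by simp
  next
   case False
   then have "isCont (%v. v * ln v) v" using v by (intro continuous_intros) auto
   then show ?thesis using continuous_at_imp_continuous_within continuous_within by blast
  qed
 qed
 then have "continuous_on {0..} (%v :: real. v ^ (s - 1) * (v * ln v))"
  by (rule continuous_on_mult[rotated]) (intro continuous_intros)
 moreover have "(%v :: real. v ^ (s - 1) * (v * ln v)) = (%v. v ^ s * ln v)"
  using assms by (cases s) (auto simp: fun_eq_iff)
 ultimately show ?thesis by (simp only:)
qed

lemma power_ln_modulus:
 assumes "s >= 1" "e > 0"
 shows "EX et>0. ALL v:{0..3}. ALL w:{0..3 :: real}. \<bar>v - w\<bar> < et --> \<bar>v ^ s * ln v - w ^ s * ln w\<bar> < e"
proof -
 have "uniformly_continuous_on {0..3 :: real} (%v. v ^ s * ln v)"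
  using continuous_on_subset[OF continuous_power_ln[OF assms(1)]]
  by (intro compact_uniformly_continuous) auto
 then obtain et where "et > 0" "!!v w. v : {0..3::real} ==> w : {0..3} ==> dist v w < et ==> dist (v ^ s * ln v) (w ^ s * ln w) < e"
  using assms(2) unfolding uniformly_continuous_on_def by metis
 then show ?thesis by (intro exI[of _ et]) (auto simp: dist_real_def)
qed

text \<open>The kernel with its argument shifted by d: smooth on the sphere, with the surface spline
  as its limit and, at s = 0, the logarithm from which \<open>bker\<close> arises.\<close>

definition kreg :: "nat => real => real^3 => real^3 => real" where
 "kreg s d z x = (1 + d - x \<bullet> z) ^ s * ln (1 + d - x \<bullet> z)"

lemma smooth_kreg: "z : S2 ==> d > 0 ==> smooth (kreg s d z)"
 unfolding kreg_def[abs_def] by (intro smooth_mult smooth_power smooth_vd smooth_ln_vd)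

text \<open>One factor of L, up to sign, lowers the exponent: the kernel of order
  \<open>Suc s\<close> goes to a multiple of the one of order s, plus a polynomial in w, minus a
  remainder with the small factor 2 d + d^2.\<close>

lemma lap_kreg:
 fixes s :: nat
 assumes z: "z : S2" and x: "x : S2" and d: "d > 0"
 defines "w \<equiv> 1 + d - x \<bullet> z" and "j \<equiv> real (Suc s)"
 shows "lap (kreg (Suc s) d z) x + j * (j + 1) * kreg (Suc s) d z x
  = 2 * (1 + d) * j^2 * kreg s d z x + (4 * (1 + d) * j * w ^ s - (2 * j + 1) * w ^ Suc s)
   - (2 * d + d^2) * ((j * (j - 1) * ln w + (2 * j - 1)) * (w ^ s / w))"
proof -
 have w: "w > 0" unfolding w_def by (rule vd_pos[OF x z d])
 have "lap (kreg (Suc s) d z) x = ((j * (j - 1) * ln w + (2 * j - 1)) * (w ^ s / w)) * (1 - (x \<bullet> z)^2)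
   - 2 * (x \<bullet> z) * (- (w ^ s * (j * ln w + 1)))"
  unfolding kreg_def[abs_def] w_def
 proof (rule lap_zonal[where F = "%y. (1 + d - y) ^ Suc s * ln (1 + d - y)"
    and F' = "%y. - ((1 + d - y) ^ s * (j * ln (1 + d - y) + 1))"
    and F'' = "%y. (j * (j - 1) * ln (1 + d - y) + (2 * j - 1)) * ((1 + d - y) ^ s / (1 + d - y))", OF z x])
  fix y :: real assume "y : {-1..1}"
  then have y: "1 + d - y > 0" using d by auto
  have "((%y. (1 + d - y) ^ Suc s * ln (1 + d - y)) has_real_derivative
    (1 + d - y) ^ Suc s * (- 1 / (1 + d - y)) + (j * (1 + d - y) ^ s * (- 1)) * ln (1 + d - y)) (at y)"
   unfolding j_def using y by (auto intro!: derivative_eq_intros simp del: power_Suc)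
  also have "(1 + d - y) ^ Suc s * (- 1 / (1 + d - y)) + (j * (1 + d - y) ^ s * (- 1)) * ln (1 + d - y)
    = - ((1 + d - y) ^ s * (j * ln (1 + d - y) + 1))"
  proof -
   have "W ^ Suc s * (- 1 / W) + (j * W ^ s * (- 1)) * ln W = - (W ^ s * (j * ln W + 1))" if "W > 0" for W
    using that by (simp add: algebra_simps)
   then show ?thesis using y by blast
  qed
  finally show "((%y. (1 + d - y) ^ Suc s * ln (1 + d - y)) has_real_derivative
    - ((1 + d - y) ^ s * (j * ln (1 + d - y) + 1))) (at y)" .
  have "((%y. - ((1 + d - y) ^ s * (j * ln (1 + d - y) + 1))) has_real_derivative
    - ((1 + d - y) ^ s * (j * (- 1 / (1 + d - y))) + (real s * (1 + d - y) ^ (s - 1) * (- 1)) * (j * ln (1 + d - y) + 1))) (at y)"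
   using y by (auto intro!: derivative_eq_intros)
  also have "real s * (1 + d - y) ^ (s - 1) = real s * ((1 + d - y) ^ s / (1 + d - y))"
   using y by (cases s) auto
  also have "- ((1 + d - y) ^ s * (j * (- 1 / (1 + d - y))) + (real s * ((1 + d - y) ^ s / (1 + d - y)) * (- 1)) * (j * ln (1 + d - y) + 1))
   = (j * (j - 1) * ln (1 + d - y) + (2 * j - 1)) * ((1 + d - y) ^ s / (1 + d - y))"
  proof -
   have "- (W ^ s * (j * (- 1 / W)) + (real s * (W ^ s / W) * (- 1)) * (j * ln W + 1))
    = (j * (j - 1) * ln W + (2 * j - 1)) * (W ^ s / W)" if "W > 0" for W
    unfolding j_def using that by (simp add: field_simps)
   then show ?thesis using y by blast
  qed
  finally show "((%y. - ((1 + d - y) ^ s * (j * ln (1 + d - y) + 1))) has_real_derivative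
    (j * (j - 1) * ln (1 + d - y) + (2 * j - 1)) * ((1 + d - y) ^ s / (1 + d - y))) (at y)" .
 next
  show "smooth (%x. - ((1 + d - x \<bullet> z) ^ s * (j * ln (1 + d - x \<bullet> z) + 1)))"
   by (intro smooth_uminus smooth_mult smooth_add smooth_const smooth_power smooth_vd smooth_ln_vd z d)
 qed
 also have "... = ((j * (j - 1) * ln w + (2 * j - 1)) * (2 * (1 + d) * w ^ s - w * w ^ s)
    - (2 * d + d^2) * ((j * (j - 1) * ln w + (2 * j - 1)) * (w ^ s / w))) + 2 * ((1 + d) - w) * (w ^ s * (j * ln w + 1))"
 proof -
  have "1 - (x \<bullet> z)^2 = 2 * (1 + d) * w - w^2 - (2 * d + d^2)"
   by (simp add: w_def power2_eq_square algebra_simps)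
  then have "(w ^ s / w) * (1 - (x \<bullet> z)^2) = (w ^ s / w) * (2 * (1 + d) * w - w^2 - (2 * d + d^2))" by simp
  also have "... = (2 * (1 + d) * w ^ s - w * w ^ s) - (2 * d + d^2) * (w ^ s / w)"
   using w by (simp add: field_simps power2_eq_square)
  finally have 1: "(w ^ s / w) * (1 - (x \<bullet> z)^2) = (2 * (1 + d) * w ^ s - w * w ^ s) - (2 * d + d^2) * (w ^ s / w)" .
  have 2: "P * (w ^ s / w) * (1 - (x \<bullet> z)^2) = P * (2 * (1 + d) * w ^ s - w * w ^ s) - (2 * d + d^2) * (P * (w ^ s / w))" for P
   unfolding mult.assoc[of P "w ^ s / w"] 1 by (simp only: right_diff_distrib mult.left_commute)
  have 3: "x \<bullet> z = (1 + d) - w" by (simp add: w_def)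
  show ?thesis unfolding 2 unfolding 3 by simp
 qed
 finally have lapw: "lap (kreg (Suc s) d z) x = ..." .
 have alg: "(((j * (j - 1) * L + (2 * j - 1)) * (2 * a * W - w * W) - B) + 2 * (a - w) * (W * (j * L + 1))) + j * (j + 1) * (w * (W * L))
  = 2 * a * j^2 * (W * L) + (4 * a * j * W - (2 * j + 1) * (w * W)) - B" for a W L B :: real
  by (simp add: algebra_simps power2_eq_square)
 have "kreg s d z x = w ^ s * ln w" "kreg (Suc s) d z x = w * (w ^ s * ln w)"
  by (simp_all add: kreg_def w_def)
 then show ?thesis unfolding lapw power_Suc by (simp only: alg)
qed

lemma lap_zonal_poly:
 "EX p'. degree p' <= degree p & (ALL z:S2. ALL x:S2. lap (%x. poly p (x \<bullet> z)) x = poly p' (x \<bullet> z))"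
proof -
 define p' where "p' = pderiv (pderiv p) * [:1, 0, -1:] - [:0, 2:] * pderiv p"
 have "degree p' <= degree p"
 proof (cases "degree p < 2")
  case True
  then have "degree (pderiv p) = 0" by (simp add: degree_pderiv)
  then have "pderiv (pderiv p) = 0" by (simp add: pderiv_eq_0_iff)
  then have e: "p' = - ([:0, 2:] * pderiv p)" by (simp add: p'_def)
  show ?thesis
  proof (cases "degree p = 0")
   case True
   then have "pderiv p = 0" by (simp add: pderiv_eq_0_iff)
   then show ?thesis by (simp add: e)
  next
   case False
   have "degree p' <= degree [:0, 2 :: real:] + degree (pderiv p)" unfolding e degree_minus by (rule degree_mult_le)
   then show ?thesis using \<open>degree (pderiv p) = 0\<close> False by simp
  qed
 next
  case False
  have "degree (pderiv (pderiv p) * [:1, 0, -1:]) <= degree (pderiv (pderiv p)) + degree [:1, 0, -1 :: real:]"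
   by (rule degree_mult_le)
  also have "... <= degree p" using False by (simp add: degree_pderiv)
  finally have 1: "degree (pderiv (pderiv p) * [:1, 0, -1:]) <= degree p" .
  have "degree ([:0, 2:] * pderiv p) <= degree [:0, 2 :: real:] + degree (pderiv p)" by (rule degree_mult_le)
  also have "... <= degree p" using False by (simp add: degree_pderiv)
  finally show ?thesis unfolding p'_def using 1 by (rule degree_diff_le[rotated])
 qed
 moreover have "lap (%x. poly p (x \<bullet> z)) x = poly p' (x \<bullet> z)" if "z : S2" "x : S2" for x z
 proof -
  have "smooth (%x. poly (pderiv p) (x \<bullet> z))"
   unfolding poly_altdef by (intro smooth_sum smooth_mult smooth_const smooth_power smooth_inner)
  then have "lap (%x. poly p (x \<bullet> z)) x
   = poly (pderiv (pderiv p)) (x \<bullet> z) * (1 - (x \<bullet> z)^2) - 2 * (x \<bullet> z) * poly (pderiv p) (x \<bullet> z)"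
   by (intro lap_zonal that poly_DERIV)
  then show ?thesis by (simp add: p'_def power2_eq_square algebra_simps)
 qed
 ultimately show ?thesis by blast
qed

lemma smooth_zonal_poly [intro]: "smooth (%x. poly p (x \<bullet> z))"
 unfolding poly_altdef by (intro smooth_sum smooth_mult smooth_const smooth_power smooth_inner)

lemma Lop_zonal_poly:
 "EX p'. degree p' <= degree p & (ALL z:S2. ALL x:S2. Lop s (%x. poly p (x \<bullet> z)) x = poly p' (x \<bullet> z))"
proof (induction s)
 case 0
 obtain p' where "degree p' <= degree p" "ALL z:S2. ALL x:S2. lap (%x. poly p (x \<bullet> z)) x = poly p' (x \<bullet> z)"
  using lap_zonal_poly by blast
 then show ?case by (intro exI[of _ "- p'"]) simp
next
 case (Suc s)
 then obtain p' where p': "degree p' <= degree p" "ALL z:S2. ALL x:S2. Lop s (%x. poly p (x \<bullet> z)) x = poly p' (x \<bullet> z)"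
  by blast
 obtain p'' where p'': "degree p'' <= degree p'" "ALL z:S2. ALL x:S2. lap (%x. poly p' (x \<bullet> z)) x = poly p'' (x \<bullet> z)"
  using lap_zonal_poly by blast
 let ?r = "- p'' - smult ((real s + 1) * (real s + 2)) p'"
 have "degree ?r <= degree p"
  using p'(1) p''(1) degree_smult_le[of "(real s + 1) * (real s + 2)" p'] by (intro degree_diff_le) auto
 moreover have "Lop (Suc s) (%x. poly p (x \<bullet> z)) x = poly ?r (x \<bullet> z)" if zx: "z : S2" "x : S2" for z x
 proof -
  have "lap (Lop s (%x. poly p (x \<bullet> z))) x = lap (%x. poly p' (x \<bullet> z)) x"
   by (rule lap_cong) (use p'(2) zx in auto)
  then show ?thesis using p' p'' zx by simp
 qed
 ultimately show ?case by blast
qed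

text \<open>AM-GM between the square of the integrand and a constant. The bound is far above the
  true logarithmic size, but it still tends to 0 when multiplied by 2 d + d^2.\<close>

lemma integral_vd_inverse:
 assumes z: "z : S2" and d: "0 < d"
 shows "(SI x. 1 / (1 + d - x \<bullet> z)) <= area / sqrt d"
proof -
 have i: "integrable sgm (%x. 1 / 2 * (sqrt d * (1 / (1 + d - x \<bullet> z)^2) + 1 / sqrt d))"
  by (intro integrable_mult_right Bochner_Integration.integrable_add integral_vd_neg2 z d) simp
 have "(SI x. 1 / (1 + d - x \<bullet> z)) <= (SI x. 1 / 2 * (sqrt d * (1 / (1 + d - x \<bullet> z)^2) + 1 / sqrt d))"
 proof (rule integral_mono')
  fix x assume "x : space sgm"
  then have w: "1 + d - x \<bullet> z > 0" using vd_pos z d by simp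
  define u where "u = 1 / (1 + d - x \<bullet> z)"
  define r where "r = sqrt d"
  have r: "r > 0" using d by (simp add: r_def)
  have "0 <= (r * u - 1)^2 / r" using r by simp
  also have "... = r * u^2 + 1 / r - 2 * u" using r by (simp add: power2_eq_square field_simps)
  finally have "u <= 1 / 2 * (r * u^2 + 1 / r)" by simp
  then show "1 / (1 + d - x \<bullet> z) <= 1 / 2 * (sqrt d * (1 / (1 + d - x \<bullet> z)^2) + 1 / sqrt d)"
   by (simp add: u_def r_def power_one_over)
  show "0 <= 1 / 2 * (sqrt d * (1 / (1 + d - x \<bullet> z)^2) + 1 / sqrt d)" using d by simp
 qed (rule i)
 also have "... = 1 / 2 * (sqrt d * (area / (2 * d + d^2)) + 1 / sqrt d * area)"
 proof -
  have "(SI x. 1 / 2 * (sqrt d * (1 / (1 + d - x \<bullet> z)^2) + 1 / sqrt d))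
    = 1 / 2 * (SI x. sqrt d * (1 / (1 + d - x \<bullet> z)^2) + 1 / sqrt d)"
   by (rule integral_mult_right_zero)
  also have "(SI x. sqrt d * (1 / (1 + d - x \<bullet> z)^2) + 1 / sqrt d)
    = (SI x. sqrt d * (1 / (1 + d - x \<bullet> z)^2)) + (SI x. 1 / sqrt d)"
   by (intro Bochner_Integration.integral_add integrable_mult_right integral_vd_neg2 z d) simp
  also have "(SI x. sqrt d * (1 / (1 + d - x \<bullet> z)^2)) = sqrt d * (area / (2 * d + d^2))"
   by (simp only: integral_mult_right_zero integral_vd_neg2(1)[OF z d])
  finally show ?thesis by (simp add: area_def)
 qed
 also have "... <= 1 / 2 * (sqrt d * (area / d) + 1 / sqrt d * area)"
  using d area_pos by (intro mult_left_mono add_mono divide_left_mono) (auto simp: add_pos_pos)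
 also have "sqrt d * (area / d) = area / sqrt d"
 proof -
  have "sqrt d ~= 0" "d = sqrt d * sqrt d" using d by auto
  then show ?thesis by (metis nonzero_mult_divide_mult_cancel_left times_divide_eq_right)
 qed
 finally show ?thesis using area_pos by simp
qed

lemma integral_tendsto_at_right_0:
 fixes f :: "real => real^3 => real"
 assumes "!!d. 0 < d ==> d < 1 ==> f d : borel_measurable sgm" "f0 : borel_measurable sgm"
  and "!!d x. 0 < d ==> d < 1 ==> x : S2 ==> \<bar>f d x\<bar> <= B"
  and "!!x. x : S2 ==> ((%d. f d x) \<longlongrightarrow> f0 x) (at_right 0)"
 shows "((%d. (SI x. f d x)) \<longlongrightarrow> (SI x. f0 x)) (at_right 0)"
proof (rule tendsto_at_right_sequentially[of 0 1])
 fix S :: "nat => real" assume S: "!!n. 0 < S n" "!!n. S n < 1" "S \<longlonglongrightarrow> 0"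
 show "(%n. (SI x. f (S n) x)) \<longlonglongrightarrow> (SI x. f0 x)"
 proof (rule integral_dominated_convergence[where w = "%_. B"])
  show "AE x in sgm. (%n. f (S n) x) \<longlonglongrightarrow> f0 x"
  proof (rule AE_I2)
   fix x assume "x : space sgm"
   then have "((%d. f d x) \<longlongrightarrow> f0 x) (at_right 0)" using assms(4) by simp
   moreover have "filterlim S (at_right 0) sequentially"
    using S unfolding filterlim_at by (auto simp: less_imp_neq[symmetric] eventually_sequentially)
   ultimately show "(%n. f (S n) x) \<longlonglongrightarrow> f0 x" by (rule filterlim_compose)
  qed
 qed (use assms S in auto)
qed simp

text \<open>Green's identity in weak form by induction on s: the last factor of L is moved onto the
  kernel, where \<open>lap_kreg\<close> applies. The polynomial part passes through the remaining
  factors as a zonal polynomial, and the remainder disappears in the limit.\<close>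

lemma kreg_green_limit:
 "EX c q. c ~= 0 & degree q <= s & (ALL z:S2. ALL g. smooth g -->
  ((%d. (SI x. kreg s d z x * Lop s g x)) \<longlongrightarrow> c * g z + (SI x. poly q (x \<bullet> z) * g x)) (at_right 0))"
proof (induction s)
 case 0
 have "((%d. (SI x. kreg 0 d z x * Lop 0 g x)) \<longlongrightarrow> (- area) * g z + (SI x. poly [:1:] (x \<bullet> z) * g x)) (at_right 0)"
  if z: "z : S2" and g: "smooth g" for z g
 proof -
  have "(SI x. kreg 0 d z x * Lop 0 g x) = (- area) * (SI x. bker d z x * g x) + (SI x. g x)"
   if d: "d > 0" for d
  proof -
   have "(SI x. kreg 0 d z x * Lop 0 g x) = - (SI x. ln (1 + d - x \<bullet> z) * lap g x)"
    by (simp add: kreg_def)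
   also have "... = - (SI x. lap (%x. ln (1 + d - x \<bullet> z)) x * g x)"
    using lap_symmetric[OF smooth_ln_vd[OF z d] g] by simp
   also have "... = - (SI x. area * (bker d z x * g x) - g x)"
    by (intro arg_cong[where f = uminus] Bochner_Integration.integral_cong)
     (simp_all add: lap_ln[OF z _ d] algebra_simps)
   also have "(SI x. area * (bker d z x * g x) - g x) = (SI x. area * (bker d z x * g x)) - (SI x. g x)"
    by (intro integral_smooth_diff smooth_mult smooth_const smooth_bker z d g)
   finally show ?thesis by simp
  qed
  then have ev: "\<forall>\<^sub>F d in at_right 0. (- area) * (SI x. bker d z x * g x) + (SI x. g x) = (SI x. kreg 0 d z x * Lop 0 g x)"
   unfolding eventually_at_right_field by (intro exI[of _ 1]) auto
  have "((%d. (- area) * (SI x. bker d z x * g x) + (SI x. g x)) \<longlongrightarrow> (- area) * g z + (SI x. g x)) (at_right 0)"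
   by (intro tendsto_intros bker_tendsto smooth_continuous g z)
  then show ?thesis using Lim_transform_eventually[OF _ ev] by simp
 qed
 then show ?case using area_pos by (intro exI[of _ "- area"] exI[of _ "[:1:]"]) auto
next
 case (Suc s)
 then obtain c q where c: "c ~= 0" and q: "degree q <= s" and lim: "!!z g. z : S2 ==> smooth g ==>
  ((%d. (SI x. kreg s d z x * Lop s g x)) \<longlongrightarrow> c * g z + (SI x. poly q (x \<bullet> z) * g x)) (at_right 0)"
  by blast
 define j where "j = real (Suc s)"
 have j: "j >= 1" by (simp add: j_def)
 define P where "P = smult (4 * j) ([:1, -1:] ^ s) - smult (2 * j + 1) ([:1, -1:] ^ Suc s)"
 have degP: "degree P <= Suc s"
 proof -
  have d: "degree (smult a ([:1, -1 :: real:] ^ n)) <= n" for a n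
   using degree_smult_le[of a "[:1, -1 :: real:] ^ n"] degree_power_le[of "[:1, -1 :: real:]" n] by simp
  show ?thesis unfolding P_def using d[of "4 * j" s] by (intro degree_diff_le d) auto
 qed
 obtain P' where P': "degree P' <= degree P" "!!z x. z : S2 ==> x : S2 ==> Lop s (%x. poly P (x \<bullet> z)) x = poly P' (x \<bullet> z)"
  using Lop_zonal_poly[of P s] by blast
 \<comment> \<open>The multiplier 2 j^2 of \<open>lap_kreg\<close> at d = 0, with the sign of the
   factor - lap - j (j + 1).\<close>
 define c' where "c' = - (2 * j^2 * c)"
 define q' where "q' = - (smult (2 * j^2) q) - P'"
 have "degree q' <= Suc s"
  unfolding q'_def using P'(1) degP q degree_smult_le[of "2 * j^2" q] by (intro degree_diff_le) auto
 moreover have "c' ~= 0" using c j by (simp add: c'_def)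
 moreover have "((%d. (SI x. kreg (Suc s) d z x * Lop (Suc s) g x)) \<longlongrightarrow> c' * g z + (SI x. poly q' (x \<bullet> z) * g x)) (at_right 0)"
  if z: "z : S2" and g: "smooth g" for z g
 proof -
  define G where "G = Lop s g"
  have G: "smooth G" unfolding G_def using g by (rule smooth_Lop)
  obtain B where B: "B > 0" "!!x. x : S2 ==> \<bar>G x\<bar> <= B"
   using bounded_cont_S2[OF smooth_continuous[OF G]] by blast
  let ?w = "%d x. 1 + d - x \<bullet> z"
  let ?p = "%d x. 4 * (1 + d) * j * ?w d x ^ s - (2 * j + 1) * ?w d x ^ Suc s"
  let ?R = "%d x. (j * (j - 1) * ln (?w d x) + (2 * j - 1)) * (?w d x ^ s / ?w d x)"
  let ?b = "%d. 2 * d + d^2 :: real"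
  note sI = smooth_mult smooth_const smooth_diff smooth_add smooth_power smooth_vd smooth_divide smooth_ln_vd vd_pos z G
  have split: "(SI x. kreg (Suc s) d z x * Lop (Suc s) g x)
    = - (2 * (1 + d) * j^2 * (SI x. kreg s d z x * G x)) - (SI x. ?p d x * G x) + ?b d * (SI x. ?R d x * G x)"
   if d: "d > 0" for d
  proof -
   have k: "smooth (kreg (Suc s) d z)" "smooth (kreg s d z)" using smooth_kreg[OF z d] by auto
   have R: "smooth (?R d)" by (intro sI d)
   have p: "smooth (?p d)" by (intro sI d)
   have "(SI x. kreg (Suc s) d z x * Lop (Suc s) g x)
    = (SI x. (- 1) * (kreg (Suc s) d z x * lap G x) - j * (j + 1) * (kreg (Suc s) d z x * G x))"
    by (rule Bochner_Integration.integral_cong) (simp_all add: G_def j_def algebra_simps)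
   also have "... = (- 1) * (SI x. kreg (Suc s) d z x * lap G x) - j * (j + 1) * (SI x. kreg (Suc s) d z x * G x)"
    by (subst integral_smooth_diff) (intro smooth_mult smooth_const k G smooth_lap, intro smooth_mult smooth_const k G, simp)
   also have "(SI x. kreg (Suc s) d z x * lap G x) = (SI x. lap (kreg (Suc s) d z) x * G x)"
    using lap_symmetric[OF k(1) G] by simp
   also have "(- 1) * (SI x. lap (kreg (Suc s) d z) x * G x) - j * (j + 1) * (SI x. kreg (Suc s) d z x * G x)
     = (SI x. (- 1) * (lap (kreg (Suc s) d z) x * G x) - j * (j + 1) * (kreg (Suc s) d z x * G x))"
    by (subst integral_smooth_diff) (intro smooth_mult smooth_const k G smooth_lap, intro smooth_mult smooth_const k G, simp)
   also have "... = (SI x. (- (2 * (1 + d) * j^2)) * (kreg s d z x * G x) - ?p d x * G x + ?b d * (?R d x * G x))"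
   proof (rule Bochner_Integration.integral_cong[OF refl])
    fix x assume "x : space sgm"
    then have x: "x : S2" by simp
    have "lap (kreg (Suc s) d z) x + j * (j + 1) * kreg (Suc s) d z x
     = 2 * (1 + d) * j^2 * kreg s d z x + ?p d x - ?b d * ?R d x"
     using lap_kreg[OF z x d, of s] unfolding j_def by simp
    then have "lap (kreg (Suc s) d z) x * G x + j * (j + 1) * (kreg (Suc s) d z x * G x)
     = (2 * (1 + d) * j^2 * kreg s d z x + ?p d x - ?b d * ?R d x) * G x"
     by (metis distrib_right mult.assoc)
    then show "(- 1) * (lap (kreg (Suc s) d z) x * G x) - j * (j + 1) * (kreg (Suc s) d z x * G x)
     = (- (2 * (1 + d) * j^2)) * (kreg s d z x * G x) - ?p d x * G x + ?b d * (?R d x * G x)"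
     by (simp add: left_diff_distrib distrib_right mult.assoc)
   qed
   also have "... = (SI x. (- (2 * (1 + d) * j^2)) * (kreg s d z x * G x) - ?p d x * G x) + (SI x. ?b d * (?R d x * G x))"
    by (intro integral_smooth_add smooth_diff smooth_mult[OF smooth_const] smooth_mult k G R p)
   also have "(SI x. (- (2 * (1 + d) * j^2)) * (kreg s d z x * G x) - ?p d x * G x)
    = (SI x. (- (2 * (1 + d) * j^2)) * (kreg s d z x * G x)) - (SI x. ?p d x * G x)"
    by (intro integral_smooth_diff smooth_mult[OF smooth_const] smooth_mult k G p)
   finally show ?thesis unfolding integral_mult_right_zero by (simp only: mult_minus_left)
  qed
  have lim1: "((%d. 2 * (1 + d) * j^2 * (SI x. kreg s d z x * G x)) \<longlongrightarrow>
    2 * (1 + 0) * j^2 * (c * g z + (SI x. poly q (x \<bullet> z) * g x))) (at_right 0)"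
   unfolding G_def by (intro tendsto_mult tendsto_const tendsto_add lim[OF z g] tendsto_ident_at)
  have lim2: "((%d. (SI x. ?p d x * G x)) \<longlongrightarrow> (SI x. ?p 0 x * G x)) (at_right 0)"
   proof (rule integral_tendsto_at_right_0[where B = "(8 * j * 3 ^ s + (2 * j + 1) * 3 ^ Suc s) * B"])
    fix d :: real assume d: "0 < d" "d < 1"
    show "(%x. ?p d x * G x) : borel_measurable sgm"
     by (intro meas_cont smooth_continuous sI)
    fix x assume x: "x : S2"
    have w: "0 <= ?w d x" "?w d x <= 3" using v_nonneg[OF x z] v_le[OF x z] d by auto
    have "\<bar>?p d x\<bar> <= \<bar>4 * (1 + d) * j * ?w d x ^ s\<bar> + \<bar>(2 * j + 1) * ?w d x ^ Suc s\<bar>"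
     by (rule abs_triangle_ineq4)
    also have "... <= 8 * j * 3 ^ s + (2 * j + 1) * 3 ^ Suc s"
     unfolding abs_mult power_abs using w d j
     by (intro add_mono mult_mono power_mono mult_nonneg_nonneg) auto
    finally show "\<bar>?p d x * G x\<bar> <= (8 * j * 3 ^ s + (2 * j + 1) * 3 ^ Suc s) * B"
     unfolding abs_mult using B(2)[OF x] by (intro mult_mono) auto
   next
    show "(%x. ?p 0 x * G x) : borel_measurable sgm"
     by (intro meas_cont smooth_continuous sI)
    show "((%d. ?p d x * G x) \<longlongrightarrow> ?p 0 x * G x) (at_right 0)" if "x : S2" for x
     by (intro tendsto_intros)
   qed
  \<comment> \<open>The remainder kernel is bounded by M / w, whose integral is at most M area /
    sqrt d, against a prefactor of at most 3 d.\<close>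
  have lim3: "((%d. ?b d * (SI x. ?R d x * G x)) \<longlongrightarrow> 0) (at_right 0)"
  proof (rule Lim_null_comparison)
   define M where "M = (j * (j - 1) * 9 + (2 * j - 1)) * 3 ^ s"
   have M: "M >= 0" using j by (simp add: M_def)
   have Rle: "\<bar>?R d x\<bar> <= M * (1 / ?w d x)" if d: "0 < d" "d < 1" and x: "x : S2" for d x
   proof -
    have w: "0 < ?w d x" "?w d x <= 3" using vd_pos[OF x z d(1)] v_le[OF x z] d by auto
    have "\<bar>(j * (j - 1) * ln (?w d x) + (2 * j - 1)) * ?w d x ^ s\<bar>
     <= j * (j - 1) * \<bar>ln (?w d x) * ?w d x ^ s\<bar> + (2 * j - 1) * \<bar>?w d x ^ s\<bar>"
     using abs_triangle_ineq[of "j * (j - 1) * (ln (?w d x) * ?w d x ^ s)" "(2 * j - 1) * ?w d x ^ s"] j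
     by (simp add: abs_mult distrib_right mult.assoc)
    also have "j * (j - 1) * \<bar>ln (?w d x) * ?w d x ^ s\<bar> <= j * (j - 1) * (9 * 3 ^ s)"
    proof (cases s)
     case 0
     then show ?thesis by (simp add: j_def)
    next
     case (Suc r)
     have "\<bar>ln (?w d x) * ?w d x ^ s\<bar> = \<bar>?w d x * ln (?w d x)\<bar> * ?w d x ^ r"
      using w by (simp add: Suc abs_mult mult_ac power_abs)
     also have "... <= 9 * 3 ^ r" using abs_mult_ln_le'[OF w] w by (intro mult_mono power_mono) auto
     also have "... <= 9 * 3 ^ s" by (simp add: Suc)
     finally show ?thesis using j by (intro mult_left_mono) auto
    qed
    also have "(2 * j - 1) * \<bar>?w d x ^ s\<bar> <= (2 * j - 1) * 3 ^ s"
     using w j by (intro mult_left_mono) (auto simp: power_abs intro: power_mono)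
    finally have "\<bar>(j * (j - 1) * ln (?w d x) + (2 * j - 1)) * ?w d x ^ s\<bar> <= j * (j - 1) * (9 * 3 ^ s) + (2 * j - 1) * 3 ^ s"
     by simp
    also have "... = M" by (simp add: M_def algebra_simps)
    finally have "\<bar>(j * (j - 1) * ln (?w d x) + (2 * j - 1)) * ?w d x ^ s\<bar> <= M" .
    then have "\<bar>(j * (j - 1) * ln (?w d x) + (2 * j - 1)) * ?w d x ^ s\<bar> * (1 / ?w d x) <= M * (1 / ?w d x)"
     using w by (intro mult_right_mono) auto
    moreover have "\<bar>?R d x\<bar> = \<bar>(j * (j - 1) * ln (?w d x) + (2 * j - 1)) * ?w d x ^ s\<bar> * (1 / ?w d x)"
     unfolding times_divide_eq_right abs_divide abs_of_pos[OF w(1)] by simp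
    ultimately show ?thesis by (simp only:)
   qed
   have "norm (?b d * (SI x. ?R d x * G x)) <= 3 * (M * B * area) * sqrt d" if d: "0 < d" "d < 1" for d
   proof -
    have sinv: "smooth (%x. 1 / ?w d x)" by (intro sI d)
    have "\<bar>SI x. ?R d x * G x\<bar> <= (SI x. \<bar>?R d x * G x\<bar>)" by (rule integral_abs_bound)
    also have "... <= (SI x. (M * B) * (1 / ?w d x))"
    proof (rule integral_mono')
     show "integrable sgm (%x. (M * B) * (1 / ?w d x))" by (intro int_smooth smooth_mult smooth_const sinv)
     fix x assume "x : space sgm"
     then have x: "x : S2" by simp
     show "0 <= (M * B) * (1 / ?w d x)" using M B(1) vd_pos[OF x z d(1)] by simp
     have "\<bar>?R d x * G x\<bar> <= (M * (1 / ?w d x)) * B"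
      unfolding abs_mult[of "?R d x"] using M vd_pos[OF x z d(1)]
      by (intro mult_mono Rle[OF d x] B(2)[OF x]) auto
     then show "\<bar>?R d x * G x\<bar> <= (M * B) * (1 / ?w d x)" by (simp only: mult_ac)
    qed
    also have "... = (M * B) * (SI x. 1 / ?w d x)" by (rule integral_mult_right_zero)
    also have "... <= (M * B) * (area / sqrt d)"
     using integral_vd_inverse[OF z d(1)] M B(1) by (intro mult_left_mono) auto
    finally have 1: "\<bar>SI x. ?R d x * G x\<bar> <= (M * B) * (area / sqrt d)" .
    have "d * d <= d" using d by simp
    then have "\<bar>?b d\<bar> <= 3 * d" using d by (simp add: power2_eq_square)
    then have "\<bar>?b d\<bar> * \<bar>SI x. ?R d x * G x\<bar> <= (3 * d) * ((M * B) * (area / sqrt d))"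
     using 1 by (intro mult_mono) auto
    also have "... = 3 * (M * B * area) * (d / sqrt d)" by simp
    also have "d / sqrt d = sqrt d" using d by (simp add: real_div_sqrt)
    finally show ?thesis by (simp add: abs_mult)
   qed
   then show "\<forall>\<^sub>F d in at_right 0. norm (?b d * (SI x. ?R d x * G x)) <= 3 * (M * B * area) * sqrt d"
    unfolding eventually_at_right_field by (intro exI[of _ 1]) auto
   have "((%d. 3 * (M * B * area) * sqrt d) \<longlongrightarrow> 3 * (M * B * area) * sqrt 0) (at_right 0)"
    by (intro tendsto_intros)
   then show "((%d. 3 * (M * B * area) * sqrt d) \<longlongrightarrow> 0) (at_right 0)" by simp
  qed
  have p0: "(SI x. ?p 0 x * G x) = (SI x. poly P' (x \<bullet> z) * g x)"
  proof -
   have "?p 0 x = poly P (x \<bullet> z)" for x by (simp add: P_def algebra_simps)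
   then have "(SI x. ?p 0 x * G x) = (SI x. poly P (x \<bullet> z) * Lop s g x)"
    by (simp only: G_def)
   also have "... = (SI x. Lop s (%x. poly P (x \<bullet> z)) x * g x)"
    by (rule Lop_symmetric[symmetric]) (intro smooth_zonal_poly g)+
   also have "... = (SI x. poly P' (x \<bullet> z) * g x)"
    by (rule Bochner_Integration.integral_cong) (simp_all add: P'(2)[OF z])
   finally show ?thesis .
  qed
  have ev: "\<forall>\<^sub>F d in at_right 0. - (2 * (1 + d) * j^2 * (SI x. kreg s d z x * G x)) - (SI x. ?p d x * G x) + ?b d * (SI x. ?R d x * G x)
    = (SI x. kreg (Suc s) d z x * Lop (Suc s) g x)"
   unfolding eventually_at_right_field using split by (intro exI[of _ 1]) simp
  have "((%d. (SI x. kreg (Suc s) d z x * Lop (Suc s) g x)) \<longlongrightarrow>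
    - (2 * (1 + 0) * j^2 * (c * g z + (SI x. poly q (x \<bullet> z) * g x))) - (SI x. ?p 0 x * G x) + 0) (at_right 0)"
   by (rule Lim_transform_eventually[OF _ ev]) (intro tendsto_add tendsto_diff tendsto_minus lim1 lim2 lim3)
  also have "- (2 * (1 + 0) * j^2 * (c * g z + (SI x. poly q (x \<bullet> z) * g x))) - (SI x. ?p 0 x * G x) + 0
   = c' * g z + ((- (2 * j^2)) * (SI x. poly q (x \<bullet> z) * g x) - (SI x. poly P' (x \<bullet> z) * g x))"
   unfolding p0 c'_def by (simp add: algebra_simps)
  also have "(- (2 * j^2)) * (SI x. poly q (x \<bullet> z) * g x) - (SI x. poly P' (x \<bullet> z) * g x)
   = (SI x. (- (2 * j^2)) * (poly q (x \<bullet> z) * g x) - poly P' (x \<bullet> z) * g x)"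
   by (subst integral_smooth_diff)
    (intro smooth_mult[OF smooth_const] smooth_mult smooth_zonal_poly g, intro smooth_mult smooth_zonal_poly g,
     simp only: integral_mult_right_zero)
  also have "... = (SI x. poly q' (x \<bullet> z) * g x)"
   by (rule Bochner_Integration.integral_cong) (simp_all add: q'_def algebra_simps)
  finally show ?thesis .
 qed
 ultimately show ?case by blast
qed

text \<open>The surface spline divided by c is a Green function of L up to a zonal polynomial of
  degree at most s. The moment conditions of the kernel space remove that polynomial term.\<close>

definition green_data :: "nat => real => real poly => bool" where
 "green_data s c q \<longleftrightarrow> c ~= 0 & degree q <= s & (ALL z:S2. ALL g. smooth g -->
  (SI x. surface_spline s x z * Lop s g x) = c * g z + (SI x. poly q (x \<bullet> z) * g x))"

lemma power_ln_bounded: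
 fixes w :: real
 assumes "s >= 1" "0 <= w" "w <= 3" shows "\<bar>w ^ s * ln w\<bar> <= 9 * 3 ^ s"
proof (cases "w = 0")
 case True then show ?thesis using assms by simp
next
 case False
 obtain r where r: "s = Suc r" using assms(1) by (cases s) auto
 have "\<bar>w ^ s * ln w\<bar> = \<bar>w * ln w\<bar> * w ^ r"
  using assms by (simp add: r abs_mult mult_ac)
 also have "... <= 9 * 3 ^ r" using abs_mult_ln_le'[of w] False assms by (intro mult_mono power_mono) auto
 also have "... <= 9 * 3 ^ s" by (simp add: r)
 finally show ?thesis .
qed

lemma surface_spline_bounded:
 assumes "s >= 1" "x : S2" "z : S2" shows "\<bar>surface_spline s x z\<bar> <= 9 * 3 ^ s"
 unfolding surface_spline_def using v_nonneg[OF assms(2,3)] v_le[OF assms(2,3)] assms(1)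
 by (intro power_ln_bounded) auto

lemma surface_spline_commute: "surface_spline s x z = surface_spline s z x"
 by (simp add: surface_spline_def inner_commute)

lemma continuous_surface_spline:
 assumes "s >= 1" "z : S2" shows "continuous_on S2 (%x. surface_spline s x z)"
 unfolding surface_spline_def
proof (rule continuous_on_compose2[OF continuous_power_ln[OF assms(1)]])
 show "continuous_on S2 (%x. 1 - x \<bullet> z)" by (rule continuous_vd)
 show "(%x. 1 - x \<bullet> z) ` S2 \<subseteq> {0..}" using v_nonneg assms(2) by auto
qed

lemma surface_spline_modulus:
 assumes "s >= 1" "e > 0"
 shows "EX et>0. ALL x:S2. ALL y:S2. ALL z:S2. norm (y - z) < et --> \<bar>surface_spline s x y - surface_spline s x z\<bar> < e"
proof -
 obtain et where et: "et > 0" "!!v w. v : {0..3} ==> w : {0..3 :: real} ==> \<bar>v - w\<bar> < et ==> \<bar>v ^ s * ln v - w ^ s * ln w\<bar> < e"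
  using power_ln_modulus[OF assms] by blast
 have "\<bar>surface_spline s x y - surface_spline s x z\<bar> < e" if "x : S2" "y : S2" "z : S2" "norm (y - z) < et" for x y z
  unfolding surface_spline_def
 proof (rule et(2))
  show "1 - x \<bullet> y : {0..3}" "1 - x \<bullet> z : {0..3}"
   using v_nonneg[OF that(1,2)] v_le[OF that(1,2)] v_nonneg[OF that(1,3)] v_le[OF that(1,3)] by auto
  have "\<bar>x \<bullet> (z - y)\<bar> <= norm x * norm (z - y)" by (rule Cauchy_Schwarz_ineq2)
  then show "\<bar>1 - x \<bullet> y - (1 - x \<bullet> z)\<bar> < et" using that by (simp add: inner_diff_right norm_minus_commute)
 qed
 then show ?thesis using et(1) by blast
qed

lemma green_data_exists:
 assumes s: "s >= 1" shows "EX c q. green_data s c q"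
proof -
 obtain c q where c: "c ~= 0" "degree q <= s" and lim: "!!z g. z : S2 ==> smooth g ==>
  ((%d. (SI x. kreg s d z x * Lop s g x)) \<longlongrightarrow> c * g z + (SI x. poly q (x \<bullet> z) * g x)) (at_right 0)"
  using kreg_green_limit[of s] by blast
 have "(SI x. surface_spline s x z * Lop s g x) = c * g z + (SI x. poly q (x \<bullet> z) * g x)"
  if z: "z : S2" and g: "smooth g" for z g
 proof -
  have cG: "continuous_on S2 (Lop s g)" using g by (intro smooth_continuous smooth_Lop)
  obtain B where B: "B > 0" "!!x. x : S2 ==> \<bar>Lop s g x\<bar> <= B" using bounded_cont_S2[OF cG] by blast
  have "((%d. (SI x. kreg s d z x * Lop s g x)) \<longlongrightarrow> (SI x. surface_spline s x z * Lop s g x)) (at_right 0)"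
  proof (rule integral_tendsto_at_right_0[where B = "9 * 3 ^ s * B"])
   fix d :: real assume d: "0 < d" "d < 1"
   show "(%x. kreg s d z x * Lop s g x) : borel_measurable sgm"
    by (intro meas_cont smooth_continuous smooth_mult smooth_kreg smooth_Lop z d g)
   fix x assume x: "x : S2"
   have "\<bar>kreg s d z x\<bar> <= 9 * 3 ^ s"
    unfolding kreg_def using vd_pos[OF x z d(1)] v_le[OF x z] d by (intro power_ln_bounded s) auto
   then show "\<bar>kreg s d z x * Lop s g x\<bar> <= 9 * 3 ^ s * B"
    unfolding abs_mult using B(2)[OF x] by (intro mult_mono) auto
  next
   show "(%x. surface_spline s x z * Lop s g x) : borel_measurable sgm"
    by (intro meas_cont continuous_on_mult continuous_surface_spline s z cG)
   fix x assume x: "x : S2"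
   have "((%d. (%v. v ^ s * ln v) (1 + d - x \<bullet> z)) \<longlongrightarrow> (%v. v ^ s * ln v) (1 + 0 - x \<bullet> z)) (at_right 0)"
   proof (rule continuous_on_tendsto_compose[OF continuous_power_ln[OF s]])
    show "((%d. 1 + d - x \<bullet> z) \<longlongrightarrow> 1 + 0 - x \<bullet> z) (at_right 0)" by (intro tendsto_intros)
    show "1 + 0 - x \<bullet> z : {0..}" using v_nonneg[OF x z] by simp
    show "\<forall>\<^sub>F d in at_right 0. 1 + d - x \<bullet> z : {0..}"
     unfolding eventually_at_right_field using vd_pos[OF x z] by (intro exI[of _ 1]) (auto intro: less_imp_le)
   qed
   then have "((%d. kreg s d z x) \<longlongrightarrow> surface_spline s x z) (at_right 0)"
    by (simp add: kreg_def surface_spline_def)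
   then show "((%d. kreg s d z x * Lop s g x) \<longlongrightarrow> surface_spline s x z * Lop s g x) (at_right 0)"
    by (intro tendsto_intros)
  qed
  then show ?thesis using lim[OF z g] tendsto_unique trivial_limit_at_right_real by blast
 qed
 then show ?thesis using c unfolding green_data_def by blast
qed

section \<open>The integral operator with kernel \<open>k\<close>\<close>

text \<open>Convolution with the surface spline. Applied to \<open>bker\<close> it produces smooth
  substitutes for the kernel translates.\<close>

definition Tm :: "nat => (real^3 => real) => real^3 => real" where
 "Tm s f x = (SI y. surface_spline s x y * f y)"

lemma continuous_surface_spline2:
 assumes "s >= 1" "x : S2" shows "continuous_on S2 (surface_spline s x)"
 using continuous_surface_spline[OF assms] by (subst (asm) surface_spline_commute) simp

lemma int_Tm:
 assumes "s >= 1" "x : S2" "continuous_on S2 f" shows "integrable sgm (%y. surface_spline s x y * f y)"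
 by (intro int_cont continuous_on_mult continuous_surface_spline2 assms)

lemma Tm_bound:
 assumes s: "s >= 1" and x: "x : S2" and f: "continuous_on S2 f" "!!y. y : S2 ==> \<bar>f y\<bar> <= B"
 shows "\<bar>Tm s f x\<bar> <= 9 * 3 ^ s * area * B"
proof -
 have "B >= 0" using f(2)[OF x] by linarith
 have "\<bar>Tm s f x\<bar> <= (SI y. \<bar>surface_spline s x y * f y\<bar>)"
  unfolding Tm_def by (rule integral_abs_bound)
 also have "... <= (SI y. 9 * 3 ^ s * B)"
 proof (rule integral_mono')
  fix y assume "y : space sgm"
  then have y: "y : S2" by simp
  show "\<bar>surface_spline s x y * f y\<bar> <= 9 * 3 ^ s * B"
   unfolding abs_mult using surface_spline_bounded[OF s x y] f(2)[OF y] by (intro mult_mono) auto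
  show "0 <= 9 * 3 ^ s * B" using \<open>B >= 0\<close> by simp
 qed simp
 also have "... = 9 * 3 ^ s * area * B" by (simp add: area_def)
 finally show ?thesis .
qed

lemma Tm_rot:
 assumes s: "s >= 1" and x: "x : S2" and f: "continuous_on S2 f"
 shows "Tm s f (rot i t x) = Tm s (%y. f (rot i t y)) x"
proof -
 have x': "rot i t x : S2" using x by simp
 have "Tm s f (rot i t x) = (SI y. surface_spline s (rot i t x) (rot i t y) * f (rot i t y))"
  unfolding Tm_def
  by (rule integral_orthogonal_surface[OF orthogonal_rot, symmetric])
   (intro continuous_on_mult continuous_surface_spline2 s x' f)
 then show ?thesis by (simp add: Tm_def surface_spline_def inner_rot)
qed

lemma Tm_diff:
 assumes "s >= 1" "x : S2" "continuous_on S2 f" "continuous_on S2 g"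
 shows "Tm s (%y. f y - g y) x = Tm s f x - Tm s g x"
 unfolding Tm_def using assms
 by (subst Bochner_Integration.integral_diff[symmetric]) (auto intro: int_Tm simp: right_diff_distrib)

lemma Tm_cmult: "Tm s (%y. c * f y) x = c * Tm s f x"
proof -
 have "surface_spline s x y * (c * f y) = c * (surface_spline s x y * f y)" for y by simp
 then show ?thesis unfolding Tm_def by (simp only: integral_mult_right_zero)
qed

lemma continuous_Tm:
 assumes s: "s >= 1" and f: "continuous_on S2 f" shows "continuous_on S2 (Tm s f)"
 unfolding continuous_on_iff
proof (intro ballI allI impI)
 fix x e assume x: "x : S2" and e: "0 < (e :: real)"
 obtain B where B: "B > 0" "!!x. x : S2 ==> \<bar>f x\<bar> <= B" using bounded_cont_S2[OF f] by blast
 define e' where "e' = e / (2 * area * B)"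
 have e': "e' > 0" using e B area_pos by (simp add: e'_def)
 obtain et where et: "et > 0" "!!x y z. x : S2 ==> y : S2 ==> z : S2 ==> norm (y - z) < et ==>
   \<bar>surface_spline s x y - surface_spline s x z\<bar> < e'"
  using surface_spline_modulus[OF s e'] by blast
 show "EX d>0. ALL x':S2. dist x' x < d --> dist (Tm s f x') (Tm s f x) < e"
 proof (intro exI conjI ballI impI)
  fix x' assume x': "x' : S2" "dist x' x < et"
  have "Tm s f x' - Tm s f x = (SI y. surface_spline s x' y * f y - surface_spline s x y * f y)"
   unfolding Tm_def by (intro Bochner_Integration.integral_diff[symmetric] int_Tm s x x'(1) f)
  also have "\<bar>...\<bar> <= (SI y. \<bar>surface_spline s x' y * f y - surface_spline s x y * f y\<bar>)"
   by (rule integral_abs_bound)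
  also have "... <= (SI y. e' * B)"
  proof (rule integral_mono')
   fix y assume "y : space sgm"
   then have y: "y : S2" by simp
   have "\<bar>surface_spline s y x' - surface_spline s y x\<bar> < e'"
    by (rule et(2)[OF y x'(1) x]) (use x'(2) in \<open>simp add: dist_norm\<close>)
   then have "\<bar>surface_spline s x' y - surface_spline s x y\<bar> <= e'"
    using surface_spline_commute[of s y x'] surface_spline_commute[of s y x] by simp
   then show "\<bar>surface_spline s x' y * f y - surface_spline s x y * f y\<bar> <= e' * B"
    unfolding left_diff_distrib[symmetric] abs_mult using B(2)[OF y] e' by (intro mult_mono) auto
   show "0 <= e' * B" using e' B by simp
  qed simp
  also have "... = e / 2" using area_pos B by (simp add: e'_def area_def[symmetric])
  finally show "dist (Tm s f x') (Tm s f x) < e" using e by (simp add: dist_real_def)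
 qed (rule et(1))
qed

text \<open>The kernel is zonal, so the operator commutes with rotations; a second-order Taylor
  bound for f, uniform on the sphere, turns this into commutation with the derivative. No derivative
  of the kernel is taken.\<close>

lemma hasX_Tm:
 assumes s: "s >= 1" and f: "smooth f" shows "hasX i (Tm s f) (Tm s (Xd i f))"
 unfolding hasX_def
proof
 fix x assume x: "x : S2"
 have cf: "continuous_on S2 f" and cX: "continuous_on S2 (Xd i f)" using f by (auto intro: smooth_continuous)
 have crot: "continuous_on S2 (%y. f (rot i t y))" for t
  by (rule continuous_on_compose2[OF cf continuous_rot]) auto
 obtain B where B: "B > 0" "!!x. x : S2 ==> \<bar>Xd i (Xd i f) x\<bar> <= B"
  using bounded_cont_S2[OF smooth_continuous[OF smooth_Xd[OF smooth_Xd[OF f]]]] by blast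
 have taylor: "\<bar>f (rot i t y) - f y - t * Xd i f y\<bar> <= t^2 * B" if y: "y : S2" for t y
 proof -
  let ?g = "%t. f (rot i t y) - t * Xd i f y"
  have lip: "\<bar>Xd i f (rot i r y) - Xd i f y\<bar> <= \<bar>r\<bar> * B" for r
  proof -
   have "norm (Xd i f (rot i r y) - Xd i f (rot i 0 y)) <= B * norm (r - 0)"
   proof (rule field_differentiable_bound[of UNIV "%r. Xd i f (rot i r y)" "%r. Xd i (Xd i f) (rot i r y)"])
    show "((%r. Xd i f (rot i r y)) has_field_derivative Xd i (Xd i f) (rot i r y)) (at r within UNIV)" for r
     using hasX_at[OF smooth_hasX[OF smooth_Xd[OF f]] y] by simp
    show "norm (Xd i (Xd i f) (rot i r y)) <= B" for r using B(2)[of "rot i r y"] y by simp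
   qed auto
   then show ?thesis by (simp add: mult.commute)
  qed
  have "norm (?g t - ?g 0) <= (\<bar>t\<bar> * B) * norm (t - 0)"
  proof (rule field_differentiable_bound[of "{-\<bar>t\<bar>..\<bar>t\<bar>}" ?g "%r. Xd i f (rot i r y) - Xd i f y"])
   show "(?g has_field_derivative Xd i f (rot i r y) - Xd i f y) (at r within {-\<bar>t\<bar>..\<bar>t\<bar>})" for r
    using hasX_at[OF smooth_hasX[OF f] y, of i r] has_field_derivative_at_within
    by (auto intro!: derivative_eq_intros)
   show "norm (Xd i f (rot i r y) - Xd i f y) <= \<bar>t\<bar> * B" if "r : {-\<bar>t\<bar>..\<bar>t\<bar>}" for r
   proof -
    have "\<bar>r\<bar> * B <= \<bar>t\<bar> * B" using that B(1) by (intro mult_right_mono) auto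
    then show ?thesis using lip[of r] by simp
   qed
  qed auto
  then show ?thesis by (simp add: power2_eq_square mult_ac abs_mult_self_eq flip: abs_mult)
 qed
 let ?K = "9 * 3 ^ s * area * B"
 have diff: "\<bar>(Tm s f (rot i t x) - Tm s f x) / t - Tm s (Xd i f) x\<bar> <= ?K * \<bar>t\<bar>" if t: "t ~= 0" for t
 proof -
  have "Tm s f (rot i t x) - Tm s f x - t * Tm s (Xd i f) x = Tm s (%y. f (rot i t y) - f y - t * Xd i f y) x"
  proof -
   have "Tm s (%y. f (rot i t y) - f y - t * Xd i f y) x
     = Tm s (%y. f (rot i t y) - f y) x - Tm s (%y. t * Xd i f y) x"
    by (rule Tm_diff[OF s x]) (intro continuous_intros crot cf cX)+
   also have "Tm s (%y. f (rot i t y) - f y) x = Tm s (%y. f (rot i t y)) x - Tm s f x"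
    by (rule Tm_diff[OF s x crot cf])
   finally show ?thesis by (simp only: Tm_cmult Tm_rot[OF s x cf])
  qed
  also have "\<bar>...\<bar> <= 9 * 3 ^ s * area * (t^2 * B)"
   by (rule Tm_bound[OF s x]) (intro continuous_intros crot cf cX, rule taylor)
  finally have "\<bar>Tm s f (rot i t x) - Tm s f x - t * Tm s (Xd i f) x\<bar> / \<bar>t\<bar> <= 9 * 3 ^ s * area * (t^2 * B) / \<bar>t\<bar>"
   by (rule divide_right_mono) simp
  moreover have "(Tm s f (rot i t x) - Tm s f x) / t - Tm s (Xd i f) x = (Tm s f (rot i t x) - Tm s f x - t * Tm s (Xd i f) x) / t"
   using t by (simp add: field_simps)
  moreover have "9 * 3 ^ s * area * (t^2 * B) / \<bar>t\<bar> = ?K * \<bar>t\<bar>"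
   using t by (simp add: power2_eq_square abs_if)
  ultimately show ?thesis by (simp add: abs_divide)
 qed
 have "((%t. (Tm s f (rot i t x) - Tm s f x) / t - Tm s (Xd i f) x) \<longlongrightarrow> 0) (at 0)"
 proof (rule Lim_null_comparison)
  show "\<forall>\<^sub>F t in at 0. norm ((Tm s f (rot i t x) - Tm s f x) / t - Tm s (Xd i f) x) <= ?K * \<bar>t\<bar>"
   unfolding eventually_at using diff by (intro exI[of _ 1]) auto
  have "((%t :: real. ?K * \<bar>t\<bar>) \<longlongrightarrow> ?K * \<bar>0\<bar>) (at 0)" by (intro tendsto_intros)
  then show "((%t :: real. ?K * \<bar>t\<bar>) \<longlongrightarrow> 0) (at 0)" by simp
 qed
 then have "((%t. (Tm s f (rot i t x) - Tm s f x) / t) \<longlongrightarrow> Tm s (Xd i f) x) (at 0)"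
  by (rule LIM_zero_cancel)
 then show "((%t. Tm s f (rot i t x)) has_real_derivative Tm s (Xd i f) x) (at 0)"
  by (simp add: has_field_derivative_iff)
qed

lemma smooth_Tm: assumes s: "s >= 1" shows "smooth f ==> smooth (Tm s f)"
 unfolding smooth_def[of "Tm s f"]
proof
 fix n show "smooth f ==> smoothn n (Tm s f)"
 proof (induction n arbitrary: f)
  case 0 then show ?case using continuous_Tm[OF s smooth_continuous] by simp
 next
  case (Suc n)
  have "EX g. hasX i (Tm s f) g & smoothn n g" for i
   using hasX_Tm[OF s Suc.prems] Suc.IH[OF smooth_Xd[OF Suc.prems]] by blast
  then show ?case using continuous_Tm[OF s smooth_continuous[OF Suc.prems]] by simp
 qed
qed

lemma Xd_Tm: "s >= 1 ==> smooth f ==> x : S2 ==> Xd i (Tm s f) x = Tm s (Xd i f) x"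
 using hasX_Xd[OF hasX_Tm] by blast

lemma lap_Tm:
 assumes s: "s >= 1" and f: "smooth f" and x: "x : S2" shows "lap (Tm s f) x = Tm s (lap f) x"
proof -
 have "Xd i (Xd i (Tm s f)) x = Tm s (Xd i (Xd i f)) x" for i
  using Xd_cong[of "Xd i (Tm s f)" "Tm s (Xd i f)" x i] Xd_Tm s f x smooth_Xd by simp
 then have "lap (Tm s f) x = (SUM i:UNIV. (SI y. surface_spline s x y * Xd i (Xd i f) y))"
  by (simp add: lap_def Tm_def)
 also have "... = (SI y. (SUM i:UNIV. surface_spline s x y * Xd i (Xd i f) y))"
  by (intro Bochner_Integration.integral_sum[symmetric] int_Tm s x smooth_continuous smooth_Xd f)
 finally show ?thesis by (simp add: Tm_def lap_def sum_distrib_left)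
qed

lemma Lop_Tm_commute:
 assumes s: "s >= 1" and f: "smooth f"
 shows "x : S2 ==> Lop n (Tm s f) x = Tm s (Lop n f) x"
proof (induction n arbitrary: x)
 case 0
 then show ?case using lap_Tm[OF s f] Tm_cmult[of s "-1" "lap f" x] by simp
next
 case (Suc n)
 let ?a = "(real n + 1) * (real n + 2)"
 have "lap (Lop n (Tm s f)) x = lap (Tm s (Lop n f)) x" by (rule lap_cong) (use Suc in auto)
 also have "... = Tm s (lap (Lop n f)) x" by (rule lap_Tm[OF s smooth_Lop[OF f] Suc.prems])
 finally have "Lop (Suc n) (Tm s f) x = (- 1) * Tm s (lap (Lop n f)) x - ?a * Tm s (Lop n f) x"
  using Suc by simp
 also have "... = Tm s (%y. (- 1) * lap (Lop n f) y - ?a * Lop n f y) x"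
  by (subst Tm_diff[OF s Suc.prems])
   (intro continuous_on_mult_left smooth_continuous smooth_lap smooth_Lop f,
   intro continuous_on_mult_left smooth_continuous smooth_lap smooth_Lop f, simp only: Tm_cmult)
 finally show ?case by simp
qed

lemma Lop_Tm:
 assumes s: "s >= 1" and g: "green_data s c q" and f: "smooth f" and x: "x : S2"
 shows "Lop s (Tm s f) x = c * f x + (SI y. poly q (y \<bullet> x) * f y)"
proof -
 have "Lop s (Tm s f) x = (SI y. surface_spline s y x * Lop s f y)"
  using Lop_Tm_commute[OF s f x] by (simp add: Tm_def surface_spline_commute[of s x])
 then show ?thesis using g f x unfolding green_data_def by simp
qed

section \<open>Smooth approximation of kernel sums\<close>

lemma zonal_modulus:
 fixes F :: "real => real"
 assumes F: "continuous_on {-1..1} F" and e: "e > 0"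
 shows "EX et>0. ALL x:S2. ALL y:S2. ALL z:S2. norm (y - z) < et --> \<bar>F (y \<bullet> x) - F (z \<bullet> x)\<bar> < e"
proof -
 have "uniformly_continuous_on {-1..1} F" using F by (intro compact_uniformly_continuous) auto
 then obtain et where et: "et > 0" "!!v w. v : {-1..1::real} ==> w : {-1..1} ==> dist v w < et ==> dist (F v) (F w) < e"
  using e unfolding uniformly_continuous_on_def by metis
 have "\<bar>F (y \<bullet> x) - F (z \<bullet> x)\<bar> < e" if "x : S2" "y : S2" "z : S2" "norm (y - z) < et" for x y z
 proof -
  have "\<bar>(y - z) \<bullet> x\<bar> <= norm (y - z) * norm x" by (rule Cauchy_Schwarz_ineq2)
  then have "dist (y \<bullet> x) (z \<bullet> x) < et" using that by (simp add: dist_real_def inner_diff_left)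
  then show ?thesis
   using et(2)[of "y \<bullet> x" "z \<bullet> x"] S2_inner_bounds[OF that(2,1)] S2_inner_bounds[OF that(3,1)]
   by (simp add: dist_real_def)
 qed
 then show ?thesis using et(1) by blast
qed

lemma norm_lt_of_vd:
 assumes "y : S2" "z : S2" "0 < et" "1 - y \<bullet> z < et^2 / 2" shows "norm (y - z) < et"
proof -
 have "(norm (y - z))^2 < et^2" using S2_norm_diff[OF assms(1,2)] assms(4) by simp
 then show ?thesis using assms(3) by (simp add: power_less_imp_less_base)
qed

lemma bker_zonal_eventually:
 assumes z: "z : S2" and e: "e > 0"
  and meas: "!!x. x : S2 ==> continuous_on S2 (f x)"
  and B: "!!x y. x : S2 ==> y : S2 ==> \<bar>f x y\<bar> <= B"
  and mod: "!!e. e > 0 ==> EX et>0. ALL x:S2. ALL y:S2. ALL z:S2. norm (y - z) < et --> \<bar>f x y - f x z\<bar> < e"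
 shows "\<forall>\<^sub>F d in at_right 0. ALL x:S2. \<bar>(SI y. bker d z y * f x y) - f x z\<bar> <= e"
proof -
 have "EX d0>0. ALL d:{0<..<d0}. ALL x:S2. \<bar>(SI y. bker d z y * f x y) - f x z\<bar> <= e"
 proof (rule bker_approx_uniform[OF z e])
  show "\<bar>f x y\<bar> <= B" if "x : S2" "y : S2" for x y using B that by blast
  show "f x : borel_measurable sgm" if "x : S2" for x using meas that by blast
  fix e :: real assume e': "e > 0"
  obtain et where et: "et > 0" "!!x y z. x : S2 ==> y : S2 ==> z : S2 ==> norm (y - z) < et ==> \<bar>f x y - f x z\<bar> < e"
   using mod[OF e'] by blast
  have "\<bar>f x y - f x z\<bar> <= e" if "x : S2" "y : S2" "1 - y \<bullet> z < et^2 / 2" for x y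
   using et(2)[OF that(1,2) z norm_lt_of_vd[OF that(2) z et(1) that(3)]] by simp
  then show "EX et>0. ALL x:S2. ALL y:S2. 1 - y \<bullet> z < et --> \<bar>f x y - f x z\<bar> <= e"
   using et(1) by (intro exI[of _ "et^2 / 2"]) auto
 qed
 then show ?thesis unfolding eventually_at_right_field by auto
qed

text \<open>Each Dirac mass at a node is replaced by \<open>bker d\<close>. The polynomial terms
  from Green's identity are then close to those of the exact nodes, whose sum vanishes by the moment
  condition, so only the Dirac-like part of \<open>Lop s u\<close> remains.\<close>

lemma mollify:
 assumes s: "s >= 1" and g: "green_data s c q" and fin: "finite Xi" and Xi: "Xi \<subseteq> S2"
  and p: "smooth p" and Lp: "!!x. x : S2 ==> Lop s p x = 0"
  and mom: "!!x. x : S2 ==> (SUM ze:Xi. a ze * poly q (x \<bullet> ze)) = 0" and e: "e > 0"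
 shows "\<forall>\<^sub>F d in at_right 0. EX u. smooth u
  & (ALL x:S2. \<bar>u x - ((SUM ze:Xi. a ze * surface_spline s x ze) + p x)\<bar> <= e)
  & (ALL x:S2. \<bar>Lop s u x - c * (SUM ze:Xi. a ze * bker d ze x)\<bar> <= e)"
proof -
 define S where "S = (SUM ze:Xi. \<bar>a ze\<bar>) + 1"
 have S: "S > 0" unfolding S_def by (simp add: sum_nonneg add_nonneg_pos)
 define e' where "e' = e / S"
 have e': "e' > 0" using e S by (simp add: e'_def)
 have sum_le: "\<bar>SUM ze:Xi. a ze * t ze\<bar> <= e" if "!!ze. ze : Xi ==> \<bar>t ze\<bar> <= e'" for t
 proof -
  have "\<bar>SUM ze:Xi. a ze * t ze\<bar> <= (SUM ze:Xi. \<bar>a ze\<bar> * e')"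
   by (rule order_trans[OF sum_abs]) (auto simp: abs_mult intro!: sum_mono mult_left_mono that)
  also have "... = (SUM ze:Xi. \<bar>a ze\<bar>) * e'" by (simp add: sum_distrib_right)
  also have "... <= S * e'" using e' by (intro mult_right_mono) (auto simp: S_def)
  also have "... = e" using S by (simp add: e'_def)
  finally show ?thesis .
 qed
 have ev1: "\<forall>\<^sub>F d in at_right 0. ALL x:S2. \<bar>(SI y. bker d ze y * surface_spline s x y) - surface_spline s x ze\<bar> <= e'"
  if "ze : Xi" for ze
  by (rule bker_zonal_eventually[OF _ e'])
   (use that Xi continuous_surface_spline2[OF s] surface_spline_bounded[OF s] surface_spline_modulus[OF s] in blast)+
 have contq: "continuous_on {-1..1} (poly q)" by (intro continuous_intros)
 have "compact (poly q ` {-1..1})" by (intro compact_continuous_image contq) auto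
 then have "bounded (poly q ` {-1..1})" by (rule compact_imp_bounded)
 then obtain B where B': "ALL y:poly q ` {-1..1}. norm y <= B" unfolding bounded_iff by blast
 have B: "\<bar>poly q t\<bar> <= B" if "t : {-1..1}" for t using B' that by simp
 have ev2: "\<forall>\<^sub>F d in at_right 0. ALL x:S2. \<bar>(SI y. bker d ze y * poly q (y \<bullet> x)) - poly q (ze \<bullet> x)\<bar> <= e'"
  if "ze : Xi" for ze
 proof (rule bker_zonal_eventually[OF _ e', where f = "%x y. poly q (y \<bullet> x)"])
  show "ze : S2" using that Xi by blast
  show "continuous_on S2 (%y. poly q (y \<bullet> x))" for x by (intro continuous_intros)
  show "\<bar>poly q (y \<bullet> x)\<bar> <= B" if "x : S2" "y : S2" for x y
   using B[of "y \<bullet> x"] S2_inner_bounds[OF that(2,1)] by simp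
 qed (rule zonal_modulus[OF contq])
 have "\<forall>\<^sub>F d in at_right (0 :: real). 0 < d" by (rule eventually_at_right_less)
 moreover have "\<forall>\<^sub>F d in at_right 0. ALL ze:Xi. ALL x:S2. \<bar>(SI y. bker d ze y * surface_spline s x y) - surface_spline s x ze\<bar> <= e'"
  by (rule eventually_ball_finite[OF fin]) (use ev1 in blast)
 moreover have "\<forall>\<^sub>F d in at_right 0. ALL ze:Xi. ALL x:S2. \<bar>(SI y. bker d ze y * poly q (y \<bullet> x)) - poly q (ze \<bullet> x)\<bar> <= e'"
  by (rule eventually_ball_finite[OF fin]) (use ev2 in blast)
 ultimately show ?thesis
 proof eventually_elim
  case (elim d)
  have sb: "smooth (bker d ze)" if "ze : Xi" for ze using smooth_bker that Xi elim(1) by blast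
  define u where "u = (%x. (SUM ze:Xi. a ze * Tm s (bker d ze) x) + p x)"
  have su: "smooth u" unfolding u_def by (intro smooth_add smooth_sum smooth_mult smooth_const smooth_Tm s sb p)
  moreover have "\<bar>u x - ((SUM ze:Xi. a ze * surface_spline s x ze) + p x)\<bar> <= e" if x: "x : S2" for x
  proof -
   have "u x - ((SUM ze:Xi. a ze * surface_spline s x ze) + p x)
    = (SUM ze:Xi. a ze * ((SI y. bker d ze y * surface_spline s x y) - surface_spline s x ze))"
    by (simp add: u_def Tm_def mult.commute right_diff_distrib sum_subtractf)
   also have "\<bar>...\<bar> <= e" by (rule sum_le) (use elim(2) x in blast)
   finally show ?thesis .
  qed
  moreover have "\<bar>Lop s u x - c * (SUM ze:Xi. a ze * bker d ze x)\<bar> <= e" if x: "x : S2" for x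
  proof -
   have "Lop s u x = Lop s (%x. SUM ze:Xi. a ze * Tm s (bker d ze) x) x + Lop s p x"
    unfolding u_def by (rule Lop_add[OF _ p x]) (intro smooth_sum smooth_mult smooth_const smooth_Tm s sb)
   also have "... = (SUM ze:Xi. Lop s (%x. a ze * Tm s (bker d ze) x) x)"
    using Lp[OF x] by (subst Lop_sum) (auto simp: x intro!: smooth_mult smooth_const smooth_Tm s sb)
   also have "... = (SUM ze:Xi. a ze * (c * bker d ze x + (SI y. bker d ze y * poly q (y \<bullet> x))))"
   proof (rule sum.cong[OF refl])
    fix ze assume ze: "ze : Xi"
    have "(SI y. poly q (y \<bullet> x) * bker d ze y) = (SI y. bker d ze y * poly q (y \<bullet> x))"
     by (rule Bochner_Integration.integral_cong) simp_all
    then show "Lop s (%x. a ze * Tm s (bker d ze) x) x = a ze * (c * bker d ze x + (SI y. bker d ze y * poly q (y \<bullet> x)))"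
     using Lop_cmult[OF smooth_Tm[OF s sb[OF ze]] x] Lop_Tm[OF s g sb[OF ze] x] by simp
   qed
   finally have "Lop s u x - c * (SUM ze:Xi. a ze * bker d ze x) = (SUM ze:Xi. a ze * (SI y. bker d ze y * poly q (y \<bullet> x)))"
    by (simp add: distrib_left sum.distrib sum_distrib_left mult_ac)
   also have "... = (SUM ze:Xi. a ze * ((SI y. bker d ze y * poly q (y \<bullet> x)) - poly q (ze \<bullet> x))) + (SUM ze:Xi. a ze * poly q (x \<bullet> ze))"
    by (simp add: right_diff_distrib sum_subtractf inner_commute)
   also have "(SUM ze:Xi. a ze * poly q (x \<bullet> ze)) = 0" by (rule mom[OF x])
   finally show ?thesis using sum_le[of "%ze. (SI y. bker d ze y * poly q (y \<bullet> x)) - poly q (ze \<bullet> x)"] elim(3) x by simp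
  qed
  ultimately show ?case by blast
 qed
qed

section \<open>Functions varying on a given scale\<close>

text \<open>Symbol-type bounds for variation on the scale r: derivatives of order j, for j up to k,
  are at most A / r^j.\<close>

primrec bd :: "nat => real => real => (real^3 => real) => bool" where
 "bd 0 r A f = (ALL x:S2. \<bar>f x\<bar> <= A)"
| "bd (Suc k) r A f = ((ALL x:S2. \<bar>f x\<bar> <= A) & (ALL i. bd k r (A / r) (Xd i f)))"

lemma bd_sup: "bd k r A f ==> x : S2 ==> \<bar>f x\<bar> <= A"
 by (cases k) auto

lemma bd_cong: "(!!x. x : S2 ==> f x = g x) ==> bd k r A f \<longleftrightarrow> bd k r A g"
proof (induction k arbitrary: f g A)
 case 0 then show ?case by simp
next
 case (Suc k)
 have "bd k r (A / r) (Xd i f) \<longleftrightarrow> bd k r (A / r) (Xd i g)" for i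
  by (rule Suc.IH) (rule Xd_cong; use Suc.prems in blast)
 then show ?case using Suc.prems by simp
qed

lemma bd_SucD: "bd (Suc k) r A f ==> bd k r A f"
 by (induction k arbitrary: A f) auto

lemma bd_mono: "bd k r A f ==> A <= B ==> r > 0 ==> bd k r B f"
proof (induction k arbitrary: A B f)
 case 0 then show ?case by fastforce
next
 case (Suc k)
 have "A / r <= B / r" using Suc.prems by (intro divide_right_mono) auto
 then have "bd k r (B / r) (Xd i f)" for i using Suc.IH[of "A / r" "Xd i f" "B / r"] Suc.prems by simp
 then show ?case using Suc.prems by fastforce
qed

lemma bd_zero: "A >= 0 ==> r > 0 ==> bd k r A (%x. 0)"
proof (induction k arbitrary: A)
 case (Suc k)
 have "Xd i (%x. 0) = (%x. 0)" for i by (simp add: fun_eq_iff)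
 then show ?case using Suc by simp
qed simp

lemma bd_const: "\<bar>c\<bar> <= A ==> r > 0 ==> bd k r A (%x. c)"
proof (cases k)
 case (Suc j)
 assume a: "\<bar>c\<bar> <= A" "r > 0"
 have "Xd i (%x. c) = (%x. 0)" for i by (simp add: fun_eq_iff)
 then show ?thesis using Suc bd_zero[of "A / r" r j] a by simp
qed simp

lemma bd_add: "smooth f ==> smooth g ==> bd k r A f ==> bd k r B g ==> bd k r (A + B) (%x. f x + g x)"
proof (induction k arbitrary: f g A B)
 case 0 then show ?case by (auto intro: order_trans[OF abs_triangle_ineq] add_mono)
next
 case (Suc k)
 have "bd k r ((A + B) / r) (Xd i (%x. f x + g x))" for i
 proof -
  have "bd k r (A / r + B / r) (%x. Xd i f x + Xd i g x)" using Suc by (intro Suc.IH) (auto intro: smooth_Xd)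
  then show ?thesis
   using bd_cong[of "Xd i (%x. f x + g x)" "%x. Xd i f x + Xd i g x" k r "(A + B) / r"] Suc.prems
   by (simp add: Xd_add add_divide_distrib)
 qed
 moreover have "\<bar>f x + g x\<bar> <= A + B" if "x : S2" for x
 proof -
  have "\<bar>f x\<bar> <= A" "\<bar>g x\<bar> <= B" using Suc.prems that by auto
  then show ?thesis using abs_triangle_ineq[of "f x" "g x"] by linarith
 qed
 ultimately show ?case by simp
qed

lemma bd_mult:
 "smooth f ==> smooth g ==> bd k r A f ==> bd k r B g ==> bd k r (2 ^ k * (A * B)) (%x. f x * g x)"
proof (induction k arbitrary: f g A B)
 case 0
 then show ?case by (auto simp: abs_mult intro!: mult_mono order_trans[OF abs_ge_zero])
next
 case (Suc k)
 have fg: "\<bar>f x\<bar> <= A" "\<bar>g x\<bar> <= B" if "x : S2" for x using Suc.prems that by auto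
 have "bd k r (2 ^ Suc k * (A * B) / r) (Xd i (%x. f x * g x))" for i
 proof -
  have "bd k r (2 ^ k * (A / r * B)) (%x. Xd i f x * g x)"
   using Suc.prems by (intro Suc.IH smooth_Xd) (auto dest: bd_SucD simp del: bd.simps(2), simp)
  moreover have "bd k r (2 ^ k * (A * (B / r))) (%x. f x * Xd i g x)"
   using Suc.prems by (intro Suc.IH smooth_Xd) (auto dest: bd_SucD simp del: bd.simps(2), simp)
  ultimately have "bd k r (2 ^ k * (A / r * B) + 2 ^ k * (A * (B / r))) (%x. Xd i f x * g x + f x * Xd i g x)"
   using Suc.prems by (intro bd_add smooth_mult smooth_Xd)
  moreover have "2 ^ k * (A / r * B) + 2 ^ k * (A * (B / r)) = 2 ^ Suc k * (A * B) / r" by simp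
  ultimately have "bd k r (2 ^ Suc k * (A * B) / r) (%x. Xd i f x * g x + f x * Xd i g x)" by (simp only:)
  then show ?thesis by (subst bd_cong[OF Xd_mult[OF Suc.prems(1,2)]])
 qed
 moreover have "\<bar>f x * g x\<bar> <= 2 ^ Suc k * (A * B)" if x: "x : S2" for x
 proof -
  have "\<bar>f x * g x\<bar> <= A * B" unfolding abs_mult using fg[OF x] by (intro mult_mono) auto
  moreover have "1 * (A * B) <= 2 ^ Suc k * (A * B)"
   using fg[OF x] by (intro mult_right_mono mult_nonneg_nonneg one_le_power) auto
  ultimately show ?thesis by linarith
 qed
 ultimately show ?case by simp
qed

lemma bd_cmult: "smooth f ==> bd k r A f ==> bd k r (\<bar>c\<bar> * A) (%x. c * f x)"
proof (induction k arbitrary: f A)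
 case 0 then show ?case by (auto simp: abs_mult intro!: mult_left_mono)
next
 case (Suc k)
 have "bd k r (\<bar>c\<bar> * A / r) (Xd i (%x. c * f x))" for i
  using Suc.IH[of "Xd i f" "A / r"] Suc.prems bd_cong[of "Xd i (%x. c * f x)" "%x. c * Xd i f x" k r "\<bar>c\<bar> * A / r"]
  by (simp add: Xd_cmult smooth_Xd)
 then show ?case using Suc.prems by (auto simp: abs_mult intro!: mult_left_mono)
qed

lemma bd_inner:
 assumes r: "0 < r" "r <= 1" shows "norm a <= A ==> bd k r A (%x. x \<bullet> a)"
proof (induction k arbitrary: a A)
 case 0
 then show ?case using Cauchy_Schwarz_ineq2[of _ a] by (fastforce intro: order_trans)
next
 case (Suc k)
 have "bd k r (A / r) (Xd i (%x. x \<bullet> a))" for i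
 proof -
  have "(norm (cross3 a (axis i 1)))^2 <= (norm a * norm (axis i 1 :: real^3))^2"
   using norm_cross_dot[of a "axis i 1"] by (metis le_add_same_cancel1 zero_le_power2)
  then have "norm (cross3 a (axis i 1)) <= norm a" by (simp add: power2_le_iff_abs_le norm_axis_1)
  also have "... <= A" by (rule Suc.prems)
  also have "A <= A / r"
  proof -
   have "A * r <= A * 1" using r order_trans[OF norm_ge_zero Suc.prems] by (intro mult_left_mono) auto
   then show ?thesis using r by (simp add: pos_le_divide_eq)
  qed
  finally have "bd k r (A / r) (%x. x \<bullet> cross3 a (axis i 1))" by (rule Suc.IH)
  then show ?thesis using bd_cong[of "Xd i (%x. x \<bullet> a)" "%x. x \<bullet> cross3 a (axis i 1)"] by (simp add: Xd_inner)
 qed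
 moreover have "\<bar>x \<bullet> a\<bar> <= A" if "x : S2" for x
  using Cauchy_Schwarz_ineq2[of x a] that Suc.prems by simp
 ultimately show ?case by simp
qed

lemma bd_compose:
 fixes F :: "nat => real => real"
 assumes F: "!!n y. y : U ==> (F n has_real_derivative F (Suc n) y) (at y)"
  and M: "!!n. EX M. ALL y:U. \<bar>F n y\<bar> <= M" and A: "A >= 0"
 shows "EX C>=0. ALL r f. r > 0 --> smooth f --> f ` S2 \<subseteq> U --> bd k r A f --> bd k r C (%x. F n (f x))"
proof (induction k arbitrary: n)
 case 0
 obtain M0 where "ALL y:U. \<bar>F n y\<bar> <= M0" using M by blast
 then have "ALL y:U. \<bar>F n y\<bar> <= \<bar>M0\<bar>" by fastforce
 then show ?case by (intro exI[of _ "\<bar>M0\<bar>"]) auto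
next
 case (Suc k)
 obtain M0 where M0: "ALL y:U. \<bar>F n y\<bar> <= M0" using M by blast
 obtain C where C: "C >= 0" "!!r f. r > 0 ==> smooth f ==> f ` S2 \<subseteq> U ==> bd k r A f ==> bd k r C (%x. F (Suc n) (f x))"
  using Suc.IH[of "Suc n"] by blast
 define D where "D = \<bar>M0\<bar> + 2 ^ k * (C * A)"
 have "0 <= 2 ^ k * (C * A)" using C(1) A by simp
 then have D: "D >= 0" "D >= 2 ^ k * (C * A)" "D >= M0" unfolding D_def by linarith+
 have "bd (Suc k) r D (%x. F n (f x))" if r: "r > 0" and f: "smooth f" "f ` S2 \<subseteq> U" "bd (Suc k) r A f" for r f
 proof -
  have "bd k r (D / r) (Xd i (%x. F n (f x)))" for i
  proof -
   have eq: "Xd i (%x. F n (f x)) x = F (Suc n) (f x) * Xd i f x" if "x : S2" for x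
    by (rule Xd_compose[OF f(1) that]) (use F f(2) in blast)
   have "bd k r (2 ^ k * (C * (A / r))) (%x. F (Suc n) (f x) * Xd i f x)"
   proof (rule bd_mult)
    show "smooth (%x. F (Suc n) (f x))" by (rule smooth_compose[where F = F and U = U and f = f, OF F f(2,1)])
    show "smooth (Xd i f)" using f(1) by (rule smooth_Xd)
    show "bd k r C (%x. F (Suc n) (f x))" using C(2)[OF r f(1,2)] bd_SucD[OF f(3)] by blast
    show "bd k r (A / r) (Xd i f)" using f(3) by simp
   qed
   moreover have "2 ^ k * (C * (A / r)) <= D / r"
    using D(2) r by (simp add: divide_right_mono)
   ultimately have "bd k r (D / r) (%x. F (Suc n) (f x) * Xd i f x)" using bd_mono r by blast
   then show ?thesis using bd_cong[of "Xd i (%x. F n (f x))" "%x. F (Suc n) (f x) * Xd i f x"] eq by blast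
  qed
  moreover have "\<bar>F n (f x)\<bar> <= D" if "x : S2" for x using M0 f(2) that D(3) by (meson image_subset_iff order_trans)
  ultimately show ?thesis by simp
 qed
 then show ?case using D(1) by blast
qed

section \<open>The inverse of a scaled smooth distance, and its derivatives\<close>

definition Psc :: "real => real^3 => real^3 => real" where
 "Psc r z x = (1 + (1 - x \<bullet> z) / r^2) powr (- 1 / 2)"

text \<open>The factor that appears when \<open>Psc\<close> is differentiated. The pair is closed
  under differentiation: derivatives are 1 / r times polynomials in \<open>Psc\<close>,
  \<open>Esc\<close> and linear functions of x, all bounded, so a single induction gives estimates
  of every order.\<close>

definition Esc :: "real => real^3 => 3 => real^3 => real" where
 "Esc r z i x = Psc r z x * ((x \<bullet> (- cross3 z (axis i 1))) / r)"

lemma scaled_pos: "x : S2 ==> z : S2 ==> 1 + (1 - x \<bullet> z) / r^2 >= 1"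
 using v_nonneg[of x z] by simp

lemma smooth_scaled: "smooth (%x. 1 + (1 - x \<bullet> z) / r^2)"
proof -
 have "smooth (%x. 1 + (1 / r^2) * (1 - x \<bullet> z))" by (intro smooth_add smooth_mult smooth_const smooth_vd)
 then show ?thesis by simp
qed

lemma smooth_Psc: "z : S2 ==> smooth (Psc r z)"
 unfolding Psc_def[abs_def] using scaled_pos[of _ z r]
 by (intro smooth_powr smooth_scaled) (meson less_le_trans zero_less_one)

lemma smooth_Esc: "z : S2 ==> smooth (Esc r z i)"
proof -
 assume z: "z : S2"
 have "smooth (%x. Psc r z x * ((1 / r) * (x \<bullet> (- cross3 z (axis i 1)))))"
  by (intro smooth_mult smooth_const smooth_inner smooth_Psc z)
 then show ?thesis unfolding Esc_def[abs_def] by simp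
qed

lemma Xd_scaled: "x : S2 ==> Xd i (%x. 1 + (1 - x \<bullet> z) / r^2) x = (x \<bullet> (- cross3 z (axis i 1))) / r^2"
proof -
 assume x: "x : S2"
 have "Xd i (%x. 1 + (1 - x \<bullet> z) / r^2) x = Xd i (%x. (1 + 1 / r^2) + (- 1 / r^2) * (x \<bullet> z)) x"
  by (rule arg_cong[where f = "%h. Xd i h x"]) (auto simp: fun_eq_iff diff_divide_distrib)
 also have "... = (- 1 / r^2) * Xd i (%x. x \<bullet> z) x"
  using Xd_add[OF smooth_const smooth_mult[OF smooth_const smooth_inner] x, of i "1 + 1 / r^2" "- 1 / r^2" z]
   Xd_cmult[OF smooth_inner x, of i "- 1 / r^2" z] Xd_const[of i "1 + 1 / r^2" x] by linarith
 finally show ?thesis using x by (simp add: Xd_inner)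
qed

lemma Psc_bounds:
 assumes "x : S2" "z : S2" shows "0 < Psc r z x" "Psc r z x <= 1"
proof -
 have "1 <= 1 + (1 - x \<bullet> z) / r^2" using assms by (rule scaled_pos)
 then show "0 < Psc r z x" "Psc r z x <= 1"
  using powr_mono2'[of "- 1 / 2" 1 "1 + (1 - x \<bullet> z) / r^2"] by (auto simp: Psc_def)
qed

lemma Xd_Psc:
 assumes r: "r > 0" and z: "z : S2" and x: "x : S2"
 shows "Xd i (Psc r z) x = (- 1 / 2 / r) * (Psc r z x * (Psc r z x * Esc r z i x))"
proof -
 let ?f = "%x. 1 + (1 - x \<bullet> z) / r^2"
 have f0: "?f x > 0" if "x : S2" for x using scaled_pos[OF that z, of r] by linarith
 have "Xd i (%x. (?f x) powr (- 1 / 2)) x = (- 1 / 2) * (?f x) powr (- 1 / 2 - 1) * Xd i ?f x"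
 proof (rule Xd_compose[OF smooth_scaled x])
  fix x assume "x : S2"
  then have "?f x > 0" by (rule f0)
  then show "((%y. y powr (- 1 / 2)) has_real_derivative - 1 / 2 * ?f x powr (- 1 / 2 - 1)) (at (?f x))"
   using has_real_derivative_powr by blast
 qed
 also have "?f x powr (- 1 / 2 - 1) = Psc r z x * (Psc r z x * Psc r z x)"
  unfolding Psc_def powr_add[symmetric] by simp
 finally have "Xd i (Psc r z) x = (- 1 / 2) * (Psc r z x * (Psc r z x * Psc r z x)) * ((x \<bullet> (- cross3 z (axis i 1))) / r^2)"
  unfolding Xd_scaled[OF x] Psc_def[abs_def] .
 then show ?thesis by (simp add: Esc_def power2_eq_square mult_ac)
qed

lemma Xd_Esc:
 assumes r: "r > 0" and z: "z : S2" and x: "x : S2"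
 shows "Xd j (Esc r z i) x = (1 / r) * ((- 1 / 2) * (Psc r z x * (Esc r z j x * Esc r z i x))
  + Psc r z x * (x \<bullet> cross3 (- cross3 z (axis i 1)) (axis j 1)))"
proof -
 let ?v = "- cross3 z (axis i 1)"
 have "Xd j (Esc r z i) x = Xd j (%x. Psc r z x * ((1 / r) * (x \<bullet> ?v))) x"
  by (rule arg_cong[where f = "%h. Xd j h x"]) (auto simp: Esc_def fun_eq_iff)
 also have "... = Xd j (Psc r z) x * ((1 / r) * (x \<bullet> ?v)) + Psc r z x * ((1 / r) * (x \<bullet> cross3 ?v (axis j 1)))"
  using Xd_mult[OF smooth_Psc[OF z, of r] smooth_mult[OF smooth_const smooth_inner] x, of j "1 / r" ?v]
   Xd_cmult[OF smooth_inner x, of j "1 / r" ?v] Xd_inner[OF x, of j ?v] by simp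
 also have "Xd j (Psc r z) x * ((1 / r) * (x \<bullet> ?v)) = (- 1 / 2 / r) * (Psc r z x * (Esc r z j x * Esc r z i x))"
  unfolding Xd_Psc[OF r z x] by (simp add: Esc_def mult_ac)
 finally show ?thesis by (simp add: algebra_simps)
qed

text \<open>With v = 1 - x . z, the derivative of x . z is at most sqrt (2 v), and
  \<open>Psc\<close> supplies the factor r / sqrt (r^2 + v) that compensates both sqrt v and 1 /
  r.\<close>

lemma Esc_bound:
 assumes r: "r > 0" and z: "z : S2" and x: "x : S2" shows "\<bar>Esc r z i x\<bar> <= 2"
proof -
 let ?v = "1 - x \<bullet> z"
 have v: "0 <= ?v" by (rule v_nonneg[OF x z])
 have "(x \<bullet> cross3 z (axis i 1))^2 <= (SUM j:UNIV. (x \<bullet> cross3 z (axis j 1))^2)"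
  by (rule member_le_sum) auto
 also have "... = 1 - (x \<bullet> z)^2" using sum_Xd_inner_sq[OF x z] by (simp add: Xd_inner x)
 also have "... = ?v * (2 - ?v)" by (simp add: power2_eq_square algebra_simps)
 also have "... <= ?v * 2" using v by (intro mult_left_mono) auto
 finally have 1: "(x \<bullet> cross3 z (axis i 1))^2 <= 2 * ?v" by simp
 have f: "1 + ?v / r^2 > 0" using scaled_pos[OF x z, of r] by linarith
 have "(y powr (- 1 / 2))^2 = 1 / y" if "y > 0" for y :: real
  using that by (simp add: power2_eq_square powr_add[symmetric] powr_minus_divide)
 then have "(Psc r z x)^2 = 1 / (1 + ?v / r^2)"
  unfolding Psc_def using f by blast
 moreover have "n^2 / r^2 * (1 / (1 + V / r^2)) = n^2 / (r^2 + V)" if "V >= 0" for n V :: real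
  using r that by (simp add: divide_simps add_pos_nonneg)
 ultimately have "(Esc r z i x)^2 = (x \<bullet> cross3 z (axis i 1))^2 / (r^2 + ?v)"
  using v by (simp add: Esc_def power_mult_distrib power_divide mult.commute)
 also have "... <= 2 * ?v / (r^2 + ?v)" using 1 r v by (intro divide_right_mono) auto
 also have "... <= 2^2"
 proof -
  have "0 < r^2 + ?v" using r v by (intro add_pos_nonneg) auto
  moreover have "2 * V <= 4 * (R + V)" if "0 <= V" "0 <= R" for V R :: real using that by simp
  then have "2 * ?v <= 4 * (r^2 + ?v)" using v zero_le_power2[of r] by blast
  ultimately have "2 * ?v / (r^2 + ?v) <= 4" by (simp only: pos_divide_le_eq)
  then show ?thesis by simp
 qed
 finally have "\<bar>Esc r z i x\<bar> <= \<bar>2\<bar>" by (simp only: abs_le_square_iff)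
 then show ?thesis by simp
qed

lemma bd_Psc_Esc:
 "EX C>=0. ALL r z. 0 < r --> r <= 1 --> z : S2 --> bd k r C (Psc r z) & (ALL i. bd k r C (Esc r z i))"
proof (induction k)
 case 0
 have "\<bar>Psc r z x\<bar> <= 2" if "x : S2" "z : S2" for r z x
  using Psc_bounds(1)[OF that, of r] Psc_bounds(2)[OF that, of r] by linarith
 then show ?case using Esc_bound by (intro exI[of _ 2]) auto
next
 case (Suc k)
 then obtain C where C: "C >= 0" "!!r z. 0 < r ==> r <= 1 ==> z : S2 ==> bd k r C (Psc r z)"
  "!!r z i. 0 < r ==> r <= 1 ==> z : S2 ==> bd k r C (Esc r z i)" by blast
 define K where "K = 2 ^ k * (C * (2 ^ k * (C * C)))"
 define D where "D = 2 + K + 2 ^ k * (C * 1)"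
 have K: "K >= 0" using C(1) by (simp add: K_def)
 have D: "D >= 2" "D >= \<bar>- 1 / 2\<bar> * K" "D >= \<bar>- 1 / 2\<bar> * K + 2 ^ k * (C * 1)" using K C(1) by (auto simp: D_def)
 have "bd (Suc k) r D (Psc r z) & (ALL i. bd (Suc k) r D (Esc r z i))" if r: "0 < r" "r <= 1" and z: "z : S2" for r z
 proof -
  note sm = smooth_Psc[OF z] smooth_Esc[OF z]
  have 1: "bd k r (D / r) (Xd i (Psc r z))" for i
  proof -
   have "bd k r K (%x. Psc r z x * (Psc r z x * Esc r z i x))"
    unfolding K_def by (intro bd_mult smooth_mult sm C r z)
   then have "bd k r (\<bar>- 1 / 2 / r\<bar> * K) (%x. (- 1 / 2 / r) * (Psc r z x * (Psc r z x * Esc r z i x)))"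
    by (intro bd_cmult smooth_mult sm)
   moreover have "\<bar>- 1 / 2 / r\<bar> * K <= D / r" using D(2) r by (simp add: abs_divide divide_right_mono field_simps)
   ultimately have "bd k r (D / r) (%x. (- 1 / 2 / r) * (Psc r z x * (Psc r z x * Esc r z i x)))"
    using bd_mono r(1) by blast
   then show ?thesis by (subst bd_cong[OF Xd_Psc[OF r(1) z]])
  qed
  have 2: "bd k r (D / r) (Xd j (Esc r z i))" for i j
  proof -
   have n: "norm (cross3 (- cross3 z (axis i 1)) (axis j 1)) <= 1"
   proof -
    have le: "norm (cross3 a (axis j 1)) <= norm a" for a :: "real^3" and j
    proof -
     have "(norm (cross3 a (axis j 1)))^2 <= (norm a * norm (axis j 1 :: real^3))^2"
      using norm_cross_dot[of a "axis j 1"] by (metis le_add_same_cancel1 zero_le_power2)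
     then show ?thesis by (simp add: power2_le_iff_abs_le norm_axis_1)
    qed
    have "norm (cross3 (- cross3 z (axis i 1)) (axis j 1)) <= norm (- cross3 z (axis i 1))" by (rule le)
    also have "... <= norm z" using le by simp
    finally show ?thesis using z by simp
   qed
   have "bd k r (2 ^ k * (C * (2 ^ k * (C * C)))) (%x. Psc r z x * (Esc r z j x * Esc r z i x))"
    by (intro bd_mult smooth_mult sm C r z)
   then have "bd k r (\<bar>- 1 / 2\<bar> * K) (%x. (- 1 / 2) * (Psc r z x * (Esc r z j x * Esc r z i x)))"
    unfolding K_def by (intro bd_cmult smooth_mult sm)
   moreover have "bd k r (2 ^ k * (C * 1)) (%x. Psc r z x * (x \<bullet> cross3 (- cross3 z (axis i 1)) (axis j 1)))"
    by (intro bd_mult sm smooth_inner C r z bd_inner n)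
   ultimately have "bd k r (\<bar>- 1 / 2\<bar> * K + 2 ^ k * (C * 1)) (%x. (- 1 / 2) * (Psc r z x * (Esc r z j x * Esc r z i x))
     + Psc r z x * (x \<bullet> cross3 (- cross3 z (axis i 1)) (axis j 1)))"
    by (intro bd_add smooth_mult smooth_const sm smooth_inner)
   then have "bd k r D (%x. (- 1 / 2) * (Psc r z x * (Esc r z j x * Esc r z i x))
     + Psc r z x * (x \<bullet> cross3 (- cross3 z (axis i 1)) (axis j 1)))"
    using bd_mono D(3) r(1) by blast
   then have h1: "bd k r (\<bar>1 / r\<bar> * D) (%x. (1 / r) * ((- 1 / 2) * (Psc r z x * (Esc r z j x * Esc r z i x))
     + Psc r z x * (x \<bullet> cross3 (- cross3 z (axis i 1)) (axis j 1))))"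
    by (intro bd_cmult smooth_add smooth_mult smooth_const sm smooth_inner)
   have h2: "\<bar>1 / r\<bar> * D = D / r" using r by simp
   show ?thesis by (subst bd_cong[OF Xd_Esc[OF r(1) z]]) (assumption, rule h1[unfolded h2])
  qed
  have "\<bar>Psc r z x\<bar> <= D" "\<bar>Esc r z i x\<bar> <= D" if "x : S2" for x i
   using Psc_bounds(1)[OF that z, of r] Psc_bounds(2)[OF that z, of r] Esc_bound[OF r(1) z that, of i] D(1) by linarith+
  then show ?thesis using 1 2 by simp
 qed
 then show ?case using D(1) by (intro exI[of _ D]) auto
qed

section \<open>Smooth cutoffs\<close>

text \<open>Derivatives of exp (-1 / x) are polynomials in y = 1 / x times exp (-y); differentiating
  P(y) exp (-y) with respect to x gives y^2 (P - P') exp (-y).\<close>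

primrec flat_poly :: "nat => real poly" where
 "flat_poly 0 = 1"
| "flat_poly (Suc n) = [:0, 0, 1:] * (flat_poly n - pderiv (flat_poly n))"

definition flat :: "nat => real => real" where
 "flat n x = (if x <= 0 then 0 else poly (flat_poly n) (1 / x) * exp (- (1 / x)))"

lemma poly_times_exp_minus_tendsto_0: "((%y :: real. poly p y * exp (- y)) \<longlongrightarrow> 0) at_top"
proof -
 have "((%y :: real. SUM i<=degree p. coeff p i * (y ^ i / exp y)) \<longlongrightarrow> (SUM i<=degree p. coeff p i * 0)) at_top"
  by (intro tendsto_sum tendsto_mult tendsto_const tendsto_power_div_exp_0)
 moreover have "(SUM i<=degree p. coeff p i * (y ^ i / exp y)) = poly p y * exp (- y)" for y
  by (simp add: poly_altdef sum_distrib_left exp_minus divide_inverse mult_ac)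
 ultimately show ?thesis by simp
qed

lemma flat_has_derivative: "(flat n has_real_derivative flat (Suc n) x) (at x)"
proof -
 consider "x < 0" | "x = 0" | "x > 0" by linarith
 then show ?thesis
 proof cases
  case 1
  have "((%x. 0 :: real) has_real_derivative 0) (at x)" by simp
  then have "(flat n has_real_derivative 0) (at x)"
   by (rule has_field_derivative_transform_within_open[where S = "{..<0}"]) (use 1 in \<open>auto simp: flat_def\<close>)
  then show ?thesis using 1 by (simp add: flat_def)
 next
  case 3
  let ?g = "%x. poly (flat_poly n) (1 / x) * exp (- (1 / x))"
  have "((%x. 1 / x) has_real_derivative - (1 / x^2)) (at x)"
   using 3 by (auto intro!: derivative_eq_intros simp: power2_eq_square)
  then have d: "((%x. poly (flat_poly n) (1 / x)) has_real_derivative poly (pderiv (flat_poly n)) (1 / x) * - (1 / x^2)) (at x)"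
   "((%x. exp (- (1 / x))) has_real_derivative exp (- (1 / x)) * (1 / x^2)) (at x)"
   using DERIV_chain2[OF poly_DERIV] DERIV_chain2[OF DERIV_exp DERIV_minus] by fastforce+
  have "(?g has_real_derivative flat (Suc n) x) (at x)"
   using DERIV_mult[OF d] 3 by (simp add: flat_def power2_eq_square algebra_simps)
  then show ?thesis
   by (rule has_field_derivative_transform_within_open[where S = "{0<..}"]) (use 3 in \<open>auto simp: flat_def\<close>)
 next
  case 2
  \<comment> \<open>Division by h multiplies by y = 1 / h, hence \<open>pCons 0\<close> on the
    polynomial; the exponential still dominates.\<close>
  have "((%h. flat n h / h) \<longlongrightarrow> 0) (at_right 0)"
  proof -
   have "((%h. poly (pCons 0 (flat_poly n)) (inverse h) * exp (- inverse h)) \<longlongrightarrow> 0) (at_right 0)"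
    by (rule filterlim_compose[OF poly_times_exp_minus_tendsto_0 filterlim_inverse_at_top_right])
   moreover have "\<forall>\<^sub>F h in at_right 0. poly (pCons 0 (flat_poly n)) (inverse h) * exp (- inverse h) = flat n h / h"
    unfolding eventually_at_right_field by (intro exI[of _ 1]) (auto simp: flat_def divide_inverse)
   ultimately show ?thesis by (rule Lim_transform_eventually)
  qed
  moreover have "((%h. flat n h / h) \<longlongrightarrow> 0) (at_left 0)"
  proof (rule tendsto_eventually)
   show "\<forall>\<^sub>F h in at_left 0. flat n h / h = 0"
    unfolding eventually_at_left_field by (intro exI[of _ "-1"]) (auto simp: flat_def)
  qed
  ultimately have "((%h. flat n h / h) \<longlongrightarrow> 0) (at 0)" by (simp add: filterlim_at_split)
  then show ?thesis using 2 by (simp add: has_field_derivative_iff flat_def)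
 qed
qed

lemma flat_0_mono: "0 < x ==> x <= y ==> flat 0 x <= flat 0 y"
 by (simp add: flat_def frac_le)

lemma flat_0_pos: "0 < x ==> 0 < flat 0 x" by (simp add: flat_def)

lemma flat_continuous: "continuous_on A (flat n)"
 using flat_has_derivative by (meson DERIV_isCont continuous_at_imp_continuous_on)

text \<open>A bump with value 1 at z that vanishes unless \<open>Psc\<close> exceeds 1 / 2, that is
  unless 1 - x . z < 3 r^2. This is the origin of the constant 3 in the separation condition and in
  the caps around bumps.\<close>

definition cutoff :: "real => real^3 => real^3 => real" where
 "cutoff r z x = flat 0 (Psc r z x - 1 / 2) / flat 0 (1 / 2)"

lemma cutoff_center: "z : S2 ==> cutoff r z z = 1"
 using flat_0_pos[of "1 / 2"] by (simp add: cutoff_def Psc_def)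

lemma smooth_cutoff: "z : S2 ==> smooth (cutoff r z)"
proof -
 assume z: "z : S2"
 have "smooth (%x. flat 0 (Psc r z x - 1 / 2))"
  by (rule smooth_compose[where F = flat and U = UNIV and k = 0])
   (auto intro: flat_has_derivative smooth_diff smooth_Psc[OF z])
 then have "smooth (%x. (1 / flat 0 (1 / 2)) * flat 0 (Psc r z x - 1 / 2))" by (intro smooth_mult smooth_const)
 then show ?thesis by (simp add: cutoff_def[abs_def])
qed

lemma cutoff_zero:
 assumes r: "r > 0" and z: "z : S2" and x: "x : S2" and v: "3 * r^2 <= 1 - x \<bullet> z"
 shows "cutoff r z x = 0"
proof -
 have "4 <= 1 + (1 - x \<bullet> z) / r^2" using v r by (simp add: field_simps)
 then have "Psc r z x <= 4 powr (- 1 / 2)" unfolding Psc_def by (intro powr_mono2') auto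
 also have "(4 :: real) powr (- 1 / 2) = 1 / 2"
 proof -
  have "(4 :: real) powr (- 1 / 2) = 1 / (4 powr (1 / 2))" by (simp add: powr_minus_divide)
  then show ?thesis by (simp add: powr_half_sqrt)
 qed
 finally show ?thesis by (simp add: cutoff_def flat_def)
qed

lemma bd_cutoff:
 "EX C>=0. ALL r z. 0 < r --> r <= 1 --> z : S2 --> bd k r C (cutoff r z)"
proof -
 obtain A where A: "A >= 0" "!!r z. 0 < r ==> r <= 1 ==> z : S2 ==> bd k r A (Psc r z)"
  using bd_Psc_Esc[of k] by blast
 have "EX C>=0. ALL r f. r > 0 --> smooth f --> f ` S2 \<subseteq> {-1..1} --> bd k r (A + 1 / 2) f --> bd k r C (%x. flat 0 (f x))"
 proof (rule bd_compose)
  show "EX M. ALL y:{-1..1}. \<bar>flat n y\<bar> <= M" for n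
  proof -
   have "compact (flat n ` {-1..1})" by (intro compact_continuous_image flat_continuous) auto
   then have "bounded (flat n ` {-1..1})" by (rule compact_imp_bounded)
   then obtain M where "ALL y:flat n ` {-1..1}. norm y <= M" unfolding bounded_iff by blast
   then show ?thesis by auto
  qed
 qed (use A flat_has_derivative in auto)
 then obtain C where C: "C >= 0" "!!r f. r > 0 ==> smooth f ==> f ` S2 \<subseteq> {-1..1} ==> bd k r (A + 1 / 2) f ==> bd k r C (%x. flat 0 (f x))"
  by blast
 have fp: "flat 0 (1 / 2) > 0" by (rule flat_0_pos) simp
 have "bd k r (\<bar>1 / flat 0 (1 / 2)\<bar> * C) (cutoff r z)" if r: "0 < r" "r <= 1" and z: "z : S2" for r z
 proof -
  have sm: "smooth (%x. Psc r z x + (- (1 / 2)))" by (intro smooth_add smooth_const smooth_Psc z)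
  have "bd k r C (%x. flat 0 (Psc r z x + (- (1 / 2))))"
  proof (rule C(2)[OF r(1) sm])
   have "Psc r z x + (- (1 / 2)) : {-1..1}" if "x : S2" for x
    using Psc_bounds[OF that z, of r] by simp
   then show "(%x. Psc r z x + (- (1 / 2))) ` S2 \<subseteq> {-1..1}" by blast
   show "bd k r (A + 1 / 2) (%x. Psc r z x + (- (1 / 2)))"
    by (intro bd_add smooth_Psc z smooth_const A r bd_const) auto
  qed
  moreover have "smooth (%x. flat 0 (Psc r z x + (- (1 / 2))))"
   by (rule smooth_compose[where F = flat and U = UNIV and k = 0]) (auto intro: flat_has_derivative sm[simplified])
  ultimately have "bd k r (\<bar>1 / flat 0 (1 / 2)\<bar> * C) (%x. (1 / flat 0 (1 / 2)) * flat 0 (Psc r z x + (- (1 / 2))))"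
   by (intro bd_cmult)
  moreover have "(%x. (1 / flat 0 (1 / 2)) * flat 0 (Psc r z x + (- (1 / 2)))) = cutoff r z"
   by (simp add: cutoff_def fun_eq_iff)
  ultimately show ?thesis by (simp only:)
 qed
 then show ?thesis using C(1) fp by (intro exI[of _ "\<bar>1 / flat 0 (1 / 2)\<bar> * C"]) auto
qed

text \<open>Continuity at the centre in the scaled variable (1 - x . z) / r^2; hence th depends
  neither on r nor on z.\<close>

lemma cutoff_ge_half:
 "EX th>0. ALL r z x. 0 < r --> z : S2 --> x : S2 --> 1 - x \<bullet> z <= th * r^2 --> 1 / 2 <= cutoff r z x"
proof -
 have "isCont (%y. flat 0 ((1 + y) powr (- 1 / 2) - 1 / 2) / flat 0 (1 / 2)) 0"
 proof -
  have "isCont (flat 0) y" for y using flat_has_derivative DERIV_isCont by blast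
  moreover have "isCont (%y :: real. (1 + y) powr (- 1 / 2) - 1 / 2) 0" by (intro continuous_intros) auto
  ultimately have "isCont (%y. flat 0 ((1 + y) powr (- 1 / 2) - 1 / 2)) 0" by (rule isCont_o2[rotated])
  then show ?thesis using flat_0_pos[of "1 / 2"] by (intro continuous_intros) auto
 qed
 then obtain d where d: "d > 0" "!!y. \<bar>y\<bar> < d ==> \<bar>flat 0 ((1 + y) powr (- 1 / 2) - 1 / 2) / flat 0 (1 / 2) - 1\<bar> < 1 / 2"
 proof -
  let ?F = "%y. flat 0 ((1 + y) powr (- 1 / 2) - 1 / 2) / flat 0 (1 / 2)"
  assume a: "!!d. 0 < d ==> (!!y. \<bar>y\<bar> < d ==> \<bar>?F y - 1\<bar> < 1 / 2) ==> thesis"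
  have F0: "?F 0 = 1" using flat_0_pos[of "1 / 2"] by simp
  have "EX d>0. ALL y. dist y 0 < d --> dist (?F y) (?F 0) < 1 / 2"
   using \<open>isCont ?F 0\<close>[unfolded continuous_at_eps_delta, rule_format, of "1 / 2"] by simp
  then show thesis using a unfolding F0 dist_real_def by auto
 qed
 have "1 / 2 <= cutoff r z x" if r: "0 < r" and "z : S2" "x : S2" "1 - x \<bullet> z <= (d / 2) * r^2" for r z x
 proof -
  have "0 <= (1 - x \<bullet> z) / r^2" using v_nonneg[OF that(3,2)] by simp
  moreover have "(1 - x \<bullet> z) / r^2 <= d / 2" using that(4) r by (simp add: pos_divide_le_eq)
  ultimately have "\<bar>(1 - x \<bullet> z) / r^2\<bar> < d" using d(1) unfolding abs_of_nonneg[OF \<open>0 <= (1 - x \<bullet> z) / r^2\<close>]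
   by (rule_tac le_less_trans[of _ "d / 2"]) simp_all
  from d(2)[OF this] have "\<bar>cutoff r z x - 1\<bar> < 1 / 2" by (simp add: cutoff_def Psc_def)
  then show ?thesis by linarith
 qed
 then show ?thesis using d(1) by (intro exI[of _ "d / 2"]) auto
qed

lemma cutoff_nonneg: "0 <= cutoff r z x"
 using flat_0_pos[of "1 / 2"] by (auto simp: cutoff_def flat_def)

lemma cutoff_le_1: "z : S2 ==> x : S2 ==> cutoff r z x <= 1"
proof -
 assume z: "z : S2" and x: "x : S2"
 show ?thesis
 proof (cases "Psc r z x - 1 / 2 <= 0")
  case True then show ?thesis by (simp add: cutoff_def flat_def)
 next
  case False
  then have "flat 0 (Psc r z x - 1 / 2) <= flat 0 (1 / 2)" using Psc_bounds(2)[OF x z, of r] by (intro flat_0_mono) auto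
  then show ?thesis using flat_0_pos[of "1 / 2"] by (simp add: cutoff_def)
 qed
qed

section \<open>Pointwise estimates\<close>

lemma integral_Cauchy_Schwarz:
 fixes f g :: "real^3 => real"
 assumes f: "f : borel_measurable sgm" "!!x. x : S2 ==> \<bar>f x\<bar> <= A"
  and g: "g : borel_measurable sgm" "!!x. x : S2 ==> \<bar>g x\<bar> <= B"
 shows "(SI x. f x * g x)^2 <= (SI x. (f x)^2) * (SI x. (g x)^2)"
proof (rule quadratic_nonneg_discriminant)
 fix t :: real
 have prod: "integrable sgm (%x. f x * g x)"
  if h: "f : borel_measurable sgm" "!!x. x : S2 ==> \<bar>f x\<bar> <= A" "g : borel_measurable sgm" "!!x. x : S2 ==> \<bar>g x\<bar> <= B"
  for f g :: "real^3 => real" and A B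
 proof (rule integrable_bounded_surface[where B = "A * B"])
  show "(%x. f x * g x) : borel_measurable sgm" using h by simp
  fix x :: "real^3" assume x: "x : S2"
  show "\<bar>f x * g x\<bar> <= A * B"
   unfolding abs_mult using h(2)[OF x] h(4)[OF x] by (intro mult_mono) auto
 qed
 have i1: "integrable sgm (%x. (f x)^2)" unfolding power2_eq_square by (rule prod[OF f f])
 have i2: "integrable sgm (%x. (g x)^2)" unfolding power2_eq_square by (rule prod[OF g g])
 have i3: "integrable sgm (%x. f x * g x)" by (rule prod[OF f g])
 have "0 <= (SI x. (f x + t * g x)^2)" by (rule Bochner_Integration.integral_nonneg) simp
 also have "... = (SI x. (f x)^2 + 2 * t * (f x * g x) + t^2 * (g x)^2)"
  by (rule Bochner_Integration.integral_cong) (simp_all add: power2_eq_square algebra_simps)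
 also have "... = (SI x. (f x)^2 + 2 * t * (f x * g x)) + (SI x. t^2 * (g x)^2)"
  by (intro Bochner_Integration.integral_add integrable_mult_right Bochner_Integration.integrable_add i1 i2 i3)
 also have "(SI x. (f x)^2 + 2 * t * (f x * g x)) = (SI x. (f x)^2) + (SI x. 2 * t * (f x * g x))"
  by (intro Bochner_Integration.integral_add integrable_mult_right i1 i3)
 finally show "0 <= (SI x. (f x)^2) + 2 * (SI x. f x * g x) * t + (SI x. (g x)^2) * t^2"
  unfolding integral_mult_right_zero by (simp add: mult_ac)
qed

text \<open>Hoelder continuity of order 1 / 2 of the logarithm in the square roots: ln (1 + y) is at
  most 2 sqrt y, with y the relative difference of the square roots. Squaring leaves one linear
  factor, which will become a distance.\<close>

lemma ln_diff_sq_le: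
 fixes a b :: real
 assumes "a > 0" "b > 0"
 shows "(ln a - ln b)^2 <= 16 * \<bar>sqrt a - sqrt b\<bar> * (1 / sqrt a + 1 / sqrt b)"
proof -
 have main: "(ln a - ln b)^2 <= 16 * (sqrt a - sqrt b) * (1 / sqrt b)" if ab: "0 < b" "b <= a" for a b :: real
 proof -
  define y where "y = (sqrt a - sqrt b) / sqrt b"
  have sb: "sqrt b > 0" using ab by simp
  have y: "y >= 0" using ab by (simp add: y_def)
  have "ln a - ln b = 2 * ln (sqrt a / sqrt b)" using ab by (simp add: ln_div ln_sqrt)
  also have "sqrt a / sqrt b = 1 + y" using sb by (simp add: y_def diff_divide_distrib)
  also have "ln (1 + y) = 2 * ln (sqrt (1 + y))" using y by (simp add: ln_sqrt)
  also have "... <= 2 * ln (1 + sqrt y)"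
  proof -
   have "1 + y <= (1 + sqrt y)^2" using y by (simp add: power2_eq_square algebra_simps)
   then have "sqrt (1 + y) <= 1 + sqrt y" using y by (intro real_le_lsqrt) auto
   then have "ln (sqrt (1 + y)) <= ln (1 + sqrt y)"
    using y by (subst ln_le_cancel_iff) (auto intro: add_pos_nonneg)
   then show ?thesis by simp
  qed
  also have "... <= 2 * sqrt y" using ln_add_one_self_le_self[of "sqrt y"] y by simp
  finally have 1: "ln a - ln b <= 4 * sqrt y" by simp
  have "0 <= ln a - ln b" using ab by simp
  then have "(ln a - ln b)^2 <= (4 * sqrt y)^2" using 1 by (intro power_mono)
  also have "... = 16 * y" using y by (simp add: power_mult_distrib)
  finally show ?thesis by (simp add: y_def)
 qed
 show ?thesis
 proof (cases "b <= a")
  case True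
  have "(ln a - ln b)^2 <= 16 * (sqrt a - sqrt b) * (1 / sqrt b)" using main[of b a] True assms by simp
  also have "... <= 16 * \<bar>sqrt a - sqrt b\<bar> * (1 / sqrt a + 1 / sqrt b)"
   using assms True by (intro mult_mono) auto
  finally show ?thesis .
 next
  case False
  have "(ln a - ln b)^2 = (ln b - ln a)^2" by (rule power2_commute)
  also have "... <= 16 * (sqrt b - sqrt a) * (1 / sqrt a)" using main[of a b] False assms by simp
  also have "... <= 16 * \<bar>sqrt a - sqrt b\<bar> * (1 / sqrt a + 1 / sqrt b)"
   using assms False by (intro mult_mono) auto
  finally show ?thesis .
 qed
qed

text \<open>The square root of 1 + d - z . x is a regularized distance, hence Lipschitz uniformly in
  d.\<close>

lemma sqrt_vd_diff:
 assumes x: "x : S2" and y: "y : S2" and z: "z : S2" and d: "d > 0"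
 shows "\<bar>sqrt (1 + d - z \<bullet> x) - sqrt (1 + d - z \<bullet> y)\<bar> <= norm (x - y)"
proof -
 let ?a = "1 + d - z \<bullet> x" and ?b = "1 + d - z \<bullet> y"
 have a: "?a > 0" "?b > 0" using vd_pos[OF z x d] vd_pos[OF z y d] by auto
 have na: "norm (x - z) <= 2 * sqrt (1 + d - z \<bullet> x)" if x: "x : S2" for x
 proof (rule power2_le_imp_le)
  have "(2 * sqrt (1 + d - z \<bullet> x))^2 = 4 * (1 + d - z \<bullet> x)" using vd_pos[OF z x d] by (simp add: power_mult_distrib)
  moreover have "(norm (x - z))^2 = 2 * (1 - z \<bullet> x)" using S2_norm_diff[OF x z] by (simp add: inner_commute)
  ultimately show "(norm (x - z))^2 <= (2 * sqrt (1 + d - z \<bullet> x))^2" using v_nonneg[OF z x] d by simp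
  show "0 <= 2 * sqrt (1 + d - z \<bullet> x)" using vd_pos[OF z x d] by simp
 qed
 have sab: "sqrt ?a + sqrt ?b > 0" using a by (intro add_pos_pos) auto
 have "\<bar>sqrt ?a - sqrt ?b\<bar> * (sqrt ?a + sqrt ?b) = \<bar>?a - ?b\<bar>"
 proof -
  have "(sqrt ?a - sqrt ?b) * (sqrt ?a + sqrt ?b) = ?a - ?b" using a by (simp add: algebra_simps)
  then show ?thesis using sab by (metis abs_mult abs_of_pos)
 qed
 also have "?a - ?b = ((x - z) \<bullet> (x - z) - (y - z) \<bullet> (y - z)) / 2"
  using x y z by (simp add: inner_diff_left inner_diff_right inner_commute)
 also have "(x - z) \<bullet> (x - z) - (y - z) \<bullet> (y - z) = (x - y) \<bullet> ((x - z) + (y - z))"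
  by (simp only: inner_diff_left inner_diff_right inner_add_right) (simp add: inner_commute)
 also have "\<bar>(x - y) \<bullet> ((x - z) + (y - z)) / 2\<bar> <= norm (x - y) * (norm (x - z) + norm (y - z)) / 2"
 proof -
  have "\<bar>(x - y) \<bullet> ((x - z) + (y - z))\<bar> <= norm (x - y) * norm ((x - z) + (y - z))" by (rule Cauchy_Schwarz_ineq2)
  also have "... <= norm (x - y) * (norm (x - z) + norm (y - z))" by (intro mult_left_mono norm_triangle_ineq) simp
  finally show ?thesis by simp
 qed
 also have "... <= norm (x - y) * (2 * sqrt ?a + 2 * sqrt ?b) / 2"
  using na[OF x] na[OF y] by (intro divide_right_mono mult_left_mono add_mono) auto
 also have "... = norm (x - y) * (sqrt ?a + sqrt ?b)" by simp
 finally show ?thesis using sab by (simp only: mult_le_cancel_right_pos)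
qed

lemma Xd_vanish:
 assumes f: "!!x. x : S2 ==> A < 1 - x \<bullet> z ==> f x = 0" and x: "x : S2" "A < 1 - x \<bullet> z"
 shows "Xd i f x = 0"
proof -
 let ?S = "{t. A < 1 - rot i t x \<bullet> z}"
 have o: "open ?S"
  by (intro open_Collect_less continuous_intros continuous_rot_t)
 have d: "((%t. 0 :: real) has_real_derivative 0) (at 0)" by simp
 have m: "0 : ?S" using x by simp
 have e: "0 = f (rot i t x)" if "t : ?S" for t
  using f[of "rot i t x"] x(1) that by simp
 have "((%t. f (rot i t x)) has_real_derivative 0) (at 0)"
  by (rule has_field_derivative_transform_within_open[OF d o m e])
 then show ?thesis by (simp add: Xd_def DERIV_imp_deriv)
qed

lemma lap_vanish:
 assumes f: "!!x. x : S2 ==> A < 1 - x \<bullet> z ==> f x = 0" and x: "x : S2" "A < 1 - x \<bullet> z"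
 shows "lap f x = 0"
 unfolding lap_def using Xd_vanish[OF Xd_vanish[OF f] x] by simp

text \<open>The singularity may lie away from the centre of the cap: inside the cap around x the
  previous bound applies, elsewhere the integrand is at most 1 / sqrt A.\<close>

lemma cap_integral_bound:
 assumes x0: "x0 : S2" and x: "x : S2" and d: "d > 0" and A: "A > 0"
 shows "(SI z. indicat_real (cap x0 A) z * (1 / sqrt (1 + d - z \<bullet> x))) <= 12 * area * sqrt A"
proof -
 have cont: "continuous_on S2 (%z. 1 / sqrt (1 + d - z \<bullet> x))"
  using vd_pos[OF _ x d] by (intro continuous_intros) (auto simp: less_imp_neq[symmetric])
 have int: "integrable sgm (%z. indicat_real (cap x A) z * (1 / sqrt (1 + d - z \<bullet> x)))"
  by (rule integrable_cap_mult[OF cont])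
 have "(SI z. indicat_real (cap x0 A) z * (1 / sqrt (1 + d - z \<bullet> x)))
   <= (SI z. indicat_real (cap x A) z * (1 / sqrt (1 + d - z \<bullet> x)) + indicat_real (cap x0 A) z * (1 / sqrt A))"
 proof (rule integral_mono')
  show "integrable sgm (%z. indicat_real (cap x A) z * (1 / sqrt (1 + d - z \<bullet> x)) + indicat_real (cap x0 A) z * (1 / sqrt A))"
   by (intro Bochner_Integration.integrable_add int integrable_mult_left integrable_cap)
  fix z assume "z : space sgm"
  then have z: "z : S2" by simp
  have w: "1 + d - z \<bullet> x > 0" by (rule vd_pos[OF z x d])
  show "indicat_real (cap x0 A) z * (1 / sqrt (1 + d - z \<bullet> x))
   <= indicat_real (cap x A) z * (1 / sqrt (1 + d - z \<bullet> x)) + indicat_real (cap x0 A) z * (1 / sqrt A)"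
  proof (cases "z : cap x A")
   case True
   then show ?thesis using w A by (auto simp: indicator_def)
  next
   case False
   then have "sqrt A <= sqrt (1 + d - z \<bullet> x)" using z d by (auto simp: cap_def)
   then have "1 / sqrt (1 + d - z \<bullet> x) <= 1 / sqrt A" using A w by (intro divide_left_mono mult_pos_pos) auto
   then show ?thesis using False by (simp add: indicator_def)
  qed
  show "0 <= indicat_real (cap x A) z * (1 / sqrt (1 + d - z \<bullet> x)) + indicat_real (cap x0 A) z * (1 / sqrt A)"
   using w A by simp
 qed
 also have "... = (SI z. indicat_real (cap x A) z * (1 / sqrt (1 + d - z \<bullet> x))) + (SI z. indicat_real (cap x0 A) z * (1 / sqrt A))"
  by (intro Bochner_Integration.integral_add int integrable_mult_left integrable_cap)
 also have "(SI z. indicat_real (cap x0 A) z * (1 / sqrt A)) = measure sgm (cap x0 A) * (1 / sqrt A)"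
  unfolding integral_mult_left_zero by simp
 also have "(SI z. indicat_real (cap x A) z * (1 / sqrt (1 + d - z \<bullet> x))) + measure sgm (cap x0 A) * (1 / sqrt A)
   <= 10 * area * sqrt A + 2 * area * A * (1 / sqrt A)"
  using cap_upper[OF x0 A] cap_integral_inv_sqrt[OF x d A] A by (intro add_mono mult_right_mono) auto
 also have "2 * area * A * (1 / sqrt A) = 2 * area * (A / sqrt A)" by simp
 also have "A / sqrt A = sqrt A" using A by (simp add: real_div_sqrt)
 finally show ?thesis by simp
qed

text \<open>Through the logarithmic Green function, G x - G y is the pairing of \<open>lap G\<close>
  with a difference of two logarithms on the cap. Cauchy-Schwarz and the bounds above give the
  factor |x - y|; 384 is 16 times 12 + 12.\<close>

lemma sobolev_cap:
 assumes G: "smooth G" and van: "!!z. z : S2 ==> A < 1 - z \<bullet> x0 ==> G z = 0"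
  and x0: "x0 : S2" and x: "x : S2" and y: "y : S2" and A: "A > 0"
 shows "(G x - G y)^2 <= (384 / area) * norm (x - y) * sqrt A * (SI z. (lap G z)^2)"
proof -
 let ?t = "norm (x - y)"
 let ?h = "%d z. ln (1 + d - z \<bullet> x) - ln (1 + d - z \<bullet> y)"
 let ?N = "(SI z. (lap G z)^2)"
 have N: "?N >= 0" by simp
 have sL: "smooth (lap G)" using G by (rule smooth_lap)
 obtain B where B: "B > 0" "!!z. z : S2 ==> \<bar>lap G z\<bar> <= B"
  using bounded_cont_S2[OF smooth_continuous[OF sL]] by blast
 have I: "(area * ((SI z. bker d x z * G z) - (SI z. bker d y z * G z)))^2 <= 384 * area * ?t * sqrt A * ?N"
  if d: "d > 0" for d
 proof -
  have sh: "smooth (?h d)" by (intro smooth_diff smooth_ln_vd x y d)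
  obtain H where H: "H > 0" "!!z. z : S2 ==> \<bar>?h d z\<bar> <= H"
   using bounded_cont_S2[OF smooth_continuous[OF sh]] by blast
  have "area * ((SI z. bker d x z * G z) - (SI z. bker d y z * G z))
    = area * (SI z. bker d x z * G z - bker d y z * G z)"
   by (subst integral_smooth_diff) (auto intro: smooth_mult smooth_bker x y d G)
  also have "... = (SI z. area * (bker d x z * G z - bker d y z * G z))" by simp
  also have "... = (SI z. lap (?h d) z * G z)"
  proof (rule Bochner_Integration.integral_cong[OF refl])
   fix z assume "z : space sgm"
   then have z: "z : S2" by simp
   have "lap (?h d) z = lap (%z. ln (1 + d - z \<bullet> x) + (- 1) * ln (1 + d - z \<bullet> y)) z" by simp
   also have "... = lap (%z. ln (1 + d - z \<bullet> x)) z + (- 1) * lap (%z. ln (1 + d - z \<bullet> y)) z"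
    by (simp only: lap_add[OF smooth_ln_vd[OF x d] smooth_mult[OF smooth_const smooth_ln_vd[OF y d]] z]
      lap_cmult[OF smooth_ln_vd[OF y d] z])
   finally have L: "lap (?h d) z = (area * bker d x z - 1) + (- 1) * (area * bker d y z - 1)"
    unfolding lap_ln[OF x z d] lap_ln[OF y z d] .
   show "area * (bker d x z * G z - bker d y z * G z) = lap (?h d) z * G z"
    unfolding L by (simp add: algebra_simps)
  qed
  also have "... = (SI z. ?h d z * lap G z)" by (rule lap_symmetric[OF sh G])
  also have "... = (SI z. (indicat_real (cap x0 A) z * ?h d z) * lap G z)"
  proof (rule Bochner_Integration.integral_cong[OF refl])
   fix z assume "z : space sgm"
   then have z: "z : S2" by simp
   show "?h d z * lap G z = (indicat_real (cap x0 A) z * ?h d z) * lap G z"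
   proof (cases "z : cap x0 A")
    case False
    then have "A < 1 - z \<bullet> x0" using z by (simp add: cap_def)
    then have "lap G z = 0" using lap_vanish[of A x0 G z] van z by blast
    then show ?thesis by simp
   qed simp
  qed
  finally have "(area * ((SI z. bker d x z * G z) - (SI z. bker d y z * G z)))^2
    = (SI z. (indicat_real (cap x0 A) z * ?h d z) * lap G z)^2" by simp
  also have "... <= (SI z. (indicat_real (cap x0 A) z * ?h d z)^2) * ?N"
  proof (rule integral_Cauchy_Schwarz[OF _ _ _ B(2)])
   show "(%z. indicat_real (cap x0 A) z * ?h d z) : borel_measurable sgm"
    by (intro borel_measurable_times borel_measurable_indicator cap_sets meas_cont smooth_continuous sh)
   show "\<bar>indicat_real (cap x0 A) z * ?h d z\<bar> <= H" if "z : S2" for z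
    using H(1) H(2)[OF that] by (auto simp: indicator_def)
   show "lap G : borel_measurable sgm" using sL by (intro meas_cont smooth_continuous)
  qed
  also have "(SI z. (indicat_real (cap x0 A) z * ?h d z)^2) <= 384 * area * ?t * sqrt A"
  proof -
   let ?g = "%x z. indicat_real (cap x0 A) z * (1 / sqrt (1 + d - z \<bullet> x))"
   have ig: "integrable sgm (?g x)" if x: "x : S2" for x
   proof (rule integrable_cap_mult)
    show "continuous_on S2 (%z. 1 / sqrt (1 + d - z \<bullet> x))"
     using vd_pos[OF _ x d] by (intro continuous_intros) (auto simp: less_imp_neq[symmetric])
   qed
   have "(SI z. (indicat_real (cap x0 A) z * ?h d z)^2) <= (SI z. (16 * ?t) * (?g x z + ?g y z))"
   proof (rule integral_mono')
    show "integrable sgm (%z. (16 * ?t) * (?g x z + ?g y z))"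
     by (intro integrable_mult_right Bochner_Integration.integrable_add ig x y)
    fix z assume "z : space sgm"
    then have z: "z : S2" by simp
    have w: "1 + d - z \<bullet> x > 0" "1 + d - z \<bullet> y > 0" using vd_pos[OF z x d] vd_pos[OF z y d] by auto
    show "0 <= (16 * ?t) * (?g x z + ?g y z)" using w by simp
    have "(?h d z)^2 <= 16 * \<bar>sqrt (1 + d - z \<bullet> x) - sqrt (1 + d - z \<bullet> y)\<bar> * (1 / sqrt (1 + d - z \<bullet> x) + 1 / sqrt (1 + d - z \<bullet> y))"
     by (rule ln_diff_sq_le[OF w])
    also have "... <= (16 * ?t) * (1 / sqrt (1 + d - z \<bullet> x) + 1 / sqrt (1 + d - z \<bullet> y))"
     using sqrt_vd_diff[OF x y z d] w by (intro mult_right_mono) auto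
    finally show "(indicat_real (cap x0 A) z * ?h d z)^2 <= (16 * ?t) * (?g x z + ?g y z)"
     by (auto simp: indicator_def)
   qed
   also have "... = (16 * ?t) * ((SI z. ?g x z) + (SI z. ?g y z))"
    unfolding integral_mult_right_zero by (subst Bochner_Integration.integral_add[OF ig[OF x] ig[OF y]]) simp
   also have "... <= (16 * ?t) * (12 * area * sqrt A + 12 * area * sqrt A)"
    by (intro mult_left_mono add_mono cap_integral_bound x0 x y d A) simp
   finally show ?thesis by (simp add: mult_ac)
  qed
  finally show ?thesis using N by (simp add: mult_right_mono)
 qed
 have "((%d. (area * ((SI z. bker d x z * G z) - (SI z. bker d y z * G z)))^2) \<longlongrightarrow> (area * (G x - G y))^2) (at_right 0)"
  by (intro tendsto_intros bker_tendsto smooth_continuous G x y)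
 then have "(area * (G x - G y))^2 <= 384 * area * ?t * sqrt A * ?N"
 proof (rule tendsto_upperbound)
  show "\<forall>\<^sub>F d in at_right 0. (area * ((SI z. bker d x z * G z) - (SI z. bker d y z * G z)))^2 <= 384 * area * ?t * sqrt A * ?N"
   unfolding eventually_at_right_field using I by (intro exI[of _ 1]) auto
 qed simp
 then have "area * (area * (G x - G y)^2) <= area * (384 * ?t * sqrt A * ?N)"
  by (simp add: power_mult_distrib power2_eq_square mult_ac)
 then have "area * (G x - G y)^2 <= 384 * ?t * sqrt A * ?N" using area_pos by simp
 then show ?thesis using area_pos by (simp add: field_simps)
qed

definition Dsc :: "real => (real^3 => real) => real^3 => real" where
 "Dsc r u x = (u x)^2 / r ^ 4 + (SUM i:UNIV. (Xd i u x)^2) / r^2 + (lap u x)^2"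

lemma smooth_Dsc: "smooth u ==> smooth (Dsc r u)"
proof -
 assume u: "smooth u"
 have "smooth (%x. (1 / r ^ 4) * (u x)^2 + (1 / r^2) * (SUM i:UNIV. (Xd i u x)^2) + (lap u x)^2)"
  by (intro smooth_add smooth_mult smooth_const smooth_power smooth_sum smooth_Xd smooth_lap u)
 then show ?thesis by (simp add: Dsc_def[abs_def])
qed

lemma Dsc_nonneg: "0 <= Dsc r u x"
 by (simp add: Dsc_def sum_nonneg)

lemma integral_Dsc:
 assumes u: "smooth u"
 shows "(SI x. Dsc r u x) = ip 0 u u / r ^ 4 + ip 1 u u / r^2 + ip 2 u u"
proof -
 note sI = smooth_add smooth_mult smooth_const smooth_power smooth_sum smooth_Xd smooth_lap u
 have "(SI x. Dsc r u x) = (SI x. (1 / r ^ 4) * (u x)^2 + (1 / r^2) * (SUM i:UNIV. (Xd i u x)^2) + (lap u x)^2)"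
  by (simp add: Dsc_def)
 also have "... = (SI x. (1 / r ^ 4) * (u x)^2 + (1 / r^2) * (SUM i:UNIV. (Xd i u x)^2)) + (SI x. (lap u x)^2)"
  by (rule integral_smooth_add) (intro sI)+
 also have "(SI x. (1 / r ^ 4) * (u x)^2 + (1 / r^2) * (SUM i:UNIV. (Xd i u x)^2))
  = (SI x. (1 / r ^ 4) * (u x)^2) + (SI x. (1 / r^2) * (SUM i:UNIV. (Xd i u x)^2))"
  by (rule integral_smooth_add) (intro sI)+
 also have "(SI x. (1 / r^2) * (SUM i:UNIV. (Xd i u x)^2)) = (1 / r^2) * (SUM i:UNIV. (SI x. (Xd i u x)^2))"
  by (subst integral_smooth_sum[symmetric]) (intro sI, rule integral_mult_right_zero)
 also have "(SI x. (1 / r ^ 4) * (u x)^2) = (1 / r ^ 4) * (SI x. (u x)^2)" by (rule integral_mult_right_zero)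
 also have "(SI x. (lap u x)^2) = ip 2 u u"
  using ip_lap_lap[OF u, of 0] by (simp add: power2_eq_square numeral_2_eq_2)
 finally show ?thesis by (simp add: power2_eq_square)
qed

text \<open>\<open>sobolev_cap\<close> is applied to u times a bump of scale r at x. The product
  vanishes at y because u does, however far y is from x, so any zero can be used.\<close>

lemma pointwise_local:
 "EX C>0. ALL r x y u. 0 < r --> r <= 1 --> x : S2 --> y : S2 --> smooth u --> u y = 0 -->
  (u x)^2 <= C * norm (x - y) * r * (SI z. indicat_real (cap x (3 * r^2)) z * Dsc r u z)"
proof -
 obtain K where K: "K >= 0" "!!r z. 0 < r ==> r <= 1 ==> z : S2 ==> bd 2 r K (cutoff r z)"
  using bd_cutoff[of 2] by blast
 define C where "C = (384 / area) * sqrt 3 * (36 * K^2) + 1"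
 have C: "C > 0" using area_pos by (simp add: C_def add_nonneg_pos)
 have "(u x)^2 <= C * norm (x - y) * r * (SI z. indicat_real (cap x (3 * r^2)) z * Dsc r u z)"
  if r: "0 < r" "r <= 1" and x: "x : S2" and y: "y : S2" and u: "smooth u" and uy: "u y = 0" for r x y u
 proof -
  let ?e = "cutoff r x" and ?A = "3 * r^2"
  let ?J = "(SI z. indicat_real (cap x ?A) z * Dsc r u z)"
  let ?G = "%z. ?e z * u z"
  have se: "smooth ?e" by (rule smooth_cutoff[OF x])
  have sG: "smooth ?G" by (intro smooth_mult se u)
  have van: "?G z = 0" if "z : S2" "?A < 1 - z \<bullet> x" for z
   using cutoff_zero[OF r(1) x that(1)] that(2) by simp
  have "(?G x - ?G y)^2 <= (384 / area) * norm (x - y) * sqrt ?A * (SI z. (lap ?G z)^2)"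
   by (rule sobolev_cap[OF sG van x x y]) (use r in simp_all)
  then have 1: "(u x)^2 <= (384 / area) * norm (x - y) * sqrt ?A * (SI z. (lap ?G z)^2)"
   using uy cutoff_center[OF x] by simp
  have "(SI z. (lap ?G z)^2) <= (SI z. 36 * K^2 * (indicat_real (cap x ?A) z * Dsc r u z))"
  proof (rule integral_mono')
   show "integrable sgm (%z. 36 * K^2 * (indicat_real (cap x ?A) z * Dsc r u z))"
    by (intro integrable_mult_right integrable_cap_mult smooth_continuous smooth_Dsc u)
   fix z assume "z : space sgm"
   then have z: "z : S2" by simp
   show "0 <= 36 * K^2 * (indicat_real (cap x ?A) z * Dsc r u z)" using Dsc_nonneg by simp
   show "(lap ?G z)^2 <= 36 * K^2 * (indicat_real (cap x ?A) z * Dsc r u z)"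
   proof (cases "z : cap x ?A")
    case False
    then have "?A < 1 - z \<bullet> x" using z by (simp add: cap_def)
    then have "lap ?G z = 0" using lap_vanish[of ?A x ?G z] van z by blast
    then show ?thesis using False by simp
   next
    case True
    have b: "bd 2 r K ?e" by (rule K(2)[OF r x])
    have e0: "\<bar>?e z\<bar> <= K" by (rule bd_sup[OF b z])
    have e1: "\<bar>Xd i ?e z\<bar> <= K / r" for i
    proof -
     have "bd 1 r (K / r) (Xd i ?e)" using b by (simp add: numeral_2_eq_2)
     then show ?thesis using bd_sup z by blast
    qed
    have e2: "\<bar>Xd i (Xd i ?e) z\<bar> <= K / r^2" for i
    proof -
     have "bd 0 r (K / r / r) (Xd i (Xd i ?e))" using b by (simp add: numeral_2_eq_2)
     then show ?thesis using bd_sup[of 0 r "K / r / r"] z by (simp add: power2_eq_square)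
    qed
    define a where "a = lap ?e z * u z"
    define b where "b = 2 * (SUM i:UNIV. Xd i ?e z * Xd i u z)"
    define c where "c = ?e z * lap u z"
    have "\<bar>lap ?e z\<bar> <= (SUM i:(UNIV :: 3 set). K / r^2)"
     unfolding lap_def by (rule order_trans[OF sum_abs]) (rule sum_mono, rule e2)
    then have "\<bar>lap ?e z\<bar> <= 3 * (K / r^2)" by simp
    then have "\<bar>a\<bar> <= 3 * (K / r^2) * \<bar>u z\<bar>" unfolding a_def abs_mult by (intro mult_right_mono) auto
    then have "a^2 <= (3 * (K / r^2) * \<bar>u z\<bar>)^2" by (metis abs_ge_zero power2_abs power_mono)
    also have "... = 9 * K^2 * ((u z)^2 / r ^ 4)" by (simp add: power_mult_distrib power_divide flip: power_mult)
    finally have a2: "a^2 <= 9 * K^2 * ((u z)^2 / r ^ 4)" .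
    have "\<bar>SUM i:UNIV. Xd i ?e z * Xd i u z\<bar> <= (SUM i:UNIV. (K / r) * \<bar>Xd i u z\<bar>)"
     by (rule order_trans[OF sum_abs]) (intro sum_mono, unfold abs_mult, intro mult_right_mono e1 abs_ge_zero)
    then have "\<bar>b\<bar> <= 2 * (K / r) * (SUM i:UNIV. \<bar>Xd i u z\<bar>)"
     unfolding b_def abs_mult[of 2] sum_distrib_left[symmetric] by simp
    then have "b^2 <= (2 * (K / r) * (SUM i:UNIV. \<bar>Xd i u z\<bar>))^2" by (metis abs_ge_zero power2_abs power_mono)
    also have "... = 4 * K^2 / r^2 * (SUM i:UNIV. \<bar>Xd i u z\<bar>)^2" by (simp add: power_mult_distrib power_divide)
    also have "(SUM i:UNIV. \<bar>Xd i u z\<bar>)^2 <= 3 * (SUM i:UNIV. (Xd i u z)^2)"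
     using Cauchy_Schwarz_ineq_sum[of "%i. 1" "%i. \<bar>Xd i u z\<bar>" "UNIV :: 3 set"] by simp
    finally have b2: "b^2 <= 12 * K^2 * ((SUM i:UNIV. (Xd i u z)^2) / r^2)"
     by (simp add: divide_right_mono mult_left_mono)
    have "\<bar>c\<bar> <= K * \<bar>lap u z\<bar>" unfolding c_def abs_mult by (intro mult_right_mono e0) simp
    then have "c^2 <= (K * \<bar>lap u z\<bar>)^2" by (metis abs_ge_zero power2_abs power_mono)
    then have c2: "c^2 <= K^2 * (lap u z)^2" by (simp add: power_mult_distrib)
    have "(lap ?G z)^2 = (a + b + c)^2"
     using lap_mult[OF se u z] by (simp add: a_def b_def c_def)
    also have "... <= 3 * (a^2 + b^2 + c^2)"
     using sum_squares_ge_zero[of "a - b" "b - c"] zero_le_power2[of "a - c"] by (simp add: power2_eq_square algebra_simps)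
    also have "... <= 3 * (12 * K^2 * ((u z)^2 / r ^ 4) + 12 * K^2 * ((SUM i:UNIV. (Xd i u z)^2) / r^2) + 12 * K^2 * (lap u z)^2)"
    proof -
     have "9 * K^2 * ((u z)^2 / r ^ 4) <= 12 * K^2 * ((u z)^2 / r ^ 4)" by (intro mult_right_mono) auto
     then have a2': "a^2 <= 12 * K^2 * ((u z)^2 / r ^ 4)" using a2 by (rule order_trans[rotated])
     have "1 * (K^2 * (lap u z)^2) <= 12 * (K^2 * (lap u z)^2)" by (intro mult_right_mono) auto
     then have c2': "c^2 <= 12 * K^2 * (lap u z)^2"
      unfolding mult_1 mult.assoc[symmetric] by (rule order_trans[OF c2])
     show ?thesis by (intro mult_left_mono add_mono a2' b2 c2') simp
    qed
    also have "... = 36 * K^2 * Dsc r u z" unfolding Dsc_def by (simp add: distrib_left)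
    finally show ?thesis using True by simp
   qed
  qed
  also have "... = 36 * K^2 * ?J" by (rule integral_mult_right_zero)
  finally have 2: "(SI z. (lap ?G z)^2) <= 36 * K^2 * ?J" .
  have J: "?J >= 0" by (intro Bochner_Integration.integral_nonneg mult_nonneg_nonneg Dsc_nonneg) simp
  have "sqrt ?A = sqrt 3 * r" using r by (simp add: real_sqrt_mult)
  then have "(u x)^2 <= (384 / area) * norm (x - y) * (sqrt 3 * r) * (36 * K^2 * ?J)"
  proof -
   have "0 <= (384 / area) * norm (x - y) * (sqrt 3 * r)" using area_pos r by simp
   from order_trans[OF 1[unfolded \<open>sqrt ?A = sqrt 3 * r\<close>] mult_left_mono[OF 2 this]] show ?thesis .
  qed
  also have "... = ((384 / area) * sqrt 3 * (36 * K^2)) * (norm (x - y) * r * ?J)" by simp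
  also have "... <= C * (norm (x - y) * r * ?J)"
   using J r by (intro mult_right_mono) (auto simp: C_def)
  finally show ?thesis by (simp add: mult.assoc)
 qed
 then show ?thesis using C by blast
qed

lemma pointwise_global:
 "EX C>0. ALL r x y u. 0 < r --> r <= 1 --> x : S2 --> y : S2 --> smooth u --> u y = 0 -->
  (u x)^2 <= C * norm (x - y) * r * (ip 0 u u / r ^ 4 + ip 1 u u / r^2 + ip 2 u u)"
proof -
 obtain C where C: "C > 0" "!!r x y u. 0 < r ==> r <= 1 ==> x : S2 ==> y : S2 ==> smooth u ==> u y = 0 ==>
  (u x)^2 <= C * norm (x - y) * r * (SI z. indicat_real (cap x (3 * r^2)) z * Dsc r u z)"
  using pointwise_local by blast
 have "(u x)^2 <= C * norm (x - y) * r * (ip 0 u u / r ^ 4 + ip 1 u u / r^2 + ip 2 u u)"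
  if h: "0 < r" "r <= 1" "x : S2" "y : S2" "smooth u" "u y = 0" for r x y u
 proof -
  have "(SI z. indicat_real (cap x (3 * r^2)) z * Dsc r u z) <= (SI z. Dsc r u z)"
   by (rule integral_mono') (use int_smooth[OF smooth_Dsc[OF h(5)]] Dsc_nonneg in \<open>auto simp: indicator_def\<close>)
  also have "... = ip 0 u u / r ^ 4 + ip 1 u u / r^2 + ip 2 u u" by (rule integral_Dsc[OF h(5)])
  finally show ?thesis
  proof -
   assume *: "(SI z. indicat_real (cap x (3 * r^2)) z * Dsc r u z) <= ip 0 u u / r ^ 4 + ip 1 u u / r^2 + ip 2 u u"
   have "0 <= C * norm (x - y) * r" using C(1) h(1) by simp
   from order_trans[OF C(2)[OF h] mult_left_mono[OF * this]] show ?thesis .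
  qed
 qed
 then show ?thesis using C(1) by blast
qed

section \<open>Functions vanishing on a dense set\<close>

text \<open>Fubini: a point z lies in the cap around x exactly when x lies in the cap around z,
  whose measure is at most 2 area a.\<close>

lemma cap_average_integral:
 fixes D :: "real^3 => real"
 assumes D: "continuous_on S2 D" "!!z. 0 <= D z" and a: "a > 0"
 shows "(SI x. (SI z. indicat_real (cap x a) z * D z)) <= 2 * area * a * (SI z. D z)"
  and "integrable sgm (%x. (SI z. indicat_real (cap x a) z * D z))"
proof -
 interpret pair_sigma_finite sgm sgm by standard
 obtain B where B: "B > 0" "!!z. z : S2 ==> \<bar>D z\<bar> <= B" using bounded_cont_S2[OF D(1)] by blast
 define f where "f = (%x z. (if 1 - z \<bullet> x <= a then D z else 0))"
 have id: "(%x. x) : sgm \<rightarrow>\<^sub>M (borel :: (real^3) measure)"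
  unfolding measurable_cong_sets[OF sets_surface_measure refl]
  by (rule measurable_restrict_space1) (rule measurable_ident_sets[OF refl])
 have m1: "fst : sgm \<Otimes>\<^sub>M sgm \<rightarrow>\<^sub>M (borel :: (real^3) measure)" "snd : sgm \<Otimes>\<^sub>M sgm \<rightarrow>\<^sub>M (borel :: (real^3) measure)"
  by (rule measurable_compose[OF measurable_fst id], rule measurable_compose[OF measurable_snd id])
 have mD: "(%p. D (snd p)) : borel_measurable (sgm \<Otimes>\<^sub>M sgm)"
  by (rule measurable_compose[OF measurable_snd meas_cont[OF D(1)]])
 have m: "(%p. f (fst p) (snd p)) : borel_measurable (sgm \<Otimes>\<^sub>M sgm)"
  unfolding f_def
 proof (rule measurable_If[OF mD])
  have "(%p. 1 - snd p \<bullet> fst p) : borel_measurable (sgm \<Otimes>\<^sub>M sgm)"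
   using borel_measurable_inner[OF m1(2,1)] by simp
  then show "{p : space (sgm \<Otimes>\<^sub>M sgm). 1 - snd p \<bullet> fst p <= a} : sets (sgm \<Otimes>\<^sub>M sgm)" by measurable
 qed simp
 have int: "integrable (sgm \<Otimes>\<^sub>M sgm) (case_prod f)"
 proof -
  interpret P: finite_measure "sgm \<Otimes>\<^sub>M sgm"
   by (rule finite_measure_pair_measure) (rule finite_measure_surface)+
  have "integrable (sgm \<Otimes>\<^sub>M sgm) (%p. f (fst p) (snd p))"
   by (rule P.integrable_const_bound[OF _ m, of B])
    (use B in \<open>auto simp: f_def space_pair_measure intro!: AE_I2\<close>)
  then show ?thesis by (simp add: case_prod_beta')
 qed
 have eq: "(SI z. indicat_real (cap x a) z * D z) = (SI z. f x z)" if "x : S2" for x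
  by (rule Bochner_Integration.integral_cong) (auto simp: f_def cap_def indicator_def)
 have "integrable sgm (%x. (SI z. f x z))"
  using integrable_fst[OF int] by simp
 then show "integrable sgm (%x. (SI z. indicat_real (cap x a) z * D z))"
  by (rule Bochner_Integration.integrable_cong[THEN iffD1, rotated 2]) (simp_all add: eq)
 have "(SI x. (SI z. indicat_real (cap x a) z * D z)) = (SI x. (SI z. f x z))"
  by (rule Bochner_Integration.integral_cong) (simp_all add: eq)
 also have "... = (SI z. (SI x. f x z))" by (rule Fubini_integral[OF int, symmetric])
 also have "... <= (SI z. 2 * area * a * D z)"
 proof (rule integral_mono')
  show "integrable sgm (%z. 2 * area * a * D z)" by (intro integrable_mult_right int_cont D)
  fix z assume "z : space sgm"
  then have z: "z : S2" by simp
  have "(SI x. f x z) = (SI x. indicat_real (cap z a) x * D z)"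
   by (rule Bochner_Integration.integral_cong) (auto simp: f_def cap_def indicator_def inner_commute)
  also have "... = measure sgm (cap z a) * D z" unfolding integral_mult_left_zero by simp
  also have "... <= 2 * area * a * D z" using cap_upper[OF z a] D(2) by (intro mult_right_mono)
  finally show "(SI x. f x z) <= 2 * area * a * D z" .
  show "0 <= 2 * area * a * D z" using D(2) a area_pos by simp
 qed
 also have "... = 2 * area * a * (SI z. D z)" by (rule integral_mult_right_zero)
 finally show "(SI x. (SI z. indicat_real (cap x a) z * D z)) <= 2 * area * a * (SI z. D z)" .
qed

text \<open>The local estimate is integrated with a node within h of x as the zero, which gains a
  factor h / r. For r = R h with R large the term in u itself is absorbed; the first-order term is
  removed by log-convexity.\<close>

lemma zeros_lemma_base:
 "EX R>=1. ALL h Xi u. 0 < h --> R * h <= 1 --> Xi \<subseteq> S2 --> (ALL x:S2. EX xi:Xi. norm (x - xi) <= h) --> smooth u -->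
  (ALL xi:Xi. u xi = 0) --> ip 0 u u <= (2 * (R * h)^2)^2 * ip 2 u u"
proof -
 obtain C where C: "C > 0" "!!r x y u. 0 < r ==> r <= 1 ==> x : S2 ==> y : S2 ==> smooth u ==> u y = 0 ==>
  (u x)^2 <= C * norm (x - y) * r * (SI z. indicat_real (cap x (3 * r^2)) z * Dsc r u z)"
  using pointwise_local by blast
 \<comment> \<open>Makes 6 C area at most R / 2, so that the prefactor 6 C area h r^3 is at most r^4
   / 2.\<close>
 define R where "R = 12 * C * area + 1"
 have R: "R >= 1" "12 * C * area <= R" using C(1) area_pos by (auto simp: R_def)
 have "ip 0 u u <= (2 * (R * h)^2)^2 * ip 2 u u"
  if h: "0 < h" "R * h <= 1" and Xi: "Xi \<subseteq> S2" "!!x. x : S2 ==> EX xi:Xi. norm (x - xi) <= h"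
   and u: "smooth u" "!!xi. xi : Xi ==> u xi = 0" for h Xi u
 proof -
  define r where "r = R * h"
  have r: "0 < r" "r <= 1" using h R by (auto simp: r_def)
  let ?D = "Dsc r u"
  let ?J = "%x. (SI z. indicat_real (cap x (3 * r^2)) z * ?D z)"
  have cD: "continuous_on S2 ?D" by (intro smooth_continuous smooth_Dsc u)
  have J0: "?J x >= 0" for x by (intro Bochner_Integration.integral_nonneg mult_nonneg_nonneg Dsc_nonneg) simp
  have r3: "3 * r^2 > 0" using r by simp
  note avg = cap_average_integral[OF cD Dsc_nonneg r3]
  have "ip 0 u u = (SI x. (u x)^2)" by (simp add: power2_eq_square)
  also have "... <= (SI x. C * h * r * ?J x)"
  proof (rule integral_mono')
   show "integrable sgm (%x. C * h * r * ?J x)" by (intro integrable_mult_right avg(2))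
   fix x assume "x : space sgm"
   then have x: "x : S2" by simp
   obtain xi where xi: "xi : Xi" "norm (x - xi) <= h" using Xi(2)[OF x] by blast
   have "(u x)^2 <= C * norm (x - xi) * r * ?J x"
    using C(2)[OF r x _ u(1) u(2)[OF xi(1)]] xi(1) Xi(1) by blast
   also have "... <= C * h * r * ?J x"
    using C(1) r xi(2) J0 by (intro mult_right_mono mult_left_mono) auto
   finally show "(u x)^2 <= C * h * r * ?J x" .
   show "0 <= C * h * r * ?J x" using C(1) h r J0 by simp
  qed
  also have "... = C * h * r * (SI x. ?J x)" by (rule integral_mult_right_zero)
  also have "... <= C * h * r * (2 * area * (3 * r^2) * (SI z. ?D z))"
   using C(1) h r avg(1) by (intro mult_left_mono) auto
  also have "... = (6 * C * area) * (h * r ^ 3) * (SI z. ?D z)"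
   by (simp add: power2_eq_square power3_eq_cube)
  also have "... <= (R / 2) * (h * r ^ 3) * (SI z. ?D z)"
   using R h r Dsc_nonneg by (intro mult_right_mono Bochner_Integration.integral_nonneg) auto
  also have "(R / 2) * (h * r ^ 3) = r ^ 4 / 2" by (simp add: r_def power4_eq_xxxx power3_eq_cube)
  also have "(SI z. ?D z) = ip 0 u u / r ^ 4 + ip 1 u u / r^2 + ip 2 u u" by (rule integral_Dsc[OF u(1)])
  also have "r ^ 4 / 2 * ... = (ip 0 u u + r^2 * ip 1 u u + (r^2)^2 * ip 2 u u) / 2"
   using r by (simp add: field_simps power4_eq_xxxx power2_eq_square)
  finally have *: "ip 0 u u <= r^2 * ip 1 u u + (r^2)^2 * ip 2 u u" by simp
  \<comment> \<open>As b is at most sqrt (a c), this is a quadratic inequality for sqrt (a / c),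
    whose solutions lie below 2 rh.\<close>
  have key: "a <= 4 * rh^2 * c" if "b^2 <= a * c" "a <= rh * b + rh^2 * c" "rh > 0" "a >= 0" "b >= 0" "c >= 0" for a b c rh :: real
  proof (rule ccontr)
   assume "\<not> a <= 4 * rh^2 * c"
   then have l: "4 * rh^2 * c < a" by simp
   have "0 <= 4 * rh^2 * c" using that by simp
   then have ap: "a > 0" using l by linarith
   have "(2 * rh * b)^2 = 4 * rh^2 * b^2" by (simp add: power_mult_distrib)
   also have "... <= 4 * rh^2 * (a * c)" using that(1) by (intro mult_left_mono) auto
   also have "... = a * (4 * rh^2 * c)" by simp
   also have "... <= a * a" using l ap by (intro mult_left_mono) auto
   finally have "(2 * rh * b)^2 <= a^2" by (simp add: power2_eq_square)
   then have "2 * rh * b <= a" using ap by (rule power2_le_imp_le[OF _ less_imp_le])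
   then have "2 * (rh * b) <= a" "4 * (rh^2 * c) < a" using l by (simp_all only: mult.assoc)
   then show False using that(2) ap by linarith
  qed
  have "(ip 1 u u)^2 <= ip 0 u u * ip 2 u u" using ip_log_convex[OF u(1), of 0] by (simp add: numeral_2_eq_2 del: ip.simps)
  then have "ip 0 u u <= 4 * (r^2)^2 * ip 2 u u"
   by (rule key[OF _ *]) (intro ip_nonneg | use r in simp)+
  also have "4 * (r^2)^2 = (2 * (R * h)^2)^2" by (simp add: r_def power_mult_distrib)
  finally show ?thesis .
 qed
 then show ?thesis using R(1) by blast
qed

text \<open>By log-convexity the quotient of each order by the next does not increase, so the
  constant found at the bottom serves at every order.\<close>

lemma zeros_lemma:
 "EX K>=1. ALL h Xi u m j. 0 < h --> K * h <= 1 --> Xi \<subseteq> S2 --> (ALL x:S2. EX xi:Xi. norm (x - xi) <= h) --> smooth u -->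
  (ALL xi:Xi. u xi = 0) --> 2 <= m --> j <= m --> ip j u u <= (K * h^2) ^ (m - j) * ip m u u"
proof -
 obtain R where R: "R >= 1" "!!h Xi u. 0 < h ==> R * h <= 1 ==> Xi \<subseteq> S2 ==> (ALL x:S2. EX xi:Xi. norm (x - xi) <= h) ==> smooth u ==>
  (ALL xi:Xi. u xi = 0) ==> ip 0 u u <= (2 * (R * h)^2)^2 * ip 2 u u"
  using zeros_lemma_base by blast
 define K where "K = 2 * R^2"
 have "R * 1 <= R * R" using R(1) by (intro mult_left_mono) auto
 then have "R <= R^2" by (simp add: power2_eq_square)
 then have K: "K >= 1" "R <= K" using R(1) unfolding K_def by linarith+
 have "ip j u u <= (K * h^2) ^ (m - j) * ip m u u"
  if h: "0 < h" "K * h <= 1" and Xi: "Xi \<subseteq> S2" "ALL x:S2. EX xi:Xi. norm (x - xi) <= h"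
   and u: "smooth u" "ALL xi:Xi. u xi = 0" and m: "2 <= m" "j <= m" for h Xi u m j
 proof -
  define ka where "ka = K * h^2"
  have ka: "ka > 0" using h K by (simp add: ka_def)
  have "R * h <= K * h" using K h by (intro mult_right_mono) auto
  then have Rh: "R * h <= 1" using h by linarith
  have "2 * (R * h)^2 = ka" by (simp add: ka_def K_def power_mult_distrib)
  then have b0: "ip 0 u u <= ka^2 * ip 2 u u" using R(2)[OF h(1) Rh Xi u] by simp
  note lc = ip_log_convex[OF u(1)]
  have step: "ip (Suc k) u u <= ka * ip (Suc (Suc k)) u u" for k
  proof (induction k)
   case 0
   have "(ip (Suc 0) u u)^2 <= ip 0 u u * ip (Suc (Suc 0)) u u" by (rule lc)
   also have "... <= ka^2 * ip 2 u u * ip (Suc (Suc 0)) u u" using b0 ip_nonneg by (intro mult_right_mono)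
   also have "... = (ka * ip (Suc (Suc 0)) u u)^2" by (simp add: power2_eq_square numeral_2_eq_2 del: ip.simps)
   finally show ?case by (rule power2_le_imp_le) (intro mult_nonneg_nonneg ip_nonneg less_imp_le[OF ka])
  next
   case (Suc k)
   let ?a = "ip (Suc k) u u" and ?b = "ip (Suc (Suc k)) u u" and ?c = "ip (Suc (Suc (Suc k))) u u"
   have "?b^2 <= ?a * ?c" by (rule lc)
   also have "... <= ka * ?b * ?c" using Suc.IH ip_nonneg by (intro mult_right_mono)
   finally have "?b * ?b <= ?b * (ka * ?c)" by (simp add: power2_eq_square mult_ac del: ip.simps)
   moreover have "?b >= 0" "?c >= 0" by (rule ip_nonneg)+
   ultimately show ?case using ka
    by (cases "?b = 0") (simp_all add: mult_le_cancel_left del: ip.simps)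
  qed
  have chain: "ip (Suc k) u u <= ka ^ n * ip (Suc k + n) u u" for k n
  proof (induction n)
   case (Suc n)
   have "ka ^ n * ip (Suc k + n) u u <= ka ^ n * (ka * ip (Suc (Suc (k + n))) u u)"
    using step[of "k + n"] ka by (intro mult_left_mono) (auto simp del: ip.simps)
   then show ?case using Suc by (simp add: mult_ac del: ip.simps)
  qed (simp del: ip.simps)
  show ?thesis
  proof (cases j)
   case (Suc k)
   then show ?thesis using chain[of k "m - j"] m by (simp add: ka_def del: ip.simps)
  next
   case 0
   have "ip 2 u u <= ka ^ (m - 2) * ip m u u" 
   proof -
    have e: "2 + (m - 2) = m" "Suc 1 = 2" using m by auto
    show ?thesis using chain[of 1 "m - 2"] unfolding e(2) e(1) .
   qed
   then have "ka^2 * ip 2 u u <= ka^2 * (ka ^ (m - 2) * ip m u u)" by (intro mult_left_mono) auto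
   also have "... = ka ^ (2 + (m - 2)) * ip m u u" unfolding power_add by simp
   also have "2 + (m - 2) = m" using m by simp
   finally show ?thesis using b0 0 by (simp add: ka_def)
  qed
 qed
 then show ?thesis using K(1) by blast
qed

section \<open>Scaled Sobolev norms and conjugation by weights\<close>

text \<open>A squared Sobolev norm in which each derivative carries a factor h. The recursive form
  suits product rules; \<open>sn_eq_sum\<close> connects it with the forms
  \<open>ip\<close>.\<close>

primrec sn :: "nat => real => (real^3 => real) => real" where
 "sn 0 h u = ip 0 u u"
| "sn (Suc k) h u = ip 0 u u + h^2 * (SUM i:UNIV. sn k h (Xd i u))"

lemma sn_eq_sum: "sn k h u = (SUM j<=k. h ^ (2 * j) * ip j u u)"
proof (induction k arbitrary: u)
 case (Suc k)
 have "sn (Suc k) h u = ip 0 u u + h^2 * (SUM i:UNIV. SUM j<=k. h ^ (2 * j) * ip j (Xd i u) (Xd i u))"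
  by (simp add: Suc.IH del: ip.simps)
 also have "(SUM i:UNIV. SUM j<=k. h ^ (2 * j) * ip j (Xd i u) (Xd i u)) = (SUM j<=k. h ^ (2 * j) * ip (Suc j) u u)"
  by (subst sum.swap) (simp add: sum_distrib_left)
 also have "h^2 * ... = (SUM j<=k. h ^ (2 * Suc j) * ip (Suc j) u u)"
  by (simp add: sum_distrib_left power2_eq_square mult.assoc del: ip.simps)
 also have "ip 0 u u + ... = (SUM j<=Suc k. h ^ (2 * j) * ip j u u)"
  unfolding sum.atMost_Suc_shift by simp
 finally show ?case .
qed simp

lemma sn_cong: "(!!x. x : S2 ==> f x = g x) ==> sn k h f = sn k h g"
 unfolding sn_eq_sum using ip_cong[of f g f g] by simp

lemma sn_nonneg: "0 <= sn k h u"
 unfolding sn_eq_sum by (intro sum_nonneg mult_nonneg_nonneg ip_nonneg) (simp add: power_mult)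

lemma sn_Suc_mono: "sn k h u <= sn (Suc k) h u"
proof -
 have "0 <= h ^ (2 * Suc k) * ip (Suc k) u u"
  by (rule mult_nonneg_nonneg[OF _ ip_nonneg]) (simp only: power_mult zero_le_power zero_le_power2)
 then show ?thesis unfolding sn_eq_sum sum.atMost_Suc by linarith
qed

lemma sn_mono: "j <= k ==> sn j h u <= sn k h u"
 by (induction k) (auto simp: le_Suc_eq simp del: sn.simps(2) intro: order_trans[OF _ sn_Suc_mono])

lemma ip_le_sn: "j <= k ==> h ^ (2 * j) * ip j u u <= sn k h u"
 unfolding sn_eq_sum by (rule member_le_sum) (auto intro!: mult_nonneg_nonneg ip_nonneg simp: power_mult)

lemma sn_Xd_le: "h^2 * sn k h (Xd i u) <= sn (Suc k) h u"
proof -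
 have "sn k h (Xd i u) <= (SUM i:UNIV. sn k h (Xd i u))"
  by (rule member_le_sum) (auto intro: sn_nonneg)
 then have "h^2 * sn k h (Xd i u) <= h^2 * (SUM i:UNIV. sn k h (Xd i u))" by (rule mult_left_mono) simp
 also have "... <= sn (Suc k) h u" using ip_nonneg[of 0 u] unfolding sn.simps by linarith
 finally show ?thesis .
qed

lemma ip_add_le:
 assumes "smooth f" "smooth g"
 shows "ip k (%x. f x + g x) (%x. f x + g x) <= 2 * ip k f f + 2 * ip k g g"
proof -
 have ng: "smooth (%x. (- 1) * g x)" by (intro smooth_mult smooth_const assms)
 have "0 <= ip k (%x. f x + (- 1) * g x) (%x. f x + (- 1) * g x)" by (rule ip_nonneg)
 also have "... = ip k f f - 2 * ip k f g + ip k g g"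
  using assms ng smooth_add[OF assms(1) ng]
  by (simp only: ip_add_left ip_add_right ip_cmult_left ip_cmult_right ip_commute[of k g f])
 finally have "2 * ip k f g <= ip k f f + ip k g g" by simp
 moreover have "ip k (%x. f x + g x) (%x. f x + g x) = ip k f f + 2 * ip k f g + ip k g g"
  using assms smooth_add[OF assms]
  by (simp only: ip_add_left ip_add_right ip_commute[of k g f])
 ultimately show ?thesis by linarith
qed

lemma sn_add_le: "smooth f ==> smooth g ==> sn k h (%x. f x + g x) <= 2 * sn k h f + 2 * sn k h g"
proof -
 assume a: "smooth f" "smooth g"
 have "sn k h (%x. f x + g x) <= (SUM j<=k. h ^ (2 * j) * (2 * ip j f f + 2 * ip j g g))"
  unfolding sn_eq_sum by (intro sum_mono mult_left_mono ip_add_le a) (simp add: power_mult)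
 also have "... = 2 * sn k h f + 2 * sn k h g"
  unfolding sn_eq_sum sum_distrib_left sum.distrib[symmetric] by (intro sum.cong refl) (simp add: algebra_simps)
 finally show ?thesis .
qed

lemma sn_uminus: "smooth f ==> sn k h (%x. - f x) = sn k h f"
proof -
 assume f: "smooth f"
 have "ip j (%x. (- 1) * f x) (%x. (- 1) * f x) = ip j f f" for j
  using f smooth_mult[OF smooth_const f, of "-1"] by (simp only: ip_cmult_left ip_cmult_right)
 then show ?thesis unfolding sn_eq_sum by simp
qed

lemma ip0_mult_le:
 assumes b: "bd k h A ta" and A: "0 <= A" and u: "smooth u"
 shows "ip 0 (%x. ta x * u x) (%x. ta x * u x) <= A^2 * ip 0 u u"
proof -
 have "(SI x. (ta x * u x) * (ta x * u x)) <= (SI x. A^2 * (u x * u x))"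
 proof (rule integral_mono')
  show "integrable sgm (%x. A^2 * (u x * u x))" by (intro int_smooth smooth_mult smooth_const u)
  fix x assume "x : space sgm"
  then have "\<bar>ta x\<bar> <= A" using bd_sup[OF b] by simp
  then have "(ta x)^2 <= A^2" using A by (simp add: abs_le_square_iff[symmetric])
  then have "(ta x)^2 * (u x * u x) <= A^2 * (u x * u x)" by (intro mult_right_mono) auto
  then show "(ta x * u x) * (ta x * u x) <= A^2 * (u x * u x)" by (simp add: power2_eq_square mult_ac)
 qed simp
 then show ?thesis by simp
qed

lemma sn_mult_le:
 "EX C>=0. ALL h A ta u. 0 < h --> 0 <= A --> smooth ta --> smooth u --> bd k h A ta --> sn k h (%x. ta x * u x) <= C * A^2 * sn k h u"
proof (induction k)
 case 0
 show ?case by (intro exI[of _ 1] conjI allI impI) (simp, simp only: sn.simps mult_1, rule ip0_mult_le)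
next
 case (Suc k)
 then obtain C where C: "C >= 0" "!!h A ta u. 0 < h ==> 0 <= A ==> smooth ta ==> smooth u ==> bd k h A ta ==>
  sn k h (%x. ta x * u x) <= C * A^2 * sn k h u" by blast
 have "sn (Suc k) h (%x. ta x * u x) <= (1 + 8 * C) * A^2 * sn (Suc k) h u"
  if h: "0 < h" and A: "0 <= A" and ta: "smooth ta" and u: "smooth u" and b: "bd (Suc k) h A ta" for h A ta u
 proof -
  note 0 = ip0_mult_le[OF b A u]
  have i: "sn k h (Xd i (%x. ta x * u x)) <= 2 * (C * (A / h)^2 * sn k h u) + 2 * (C * A^2 * sn k h (Xd i u))" for i
  proof -
   have "sn k h (Xd i (%x. ta x * u x)) = sn k h (%x. Xd i ta x * u x + ta x * Xd i u x)"
    by (rule sn_cong) (simp add: Xd_mult ta u)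
   also have "... <= 2 * sn k h (%x. Xd i ta x * u x) + 2 * sn k h (%x. ta x * Xd i u x)"
    by (intro sn_add_le smooth_mult smooth_Xd ta u)
   also have "sn k h (%x. Xd i ta x * u x) <= C * (A / h)^2 * sn k h u"
    using b A h by (intro C(2) smooth_Xd ta u) auto
   also have "sn k h (%x. ta x * Xd i u x) <= C * A^2 * sn k h (Xd i u)"
    by (intro C(2) smooth_Xd ta u h A bd_SucD[OF b])
   finally show ?thesis by simp
  qed
  have "h^2 * (SUM i:UNIV. sn k h (Xd i (%x. ta x * u x)))
   <= h^2 * (SUM i:(UNIV :: 3 set). 2 * (C * (A / h)^2 * sn k h u) + 2 * (C * A^2 * sn k h (Xd i u)))"
   by (intro mult_left_mono sum_mono i) simp
  also have "... = 6 * (C * A^2) * sn k h u + 2 * (C * A^2) * (h^2 * (SUM i:UNIV. sn k h (Xd i u)))"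
   using h by (simp add: sum.distrib sum_distrib_left[symmetric] power_divide algebra_simps)
  also have "... <= 6 * (C * A^2) * sn (Suc k) h u + 2 * (C * A^2) * sn (Suc k) h u"
  proof (intro add_mono mult_left_mono sn_Suc_mono)
   show "h^2 * (SUM i:UNIV. sn k h (Xd i u)) <= sn (Suc k) h u" using ip_nonneg[of 0 u] unfolding sn.simps by linarith
  qed (use C(1) in auto)
  finally have "sn (Suc k) h (%x. ta x * u x) <= A^2 * ip 0 u u + (6 * (C * A^2) * sn (Suc k) h u + 2 * (C * A^2) * sn (Suc k) h u)"
   unfolding sn.simps(2)[of k h "%x. ta x * u x"] using 0 by (intro add_mono)
  also have "A^2 * ip 0 u u <= A^2 * sn (Suc k) h u"
   using ip_le_sn[of 0 "Suc k" h u] by (intro mult_left_mono) auto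
  finally show ?thesis by (simp add: algebra_simps del: sn.simps)
 qed
 then show ?case using C(1) by (intro exI[of _ "1 + 8 * C"]) (auto simp del: sn.simps bd.simps)
qed

definition sq :: "nat => real => (real^3 => real) => real" where
 "sq k h u = sqrt (sn k h u)"

lemma sq_nonneg: "0 <= sq k h u" by (simp add: sq_def sn_nonneg)

lemma sq_square: "(sq k h u)^2 = sn k h u" by (simp add: sq_def sn_nonneg)

lemma sq_add_le: "smooth f ==> smooth g ==> sq k h (%x. f x + g x) <= 2 * (sq k h f + sq k h g)"
proof (rule power2_le_imp_le)
 assume "smooth f" "smooth g"
 then have "sn k h (%x. f x + g x) <= 2 * (sq k h f)^2 + 2 * (sq k h g)^2"
  using sn_add_le by (simp add: sq_square)
 also have "... <= (2 * (sq k h f + sq k h g))^2"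
  using sq_nonneg[of k h f] sq_nonneg[of k h g] by (simp add: power2_eq_square algebra_simps)
 finally show "(sq k h (%x. f x + g x))^2 <= (2 * (sq k h f + sq k h g))^2" by (simp add: sq_square)
qed (simp add: sq_nonneg)

lemma sq_mult_le:
 "EX C>=0. ALL h A ta u. 0 < h --> 0 <= A --> smooth ta --> smooth u --> bd k h A ta --> sq k h (%x. ta x * u x) <= C * A * sq k h u"
proof -
 obtain C where C: "C >= 0" "!!h A ta u. 0 < h ==> 0 <= A ==> smooth ta ==> smooth u ==> bd k h A ta ==>
  sn k h (%x. ta x * u x) <= C * A^2 * sn k h u" using sn_mult_le[of k] by blast
 have "sq k h (%x. ta x * u x) <= sqrt C * A * sq k h u"
  if "0 < h" "0 <= A" "smooth ta" "smooth u" "bd k h A ta" for h A ta u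
 proof -
  have "sqrt (sn k h (%x. ta x * u x)) <= sqrt (C * A^2 * sn k h u)" using C(2)[OF that] by simp
  then show ?thesis using that(2) by (simp add: sq_def real_sqrt_mult)
 qed
 then show ?thesis using C(1) by (intro exI[of _ "sqrt C"]) auto
qed

lemma sq_Xd_le: assumes "h > 0" shows "sq k h (Xd i u) <= sq (Suc k) h u / h"
proof -
 have "(h * sq k h (Xd i u))^2 <= (sq (Suc k) h u)^2"
  using sn_Xd_le[of h k i u] by (simp add: power_mult_distrib sq_square del: sn.simps)
 then have "h * sq k h (Xd i u) <= sq (Suc k) h u" by (rule power2_le_imp_le) (rule sq_nonneg)
 then show ?thesis using assms by (simp add: field_simps)
qed

lemma sq_Suc_mono: "sq k h u <= sq (Suc k) h u"
 unfolding sq_def using sn_Suc_mono by (intro real_sqrt_le_mono)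

lemma ip_le_sq:
 assumes h: "h > 0" and u: "smooth u" and v: "smooth v"
 shows "\<bar>ip k u v\<bar> * h ^ (2 * k) <= sq k h u * sq k h v"
proof -
 have "(ip k u v)^2 * (h ^ (2 * k))^2 <= (ip k u u * ip k v v) * (h ^ (2 * k))^2"
  by (intro mult_right_mono ip_Cauchy_Schwarz u v) simp
 also have "... = (h ^ (2 * k) * ip k u u) * (h ^ (2 * k) * ip k v v)" by (simp add: power2_eq_square)
 also have "... <= sn k h u * sn k h v"
  using h by (intro mult_mono ip_le_sn sn_nonneg mult_nonneg_nonneg ip_nonneg) auto
 finally have "(\<bar>ip k u v\<bar> * h ^ (2 * k))^2 <= (sq k h u * sq k h v)^2"
  by (simp add: power_mult_distrib sq_square)
 then show ?thesis by (rule power2_le_imp_le) (simp add: sq_nonneg)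
qed

text \<open>\<open>Bw k ta u v\<close> is \<open>ip k (u / w) (w * v)\<close> for a positive weight \<open>w\<close> with logarithmic derivatives
 \<open>ta i\<close>; the weight itself has been eliminated.\<close>

primrec Bw :: "nat => (3 => real^3 => real) => (real^3 => real) => (real^3 => real) => real" where
 "Bw 0 ta u v = (SI x. u x * v x)"
| "Bw (Suc k) ta u v = (SUM i:UNIV. Bw k ta (%x. Xd i u x - ta i x * u x) (%x. Xd i v x + ta i x * v x))"

text \<open>Differentiating u / w or w v reproduces the weight and shifts the derivative by
  \<open>ta i\<close>, downwards or upwards. At order 0 the weights cancel and only the shifts
  survive.\<close>

lemma Bw_weight:
 assumes w: "smooth w" "!!x. x : S2 ==> w x > 0" and Xw: "!!i x. x : S2 ==> Xd i w x = ta i x * w x"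
  and ta: "!!i. smooth (ta i)"
 shows "smooth u ==> smooth v ==> ip k (%x. u x / w x) (%x. w x * v x) = Bw k ta u v"
proof (induction k arbitrary: u v)
 case 0
 have "(SI x. u x / w x * (w x * v x)) = (SI x. u x * v x)"
  by (rule Bochner_Integration.integral_cong) (use w(2) in \<open>auto simp: less_imp_neq[symmetric]\<close>)
 then show ?case by simp
next
 case (Suc k)
 have sq: "smooth (%x. u x / w x)" by (intro smooth_divide Suc.prems w)
 have X1: "Xd i (%x. u x / w x) x = (Xd i u x - ta i x * u x) / w x" if x: "x : S2" for i x
 proof -
  have "Xd i u x = Xd i (%x. (u x / w x) * w x) x"
   by (rule Xd_cong[OF _ x]) (use w(2) in \<open>auto simp: less_imp_neq[symmetric]\<close>)
  also have "... = Xd i (%x. u x / w x) x * w x + (u x / w x) * (ta i x * w x)"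
   using Xd_mult[OF sq w(1) x] Xw[OF x] by simp
  finally have "Xd i u x = Xd i (%x. u x / w x) x * w x + u x * ta i x" using w(2)[OF x] by simp
  then show ?thesis using w(2)[OF x] by (simp add: field_simps)
 qed
 have X2: "Xd i (%x. w x * v x) x = w x * (Xd i v x + ta i x * v x)" if x: "x : S2" for i x
  using Xd_mult[OF w(1) Suc.prems(2) x] Xw[OF x] by (simp add: algebra_simps)
 have "ip k (Xd i (%x. u x / w x)) (Xd i (%x. w x * v x))
  = Bw k ta (%x. Xd i u x - ta i x * u x) (%x. Xd i v x + ta i x * v x)" for i
 proof -
  have "ip k (Xd i (%x. u x / w x)) (Xd i (%x. w x * v x))
   = ip k (%x. (Xd i u x - ta i x * u x) / w x) (%x. w x * (Xd i v x + ta i x * v x))"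
   by (rule ip_cong[OF X1 X2])
  also have "... = Bw k ta (%x. Xd i u x - ta i x * u x) (%x. Xd i v x + ta i x * v x)"
   by (rule Suc.IH) (intro smooth_diff smooth_add smooth_mult smooth_Xd ta Suc.prems)+
  finally show ?thesis .
 qed
 then show ?case by simp
qed

text \<open>Each occurrence of \<open>ta\<close> replaces a derivative by a factor of size be / h,
  which on the scale h is a relative error be; the normalization by h^(2 k) makes the constant
  independent of h.\<close>

lemma Bw_estimate:
 "EX C>=0. ALL h be ta u v. 0 < h --> 0 <= be --> be <= 1 --> (ALL i. smooth (ta i) & bd k h (be / h) (ta i)) --> smooth u --> smooth v -->
  \<bar>Bw k ta u v - ip k u v\<bar> * h ^ (2 * k) <= C * be * (sq k h u * sq k h v)"
proof (induction k)
 case 0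
 show ?case by (rule exI[of _ 0]) simp
next
 case (Suc k)
 then obtain C where C: "C >= 0" "!!h be ta u v. 0 < h ==> 0 <= be ==> be <= 1 ==> (ALL i. smooth (ta i) & bd k h (be / h) (ta i)) ==>
  smooth u ==> smooth v ==> \<bar>Bw k ta u v - ip k u v\<bar> * h ^ (2 * k) <= C * be * (sq k h u * sq k h v)" by blast
 obtain E where E: "E >= 0" "!!h A ta u. 0 < h ==> 0 <= A ==> smooth ta ==> smooth u ==> bd k h A ta ==>
  sq k h (%x. ta x * u x) <= E * A * sq k h u" using sq_mult_le[of k] by blast
 define F where "F = 2 * (1 + E)"
 define D where "D = 3 * (C * F^2 + 2 * E + E * E)"
 have F: "F >= 0" using E(1) by (simp add: F_def)
 have D: "D >= 0" using C(1) E(1) by (simp add: D_def)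
 have "\<bar>Bw (Suc k) ta u v - ip (Suc k) u v\<bar> * h ^ (2 * Suc k) <= D * be * (sq (Suc k) h u * sq (Suc k) h v)"
  if h: "0 < h" and be: "0 <= be" "be <= 1" and ta: "!!i. smooth (ta i)" "!!i. bd (Suc k) h (be / h) (ta i)"
   and u: "smooth u" and v: "smooth v" for h be ta u v
 proof -
  let ?S = "sq (Suc k) h"
  have bk: "bd k h (be / h) (ta i)" for i by (rule bd_SucD[OF ta(2)])
  have tau_le: "sq k h (%x. ta i x * f x) <= (E * be) * (?S f / h)" if f: "smooth f" for f i
  proof -
   have "sq k h (%x. ta i x * f x) <= E * (be / h) * sq k h f"
    using h be by (intro E(2) ta f bk) auto
   also have "... <= E * (be / h) * ?S f" using h be E(1) by (intro mult_left_mono sq_Suc_mono) auto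
   finally show ?thesis by simp
  qed
  have trm: "\<bar>Bw k ta (%x. Xd i u x - ta i x * u x) (%x. Xd i v x + ta i x * v x) - ip k (Xd i u) (Xd i v)\<bar> * h ^ (2 * k)
    <= (C * F^2 + 2 * E + E * E) * be * ((?S u / h) * (?S v / h))" for i
  proof -
   let ?tu = "%x. (- 1) * (ta i x * u x)" and ?tv = "%x. ta i x * v x"
   let ?U = "%x. Xd i u x + ?tu x" and ?V = "%x. Xd i v x + ?tv x"
   have stu: "smooth ?tu" "smooth ?tv" by (intro smooth_mult smooth_const ta u v)+
   have sX: "smooth (Xd i u)" "smooth (Xd i v)" using u v by (auto intro: smooth_Xd)
   have sU: "smooth ?U" "smooth ?V" by (intro smooth_add sX stu)+
   have "sq k h ?tu = sq k h (%x. ta i x * u x)"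
    using sn_uminus[OF smooth_mult[OF ta(1) u], of k h i] by (simp add: sq_def)
   then have ntu: "sq k h ?tu <= (E * be) * (?S u / h)" using tau_le[OF u] by simp
   have ntv: "sq k h ?tv <= (E * be) * (?S v / h)" by (rule tau_le[OF v])
   have Xu: "sq k h (Xd i u) <= ?S u / h" and Xv: "sq k h (Xd i v) <= ?S v / h" by (rule sq_Xd_le[OF h])+
   have Su: "0 <= ?S u / h" and Sv: "0 <= ?S v / h" using sq_nonneg h by (simp_all add: divide_nonneg_pos)
   have Eb: "E * be <= E" "0 <= E * be" using E(1) be mult_left_le[of be E] by auto
   have nU: "sq k h ?U <= F * (?S u / h)"
   proof -
    have "sq k h ?U <= 2 * (sq k h (Xd i u) + sq k h ?tu)" by (rule sq_add_le[OF sX(1) stu(1)])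
    also have "... <= 2 * (?S u / h + E * (?S u / h))"
     using Xu ntu mult_right_mono[OF Eb(1) Su] by (intro mult_left_mono add_mono) auto
    also have "... = F * (?S u / h)" unfolding F_def by (simp only: distrib_right mult_1 mult.assoc)
    finally show ?thesis .
   qed
   have nV: "sq k h ?V <= F * (?S v / h)"
   proof -
    have "sq k h ?V <= 2 * (sq k h (Xd i v) + sq k h ?tv)" by (rule sq_add_le[OF sX(2) stu(2)])
    also have "... <= 2 * (?S v / h + E * (?S v / h))"
     using Xv ntv mult_right_mono[OF Eb(1) Sv] by (intro mult_left_mono add_mono) auto
    also have "... = F * (?S v / h)" unfolding F_def by (simp only: distrib_right mult_1 mult.assoc)
    finally show ?thesis .
   qed
   let ?P = "(?S u / h) * (?S v / h)" and ?H = "h ^ (2 * k)"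
   have P: "0 <= ?P" by (rule mult_nonneg_nonneg[OF Su Sv])
   have H: "0 <= ?H" using h by simp
   have "\<bar>Bw k ta ?U ?V - ip k ?U ?V\<bar> * ?H <= C * be * (sq k h ?U * sq k h ?V)"
    using ta(1) bk by (intro C(2) h be sU) auto
   also have "... <= C * be * ((F * (?S u / h)) * (F * (?S v / h)))"
    using C(1) be F Su Sv by (intro mult_left_mono mult_mono nU nV sq_nonneg mult_nonneg_nonneg) auto
   also have "... = (C * F^2) * be * ?P" by (simp add: power2_eq_square mult_ac)
   finally have 1: "\<bar>Bw k ta ?U ?V - ip k ?U ?V\<bar> * ?H <= (C * F^2) * be * ?P" .
   have 2: "\<bar>ip k (Xd i u) ?tv\<bar> * ?H <= E * be * ?P"
   proof -
    have "\<bar>ip k (Xd i u) ?tv\<bar> * ?H <= sq k h (Xd i u) * sq k h ?tv" by (rule ip_le_sq[OF h sX(1) stu(2)])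
    also have "... <= (?S u / h) * ((E * be) * (?S v / h))" by (intro mult_mono Xu ntv Su sq_nonneg)
    finally show ?thesis by (simp add: mult_ac)
   qed
   have 3: "\<bar>ip k ?tu (Xd i v)\<bar> * ?H <= E * be * ?P"
   proof -
    have "\<bar>ip k ?tu (Xd i v)\<bar> * ?H <= sq k h ?tu * sq k h (Xd i v)" by (rule ip_le_sq[OF h stu(1) sX(2)])
    also have "... <= ((E * be) * (?S u / h)) * (?S v / h)"
     using E(1) be(1) Su by (intro mult_mono Xv ntu sq_nonneg mult_nonneg_nonneg)
    finally show ?thesis by (simp add: mult_ac)
   qed
   have 4: "\<bar>ip k ?tu ?tv\<bar> * ?H <= E * E * be * ?P"
   proof -
    have "\<bar>ip k ?tu ?tv\<bar> * ?H <= sq k h ?tu * sq k h ?tv" by (rule ip_le_sq[OF h stu])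
    also have "... <= ((E * be) * (?S u / h)) * ((E * be) * (?S v / h))"
     using E(1) be(1) Su by (intro mult_mono ntu ntv sq_nonneg mult_nonneg_nonneg)
    also have "... <= ((E * be) * (?S u / h)) * (E * (?S v / h))"
     using Eb E(1) be(1) Su Sv by (intro mult_left_mono mult_right_mono mult_nonneg_nonneg)
    finally show ?thesis by (simp add: mult_ac)
   qed
   have eq: "ip k ?U ?V = ip k (Xd i u) (Xd i v) + ip k (Xd i u) ?tv + ip k ?tu (Xd i v) + ip k ?tu ?tv"
    by (simp only: ip_add_left[OF sX(1) stu(1) sU(2)] ip_add_right[OF sX(2) stu(2) sX(1)] ip_add_right[OF sX(2) stu(2) stu(1)])
   have "\<bar>Bw k ta ?U ?V - ip k (Xd i u) (Xd i v)\<bar>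
    <= \<bar>Bw k ta ?U ?V - ip k ?U ?V\<bar> + \<bar>ip k (Xd i u) ?tv\<bar> + \<bar>ip k ?tu (Xd i v)\<bar> + \<bar>ip k ?tu ?tv\<bar>"
    using eq by linarith
   then have "\<bar>Bw k ta ?U ?V - ip k (Xd i u) (Xd i v)\<bar> * ?H
    <= (\<bar>Bw k ta ?U ?V - ip k ?U ?V\<bar> + \<bar>ip k (Xd i u) ?tv\<bar> + \<bar>ip k ?tu (Xd i v)\<bar> + \<bar>ip k ?tu ?tv\<bar>) * ?H"
    by (rule mult_right_mono[OF _ H])
   also have "... <= (C * F^2) * be * ?P + E * be * ?P + E * be * ?P + E * E * be * ?P"
    unfolding distrib_right by (intro add_mono 1 2 3 4)
   also have "... = (C * F^2 + 2 * E + E * E) * be * ?P"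
    unfolding distrib_right by (simp only: mult_2 distrib_right)
   finally show ?thesis by simp
  qed
  have "Bw (Suc k) ta u v - ip (Suc k) u v
   = (SUM i:UNIV. Bw k ta (%x. Xd i u x - ta i x * u x) (%x. Xd i v x + ta i x * v x) - ip k (Xd i u) (Xd i v))"
   by (simp add: sum_subtractf)
  then have "\<bar>Bw (Suc k) ta u v - ip (Suc k) u v\<bar> * h ^ (2 * k)
   <= (SUM i:UNIV. \<bar>Bw k ta (%x. Xd i u x - ta i x * u x) (%x. Xd i v x + ta i x * v x) - ip k (Xd i u) (Xd i v)\<bar> * h ^ (2 * k))"
   unfolding sum_distrib_right[symmetric] using h by (intro mult_right_mono) (auto intro: order_trans[OF sum_abs])
  also have "... <= (SUM i:(UNIV :: 3 set). (C * F^2 + 2 * E + E * E) * be * ((?S u / h) * (?S v / h)))"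
   by (intro sum_mono trm)
  also have "... = D * be * ((?S u / h) * (?S v / h))" by (simp add: D_def)
  finally have "\<bar>Bw (Suc k) ta u v - ip (Suc k) u v\<bar> * h ^ (2 * k) * h^2 <= D * be * ((?S u / h) * (?S v / h)) * h^2"
   by (rule mult_right_mono) simp
  moreover have "D * be * ((?S u / h) * (?S v / h)) * h^2 = D * be * (?S u * ?S v)"
   using h by (simp add: power2_eq_square)
  moreover have "h ^ (2 * k) * h^2 = h ^ (2 * Suc k)" by (simp add: power2_eq_square)
  ultimately show ?thesis by (simp only: mult.assoc)
 qed
 then show ?case using D by blast
qed

section \<open>Weighted coercivity\<close>

definition net :: "real => (real^3) set => bool" where
 "net h Xi \<longleftrightarrow> 0 < h & finite Xi & Xi \<subseteq> S2 & (ALL x:S2. EX xi:Xi. norm (x - xi) <= h)"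

text \<open>Only logarithmic derivatives are bounded, by be / h: the weight itself may vary
  exponentially over the sphere.\<close>

definition weight :: "nat => real => real => (real^3 => real) => bool" where
 "weight k h be w \<longleftrightarrow> smooth w & (ALL x:S2. 0 < w x) &
  (EX ta. ALL i. smooth (ta i) & bd k h (be / h) (ta i) & (ALL x:S2. Xd i w x = ta i x * w x))"

lemma bd_le: "bd k r A f ==> j <= k ==> bd j r A f"
proof (induction k)
 case (Suc k)
 show ?case
 proof (cases "j = Suc k")
  case False
  then show ?thesis using Suc.IH[OF bd_SucD[OF Suc.prems(1)]] Suc.prems(2) by linarith
 qed (use Suc.prems in blast)
qed simp

lemma sn_zeros:
 assumes m: "2 <= m"
 obtains D H where "D >= 1" "H > 0" "H <= 1"
  "!!h Xi u. net h Xi ==> h <= H ==> smooth u ==> (!!xi. xi : Xi ==> u xi = 0) ==> sn m h u <= D * h ^ (2 * m) * ip m u u"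
proof -
 obtain K where K: "K >= 1" "!!h Xi u m j. 0 < h ==> K * h <= 1 ==> Xi \<subseteq> S2 ==> (ALL x:S2. EX xi:Xi. norm (x - xi) <= h) ==>
  smooth u ==> (ALL xi:Xi. u xi = 0) ==> 2 <= m ==> j <= m ==> ip j u u <= (K * h^2) ^ (m - j) * ip m u u"
  using zeros_lemma by blast
 have "sn m h u <= (real (Suc m) * K ^ m) * h ^ (2 * m) * ip m u u"
  if n: "net h Xi" and h: "h <= 1 / K" and u: "smooth u" "!!xi. xi : Xi ==> u xi = 0" for h Xi u
 proof -
  have h0: "0 < h" and Kh: "K * h <= 1" using n h K(1) by (auto simp: net_def field_simps)
  have "h ^ (2 * j) * ip j u u <= K ^ m * h ^ (2 * m) * ip m u u" if j: "j <= m" for j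
  proof -
   have "ip j u u <= (K * h^2) ^ (m - j) * ip m u u"
    using n u j m Kh by (intro K(2)[of h Xi]) (auto simp: net_def)
   then have "h ^ (2 * j) * ip j u u <= h ^ (2 * j) * ((K * h^2) ^ (m - j) * ip m u u)"
    using h0 by (intro mult_left_mono) auto
   also have "... = K ^ (m - j) * (h ^ (2 * j) * h ^ (2 * (m - j))) * ip m u u"
    by (simp add: power_mult_distrib power_mult)
   also have "h ^ (2 * j) * h ^ (2 * (m - j)) = h ^ (2 * m)"
    unfolding power_add[symmetric] using j by (intro arg_cong[where f = "power h"]) simp
   also have "K ^ (m - j) * h ^ (2 * m) * ip m u u <= K ^ m * h ^ (2 * m) * ip m u u"
    using K(1) h0 by (intro mult_right_mono ip_nonneg power_increasing) auto
   finally show ?thesis .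
  qed
  then have "sn m h u <= (SUM j<=m. K ^ m * h ^ (2 * m) * ip m u u)"
   unfolding sn_eq_sum by (intro sum_mono) simp
  then show ?thesis by (simp add: mult.assoc)
 qed
 moreover have "1 <= real (Suc m) * K ^ m" using mult_mono[of 1 "real (Suc m)" 1 "K ^ m"] K(1) one_le_power[of K m] by simp
 ultimately show ?thesis using that[of "real (Suc m) * K ^ m" "1 / K"] K(1) by auto
qed

text \<open>The form of f against w^2 f is the conjugated form of u = w f, because f = u / w and w^2
  f = w u. Since u vanishes on the nodes along with f, its lower orders are controlled by the top
  one.\<close>

lemma coercive:
 assumes s: "s >= 1"
 obtains be H D where "0 < be" "0 < H" "H <= 1" "D >= 1"
  "!!h Xi w f. net h Xi ==> h <= H ==> weight (Suc s) h be w ==> smooth f ==> (!!xi. xi : Xi ==> f xi = 0) ==>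
   ip (Suc s) (%x. w x * f x) (%x. w x * f x) <= 2 * (SI x. Lop s f x * ((w x)^2 * f x))
  & sn (Suc s) h (%x. w x * f x) <= D * h ^ (2 * Suc s) * ip (Suc s) (%x. w x * f x) (%x. w x * f x)"
proof -
 let ?m = "Suc s"
 obtain D H where D: "D >= 1" and H: "H > 0" "H <= 1" and DH: "!!h Xi u. net h Xi ==> h <= H ==> smooth u ==>
   (!!xi. xi : Xi ==> u xi = 0) ==> sn ?m h u <= D * h ^ (2 * ?m) * ip ?m u u"
  using sn_zeros[of ?m] s by auto
 obtain c where c: "!!f g. smooth f ==> smooth g ==> (SI x. Lop s f x * g x) = ip (Suc s) f g + (SUM j<=s. c j * ip j f g)"
  using Lop_ip[of s] by blast
 have "ALL k. EX C>=0. ALL h be ta u v. 0 < h --> 0 <= be --> be <= 1 --> (ALL i. smooth (ta i) & bd k h (be / h) (ta i)) --> smooth u --> smooth v -->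
  \<bar>Bw k ta u v - ip k u v\<bar> * h ^ (2 * k) <= C * be * (sq k h u * sq k h v)" using Bw_estimate by blast
 then obtain C where C0: "!!k. C k >= 0" and C: "!!k h be ta u v. 0 < h ==> 0 <= be ==> be <= 1 ==> (ALL i. smooth (ta i) & bd k h (be / h) (ta i)) ==>
  smooth u ==> smooth v ==> \<bar>Bw k ta u v - ip k u v\<bar> * h ^ (2 * k) <= C k * be * (sq k h u * sq k h v)"
  by metis
 \<comment> \<open>Makes the error of conjugating the top order at most a quarter of it.
   \<open>H'\<close> does the same for the sum of the lower orders, which carry an extra factor h,
   so one half of the top order remains.\<close>
 define be where "be = 1 / (4 * (C ?m * D + 1))"
 define T where "T = (SUM j<=s. \<bar>c j\<bar> * ((1 + C j) * D))"
 define H' where "H' = min H (1 / (4 * (T + 1)))"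
 have CD: "0 <= C ?m * D" using C0[of ?m] D by simp
 have be: "0 < be" "be <= 1" "C ?m * D * be <= 1 / 4" using CD by (auto simp: be_def field_simps)
 have T: "0 <= T" unfolding T_def using C0 D by (intro sum_nonneg mult_nonneg_nonneg add_nonneg_nonneg) auto
 have H': "0 < H'" "H' <= H" "H' <= 1" "T * H' <= 1 / 4"
 proof -
  show "0 < H'" "H' <= H" "H' <= 1" using H T by (auto simp: H'_def)
  have "T * H' <= T * (1 / (4 * (T + 1)))" using T by (intro mult_left_mono) (auto simp: H'_def)
  also have "... <= 1 / 4" using T by (simp add: field_simps)
  finally show "T * H' <= 1 / 4" .
 qed
 have main: "ip ?m (%x. w x * f x) (%x. w x * f x) <= 2 * (SI x. Lop s f x * ((w x)^2 * f x))
  & sn ?m h (%x. w x * f x) <= D * h ^ (2 * ?m) * ip ?m (%x. w x * f x) (%x. w x * f x)"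
  if n: "net h Xi" and h: "h <= H'" and wt: "weight ?m h be w" and f: "smooth f" "!!xi. xi : Xi ==> f xi = 0" for h Xi w f
 proof -
  have h0: "0 < h" using n by (simp add: net_def)
  have h1: "h <= 1" using h H' by simp
  obtain ta where ta: "!!i. smooth (ta i)" "!!i. bd ?m h (be / h) (ta i)" "!!i x. x : S2 ==> Xd i w x = ta i x * w x"
   and w: "smooth w" "!!x. x : S2 ==> 0 < w x" using wt unfolding weight_def by blast
  define u where "u x = w x * f x" for x
  have su: "smooth u" unfolding u_def[abs_def] by (intro smooth_mult w f)
  define I where "I = ip ?m u u"
  have I: "0 <= I" unfolding I_def by (rule ip_nonneg)
  have sn: "sn ?m h u <= D * h ^ (2 * ?m) * I"
   unfolding I_def using h H' f(2) by (intro DH[OF n] su) (auto simp: u_def)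
  have eqB: "ip j f (%x. (w x)^2 * f x) = Bw j ta u u" for j
  proof -
   have "ip j f (%x. (w x)^2 * f x) = ip j (%x. u x / w x) (%x. w x * u x)"
   proof (rule ip_cong)
    fix x assume "x : S2"
    then show "f x = u x / w x" using w(2)[of x] by (simp add: u_def)
   qed (simp add: u_def power2_eq_square)
   also have "... = Bw j ta u u" by (rule Bw_weight[OF w ta(3,1) su su])
   finally show ?thesis .
  qed
  have B: "\<bar>Bw j ta u u - ip j u u\<bar> * h ^ (2 * j) <= C j * be * sn j h u" if "j <= ?m" for j
  proof -
   have "ALL i. smooth (ta i) & bd j h (be / h) (ta i)" using ta(1) bd_le[OF ta(2) that] by blast
   from C[OF h0 less_imp_le[OF be(1)] be(2) this su su] show ?thesis
    by (simp only: power2_eq_square[symmetric] sq_square)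
  qed
  have top: "\<bar>Bw ?m ta u u - I\<bar> <= I / 4"
  proof -
   have "\<bar>Bw ?m ta u u - I\<bar> * h ^ (2 * ?m) <= C ?m * be * sn ?m h u" using B[of ?m] unfolding I_def by blast
   also have "... <= C ?m * be * (D * h ^ (2 * ?m) * I)" using C0[of ?m] be by (intro mult_left_mono sn) auto
   also have "... = (C ?m * D * be) * I * h ^ (2 * ?m)" by (simp only: mult_ac)
   finally have "\<bar>Bw ?m ta u u - I\<bar> <= (C ?m * D * be) * I"
    by (rule mult_right_le_imp_le) (use h0 in simp)
   also have "... <= 1 / 4 * I" by (rule mult_right_mono[OF be(3) I])
   finally show ?thesis by simp
  qed
  have low: "\<bar>Bw j ta u u\<bar> <= (1 + C j) * D * h * I" if j: "j <= s" for j
  proof -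
   have snj: "sn j h u <= sn ?m h u" using j by (intro sn_mono) simp
   have "\<bar>Bw j ta u u\<bar> <= \<bar>Bw j ta u u - ip j u u\<bar> + ip j u u" using ip_nonneg[of j u] by linarith
   then have "\<bar>Bw j ta u u\<bar> * h ^ (2 * j) <= (\<bar>Bw j ta u u - ip j u u\<bar> + ip j u u) * h ^ (2 * j)"
    using h0 by (intro mult_right_mono) auto
   also have "... <= C j * be * sn ?m h u + sn ?m h u"
   proof -
    have "\<bar>Bw j ta u u - ip j u u\<bar> * h ^ (2 * j) <= C j * be * sn j h u" using j by (intro B) simp
    also have "... <= C j * be * sn ?m h u" using C0[of j] be by (intro mult_left_mono snj) auto
    finally have 1: "\<bar>Bw j ta u u - ip j u u\<bar> * h ^ (2 * j) <= C j * be * sn ?m h u" .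
    have "h ^ (2 * j) * ip j u u <= sn ?m h u" using j by (intro ip_le_sn) simp
    then show ?thesis using 1 unfolding distrib_right by (simp only: mult.commute add_mono)
   qed
   also have "... <= (1 + C j) * sn ?m h u"
    using mult_right_mono[OF mult_left_le[OF be(2) C0[of j]] sn_nonneg[of ?m h u]] unfolding distrib_right by simp
   also have "... <= (1 + C j) * (D * h ^ (2 * ?m) * I)" using C0[of j] by (intro mult_left_mono sn) auto
   also have "h ^ (2 * ?m) = h ^ (2 * ?m - 2 * j) * h ^ (2 * j)" using j by (simp flip: power_add)
   also have "(1 + C j) * (D * (h ^ (2 * ?m - 2 * j) * h ^ (2 * j)) * I) = ((1 + C j) * D * h ^ (2 * ?m - 2 * j) * I) * h ^ (2 * j)"
    by (simp only: mult_ac)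
   finally have "\<bar>Bw j ta u u\<bar> <= (1 + C j) * D * h ^ (2 * ?m - 2 * j) * I"
    by (rule mult_right_le_imp_le) (use h0 in simp)
   also have "... <= (1 + C j) * D * h ^ 1 * I"
    using j h0 h1 C0[of j] D I by (intro mult_right_mono mult_left_mono power_decreasing) auto
   finally show ?thesis by simp
  qed
  have "\<bar>SUM j<=s. c j * Bw j ta u u\<bar> <= (SUM j<=s. \<bar>c j\<bar> * ((1 + C j) * D * h * I))"
   by (rule order_trans[OF sum_abs]) (auto simp: abs_mult intro!: sum_mono mult_left_mono low)
  also have "... = T * h * I" unfolding T_def sum_distrib_right by (intro sum.cong refl) (simp only: mult_ac)
  also have "... <= (1 / 4) * I"
   using mult_left_mono[OF h T] H'(4) by (intro mult_right_mono I) linarith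
  finally have lower: "\<bar>SUM j<=s. c j * Bw j ta u u\<bar> <= (1 / 4) * I" .
  have "(SI x. Lop s f x * ((w x)^2 * f x)) = Bw ?m ta u u + (SUM j<=s. c j * Bw j ta u u)"
   using c[OF f(1), of "%x. (w x)^2 * f x"] w f by (simp only: eqB smooth_mult smooth_power)
  then have "I <= 2 * (SI x. Lop s f x * ((w x)^2 * f x))" using top lower by linarith
  then show ?thesis using sn unfolding I_def u_def[abs_def] by blast
 qed
 show ?thesis by (rule that[OF be(1) H'(1,3) D main])
qed

section \<open>Energy estimate for the error between a kernel sum and a smooth interpolant\<close>

lemma smooth_prod:
 assumes "finite A" shows "(!!a. a : A ==> smooth (f a)) ==> smooth (%x. PROD a:A. f a x)"
 using assms by (induction A rule: finite_induct) auto

lemma S2_inner_eq_1: "x : S2 ==> y : S2 ==> x \<bullet> y = 1 \<longleftrightarrow> x = y"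
 using S2_norm_diff[of x y] by auto

text \<open>Smooth functions dual to the nodes, with no control of their size: they correct nodal
  values by amounts that tend to 0.\<close>

lemma smooth_delta_family:
 assumes "finite Xi" "Xi \<subseteq> S2"
 obtains ph where "!!ze. smooth (ph ze)" "!!ze xi. ze : Xi ==> xi : Xi ==> ph ze xi = (if xi = ze then 1 else 0 :: real)"
proof -
 define ph where "ph ze x = (PROD xi:Xi - {ze}. (1 / (1 - ze \<bullet> xi)) * (1 - x \<bullet> xi))" for ze x :: "real^3"
 have "smooth (ph ze)" for ze
  unfolding ph_def[abs_def] using assms by (intro smooth_prod smooth_mult smooth_const smooth_vd) auto
 moreover have "ph ze xi = (if xi = ze then 1 else 0)" if "ze : Xi" "xi : Xi" for ze xi
 proof (cases "xi = ze")
  case True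
  have "1 - ze \<bullet> x ~= 0" if "x : Xi - {ze}" for x
   using S2_inner_eq_1[of ze x] that \<open>ze : Xi\<close> assms(2) by auto
  then show ?thesis using True by (simp add: ph_def)
 next
  case False
  have "(1 / (1 - ze \<bullet> xi)) * (1 - xi \<bullet> xi) = 0" using that(2) assms(2) by (simp add: subset_iff)
  then show ?thesis using False that assms(1) unfolding ph_def by (auto intro!: prod_zero)
 qed
 ultimately show ?thesis by (rule that)
qed

text \<open>What Green's identity requires of coefficients and polynomial part; elements of the
  kernel space satisfy it by \<open>admissibleI\<close>. In this form the analysis precedes the
  study of spherical harmonics.\<close>

definition admissible :: "nat => real poly => (real^3) set => (real^3 => real) => (real^3 => real) => bool" where
 "admissible s q Xi a p \<longleftrightarrow> smooth p & (ALL x:S2. Lop s p x = 0) & (ALL x:S2. (SUM ze:Xi. a ze * poly q (x \<bullet> ze)) = 0)"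

definition pot :: "nat => (real^3) set => (real^3 => real) => (real^3 => real) => real^3 => real" where
 "pot s Xi a p x = (SUM ze:Xi. a ze * surface_spline s x ze) + p x"

lemma continuous_pot:
 assumes "s >= 1" "Xi \<subseteq> S2" "smooth p" shows "continuous_on S2 (pot s Xi a p)"
 unfolding pot_def[abs_def] using assms
 by (intro continuous_on_add continuous_on_sum continuous_on_mult_left continuous_surface_spline smooth_continuous) auto

lemma integral_abs_le_area:
 assumes "g : borel_measurable sgm" "!!x. x : S2 ==> \<bar>g x\<bar> <= B" shows "\<bar>SI x. g x\<bar> <= B * area"
proof -
 have i: "integrable sgm g" by (rule integrable_bounded_surface[OF assms])
 have "\<bar>SI x. g x\<bar> <= (SI x. \<bar>g x\<bar>)" by simp
 also have "... <= (SI x. B)"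
  by (rule integral_mono[OF integrable_abs[OF i] int_cont[OF continuous_on_const]]) (use assms(2) in auto)
 also have "... = B * area" by (simp add: area_def)
 finally show ?thesis .
qed

text \<open>Formally, L maps the kernel sum to Dirac masses at the nodes, where w^2 f vanishes;
  hence the pairings of L f and of L Ph with w^2 f cancel. The kernel sum is mollified and its nodal
  values are corrected by the dual functions, so that f vanishes exactly on the nodes.\<close>

lemma approx_error:
 assumes s: "s >= 1" and g: "green_data s c q" and fin: "finite Xi" and Xi: "Xi \<subseteq> S2"
  and adm: "admissible s q Xi a p" and Ph: "smooth Ph" "!!xi. xi : Xi ==> Ph xi = pot s Xi a p xi"
  and w: "smooth w" and e: "e > 0"
 obtains f where "smooth f" "!!xi. xi : Xi ==> f xi = 0" "!!x. x : S2 ==> \<bar>f x - (pot s Xi a p x - Ph x)\<bar> <= e"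
  "\<bar>(SI x. Lop s f x * ((w x)^2 * f x)) + (SI x. Lop s Ph x * ((w x)^2 * f x))\<bar> <= e"
proof -
 define f0 where "f0 x = pot s Xi a p x - Ph x" for x
 have p: "smooth p" "!!x. x : S2 ==> Lop s p x = 0" "!!x. x : S2 ==> (SUM ze:Xi. a ze * poly q (x \<bullet> ze)) = 0"
  using adm by (auto simp: admissible_def)
 have f0: "continuous_on S2 f0" unfolding f0_def[abs_def]
  by (intro continuous_on_diff continuous_pot s Xi p smooth_continuous Ph)
 obtain ph where ph: "!!ze. smooth (ph ze)" "!!ze xi. ze : Xi ==> xi : Xi ==> ph ze xi = (if xi = ze then 1 else 0 :: real)"
  using smooth_delta_family[OF fin Xi] by metis
 obtain F where F: "F > 0" "!!x. x : S2 ==> \<bar>f0 x\<bar> <= F" using bounded_cont_S2[OF f0] by blast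
 obtain W where W: "W > 0" "!!x. x : S2 ==> \<bar>(w x)^2\<bar> <= W"
  using bounded_cont_S2[OF smooth_continuous[OF smooth_power[OF w, of 2]]] by blast
 have cM: "continuous_on S2 (%x. SUM ze:Xi. \<bar>ph ze x\<bar>)"
  by (rule continuous_on_sum, rule continuous_on_rabs, rule smooth_continuous, rule ph(1))
 have cN: "continuous_on S2 (%x. SUM ze:Xi. \<bar>Lop s (ph ze) x\<bar>)"
  by (rule continuous_on_sum, rule continuous_on_rabs, rule smooth_continuous, rule smooth_Lop, rule ph(1))
 obtain M where M: "M > 0" "!!x. x : S2 ==> \<bar>SUM ze:Xi. \<bar>ph ze x\<bar>\<bar> <= M"
  using bounded_cont_S2[OF cM] by blast
 obtain N where N: "N > 0" "!!x. x : S2 ==> \<bar>SUM ze:Xi. \<bar>Lop s (ph ze) x\<bar>\<bar> <= N"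
  using bounded_cont_S2[OF cN] by blast
 define G where "G = F + 1 + M"
 define S where "S = \<bar>c\<bar> * (SUM ze:Xi. \<bar>a ze\<bar>)"
 have S: "0 <= S" by (simp add: S_def sum_nonneg)
 have G: "0 < G" using F M by (simp add: G_def)
 \<comment> \<open>Collects the error terms divided by e': those of L u and L E, the averages
   against the Dirac family, and the distance of f from f0.\<close>
 define Q where "Q = (1 + N) * (W * G) * area + S + S * (W * (1 + M)) + (1 + M)"
 have "0 < (1 + N) * (W * G) * area" "0 <= S * (W * (1 + M))" using N W G S M area_pos by simp_all
 then have Q: "0 < Q" unfolding Q_def using S M by linarith
 define e' where "e' = min 1 (e / Q)"
 have e': "0 < e'" "e' <= 1" "e' * Q <= e" using e Q by (simp_all add: e'_def min_def field_simps)
 have f0z: "f0 ze = 0" if "ze : Xi" for ze using Ph(2)[OF that] by (simp add: f0_def)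
 have cw: "continuous_on S2 (%x. (w x)^2 * f0 x)"
  by (intro continuous_on_mult f0 smooth_continuous[OF smooth_power[OF w]])
 have "\<forall>\<^sub>F d in at_right 0. \<bar>SI x. bker d ze x * ((w x)^2 * f0 x)\<bar> < e'" if "ze : Xi" for ze
  using tendstoD[OF bker_tendsto[OF cw] e'(1), of ze] f0z[OF that] that Xi by (auto simp: dist_real_def)
 then have "\<forall>\<^sub>F d in at_right 0. ALL ze:Xi. \<bar>SI x. bker d ze x * ((w x)^2 * f0 x)\<bar> < e'"
  using fin by (intro eventually_ball_finite) auto
 moreover have "\<forall>\<^sub>F d in at_right 0. EX u. smooth u & (ALL x:S2. \<bar>u x - pot s Xi a p x\<bar> <= e')
  & (ALL x:S2. \<bar>Lop s u x - c * (SUM ze:Xi. a ze * bker d ze x)\<bar> <= e')"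
  unfolding pot_def by (rule mollify[OF s g fin Xi p(1) _ _ e'(1)]) (fact p(2), fact p(3))
 moreover have "\<forall>\<^sub>F d in at_right 0. (0 :: real) < d" by (simp add: eventually_at_right_less)
 ultimately have "\<forall>\<^sub>F d in at_right 0. 0 < d & (ALL ze:Xi. \<bar>SI x. bker d ze x * ((w x)^2 * f0 x)\<bar> < e') &
  (EX u. smooth u & (ALL x:S2. \<bar>u x - pot s Xi a p x\<bar> <= e')
  & (ALL x:S2. \<bar>Lop s u x - c * (SUM ze:Xi. a ze * bker d ze x)\<bar> <= e'))"
  by eventually_elim (intro conjI)
 from eventually_happens'[OF trivial_limit_at_right_real this]
 obtain d u where d: "0 < d" and bk: "!!ze. ze : Xi ==> \<bar>SI x. bker d ze x * ((w x)^2 * f0 x)\<bar> < e'"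
  and u: "smooth u" "!!x. x : S2 ==> \<bar>u x - pot s Xi a p x\<bar> <= e'"
   "!!x. x : S2 ==> \<bar>Lop s u x - c * (SUM ze:Xi. a ze * bker d ze x)\<bar> <= e'" by blast
 define E where "E x = (SUM ze:Xi. (u ze - Ph ze) * ph ze x)" for x
 have sE: "smooth E" unfolding E_def[abs_def] by (intro smooth_sum smooth_mult smooth_const ph)
 have ez: "\<bar>u ze - Ph ze\<bar> <= e'" if "ze : Xi" for ze using u(2)[of ze] Ph(2)[OF that] that Xi by auto
 have E_le: "\<bar>E x\<bar> <= e' * M" if "x : S2" for x
 proof -
  have "\<bar>E x\<bar> <= (SUM ze:Xi. e' * \<bar>ph ze x\<bar>)" unfolding E_def
   by (rule order_trans[OF sum_abs]) (auto simp: abs_mult intro!: sum_mono mult_right_mono ez)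
  also have "... <= e' * M" using M(2)[OF that] e'(1) unfolding sum_distrib_left[symmetric] by (intro mult_left_mono) auto
  finally show ?thesis .
 qed
 have LE_le: "\<bar>Lop s E x\<bar> <= e' * N" if "x : S2" for x
 proof -
  have "Lop s E x = (SUM ze:Xi. Lop s (%x. (u ze - Ph ze) * ph ze x) x)"
   unfolding E_def[abs_def] using ph(1) that by (intro Lop_sum smooth_mult smooth_const) auto
  also have "... = (SUM ze:Xi. (u ze - Ph ze) * Lop s (ph ze) x)" using ph(1) that by (simp add: Lop_cmult)
  also have "\<bar>...\<bar> <= (SUM ze:Xi. e' * \<bar>Lop s (ph ze) x\<bar>)"
   by (rule order_trans[OF sum_abs]) (auto simp: abs_mult intro!: sum_mono mult_right_mono ez)
  also have "... <= e' * N" using N(2)[OF that] e'(1) unfolding sum_distrib_left[symmetric] by (intro mult_left_mono) auto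
  finally show ?thesis .
 qed
 define f where "f x = u x - (Ph x + E x)" for x
 have sf: "smooth f" unfolding f_def[abs_def] by (intro smooth_diff smooth_add u Ph sE)
 have fz: "f xi = 0" if "xi : Xi" for xi
  using that fin by (simp add: f_def E_def ph(2) if_distrib[of "%t. _ * t"] cong: if_cong)
 have ff0: "\<bar>f x - f0 x\<bar> <= e' * (1 + M)" if "x : S2" for x
  using u(2)[OF that] E_le[OF that] unfolding f_def f0_def distrib_left by linarith
 have fG: "\<bar>f x\<bar> <= G" if "x : S2" for x
 proof -
  have "e' * (1 + M) <= 1 * (1 + M)" using e' M by (intro mult_right_mono) auto
  then have "\<bar>f x - f0 x\<bar> <= 1 + M" using ff0[OF that] by (simp only: mult_1)
  then show ?thesis using F(2)[OF that] unfolding G_def by linarith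
 qed
 have wf: "\<bar>(w x)^2 * f x\<bar> <= W * G" if "x : S2" for x
  unfolding abs_mult using W fG that by (intro mult_mono) auto
 define V where "V x = Lop s u x - c * (SUM ze:Xi. a ze * bker d ze x) - Lop s E x" for x
 have sb: "smooth (%x. c * (SUM ze:Xi. a ze * bker d ze x))" using d Xi by (intro smooth_mult smooth_const smooth_sum smooth_bker) auto
 have sV: "smooth V" unfolding V_def[abs_def] by (intro smooth_diff smooth_Lop u sE sb)
 have V: "\<bar>V x\<bar> <= e' * (1 + N)" if "x : S2" for x
  using u(3)[OF that] LE_le[OF that] unfolding V_def distrib_left by linarith
 have sw: "smooth (%x. (w x)^2 * f x)" by (intro smooth_mult smooth_power w sf)
 have "(SI x. Lop s f x * ((w x)^2 * f x)) + (SI x. Lop s Ph x * ((w x)^2 * f x))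
  = (SI x. Lop s f x * ((w x)^2 * f x) + Lop s Ph x * ((w x)^2 * f x))"
  using sf Ph(1) sw by (intro Bochner_Integration.integral_add[symmetric] int_smooth smooth_mult[of "Lop s _" "%x. (w x)^2 * f x"] smooth_Lop) auto
 also have "... = (SI x. V x * ((w x)^2 * f x) + (SUM ze:Xi. (c * a ze) * (bker d ze x * ((w x)^2 * f x))))"
 proof (rule Bochner_Integration.integral_cong[OF refl])
  fix x assume "x : space sgm"
  then have x: "x : S2" by simp
  have "Lop s u x = Lop s (%x. f x + (Ph x + E x)) x" by (simp add: f_def)
  also have "... = Lop s f x + (Lop s Ph x + Lop s E x)"
   using sf Ph(1) sE x by (simp add: Lop_add[OF sf smooth_add[OF Ph(1) sE] x] Lop_add)
  finally have "Lop s f x + Lop s Ph x = V x + c * (SUM ze:Xi. a ze * bker d ze x)" by (simp add: V_def)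
  moreover have "(SUM ze:Xi. (c * a ze) * (bker d ze x * ((w x)^2 * f x))) = c * (SUM ze:Xi. a ze * bker d ze x) * ((w x)^2 * f x)"
   by (simp only: sum_distrib_left sum_distrib_right mult.assoc)
  ultimately show "Lop s f x * ((w x)^2 * f x) + Lop s Ph x * ((w x)^2 * f x) = V x * ((w x)^2 * f x) + (SUM ze:Xi. (c * a ze) * (bker d ze x * ((w x)^2 * f x)))"
   by (simp only: distrib_right[symmetric])
 qed
 also have "... = (SI x. V x * ((w x)^2 * f x)) + (SUM ze:Xi. (c * a ze) * (SI x. bker d ze x * ((w x)^2 * f x)))"
 proof -
  have sm: "smooth (%x. (c * a ze) * (bker d ze x * ((w x)^2 * f x)))" if "ze : Xi" for ze
   using that Xi d by (intro smooth_mult[OF smooth_const] smooth_mult[OF _ sw] smooth_bker) auto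
  have "smooth (%x. SUM ze:Xi. (c * a ze) * (bker d ze x * ((w x)^2 * f x)))" by (rule smooth_sum[OF sm])
  from Bochner_Integration.integral_add[OF int_smooth[OF smooth_mult[OF sV sw]] int_smooth[OF this]]
  show ?thesis by (simp add: integral_smooth_sum[OF sm])
 qed
 finally have eq: "(SI x. Lop s f x * ((w x)^2 * f x)) + (SI x. Lop s Ph x * ((w x)^2 * f x))
  = (SI x. V x * ((w x)^2 * f x)) + (SUM ze:Xi. (c * a ze) * (SI x. bker d ze x * ((w x)^2 * f x)))" .
 have I1: "\<bar>SI x. V x * ((w x)^2 * f x)\<bar> <= (e' * (1 + N)) * (W * G) * area"
 proof (rule integral_abs_le_area)
  fix x assume "x : S2"
  then show "\<bar>V x * ((w x)^2 * f x)\<bar> <= (e' * (1 + N)) * (W * G)"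
   unfolding abs_mult[of "V x"] using V wf e' N by (intro mult_mono) auto
 qed (intro meas_cont smooth_continuous smooth_mult[OF sV sw])
 \<comment> \<open>The densities \<open>bker d ze\<close> are unbounded as d decreases, so only
   averages can be used: that of w^2 f0 tends to its value 0 at the node, and mass 1 bounds that of
   w^2 (f - f0).\<close>
 have I2: "\<bar>SI x. bker d ze x * ((w x)^2 * f x)\<bar> <= e' + W * (e' * (1 + M))" if z: "ze : Xi" for ze
 proof -
  have zS: "ze : S2" using z Xi by auto
  have cb: "continuous_on S2 (bker d ze)" using zS d by (intro smooth_continuous smooth_bker)
  have cwf: "continuous_on S2 (%x. (w x)^2 * (f x - f0 x))"
   by (intro continuous_on_mult continuous_on_diff f0 smooth_continuous[OF sf] smooth_continuous[OF smooth_power[OF w]])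
  have "(SI x. bker d ze x * ((w x)^2 * f x))
   = (SI x. bker d ze x * ((w x)^2 * f0 x) + bker d ze x * ((w x)^2 * (f x - f0 x)))"
   by (simp add: right_diff_distrib)
  also have "... = (SI x. bker d ze x * ((w x)^2 * f0 x)) + (SI x. bker d ze x * ((w x)^2 * (f x - f0 x)))"
   by (intro Bochner_Integration.integral_add int_cont continuous_on_mult[OF cb] cw cwf)
  finally have 1: "(SI x. bker d ze x * ((w x)^2 * f x))
   = (SI x. bker d ze x * ((w x)^2 * f0 x)) + (SI x. bker d ze x * ((w x)^2 * (f x - f0 x)))" .
  have "\<bar>(SI x. bker d ze x * ((w x)^2 * (f x - f0 x)))\<bar> <= W * (e' * (1 + M))"
  proof (rule bker_average_le[OF zS d meas_cont[OF cwf]])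
   fix x assume "x : S2"
   then show "\<bar>(w x)^2 * (f x - f0 x)\<bar> <= W * (e' * (1 + M))"
    unfolding abs_mult[of "(w x)^2"] using W ff0 by (intro mult_mono) auto
  qed
  then show ?thesis using 1 bk[OF z] by linarith
 qed
 have "\<bar>SUM ze:Xi. (c * a ze) * (SI x. bker d ze x * ((w x)^2 * f x))\<bar> <= (SUM ze:Xi. (\<bar>c\<bar> * \<bar>a ze\<bar>) * (e' + W * (e' * (1 + M))))"
  by (rule order_trans[OF sum_abs]) (auto simp: abs_mult intro!: sum_mono mult_left_mono I2)
 also have "... = S * (e' + W * (e' * (1 + M)))" by (simp only: S_def sum_distrib_left sum_distrib_right)
 finally have I3: "\<bar>SUM ze:Xi. (c * a ze) * (SI x. bker d ze x * ((w x)^2 * f x))\<bar> <= S * (e' + W * (e' * (1 + M)))" .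
 have tot: "(e' * (1 + N)) * (W * G) * area + S * (e' + W * (e' * (1 + M))) + e' * (1 + M) = e' * Q"
  unfolding Q_def by (simp add: algebra_simps)
 have nn: "0 <= (e' * (1 + N)) * (W * G) * area + S * (e' + W * (e' * (1 + M)))" "0 <= e' * (1 + M)"
  using e' N W G area_pos S M by (auto intro!: add_nonneg_nonneg mult_nonneg_nonneg)
 show ?thesis
 proof (rule that[OF sf fz])
  fix x assume "x : S2"
  then show "\<bar>f x - (pot s Xi a p x - Ph x)\<bar> <= e" using ff0[of x] tot nn e'(3) unfolding f0_def by linarith
 next
  show "\<bar>(SI x. Lop s f x * ((w x)^2 * f x)) + (SI x. Lop s Ph x * ((w x)^2 * f x))\<bar> <= e"
   unfolding eq using I1 I3 tot nn e'(3) by linarith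
 qed
qed

text \<open>The estimate is stated with \<open>h ^ (4 * s + 1) = h ^ (4 * m - 3)\<close> for \<open>m = s + 1\<close>.\<close>

definition decay_estimate :: "nat => real poly => real => real => real => bool" where
 "decay_estimate s q be H C \<longleftrightarrow> (ALL h Xi w a p Ph La x xi. net h Xi --> h <= H --> weight (Suc s) h be w --> admissible s q Xi a p --> smooth Ph -->
  (ALL xi:Xi. Ph xi = pot s Xi a p xi) --> (SI x. (w x * Lop s Ph x)^2) <= La --> x : S2 --> xi : Xi -->
  (w x * (pot s Xi a p x - Ph x))^2 <= C * norm (x - xi) * h ^ (4 * s + 1) * La)"

text \<open>Coercivity bounds the energy I by the pairing with L Ph. Cauchy-Schwarz and absorption
  of a part of I leave I <= 4 e + 4 D h^(2 m) La with m = s + 1, and the pointwise estimate at r = h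
  adds the factor h / h^4 and another h^(2 m).\<close>

lemma weighted_decay:
 assumes s: "s >= 1" and g: "green_data s c q"
 obtains be H C where "0 < be" "0 < H" "H <= 1" "0 < C" "decay_estimate s q be H C"
proof (rule coercive[OF s])
 let ?m = "Suc s"
 fix be H D :: real
 assume be: "0 < be" and H: "0 < H" "H <= 1" and D: "D >= 1" and co:
  "!!h Xi w f. net h Xi ==> h <= H ==> weight (Suc s) h be w ==> smooth f ==> (!!xi. xi : Xi ==> f xi = 0) ==>
   ip (Suc s) (%x. w x * f x) (%x. w x * f x) <= 2 * (SI x. Lop s f x * ((w x)^2 * f x))
  & sn (Suc s) h (%x. w x * f x) <= D * h ^ (2 * Suc s) * ip (Suc s) (%x. w x * f x) (%x. w x * f x)"
 obtain C where C: "C > 0" "!!r x y u. 0 < r ==> r <= 1 ==> x : S2 ==> y : S2 ==> smooth u ==> u y = 0 ==>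
  (u x)^2 <= C * norm (x - y) * r * (ip 0 u u / r ^ 4 + ip 1 u u / r^2 + ip 2 u u)"
  using pointwise_global by blast
 have main: "(w x * (pot s Xi a p x - Ph x))^2 <= (4 * C * D^2) * norm (x - xi) * h ^ (4 * s + 1) * La"
  if n: "net h Xi" and h: "h <= H" and wt: "weight (Suc s) h be w" and adm: "admissible s q Xi a p" and Ph: "smooth Ph"
   "!!xi. xi : Xi ==> Ph xi = pot s Xi a p xi" and La: "(SI x. (w x * Lop s Ph x)^2) <= La" and x: "x : S2" and xi: "xi : Xi"
  for h Xi w a p Ph La x xi
 proof -
  have h0: "0 < h" and fin: "finite Xi" and Xi: "Xi \<subseteq> S2" using n by (auto simp: net_def)
  have w: "smooth w" "!!x. x : S2 ==> 0 < w x" using wt by (auto simp: weight_def)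
  have "0 <= (SI x. (w x * Lop s Ph x)^2)" by (rule Bochner_Integration.integral_nonneg) simp
  then have La0: "0 <= La" using La by linarith
  let ?B = "D * h ^ (2 * ?m) * La" and ?A = "C * norm (x - xi) * (h / h ^ 4 * (D * h ^ (2 * ?m)))"
  have A0: "0 <= ?A" using C(1) D h0 by (intro mult_nonneg_nonneg) auto
  have step: "w x * \<bar>pot s Xi a p x - Ph x\<bar> <= w x * e + sqrt (?A * (4 * e + 4 * ?B))" if e: "e > 0" for e
  proof -
   obtain f where f: "smooth f" "!!xi. xi : Xi ==> f xi = 0" "!!x. x : S2 ==> \<bar>f x - (pot s Xi a p x - Ph x)\<bar> <= e"
    and fe: "\<bar>(SI x. Lop s f x * ((w x)^2 * f x)) + (SI x. Lop s Ph x * ((w x)^2 * f x))\<bar> <= e"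
    by (rule approx_error[OF s g fin Xi adm Ph(1) _ w(1) e]) (erule Ph(2), rule that)
   define u where "u x = w x * f x" for x
   have su: "smooth u" unfolding u_def[abs_def] by (intro smooth_mult w f)
   have sL: "smooth (%x. w x * Lop s Ph x)" by (intro smooth_mult w smooth_Lop Ph)
   define I where "I = ip ?m u u"
   have I: "0 <= I" unfolding I_def by (rule ip_nonneg)
   have I1: "I <= 2 * (SI x. Lop s f x * ((w x)^2 * f x))" and I2: "sn ?m h u <= D * h ^ (2 * ?m) * I"
    using co[OF n h wt f(1,2)] unfolding I_def u_def[abs_def] by blast+
   have a1: "(SI x. Lop s Ph x * ((w x)^2 * f x)) = ip 0 (%x. w x * Lop s Ph x) u"
    by (simp add: u_def power2_eq_square mult_ac)
   have a2: "(ip 0 (%x. w x * Lop s Ph x) u)^2 <= La * (D * h ^ (2 * ?m) * I)"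
   proof -
    have "ip 0 u u <= D * h ^ (2 * ?m) * I" using ip_le_sn[of 0 ?m h u] I2 by simp
    moreover have "ip 0 (%x. w x * Lop s Ph x) (%x. w x * Lop s Ph x) <= La" using La by (simp add: power2_eq_square)
    ultimately show ?thesis
     using La0 by (intro order_trans[OF ip_Cauchy_Schwarz[OF sL su]] mult_mono ip_nonneg)
   qed
   have a3: "La * (D * h ^ (2 * ?m) * I) <= (?B + I / 4)^2"
   proof -
    have "0 <= (?B - I / 4)^2" by simp
    then show ?thesis by (simp add: power2_eq_square algebra_simps)
   qed
   have B0: "0 <= ?B" using D h0 La0 by simp
   have "\<bar>SI x. Lop s Ph x * ((w x)^2 * f x)\<bar>^2 <= (?B + I / 4)^2" unfolding power2_abs a1 by (rule order_trans[OF a2 a3])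
   then have "\<bar>SI x. Lop s Ph x * ((w x)^2 * f x)\<bar> <= ?B + I / 4"
    by (rule power2_le_imp_le) (use B0 I in linarith)
   then have I4: "I <= 4 * e + 4 * ?B" using I1 fe by linarith
   have "(u x)^2 <= C * norm (x - xi) * h * (ip 0 u u / h ^ 4 + ip 1 u u / h^2 + ip 2 u u)"
    using xi Xi f(2) h H by (intro C(2) h0 x su) (auto simp: u_def)
   also have "ip 0 u u / h ^ 4 + ip 1 u u / h^2 + ip 2 u u = sn 2 h u / h ^ 4"
   proof -
    have "{..2::nat} = {0, 1, 2}" by auto
    then have "sn 2 h u = ip 0 u u + h^2 * ip 1 u u + h ^ 4 * ip 2 u u" by (simp add: sn_eq_sum del: ip.simps)
    then show ?thesis using h0 by (simp only: add_divide_distrib) (simp add: field_simps power2_eq_square power4_eq_xxxx del: ip.simps)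
   qed
   also have "C * norm (x - xi) * h * (sn 2 h u / h ^ 4) <= C * norm (x - xi) * h * ((D * h ^ (2 * ?m) * (4 * e + 4 * ?B)) / h ^ 4)"
   proof -
    have "sn 2 h u <= D * h ^ (2 * ?m) * I" using s by (intro order_trans[OF sn_mono I2]) simp
    also have "... <= D * h ^ (2 * ?m) * (4 * e + 4 * ?B)" using D h0 by (intro mult_left_mono I4) auto
    finally show ?thesis using C(1) h0 by (intro mult_left_mono divide_right_mono) auto
   qed
   also have "... = ?A * (4 * e + 4 * ?B)" by simp
   finally have "\<bar>u x\<bar> <= sqrt (?A * (4 * e + 4 * ?B))" by (simp add: real_le_rsqrt)
   moreover have "w x * \<bar>pot s Xi a p x - Ph x\<bar> <= w x * (\<bar>f x\<bar> + e)"
    using f(3)[OF x] w(2)[OF x] by (intro mult_left_mono) auto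
   ultimately show ?thesis using w(2)[OF x] by (simp add: u_def abs_mult distrib_left)
  qed
  have lim: "((%e. w x * e + sqrt (?A * (4 * e + 4 * ?B))) \<longlongrightarrow> w x * 0 + sqrt (?A * (4 * 0 + 4 * ?B))) (at_right 0)"
   by (intro tendsto_intros)
  have "w x * \<bar>pot s Xi a p x - Ph x\<bar> <= w x * 0 + sqrt (?A * (4 * 0 + 4 * ?B))"
   by (rule tendsto_lowerbound[OF lim eventually_mono[OF eventually_at_right_less step] trivial_limit_at_right_real])
  then have "(w x * \<bar>pot s Xi a p x - Ph x\<bar>)^2 <= (sqrt (?A * (4 * ?B)))^2"
   using w(2)[OF x] by (intro power_mono) auto
  also have "... = ?A * (4 * ?B)" using C(1) D h0 La0 by (intro real_sqrt_pow2 mult_nonneg_nonneg) auto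
  also have "... = (4 * C * D^2) * norm (x - xi) * (h / h ^ 4 * h ^ (2 * ?m) * h ^ (2 * ?m)) * La" by (simp add: power2_eq_square)
  also have "h / h ^ 4 * h ^ (2 * ?m) * h ^ (2 * ?m) = h ^ (4 * s + 1)"
  proof -
   have "h ^ (2 * ?m) * h ^ (2 * ?m) = h ^ (4 * s) * h ^ 4" unfolding power_add[symmetric] by (intro arg_cong[where f = "power h"]) simp
   then show ?thesis using h0 by (simp add: mult.assoc)
  qed
  finally show ?thesis by (simp add: power_mult_distrib)
 qed
 have cp: "0 < 4 * C * D^2" using C(1) D by simp
 have "decay_estimate s q be H (4 * C * D^2)"
  unfolding decay_estimate_def by (intro allI impI, rule main) (assumption | erule (1) bspec)+
 then show thesis by (rule that[OF be H cp])
qed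

text \<open>\<open>1 / Psc\<close> is a smooth substitute for 1 plus the distance to z in units of
  h, and its derivative is \<open>Esc / (2 * h)\<close>; the bound on \<open>Esc\<close> limits
  nu.\<close>

lemma exp_weight:
 assumes be: "be > 0"
 obtains nu where "nu > 0" "!!h z. 0 < h ==> h <= 1 ==> z : S2 ==> weight k h be (%x. exp (nu * (1 / Psc h z x)))"
proof -
 obtain C where C: "C >= 0" "!!r z i. 0 < r ==> r <= 1 ==> z : S2 ==> bd k r C (Esc r z i)"
  using bd_Psc_Esc[of k] by blast
 define nu where "nu = be / (C + 1)"
 have nu: "nu > 0" "nu * C <= be" using be C(1) by (simp_all add: nu_def field_simps)
 have "weight k h be (%x. exp (nu * (1 / Psc h z x)))" if h: "0 < h" "h <= 1" and z: "z : S2" for h z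
 proof -
  let ?ta = "%i x. (nu / (2 * h)) * Esc h z i x"
  have P: "smooth (%x. 1 / Psc h z x)" using Psc_bounds(1)[OF _ z] by (intro smooth_divide smooth_const smooth_Psc z)
  have X: "Xd i (%x. exp (nu * (1 / Psc h z x))) x = ?ta i x * exp (nu * (1 / Psc h z x))" if x: "x : S2" for i x
  proof -
   note p = Psc_bounds(1)[OF _ z, of _ h]
   have "Xd i (%x. 1 / Psc h z x) x = - (1 / (Psc h z x)^2) * Xd i (Psc h z) x"
   proof (rule Xd_compose[OF smooth_Psc[OF z] x])
    fix x assume "x : S2"
    then show "((%y. 1 / y) has_real_derivative - (1 / (Psc h z x)^2)) (at (Psc h z x))"
     using p[of x] by (auto intro!: derivative_eq_intros simp: power2_eq_square)
   qed
   also have "... = (1 / (2 * h)) * Esc h z i x"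
    using p[OF x] h by (simp add: Xd_Psc[OF h(1) z x] power2_eq_square)
   finally have 1: "Xd i (%x. 1 / Psc h z x) x = (1 / (2 * h)) * Esc h z i x" .
   have 2: "Xd i (%x. exp (nu * (1 / Psc h z x))) x = exp (nu * (1 / Psc h z x)) * Xd i (%x. nu * (1 / Psc h z x)) x"
    by (rule Xd_compose[OF smooth_mult[OF smooth_const P] x]) (rule DERIV_exp)
   show ?thesis unfolding 2 Xd_cmult[OF P x] 1 by simp
  qed
  have b: "bd k h (be / h) (?ta i)" for i
  proof (rule bd_mono[OF bd_cmult[OF smooth_Esc[OF z] C(2)[OF h z]] _ h(1)])
   have "nu * C <= 2 * be" using nu(2) be by linarith
   then show "\<bar>nu / (2 * h)\<bar> * C <= be / h" using nu h by (simp add: field_simps)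
  qed
  show ?thesis unfolding weight_def
  proof (intro conjI ballI exI[of _ ?ta] allI)
   show "smooth (%x. exp (nu * (1 / Psc h z x)))" by (intro smooth_exp smooth_mult smooth_const P)
  qed (use X b smooth_Esc[OF z] in \<open>auto intro!: smooth_mult simp del: times_divide_eq_left\<close>)
 qed
 then show ?thesis using nu(1) that by blast
qed

text \<open>The lower bound makes the weight grow exponentially with the distance; the upper bound
  keeps it bounded where a bump of radius at most h lives.\<close>

lemma Psc_inverse_bounds:
 assumes "x : S2" "z : S2" "h > 0"
 shows "norm (x - z) / (2 * h) <= 1 / Psc h z x" "1 - x \<bullet> z <= 3 * h^2 ==> 1 / Psc h z x <= 2"
proof -
 have e: "1 / Psc h z x = sqrt (1 + (1 - x \<bullet> z) / h^2)"
 proof -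
  let ?y = "1 + (1 - x \<bullet> z) / h^2"
  have y: "1 <= ?y" by (rule scaled_pos[OF assms(1,2)])
  have "Psc h z x = ?y powr (- (1 / 2))" by (simp add: Psc_def)
  also have "... = 1 / ?y powr (1 / 2)" by (rule powr_minus_divide)
  also have "?y powr (1 / 2) = sqrt ?y" using y by (intro powr_half_sqrt) linarith
  finally show ?thesis by simp
 qed
 have eq: "(norm (x - z) / (2 * h))^2 = (1 - x \<bullet> z) / h^2 / 2"
  using assms(3) by (simp add: power_divide S2_norm_diff[OF assms(1,2)] power_mult_distrib field_simps)
 have v: "0 <= (1 - x \<bullet> z) / h^2" using v_nonneg[OF assms(1,2)] by simp
 have "t / 2 <= 1 + t" if "0 <= t" for t :: real using that by linarith
 from this[OF v] have "(norm (x - z) / (2 * h))^2 <= 1 + (1 - x \<bullet> z) / h^2" unfolding eq .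
 then show "norm (x - z) / (2 * h) <= 1 / Psc h z x" unfolding e by (rule real_le_rsqrt)
 assume "1 - x \<bullet> z <= 3 * h^2"
 then have "1 + (1 - x \<bullet> z) / h^2 <= 2^2" using assms(3) by (simp add: field_simps)
 then show "1 / Psc h z x <= 2" unfolding e by (simp add: real_le_lsqrt scaled_pos)
qed

lemma bd_lap: "bd (Suc (Suc k)) r A f ==> smooth f ==> bd k r (3 * (A / r^2)) (lap f)"
proof -
 assume b: "bd (Suc (Suc k)) r A f" and f: "smooth f"
 have b': "bd k r (A / r^2) (Xd i (Xd i f))" for i using b by (simp add: power2_eq_square)
 have s: "smooth (Xd i (Xd i f))" for i by (intro smooth_Xd f)
 have "bd k r (A / r^2 + A / r^2 + A / r^2) (%x. Xd 1 (Xd 1 f) x + Xd 2 (Xd 2 f) x + Xd 3 (Xd 3 f) x)"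
  by (intro bd_add smooth_add s b')
 moreover have "lap f = (%x. Xd 1 (Xd 1 f) x + Xd 2 (Xd 2 f) x + Xd 3 (Xd 3 f) x)"
  by (simp add: lap_def[abs_def] sum_3)
 ultimately show ?thesis by (simp add: algebra_simps)
qed

text \<open>Each of the s + 1 second-order factors costs r^(-2); their constant terms cost no more
  because r is at most 1.\<close>

lemma bd_Lop: "EX C>=0. ALL r A f. 0 < r --> r <= 1 --> 0 <= A --> smooth f --> bd (k + 2 * Suc s) r A f --> bd k r (C * A / r ^ (2 * Suc s)) (Lop s f)"
proof (induction s arbitrary: k)
 case 0
 have "bd k r (3 * A / r ^ (2 * Suc 0)) (Lop 0 f)" if "smooth f" "bd (k + 2 * Suc 0) r A f" for r A f
  using bd_cmult[OF smooth_lap[OF that(1)] bd_lap[OF _ that(1)], of k r A "-1"] that(2) by (simp add: power2_eq_square)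
 then show ?case by (intro exI[of _ 3]) auto
next
 case (Suc s)
 obtain C1 where C1: "C1 >= 0" "!!r A f. 0 < r ==> r <= 1 ==> 0 <= A ==> smooth f ==> bd (k + 2 + 2 * Suc s) r A f ==> bd (k + 2) r (C1 * A / r ^ (2 * Suc s)) (Lop s f)"
  using Suc.IH[of "k + 2"] by blast
 define M where "M = (real s + 1) * (real s + 2)"
 have "bd k r ((3 + M) * C1 * A / r ^ (2 * Suc (Suc s))) (Lop (Suc s) f)"
  if r: "0 < r" "r <= 1" and A: "0 <= A" and f: "smooth f" and b: "bd (k + 2 * Suc (Suc s)) r A f" for r A f
 proof -
  let ?B = "C1 * A / r ^ (2 * Suc s)"
  have B0: "0 <= ?B" using C1(1) A r by simp
  have "k + 2 * Suc (Suc s) = k + 2 + 2 * Suc s" by simp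
  then have b2: "bd (k + 2) r ?B (Lop s f)" using b by (intro C1(2) r A f) (simp only:)
  have sL: "smooth (Lop s f)" by (rule smooth_Lop[OF f])
  have 1: "bd k r (\<bar>-1\<bar> * (3 * (?B / r^2))) (%x. (-1) * lap (Lop s f) x)"
   by (rule bd_cmult[OF smooth_lap[OF sL] bd_lap[OF _ sL]]) (use b2 in simp)
  have 2: "bd k r (\<bar>- M\<bar> * ?B) (%x. (- M) * Lop s f x)"
   by (rule bd_cmult[OF sL bd_le[OF b2]]) simp
  have "bd k r (\<bar>-1\<bar> * (3 * (?B / r^2)) + \<bar>- M\<bar> * ?B) (%x. (-1) * lap (Lop s f) x + (- M) * Lop s f x)"
   by (rule bd_add[OF _ _ 1 2]) (intro smooth_mult smooth_const smooth_lap sL)+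
  moreover have "(%x. (-1) * lap (Lop s f) x + (- M) * Lop s f x) = Lop (Suc s) f" by (simp add: M_def)
  moreover have "\<bar>-1\<bar> * (3 * (?B / r^2)) + \<bar>- M\<bar> * ?B <= (3 + M) * C1 * A / r ^ (2 * Suc (Suc s))"
  proof -
   have "?B * r^2 <= ?B" using B0 r by (intro mult_left_le power_le_one) auto
   then have "?B <= ?B / r^2" by (rule pos_le_divide_eq[OF zero_less_power[OF r(1)], THEN iffD2])
   then have "M * ?B <= M * (?B / r^2)" by (intro mult_left_mono) (auto simp: M_def)
   moreover have "(3 + M) * C1 * A / r ^ (2 * Suc (Suc s)) = 3 * (?B / r^2) + M * (?B / r^2)"
    using r by (simp add: field_simps power2_eq_square)
   moreover have "\<bar>- M\<bar> = M" by (simp add: M_def)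
   ultimately show ?thesis by simp
  qed
  ultimately show ?thesis using bd_mono[OF _ _ r(1)] by simp
 qed
 moreover have "0 <= (3 + M) * C1" using C1(1) by (auto simp: M_def)
 ultimately show ?case by (intro exI[of _ "(3 + M) * C1"]) auto
qed

lemma Lop_vanish:
 assumes "!!y. y : S2 ==> a < 1 - y \<bullet> z ==> f y = 0" "x : S2" "a < 1 - x \<bullet> z"
 shows "Lop s f x = 0"
 using assms(2,3)
proof (induction s arbitrary: x)
 case 0
 have "Xd i (Xd i f) x = 0" for i using assms(1) 0 by (intro Xd_vanish[of a z]) auto
 then show ?case by (simp add: lap_def)
next
 case (Suc s)
 have "Xd i (Xd i (Lop s f)) x = 0" for i using Suc by (intro Xd_vanish[of a z]) auto
 then show ?case using Suc by (simp add: lap_def)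
qed

text \<open>Reads off coefficients: a test function equal to 1 at one node and 0 at the others
  isolates one of them.\<close>

lemma pot_green:
 assumes s: "s >= 1" and g: "green_data s c q" and fin: "finite Xi" and Xi: "Xi \<subseteq> S2"
  and adm: "admissible s q Xi a p" and f: "smooth f"
 shows "(SI x. pot s Xi a p x * Lop s f x) = c * (SUM ze:Xi. a ze * f ze)"
proof -
 have p: "smooth p" "!!x. x : S2 ==> Lop s p x = 0" "!!x. x : S2 ==> (SUM ze:Xi. a ze * poly q (x \<bullet> ze)) = 0"
  using adm by (auto simp: admissible_def)
 have cL: "continuous_on S2 (Lop s f)" by (intro smooth_continuous smooth_Lop f)
 have ck: "continuous_on S2 (%x. a ze * (surface_spline s x ze * Lop s f x))" if "ze : Xi" for ze
  using that Xi by (intro continuous_on_mult[OF _ cL] continuous_on_mult_left continuous_surface_spline s) auto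
 have "(SI x. pot s Xi a p x * Lop s f x)
  = (SI x. (SUM ze:Xi. a ze * (surface_spline s x ze * Lop s f x)) + p x * Lop s f x)"
  by (simp add: pot_def distrib_right sum_distrib_right mult.assoc)
 also have "... = (SI x. (SUM ze:Xi. a ze * (surface_spline s x ze * Lop s f x))) + (SI x. p x * Lop s f x)"
  by (intro Bochner_Integration.integral_add int_cont continuous_on_sum ck continuous_on_mult[OF smooth_continuous[OF p(1)] cL])
 also have "(SI x. (SUM ze:Xi. a ze * (surface_spline s x ze * Lop s f x))) = (SUM ze:Xi. (SI x. a ze * (surface_spline s x ze * Lop s f x)))"
  by (intro Bochner_Integration.integral_sum int_cont ck)
 also have "... = (SUM ze:Xi. c * (a ze * f ze) + (SI x. a ze * (poly q (x \<bullet> ze) * f x)))"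
 proof (rule sum.cong[OF refl])
  fix ze assume "ze : Xi"
  then have "(SI x. surface_spline s x ze * Lop s f x) = c * f ze + (SI x. poly q (x \<bullet> ze) * f x)"
   using g f Xi by (auto simp: green_data_def)
  then show "(SI x. a ze * (surface_spline s x ze * Lop s f x)) = c * (a ze * f ze) + (SI x. a ze * (poly q (x \<bullet> ze) * f x))"
   by (simp add: algebra_simps)
 qed
 also have "... = c * (SUM ze:Xi. a ze * f ze) + (SI x. (SUM ze:Xi. a ze * (poly q (x \<bullet> ze) * f x)))"
  unfolding sum.distrib sum_distrib_left[symmetric]
  by (subst integral_smooth_sum) (intro smooth_mult[OF smooth_const] smooth_mult[OF smooth_zonal_poly] f, rule refl)
 also have "(SI x. (SUM ze:Xi. a ze * (poly q (x \<bullet> ze) * f x))) = (SI x. 0)"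
  by (rule Bochner_Integration.integral_cong) (simp_all add: mult.assoc[symmetric] sum_distrib_right[symmetric] p(3))
 also have "(SI x. p x * Lop s f x) = (SI x. Lop s p x * f x)" by (rule Lop_symmetric[OF p(1) f, symmetric])
 also have "... = (SI x. 0)" by (rule Bochner_Integration.integral_cong) (simp_all add: p(2))
 finally show ?thesis by simp
qed

lemma integral_cap_le:
 assumes f: "continuous_on S2 f" and B: "!!x. x : cap z a ==> \<bar>f x\<bar> <= B" and z: "z : S2" and a: "a > 0" and B0: "B >= 0"
  and v: "!!x. x : S2 ==> a < 1 - x \<bullet> z ==> f x = 0"
 shows "\<bar>SI x. f x\<bar> <= B * (2 * area * a)"
proof -
 have i: "integrable sgm f" by (rule int_cont[OF f])
 have "\<bar>SI x. f x\<bar> <= (SI x. \<bar>f x\<bar>)" by simp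
 also have "... <= (SI x. B * indicat_real (cap z a) x)"
 proof (rule integral_mono[OF integrable_abs[OF i]])
  fix x assume "x : space sgm"
  then show "\<bar>f x\<bar> <= B * indicat_real (cap z a) x"
   using B[of x] v[of x] by (cases "x : cap z a") (auto simp: cap_def)
 qed simp
 also have "... = B * measure sgm (cap z a)" by simp
 also have "... <= B * (2 * area * a)" by (rule mult_left_mono[OF cap_upper[OF z a] B0])
 finally show ?thesis .
qed

text \<open>The bump of radius ka h around a node vanishes at all other nodes, so it interpolates
  the data of a Lagrange function.\<close>

definition sep :: "real => real => (real^3) set => bool" where
 "sep ka h Xi \<longleftrightarrow> (ALL xi:Xi. ALL ze:Xi. xi ~= ze --> 3 * (ka * h)^2 <= 1 - xi \<bullet> ze)"

lemma cutoff_sep: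
 assumes "sep ka h Xi" "Xi \<subseteq> S2" "xi : Xi" "ze : Xi" "0 < ka" "0 < h"
 shows "cutoff (ka * h) ze xi = (if xi = ze then 1 else 0)"
proof (cases "xi = ze")
 case True
 then show ?thesis using assms by (auto intro!: cutoff_center)
next
 case False
 then show ?thesis using assms unfolding sep_def by (auto intro!: cutoff_zero)
qed

lemma Lop_cutoff:
 obtains C where "C > 0" "!!r z x. 0 < r ==> r <= 1 ==> z : S2 ==> x : S2 ==> \<bar>Lop s (cutoff r z) x\<bar> <= C / r ^ (2 * Suc s)"
  "!!r z x. 0 < r ==> z : S2 ==> x : S2 ==> 3 * r^2 < 1 - x \<bullet> z ==> Lop s (cutoff r z) x = 0"
proof -
 obtain C1 where C1: "C1 >= 0" "!!r A f. 0 < r ==> r <= 1 ==> 0 <= A ==> smooth f ==> bd (0 + 2 * Suc s) r A f ==> bd 0 r (C1 * A / r ^ (2 * Suc s)) (Lop s f)"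
  using bd_Lop[where k = 0 and s = s] by blast
 obtain C2 where C2: "C2 >= 0" "!!r z. 0 < r ==> r <= 1 ==> z : S2 ==> bd (0 + 2 * Suc s) r C2 (cutoff r z)"
  using bd_cutoff by blast
 have "\<bar>Lop s (cutoff r z) x\<bar> <= (C1 * C2 + 1) / r ^ (2 * Suc s)"
  if r: "0 < r" "r <= 1" and z: "z : S2" and x: "x : S2" for r z x
 proof -
  have "\<bar>Lop s (cutoff r z) x\<bar> <= C1 * C2 / r ^ (2 * Suc s)"
   by (rule bd_sup[OF C1(2)[OF r C2(1) smooth_cutoff[OF z] C2(2)[OF r z]] x])
  also have "... <= (C1 * C2 + 1) / r ^ (2 * Suc s)" using r by (intro divide_right_mono) auto
  finally show ?thesis .
 qed
 moreover have "Lop s (cutoff r z) x = 0" if "0 < r" "z : S2" "x : S2" "3 * r^2 < 1 - x \<bullet> z" for r z x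
  using that by (intro Lop_vanish[of "3 * r^2" z]) (auto intro: cutoff_zero)
 moreover have "0 < C1 * C2 + 1" using C1(1) C2(1) by (simp add: add_nonneg_pos)
 ultimately show ?thesis using that by blast
qed

lemma norm_le_of_cap:
 assumes "x : S2" "z : S2" "1 - x \<bullet> z <= 3 * r^2" "0 <= r" shows "norm (x - z) <= 3 * r"
proof (rule power2_le_imp_le)
 have "(norm (x - z))^2 <= 6 * r^2" using assms by (simp add: S2_norm_diff)
 also have "... <= (3 * r)^2" by (simp add: power_mult_distrib)
 finally show "(norm (x - z))^2 <= (3 * r)^2" .
qed (use assms in simp)

section \<open>Unisolvence and the exponential decay of Lagrange functions\<close>

definition unisolvent :: "nat => real poly => real => bool" where
 "unisolvent s q H \<longleftrightarrow> (ALL h Xi a p. net h Xi --> h <= H --> admissible s q Xi a p -->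
  (ALL xi:Xi. pot s Xi a p xi = 0) --> (ALL xi:Xi. a xi = 0) & (ALL x:S2. p x = 0))"

text \<open>With w = 1 and Ph = 0 the decay estimate has right-hand side 0, so the kernel sum
  vanishes on the whole sphere; Green's identity then gives each coefficient.\<close>

lemma pot_zero:
 assumes s: "s >= 1" and g: "green_data s c q"
 obtains H where "H > 0" "H <= 1" "unisolvent s q H"
proof (rule weighted_decay[OF s g])
 fix be H C :: real
 assume be: "0 < be" and H: "0 < H" "H <= 1" and C: "0 < C"
  and de: "decay_estimate s q be H C"
 note wd = de[unfolded decay_estimate_def, rule_format]
 have main: "(ALL xi:Xi. a xi = 0) & (ALL x:S2. p x = 0)" if n: "net h Xi" and h: "h <= H" and adm: "admissible s q Xi a p"
  and z: "!!xi. xi : Xi ==> pot s Xi a p xi = 0" for h Xi a p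
 proof -
  have h0: "0 < h" and fin: "finite Xi" and Xi: "Xi \<subseteq> S2" using n by (auto simp: net_def)
  have "bd (Suc s) h (be / h) (%x. 0)" using be h0 by (intro bd_zero) auto
  then have wt: "weight (Suc s) h be (%x. 1)" unfolding weight_def
   by (intro conjI exI[of _ "%i x. 0"]) (auto simp del: bd.simps)
  have pz: "pot s Xi a p x = 0" if x: "x : S2" for x
  proof -
   obtain xi where xi: "xi : Xi" using n x unfolding net_def by blast
   have "(SI x. (1 * Lop s (%x. 0) x)^2) = (SI x. 0)"
    by (rule Bochner_Integration.integral_cong) (auto simp: Lop_zero)
   then have "(1 * (pot s Xi a p x - 0))^2 <= C * norm (x - xi) * h ^ (4 * s + 1) * 0"
    by (intro wd[OF n h wt adm smooth_const _ _ x xi]) (simp_all add: z)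
   then show ?thesis by simp
  qed
  obtain ph where ph: "!!ze. smooth (ph ze)" "!!ze xi. ze : Xi ==> xi : Xi ==> ph ze xi = (if xi = ze then 1 else 0 :: real)"
   using smooth_delta_family[OF fin Xi] by metis
  have a: "a xi = 0" if xi: "xi : Xi" for xi
  proof -
   have "(SI x. pot s Xi a p x * Lop s (ph xi) x) = (SI x. 0)"
    by (rule Bochner_Integration.integral_cong) (auto simp: pz)
   then have "c * (SUM ze:Xi. a ze * ph xi ze) = 0" using pot_green[OF s g fin Xi adm ph(1)[of xi]] by simp
   moreover have "(SUM ze:Xi. a ze * ph xi ze) = (SUM ze:Xi. if ze = xi then a ze else 0)"
    by (rule sum.cong) (auto simp: ph(2)[OF xi])
   ultimately show ?thesis using xi fin g by (simp add: green_data_def)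
  qed
  moreover have "p x = 0" if "x : S2" for x using pz[OF that] a by (simp add: pot_def)
  ultimately show ?thesis by blast
 qed
 have "unisolvent s q H" unfolding unisolvent_def by (intro allI impI, rule main) (assumption | erule (1) bspec)+
 then show thesis by (rule that[OF H])
qed

text \<open>The first estimate holds for every node ze, not only for xi0: near any node the function
  is close to its bump, beyond what decay alone would give.\<close>

definition lagrange_estimate :: "nat => real poly => real => real => real => real => bool" where
 "lagrange_estimate s q ka nu H C \<longleftrightarrow> (ALL h Xi xi0 a p x ze. net h Xi --> h <= H --> sep ka h Xi --> admissible s q Xi a p --> xi0 : Xi -->
  (ALL xi:Xi. pot s Xi a p xi = (if xi = xi0 then 1 else 0)) --> x : S2 --> ze : Xi -->
  \<bar>pot s Xi a p x - cutoff (ka * h) xi0 x\<bar> <= C * sqrt (norm (x - ze) / h) * exp (- nu * (norm (x - xi0) / h))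
  & \<bar>pot s Xi a p x\<bar> <= C * exp (- nu * (norm (x - xi0) / h))
  & \<bar>a ze\<bar> <= C / h ^ (2 * s) * exp (- nu * (norm (ze - xi0) / h)))"

text \<open>Weighted decay with Ph the bump at xi0 and the weight centred there: L Ph lives where
  the weight is at most exp (2 mu). Testing Green's identity with a bump at ze passes the decay on
  to the coefficients.\<close>

lemma lagrange_decay:
 assumes s: "s >= 1" and g: "green_data s c q" and ka: "0 < ka" "ka <= 1"
 obtains nu H C where "nu > 0" "H > 0" "H <= 1" "C > 0" "lagrange_estimate s q ka nu H C"
proof (rule weighted_decay[OF s g])
 fix be H1 C1 :: real
 assume be: "0 < be" and H: "0 < H1" "H1 <= 1" and C1: "0 < C1"
  and de: "decay_estimate s q be H1 C1"
 note wd = de[unfolded decay_estimate_def, rule_format]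
 obtain mu where mu: "mu > 0" and wt: "!!h z. 0 < h ==> h <= 1 ==> z : S2 ==> weight (Suc s) h be (%x. exp (mu * (1 / Psc h z x)))"
  using exp_weight[OF be] by metis
 obtain B where B: "B > 0" "!!r z x. 0 < r ==> r <= 1 ==> z : S2 ==> x : S2 ==> \<bar>Lop s (cutoff r z) x\<bar> <= B / r ^ (2 * Suc s)"
  "!!r z x. 0 < r ==> z : S2 ==> x : S2 ==> 3 * r^2 < 1 - x \<bullet> z ==> Lop s (cutoff r z) x = 0"
  using Lop_cutoff[of s] by metis
 \<comment> \<open>The exponent of the weight is only known to dominate mu times the distance
   divided by 2 h.\<close>
 define nu where "nu = mu / 2"
 have nu: "0 < nu" using mu by (simp add: nu_def)
 define K where "K = C1 * (exp (mu * 2) * B)^2 * (6 * area) / ka ^ (4 * s + 2)"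
 define D where "D = exp (3 * nu) + sqrt K"
 define E where "E = 6 * area * D * exp (3 * nu) * B / (\<bar>c\<bar> * ka ^ (2 * s))"
 have c: "c ~= 0" using g by (simp add: green_data_def)
 have K: "0 < K" unfolding K_def using C1 B(1) ka area_pos by simp
 have D: "0 < D" unfolding D_def using K by (simp add: add_pos_pos)
 have E: "0 < E" unfolding E_def using c ka area_pos D B(1) by simp
 have main: "\<bar>pot s Xi a p x - cutoff (ka * h) xi0 x\<bar> <= (D + E) * sqrt (norm (x - ze) / h) * exp (- nu * (norm (x - xi0) / h))
  & \<bar>pot s Xi a p x\<bar> <= (D + E) * exp (- nu * (norm (x - xi0) / h))
  & \<bar>a ze\<bar> <= (D + E) / h ^ (2 * s) * exp (- nu * (norm (ze - xi0) / h))"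
  if n: "net h Xi" and hH: "h <= H1" and sp: "sep ka h Xi" and adm: "admissible s q Xi a p" and xi0: "xi0 : Xi"
   and lag: "!!xi. xi : Xi ==> pot s Xi a p xi = (if xi = xi0 then 1 else 0)" and x: "x : S2" and ze: "ze : Xi" for h Xi xi0 a p x ze
 proof -
  have h: "0 < h" "h <= 1" and fin: "finite Xi" and Xi: "Xi \<subseteq> S2" using n hH H by (auto simp: net_def)
  have xiS: "xi0 : S2" and zeS: "ze : S2" using xi0 ze Xi by auto
  define r where "r = ka * h"
  have r: "0 < r" "r <= h" "r <= 1" using ka h mult_right_mono[OF ka(2), of h] by (auto simp: r_def intro: mult_le_one)
  have r2: "r^2 <= h^2" using r by (intro power_mono) auto
  let ?w = "%x. exp (mu * (1 / Psc h xi0 x))" and ?Ph = "cutoff r xi0" and ?B = "B / r ^ (2 * Suc s)"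
  let ?La = "(exp (mu * 2) * ?B)^2 * (2 * area * (3 * r^2))"
  have B0: "0 <= ?B" using B(1) r by simp
  have sPh: "smooth (cutoff r z)" if "z : S2" for z by (rule smooth_cutoff[OF that])
  have sw: "smooth ?w" using wt[OF h xiS] by (simp add: weight_def)
  have "\<bar>SI x. (?w x * Lop s ?Ph x)^2\<bar> <= ?La"
  proof (rule integral_cap_le[OF _ _ xiS])
   show "continuous_on S2 (%x. (?w x * Lop s ?Ph x)^2)" by (intro smooth_continuous smooth_power smooth_mult sw smooth_Lop sPh xiS)
   show "0 < 3 * r^2" "0 <= (exp (mu * 2) * ?B)^2" using r by simp_all
   show "(?w x * Lop s ?Ph x)^2 = 0" if "x : S2" "3 * r^2 < 1 - x \<bullet> xi0" for x using B(3)[OF r(1) xiS that] by simp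
   fix y assume y: "y : cap xi0 (3 * r^2)"
   then have yS: "y : S2" and y3: "1 - y \<bullet> xi0 <= 3 * h^2" using r2 by (auto simp: cap_def)
   have "?w y <= exp (mu * 2)" using mu Psc_inverse_bounds(2)[OF yS xiS h(1) y3] by (intro exp_le_cancel_iff[THEN iffD2] mult_left_mono) auto
   then have "\<bar>?w y * Lop s ?Ph y\<bar> <= exp (mu * 2) * ?B"
    unfolding abs_mult using B(2)[OF r(1,3) xiS yS] by (intro mult_mono) auto
   then have "\<bar>?w y * Lop s ?Ph y\<bar>^2 <= (exp (mu * 2) * ?B)^2" by (rule power_mono) simp
   then show "\<bar>(?w y * Lop s ?Ph y)^2\<bar> <= (exp (mu * 2) * ?B)^2" by simp
  qed
  then have La: "(SI x. (?w x * Lop s ?Ph x)^2) <= ?La" by linarith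
  have Pheq: "?Ph xi = pot s Xi a p xi" if "xi : Xi" for xi
   using cutoff_sep[OF sp Xi that xi0 ka(1) h(1)] lag[OF that] by (simp add: r_def)
  \<comment> \<open>L Ph has size r^(-2 s - 2) on a cap of measure of order r^2, so its square
    integral is of order r^(-4 s - 2); multiplied by h^(4 s + 1) this leaves 1 / h.\<close>
  have KLa: "C1 * h ^ (4 * s + 1) * ?La = K / h"
  proof -
   have "r ^ (2 * Suc s) * r ^ (2 * Suc s) = r ^ (4 * s + 2) * r^2" unfolding power_add[symmetric] by (intro arg_cong[where f = "power r"]) simp
   then have "(r ^ (2 * Suc s))^2 = ka ^ (4 * s + 2) * (h ^ (4 * s + 1) * h) * r^2"
    by (simp only: power2_eq_square[of "r ^ (2 * Suc s)"]) (simp add: r_def power_mult_distrib)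
   then have "?La = (exp (mu * 2) * B)^2 * (6 * area) * r^2 / (ka ^ (4 * s + 2) * (h ^ (4 * s + 1) * h) * r^2)"
    by (simp only: times_divide_eq_right power_divide) simp
   also have "... = (exp (mu * 2) * B)^2 * (6 * area) / (ka ^ (4 * s + 2) * (h ^ (4 * s + 1) * h))" using r by simp
   finally show ?thesis using h ka unfolding K_def by (simp del: power_Suc power_add)
  qed
  have est: "\<bar>pot s Xi a p x - ?Ph x\<bar> <= sqrt K * sqrt (norm (x - ze) / h) * exp (- nu * (norm (x - xi0) / h))"
   if x: "x : S2" and ze: "ze : Xi" for x ze
  proof -
   let ?d = "\<bar>pot s Xi a p x - ?Ph x\<bar>" and ?e = "exp (nu * (norm (x - xi0) / h))"
   have "(?w x * (pot s Xi a p x - ?Ph x))^2 <= C1 * norm (x - ze) * h ^ (4 * s + 1) * ?La"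
    by (rule wd[OF n hH wt[OF h xiS] adm sPh[OF xiS] Pheq La x ze])
   also have "... = norm (x - ze) * (C1 * h ^ (4 * s + 1) * ?La)" by (simp only: mult_ac)
   also have "... = K * (norm (x - ze) / h)" unfolding KLa by simp
   finally have "\<bar>?w x * (pot s Xi a p x - ?Ph x)\<bar> <= sqrt (K * (norm (x - ze) / h))" by (simp only: real_le_rsqrt power2_abs)
   then have 1: "?w x * ?d <= sqrt K * sqrt (norm (x - ze) / h)" by (simp only: abs_mult abs_exp_cancel real_sqrt_mult)
   have "nu * (norm (x - xi0) / h) = mu * (norm (x - xi0) / (2 * h))" by (simp add: nu_def)
   also have "... <= mu * (1 / Psc h xi0 x)" using Psc_inverse_bounds(1)[OF x xiS h(1)] mu by (intro mult_left_mono) auto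
   finally have "?e * ?d <= ?w x * ?d" by (intro mult_right_mono) auto
   then have "?e * ?d <= sqrt K * sqrt (norm (x - ze) / h)" using 1 by linarith
   then have "?d <= sqrt K * sqrt (norm (x - ze) / h) / ?e" by (simp add: pos_le_divide_eq mult.commute)
   then show ?thesis by (simp add: exp_minus divide_inverse)
  qed
  have near: "cutoff r xi0 x <= exp (3 * nu) * exp (- nu * (norm (x - xi0) / h))" if x: "x : S2" for x
  proof (cases "3 * r^2 <= 1 - x \<bullet> xi0")
   case True then show ?thesis using cutoff_zero[OF r(1) xiS x] by simp
  next
   case False
   then have "norm (x - xi0) <= 3 * h" using r norm_le_of_cap[OF x xiS, of r] by linarith
   then have "0 <= nu * (3 - norm (x - xi0) / h)" using nu h by (intro mult_nonneg_nonneg) (auto simp: field_simps)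
   then have "1 <= exp (3 * nu + - nu * (norm (x - xi0) / h))" by (simp add: algebra_simps)
   then show ?thesis using cutoff_le_1[OF xiS x, of r] unfolding exp_add by linarith
  qed
  have pd: "\<bar>pot s Xi a p x\<bar> <= D * exp (- nu * (norm (x - xi0) / h))" if x: "x : S2" for x
  proof -
   obtain ze where z: "ze : Xi" "norm (x - ze) <= h" using n x unfolding net_def by blast
   have "sqrt K * sqrt (norm (x - ze) / h) <= sqrt K * 1" using z h K by (intro mult_left_mono) auto
   then have "sqrt K * sqrt (norm (x - ze) / h) * exp (- nu * (norm (x - xi0) / h)) <= sqrt K * 1 * exp (- nu * (norm (x - xi0) / h))"
    by (intro mult_right_mono) auto
   then show ?thesis using est[OF x z(1)] near[OF x] cutoff_nonneg[of r xi0 x] unfolding D_def distrib_right by linarith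
  qed
  have "\<bar>SI x. pot s Xi a p x * Lop s (cutoff r ze) x\<bar>
   <= (D * (exp (3 * nu) * exp (- nu * (norm (ze - xi0) / h))) * ?B) * (2 * area * (3 * r^2))"
  proof (rule integral_cap_le[OF _ _ zeS])
   have "smooth p" using adm by (simp add: admissible_def)
   then show "continuous_on S2 (%x. pot s Xi a p x * Lop s (cutoff r ze) x)"
    by (intro continuous_on_mult continuous_pot s Xi smooth_continuous smooth_Lop sPh zeS)
   show "0 < 3 * r^2" using r by simp
   show "0 <= D * (exp (3 * nu) * exp (- nu * (norm (ze - xi0) / h))) * ?B" using D by (intro mult_nonneg_nonneg[OF _ B0]) auto
   show "pot s Xi a p x * Lop s (cutoff r ze) x = 0" if "x : S2" "3 * r^2 < 1 - x \<bullet> ze" for x using B(3)[OF r(1) zeS that] by simp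
   fix y assume y: "y : cap ze (3 * r^2)"
   then have yS: "y : S2" and "norm (y - ze) <= 3 * r" using norm_le_of_cap[of y ze r] r zeS by (auto simp: cap_def)
   then have "norm (ze - xi0) - 3 * h <= norm (y - xi0)"
    using norm_triangle_ineq[of "ze - y" "y - xi0"] r by (simp add: norm_minus_commute)
   then have "norm (ze - xi0) / h - 3 <= norm (y - xi0) / h"
    using divide_right_mono[of "norm (ze - xi0) - 3 * h" "norm (y - xi0)" h] h by (simp add: diff_divide_distrib)
   then have "nu * (norm (ze - xi0) / h - 3) <= nu * (norm (y - xi0) / h)" using nu by (intro mult_left_mono) auto
   then have "exp (- nu * (norm (y - xi0) / h)) <= exp (3 * nu + - nu * (norm (ze - xi0) / h))" by (simp add: algebra_simps)
   then have "D * exp (- nu * (norm (y - xi0) / h)) <= D * (exp (3 * nu) * exp (- nu * (norm (ze - xi0) / h)))"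
    unfolding exp_add using D by (intro mult_left_mono) auto
   then have "\<bar>pot s Xi a p y\<bar> <= D * (exp (3 * nu) * exp (- nu * (norm (ze - xi0) / h)))" using pd[OF yS] by linarith
   then show "\<bar>pot s Xi a p y * Lop s (cutoff r ze) y\<bar> <= D * (exp (3 * nu) * exp (- nu * (norm (ze - xi0) / h))) * ?B"
    unfolding abs_mult using B(2)[OF r(1,3) zeS yS] D by (intro mult_mono) auto
  qed
  moreover have "(SI x. pot s Xi a p x * Lop s (cutoff r ze) x) = c * a ze"
  proof -
   have "(SUM xi:Xi. a xi * cutoff r ze xi) = (SUM xi:Xi. if xi = ze then a xi else 0)"
    using cutoff_sep[OF sp Xi _ ze ka(1) h(1)] by (intro sum.cong) (auto simp: r_def)
   then show ?thesis using pot_green[OF s g fin Xi adm sPh[OF zeS]] ze fin by simp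
  qed
  ultimately have "\<bar>c * a ze\<bar> <= (D * (exp (3 * nu) * exp (- nu * (norm (ze - xi0) / h))) * ?B) * (2 * area * (3 * r^2))" by (simp only:)
  then have "\<bar>a ze\<bar> * \<bar>c\<bar> <= (D * (exp (3 * nu) * exp (- nu * (norm (ze - xi0) / h))) * ?B) * (2 * area * (3 * r^2))" unfolding abs_mult mult.commute[of "\<bar>c\<bar>"] .
  then have "\<bar>a ze\<bar> <= (D * (exp (3 * nu) * exp (- nu * (norm (ze - xi0) / h))) * ?B) * (2 * area * (3 * r^2)) / \<bar>c\<bar>"
   using c by (intro pos_le_divide_eq[THEN iffD2]) simp_all
  also have "... = E / h ^ (2 * s) * exp (- nu * (norm (ze - xi0) / h))"
  proof -
   have "r ^ (2 * Suc s) = ka ^ (2 * s) * h ^ (2 * s) * r^2" by (simp add: r_def power_mult_distrib power2_eq_square)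
   then show ?thesis using r(1) unfolding E_def by (simp add: mult_ac del: power_Suc mult_Suc_right)
  qed
  also have "... <= (D + E) / h ^ (2 * s) * exp (- nu * (norm (ze - xi0) / h))"
   using D h by (intro mult_right_mono divide_right_mono) auto
  finally have a: "\<bar>a ze\<bar> <= (D + E) / h ^ (2 * s) * exp (- nu * (norm (ze - xi0) / h))" .
  have "sqrt K * sqrt (norm (x - ze) / h) * exp (- nu * (norm (x - xi0) / h)) <= (D + E) * sqrt (norm (x - ze) / h) * exp (- nu * (norm (x - xi0) / h))"
   using E h by (intro mult_right_mono) (auto simp: D_def)
  moreover have "D * exp (- nu * (norm (x - xi0) / h)) <= (D + E) * exp (- nu * (norm (x - xi0) / h))"
   using E by (intro mult_right_mono) auto
  ultimately show ?thesis using est[OF x ze] pd[OF x] a unfolding r_def by linarith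
 qed
 have KE: "0 < D + E" using D E by (simp add: add_pos_pos)
 have "lagrange_estimate s q ka nu H1 (D + E)"
  unfolding lagrange_estimate_def by (intro allI impI, rule main) (assumption | erule (1) bspec)+
 then show thesis by (rule that[OF nu H KE])
qed

section \<open>Linear algebra in function spaces\<close>

text \<open>The structure of \<open>fun_vs\<close> over an arbitrary argument type, so that
  coefficient vectors on finite index sets are covered as well.\<close>

interpretation fv: vector_space "%(c::real) (f::'i => real) x. c * f x"
 by unfold_locales (auto simp: fun_eq_iff algebra_simps)

lemma sum_fun_apply: "(SUM a:A. f a :: 'i => real) x = (SUM a:A. f a x)"
 by (induction A rule: infinite_finite_induct) auto

lemma span_family:
 fixes b :: "'j => 'i => real"
 assumes "finite I" "inj_on b I" "y : fv.span (b ` I)"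
 obtains u where "!!x. y x = (SUM i:I. u i * b i x)"
proof -
 obtain u where "y = (SUM v:b ` I. (%x. u v * v x))" using assms(1,3) by (auto simp: fv.span_finite)
 then have "y x = (SUM i:I. u (b i) * b i x)" for x using assms(2) by (simp add: sum_fun_apply sum.reindex)
 then show ?thesis by (rule that)
qed

lemma family_in_span:
 fixes b :: "'j => 'i => real"
 shows "(%x. SUM i:I. u i * b i x) : fv.span (b ` I)"
proof -
 have "(SUM i:I. (%x. u i * b i x)) : fv.span (b ` I)" by (intro fv.span_sum fv.span_scale fv.span_base) simp
 moreover have "(SUM i:I. (%x. u i * b i x)) = (%x. SUM i:I. u i * b i x)" by (rule ext) (simp add: sum_fun_apply)
 ultimately show ?thesis by simp
qed

text \<open>Dimension count by exchange: if some t j were outside the span of b, adding it would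
  give card I + 1 independent vectors inside a space spanned by card I.\<close>

lemma family_spans:
 fixes b t :: "'j => 'i => real"
 assumes I: "finite I" and indep: "!!u. (!!x. (SUM i:I. u i * b i x) = 0) ==> ALL i:I. u i = 0"
  and sp: "!!i. i : I ==> b i : fv.span (t ` I)"
 shows "inj_on b I" "fv.independent (b ` I)" "fv.span (t ` I) \<subseteq> fv.span (b ` I)"
proof -
 show inj: "inj_on b I"
 proof (rule inj_onI, rule ccontr)
  fix i j assume ij: "i : I" "j : I" "b i = b j" "i ~= j"
  define u where "u = (%k. (if k = i then 1 else 0) - (if k = j then 1 else 0 :: real))"
  have "(SUM k:I. u k * b k x) = b i x - b j x" for x
   using ij I by (simp add: u_def left_diff_distrib sum_subtractf if_distrib[of "%c. c * _"] cong: if_cong)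
  then show False using indep[of u] ij by (auto simp: u_def)
 qed
 show ind: "fv.independent (b ` I)"
  unfolding fv.dependent_finite[OF finite_imageI[OF I]]
 proof (intro notI, elim exE conjE bexE)
  fix u v assume v: "v : b ` I" "u v ~= 0" and 0: "(SUM v:b ` I. (%x. u v * v x)) = 0"
  have "(SUM i:I. u (b i) * b i x) = 0" for x
   using fun_cong[OF 0, of x] inj by (simp add: sum_fun_apply sum.reindex)
  then show False using indep[of "%i. u (b i)"] v by auto
 qed
 have "t j : fv.span (b ` I)" if j: "j : I" for j
 proof (rule ccontr)
  assume n: "t j \<notin> fv.span (b ` I)"
  then have "t j \<notin> b ` I" using fv.span_base by blast
  have "finite (insert (t j) (b ` I)) & card (insert (t j) (b ` I)) <= card (t ` I)"
   using I j sp by (intro fv.independent_span_bound fv.independent_insertI n ind) (auto intro: fv.span_base)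
  moreover have "card (insert (t j) (b ` I)) = Suc (card I)" using \<open>t j \<notin> b ` I\<close> I inj by (simp add: card_image)
  ultimately show False using card_image_le[OF I, of t] by linarith
 qed
 then show "fv.span (t ` I) \<subseteq> fv.span (b ` I)" by (intro fv.span_minimal fv.subspace_span) auto
qed

text \<open>The columns of M become functions supported in I; injectivity is then linear
  independence, and \<open>family_spans\<close> turns it into solvability.\<close>

lemma square_system:
 fixes M :: "'i => 'i => real"
 assumes I: "finite I" and inj: "!!u. (!!i. i : I ==> (SUM j:I. M i j * u j) = 0) ==> ALL j:I. u j = 0"
 obtains u where "!!i. i : I ==> (SUM j:I. M i j * u j) = y i"
proof -
 define b where "b j i = (if i : I then M i j else 0)" for i j
 define t where "t j i = (if i = j then 1 else 0 :: real)" for i j :: 'i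
 have rep: "f : fv.span (t ` I)" if "!!i. i \<notin> I ==> f i = 0" for f
 proof -
  have "f = (%i. SUM j:I. f j * t j i)" using that I by (auto simp: t_def fun_eq_iff if_distrib[of "%c. _ * c"] cong: if_cong)
  then show ?thesis by (metis family_in_span)
 qed
 have 1: "ALL j:I. u j = 0" if z: "!!x. (SUM j:I. u j * b j x) = 0" for u
 proof (rule inj)
  fix i assume "i : I"
  then show "(SUM j:I. M i j * u j) = 0" using z[of i] by (simp add: b_def mult.commute)
 qed
 have 2: "b j : fv.span (t ` I)" for j by (rule rep) (simp add: b_def)
 have inj: "inj_on b I" by (rule family_spans(1)[OF I _ 2]) (rule 1)
 have "fv.span (t ` I) \<subseteq> fv.span (b ` I)" by (rule family_spans(3)[OF I _ 2]) (rule 1)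
 moreover have "(%i. if i : I then y i else 0) : fv.span (t ` I)" by (rule rep) simp
 ultimately have "(%i. if i : I then y i else 0) : fv.span (b ` I)" by (rule subsetD)
 then obtain u where u: "!!i. (if i : I then y i else 0) = (SUM j:I. u j * b j i)"
  by (rule span_family[OF I inj]) (rule that)
 have "(SUM j:I. M i j * u j) = y i" if "i : I" for i
  using u[of i] that by (simp add: b_def mult.commute)
 then show ?thesis by (rule that)
qed

text \<open>A minimal subset on which the elements of \<open>V\<close> are determined by their values carries a dual basis of \<open>V\<close>.\<close>

lemma cardinal_functions:
 fixes V :: "('i => real) set"
 assumes V: "fv.subspace V" and fin: "finite X" and uni: "!!f. f : V ==> (!!x. x : X ==> f x = 0) ==> f = 0"
 obtains Z l where "Z \<subseteq> X" "!!z. z : Z ==> l z : V" "!!z y. z : Z ==> y : Z ==> l z y = (if y = z then 1 else 0)"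
  "!!f x. f : V ==> f x = (SUM z:Z. f z * l z x)"
proof -
 define P where "P Z \<longleftrightarrow> Z \<subseteq> X & (ALL f:V. (ALL x:Z. f x = 0) --> f = 0)" for Z
 have "P X" using uni by (auto simp: P_def)
 then obtain Z where Z: "P Z" and min: "!!Y. P Y ==> card Z <= card Y" using ex_has_least_nat[of P X card] by auto
 have fZ: "finite Z" using Z fin finite_subset by (auto simp: P_def)
 have "EX g. g : V & (ALL y:Z. g y = (if y = z then 1 else 0))" if z: "z : Z" for z
 proof -
  have "\<not> P (Z - {z})" using min[of "Z - {z}"] card_Diff1_less[OF fZ z] by linarith
  then obtain f where f: "f : V" "ALL x:Z - {z}. f x = 0" "f ~= 0" using Z by (auto simp: P_def)
  have "f z ~= 0" using Z f by (auto simp: P_def)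
  then show ?thesis using f(2) z fv.subspace_scale[OF V f(1), of "1 / f z"] by (intro exI[of _ "%x. 1 / f z * f x"]) auto
 qed
 then obtain l where l: "!!z. z : Z ==> l z : V" "!!z y. z : Z ==> y : Z ==> l z y = (if y = z then 1 else 0)" by metis
 have "f x = (SUM z:Z. f z * l z x)" if f: "f : V" for f x
 proof -
  let ?g = "f - (SUM z:Z. (%x. f z * l z x))"
  have "?g : V" by (intro fv.subspace_diff fv.subspace_sum fv.subspace_scale V f l)
  moreover have "?g y = 0" if "y : Z" for y
   using that fZ l(2) by (simp add: sum_fun_apply if_distrib[of "%c. _ * c"] cong: if_cong)
  ultimately have "?g = 0" using Z by (auto simp: P_def)
  then have "?g x = 0" by simp
  then show ?thesis by (simp add: sum_fun_apply)
 qed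
 then show ?thesis using that[of Z l] l Z by (auto simp: P_def)
qed

section \<open>Spherical harmonics\<close>

lemma linear_eq_inner: "bounded_linear f ==> f x = x \<bullet> (\<chi> j. f (axis j 1))" for f :: "real^3 => real"
proof -
 assume f: "bounded_linear f"
 have "x = (SUM j:UNIV. x $ j *\<^sub>R axis j 1)" by (simp add: vec_eq_iff axis_def if_distrib[of "%c. _ * c"] cong: if_cong)
 then have "f x = f (SUM j:UNIV. x $ j *\<^sub>R axis j 1)" by (rule arg_cong)
 also have "... = (SUM j:UNIV. x $ j * f (axis j 1))"
  by (simp add: linear_sum[OF bounded_linear.linear[OF f]] linear_scale[OF bounded_linear.linear[OF f]])
 finally show ?thesis by (simp add: inner_vec_def)
qed

lemma smooth_rpf: "real_polynomial_function f ==> smooth f"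
proof (induction rule: real_polynomial_function.induct)
 case (linear f)
 then have "f = (%x. x \<bullet> (\<chi> j. f (axis j 1)))" using linear_eq_inner by blast
 then show ?case using smooth_inner[of "\<chi> j. f (axis j 1)"] by simp
qed auto

lemma curve_derivative:
 fixes g :: "3 => real"
 assumes f: "(f has_derivative (%v. SUM j:UNIV. v $ j * g j)) (at (ga t))" and ga: "(ga has_vector_derivative w) (at t)"
 shows "((%t. f (ga t)) has_real_derivative (SUM j:UNIV. w $ j * g j)) (at t)"
proof -
 have "((f \<circ> ga) has_derivative ((%v. SUM j:UNIV. v $ j * g j) \<circ> (%h. h *\<^sub>R w))) (at t)"
  by (rule diff_chain_at[OF ga[unfolded has_vector_derivative_def] f])
 moreover have "(%v. SUM j:UNIV. v $ j * g j) \<circ> (%h. h *\<^sub>R w) = (*) (SUM j:UNIV. w $ j * g j)"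
  by (auto simp: fun_eq_iff sum_distrib_left sum_distrib_right mult_ac intro!: sum.cong)
 ultimately show ?thesis by (simp add: has_field_derivative_def o_def)
qed

lemma partial_deriv_eqI:
 assumes "(f has_derivative (%v. SUM j:UNIV. v $ j * g j)) (at x)" shows "partial_deriv i f x = g i"
proof -
 have "((%t. f (x + t *\<^sub>R axis i 1)) has_real_derivative (SUM j:UNIV. axis i 1 $ j * g j)) (at 0)"
  by (rule curve_derivative) (use assms in \<open>auto intro!: derivative_eq_intros\<close>)
 then show ?thesis by (simp add: partial_deriv_def DERIV_imp_deriv axis_def if_distrib[of "%c. c * _"] cong: if_cong)
qed

lemma rpf_partial:
 assumes "real_polynomial_function f"
 shows "real_polynomial_function (partial_deriv j f)"
  "(f has_derivative (%v. SUM j:UNIV. v $ j * partial_deriv j f x)) (at x)"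
proof -
 have "EX g. (ALL j. real_polynomial_function (g j)) & (ALL x. (f has_derivative (%v. SUM j:UNIV. v $ j * g j x)) (at x))"
  using assms
 proof (induction rule: real_polynomial_function.induct)
  case (linear f)
  have e: "f v = (SUM j:UNIV. v $ j * f (axis j 1))" for v using linear_eq_inner[OF linear, of v] by (simp add: inner_vec_def)
  have "(%v. SUM j:UNIV. v $ j * f (axis j 1)) = f" by (rule ext, rule e[symmetric])
  then have "(f has_derivative (%v. SUM j:UNIV. v $ j * f (axis j 1))) (at x)" for x
   using bounded_linear_imp_has_derivative[OF linear] by simp
  then show ?case by (intro exI[of _ "%j x. f (axis j 1)"]) auto
 next
  case (const c)
  show ?case by (intro exI[of _ "%j x. 0"]) auto
 next
  case (add f1 f2)
  then obtain g1 g2 where g: "!!j. real_polynomial_function (g1 j)" "!!j. real_polynomial_function (g2 j)"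
   "!!x. (f1 has_derivative (%v. SUM j:UNIV. v $ j * g1 j x)) (at x)" "!!x. (f2 has_derivative (%v. SUM j:UNIV. v $ j * g2 j x)) (at x)"
   by blast
  have "((%x. f1 x + f2 x) has_derivative (%v. SUM j:UNIV. v $ j * (g1 j x + g2 j x))) (at x)" for x
   using has_derivative_add[OF g(3,4)] by (simp add: distrib_left sum.distrib)
  then show ?case using g(1,2) by (intro exI[of _ "%j x. g1 j x + g2 j x"]) auto
 next
  case (mult f1 f2)
  then obtain g1 g2 where g: "!!j. real_polynomial_function (g1 j)" "!!j. real_polynomial_function (g2 j)"
   "!!x. (f1 has_derivative (%v. SUM j:UNIV. v $ j * g1 j x)) (at x)" "!!x. (f2 has_derivative (%v. SUM j:UNIV. v $ j * g2 j x)) (at x)"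
   by blast
  have "((%x. f1 x * f2 x) has_derivative (%v. SUM j:UNIV. v $ j * (f1 x * g2 j x + g1 j x * f2 x))) (at x)" for x
   using has_derivative_mult[OF g(3,4)] by (simp add: distrib_left sum.distrib sum_distrib_left sum_distrib_right mult_ac)
  then show ?case using g(1,2) mult.hyps by (intro exI[of _ "%j x. f1 x * g2 j x + g1 j x * f2 x"]) (auto intro!: real_polynomial_function.intros(3) real_polynomial_function.intros(4))
 qed
 then obtain g where g: "!!j. real_polynomial_function (g j)" "!!x. (f has_derivative (%v. SUM j:UNIV. v $ j * g j x)) (at x)" by blast
 have "partial_deriv j f = g j" for j using partial_deriv_eqI[OF g(2)] by blast
 then show "real_polynomial_function (partial_deriv j f)" "(f has_derivative (%v. SUM j:UNIV. v $ j * partial_deriv j f x)) (at x)"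
  using g by simp_all
qed

lemma Xd_rpf:
 assumes f: "real_polynomial_function f" and x: "x : S2"
 shows "Xd i f x = (SUM j:UNIV. (x \<bullet> cross3 (axis j 1) (axis i 1)) * partial_deriv j f x)"
proof -
 have "((%t. rot i t x) has_vector_derivative cross3 (axis i 1) x) (at 0)"
  unfolding rot_def by (auto intro!: derivative_eq_intros)
 from curve_derivative[OF rpf_partial(2)[OF f] this]
 have "Xd i f x = (SUM j:UNIV. cross3 (axis i 1) x $ j * partial_deriv j f x)" by (simp add: Xd_def DERIV_imp_deriv)
 moreover have "cross3 (axis i 1) x $ j = x \<bullet> cross3 (axis j 1) (axis i 1)" for j
  by (metis cross_triple inner_axis inner_commute inner_real_def mult_1 real_inner_1_right)
 ultimately show ?thesis by simp
qed

lemma solid_harmonic_euler: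
 assumes "homogeneous_polynomial l f"
 shows "(SUM j:UNIV. x $ j * partial_deriv j f x) = real l * f x"
proof -
 have f: "real_polynomial_function f" and h: "!!t x. f (t *\<^sub>R x) = t ^ l * f x"
  using assms by (auto simp: homogeneous_polynomial_def)
 have "((%t. t *\<^sub>R x) has_vector_derivative x) (at 1)" by (auto intro!: derivative_eq_intros)
 from curve_derivative[OF rpf_partial(2)[OF f] this]
 have "((%t. t ^ l * f x) has_real_derivative (SUM j:UNIV. x $ j * partial_deriv j f x)) (at 1)" by (simp add: h)
 moreover have "((%t. t ^ l * f x) has_real_derivative real l * f x) (at 1)" by (auto intro!: derivative_eq_intros)
 ultimately show ?thesis by (rule DERIV_unique)
qed

lemma solid_harmonic_euler2:
 assumes "homogeneous_polynomial l f"
 shows "(SUM j:UNIV. SUM k:UNIV. x $ j * x $ k * partial_deriv k (partial_deriv j f) x) = (real l * real l - real l) * f x"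
proof -
 have f: "real_polynomial_function f" using assms by (auto simp: homogeneous_polynomial_def)
 have ga: "((%t. t *\<^sub>R x) has_vector_derivative x) (at 1)" by (auto intro!: derivative_eq_intros)
 note d = curve_derivative[OF rpf_partial(2) ga]
 have "((%t. SUM j:UNIV. (t * x $ j) * partial_deriv j f (t *\<^sub>R x)) has_real_derivative
  (SUM j:UNIV. x $ j * partial_deriv j f x + (SUM k:UNIV. x $ k * partial_deriv k (partial_deriv j f) x) * x $ j)) (at 1)"
  by (rule DERIV_sum) (auto intro!: derivative_eq_intros d[OF rpf_partial(1)[OF f], simplified] simp: f)
 moreover have "((%t. real l * f (t *\<^sub>R x)) has_real_derivative real l * (real l * f x)) (at 1)"
  using DERIV_cmult[OF d[OF f], of "real l"] solid_harmonic_euler[OF assms, of x] by simp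
 moreover have "(SUM j:UNIV. (t * x $ j) * partial_deriv j f (t *\<^sub>R x)) = real l * f (t *\<^sub>R x)" for t
  using solid_harmonic_euler[OF assms, of "t *\<^sub>R x"] by simp
 ultimately have "(SUM j:UNIV. x $ j * partial_deriv j f x + (SUM k:UNIV. x $ k * partial_deriv k (partial_deriv j f) x) * x $ j) = real l * (real l * f x)"
  using DERIV_unique by simp
 then show ?thesis using solid_harmonic_euler[OF assms, of x]
  by (simp add: sum.distrib sum_distrib_left mult_ac algebra_simps)
qed

text \<open>Expanding the rotation fields gives |x|^2 times the Euclidean Laplacian minus radial
  terms, which Euler's relations evaluate as l (l - 1) + 2 l times f.\<close>

lemma lap_solid_harmonic:
 assumes sh: "solid_harmonic l f" and x: "x : S2"
 shows "lap f x = - (real l * (real l + 1)) * f x"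
proof -
 have hp: "homogeneous_polynomial l f" and L: "laplacian f x = 0" and f: "real_polynomial_function f"
  using sh by (auto simp: solid_harmonic_def homogeneous_polynomial_def)
 let ?a = "%i j. cross3 (axis j 1) (axis i 1) :: real^3"
 let ?p = "%j. partial_deriv j f"
 have X: "Xd i (Xd i f) x = (SUM j:UNIV. (x \<bullet> cross3 (?a i j) (axis i 1)) * ?p j x
   + (x \<bullet> ?a i j) * (SUM k:UNIV. (x \<bullet> ?a i k) * partial_deriv k (?p j) x))" for i
 proof -
  have "Xd i (Xd i f) x = Xd i (%x. SUM j:UNIV. (x \<bullet> ?a i j) * ?p j x) x"
   by (rule Xd_cong[OF Xd_rpf[OF f] x])
  also have "... = (SUM j:UNIV. Xd i (%x. (x \<bullet> ?a i j) * ?p j x) x)"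
   using smooth_rpf[OF rpf_partial(1)[OF f]] x by (intro Xd_sum smooth_mult smooth_inner)
  also have "... = (SUM j:UNIV. (x \<bullet> cross3 (?a i j) (axis i 1)) * ?p j x
   + (x \<bullet> ?a i j) * (SUM k:UNIV. (x \<bullet> ?a i k) * partial_deriv k (?p j) x))"
   using smooth_rpf[OF rpf_partial(1)[OF f]] x
   by (simp add: Xd_mult Xd_inner Xd_rpf[OF rpf_partial(1)[OF f]])
  finally show ?thesis .
 qed
 have xx: "(x $ 1)^2 + (x $ 2)^2 + (x $ 3)^2 = 1" using S2_inner_self[OF x] by (simp add: inner_vec_def sum_3 power2_eq_square)
 have "lap f x = ((x $ 1)^2 + (x $ 2)^2 + (x $ 3)^2) * laplacian f x
  - (SUM j:UNIV. SUM k:UNIV. x $ j * x $ k * partial_deriv k (?p j) x) - 2 * (SUM j:UNIV. x $ j * ?p j x)"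
  unfolding lap_def X laplacian_def
  by (simp add: sum_3 cross3_simps inner_vec_def axis_def) (simp add: algebra_simps power2_eq_square)
 then show ?thesis using L solid_harmonic_euler[OF hp, of x] solid_harmonic_euler2[OF hp, of x]
  by (simp add: algebra_simps)
qed

text \<open>The eigenvalue is the product of l (l + 1) - j (j + 1) over j up to s; the factor with j
  = l makes it 0 when l is at most s.\<close>

lemma Lop_eigen:
 assumes f: "smooth f" and e: "!!x. x : S2 ==> lap f x = - (real l * (real l + 1)) * f x"
 shows "EX mu. (ALL x:S2. Lop s f x = mu * f x) & (l <= s --> mu = 0)"
proof (induction s)
 case 0
 show ?case using e by (intro exI[of _ "real l * (real l + 1)"]) auto
next
 case (Suc s)
 then obtain mu where mu: "!!x. x : S2 ==> Lop s f x = mu * f x" "l <= s ==> mu = 0" by blast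
 have "Lop (Suc s) f x = (mu * (real l * (real l + 1) - (real s + 1) * (real s + 2))) * f x" if x: "x : S2" for x
 proof -
  have "lap (Lop s f) x = mu * lap f x" using lap_cong[OF mu(1) x] lap_cmult[OF f x] by simp
  then show ?thesis using e[OF x] mu(1)[OF x] by (simp add: algebra_simps)
 qed
 moreover have "mu * (real l * (real l + 1) - (real s + 1) * (real s + 2)) = 0" if "l <= Suc s"
  using that mu(2) by (cases "l = Suc s") (auto simp: algebra_simps)
 ultimately show ?case by blast
qed

lemma spherical_harmonics_Lop:
 assumes "p : spherical_harmonics s" shows "smooth p & (ALL x:S2. Lop s p x = 0)"
 using assms unfolding spherical_harmonics_def
proof (rule fun_vs.span_induct[where P = "%p. smooth p & (ALL x:S2. Lop s p x = 0)"])
 show "fun_vs.subspace {p. smooth p & (ALL x:S2. Lop s p x = 0)}"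
  unfolding fun_vs.subspace_def plus_fun_def zero_fun_def by (auto simp: Lop_add Lop_cmult Lop_zero)
next
 fix p assume "p : {sphere_restrict f | l f. l <= s & solid_harmonic l f}"
 then obtain l f where p: "p = sphere_restrict f" and l: "l <= s" and f: "solid_harmonic l f" by blast
 have sf: "smooth f" using f by (intro smooth_rpf) (auto simp: solid_harmonic_def homogeneous_polynomial_def)
 have eq: "p x = f x" if "x : S2" for x using that by (simp add: p sphere_restrict_def)
 have "Lop s f x = 0" if "x : S2" for x using Lop_eigen[OF sf lap_solid_harmonic[OF f], of s] l that by auto
 then show "smooth p & (ALL x:S2. Lop s p x = 0)" using smooth_cong[of p f] Lop_cong[of p f] eq sf by auto
qed

lemma partial_deriv_sum:
 assumes "!!i. i : A ==> real_polynomial_function (f i)"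
 shows "partial_deriv j (%x. SUM i:A. c i * f i x) = (%x. SUM i:A. c i * partial_deriv j (f i) x)"
proof
 fix x
 have "((%x. SUM i:A. c i * f i x) has_derivative (%v. SUM i:A. c i * (SUM j:UNIV. v $ j * partial_deriv j (f i) x))) (at x)"
  by (intro has_derivative_sum has_derivative_mult_right rpf_partial(2) assms)
 moreover have "(%v :: real^3. SUM i:A. c i * (SUM j:UNIV. v $ j * partial_deriv j (f i) x))
  = (%v. SUM j:UNIV. v $ j * (SUM i:A. c i * partial_deriv j (f i) x))"
  unfolding sum_distrib_left by (subst sum.swap) (simp only: mult_ac)
 ultimately show "partial_deriv j (%x. SUM i:A. c i * f i x) x = (SUM i:A. c i * partial_deriv j (f i) x)"
  using partial_deriv_eqI[where g = "%j. SUM i:A. c i * partial_deriv j (f i) x"] by simp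
qed

section \<open>Zonal harmonics and zonal polynomials\<close>

lemma laplacian_zonal:
 assumes z: "z : S2"
 shows "laplacian (%x. (x \<bullet> z) ^ m * (x \<bullet> x) ^ i) x
  = real m * real (m - 1) * ((x \<bullet> z) ^ (m - 2) * (x \<bullet> x) ^ i)
   + (4 * real i * real m + 2 * real i * (2 * real i + 1)) * ((x \<bullet> z) ^ m * (x \<bullet> x) ^ (i - 1))"
proof -
 have ex: "(x + t *\<^sub>R axis j 1) \<bullet> z = x \<bullet> z + t * z $ j"
  "(x + t *\<^sub>R axis j 1) \<bullet> (x + t *\<^sub>R axis j 1) = x \<bullet> x + 2 * t * x $ j + t * t"
  "(x + t *\<^sub>R axis j 1) $ j = x $ j + t" for x :: "real^3" and t j
  by (simp_all add: inner_add_left inner_add_right inner_axis inner_axis' inner_commute algebra_simps)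
 let ?g = "%j x. real m * (x \<bullet> z) ^ (m - 1) * z $ j * (x \<bullet> x) ^ i + (x \<bullet> z) ^ m * (real i * (x \<bullet> x) ^ (i - 1) * (2 * x $ j))"
 have 1: "partial_deriv j (%x. (x \<bullet> z) ^ m * (x \<bullet> x) ^ i) = ?g j" for j
  unfolding partial_deriv_def ex by (rule ext, rule DERIV_imp_deriv) (auto intro!: derivative_eq_intros simp: algebra_simps)
 have 2: "partial_deriv j (?g j) x = real m * real (m - 1) * (x \<bullet> z) ^ (m - 2) * (z $ j)^2 * (x \<bullet> x) ^ i
  + 4 * real m * real i * (x \<bullet> z) ^ (m - 1) * (x \<bullet> x) ^ (i - 1) * (x $ j * z $ j)
  + (x \<bullet> z) ^ m * (4 * real i * real (i - 1) * (x \<bullet> x) ^ (i - 2) * (x $ j)^2 + 2 * real i * (x \<bullet> x) ^ (i - 1))" for j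
  unfolding partial_deriv_def ex
  by (rule DERIV_imp_deriv) (auto intro!: derivative_eq_intros simp: algebra_simps power2_eq_square numeral_2_eq_2)
 have zz: "z $ 1 * z $ 1 + z $ 2 * z $ 2 + z $ 3 * z $ 3 = 1" using S2_inner_self[OF z] by (simp add: inner_vec_def sum_3)
 have A: "laplacian (%x. (x \<bullet> z) ^ m * (x \<bullet> x) ^ i) x
  = real m * real (m - 1) * (x \<bullet> z) ^ (m - 2) * (z $ 1 * z $ 1 + z $ 2 * z $ 2 + z $ 3 * z $ 3) * (x \<bullet> x) ^ i
  + 4 * real m * real i * (x \<bullet> z) ^ (m - 1) * (x \<bullet> x) ^ (i - 1) * (x \<bullet> z)
  + (x \<bullet> z) ^ m * (4 * real i * real (i - 1) * (x \<bullet> x) ^ (i - 2) * (x \<bullet> x) + 6 * real i * (x \<bullet> x) ^ (i - 1))"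
  unfolding laplacian_def 1 2 sum_3 power2_eq_square inner_vec_def[of x z] inner_vec_def[of x x] inner_real_def by (simp only: ring_distribs mult_ac)
 have B: "4 * real m * real i * (x \<bullet> z) ^ (m - 1) * (x \<bullet> x) ^ (i - 1) * (x \<bullet> z) = 4 * real i * real m * ((x \<bullet> z) ^ m * (x \<bullet> x) ^ (i - 1))"
  by (cases m) simp_all
 have C: "(x \<bullet> z) ^ m * (4 * real i * real (i - 1) * (x \<bullet> x) ^ (i - 2) * (x \<bullet> x) + 6 * real i * (x \<bullet> x) ^ (i - 1))
  = 2 * real i * (2 * real i + 1) * ((x \<bullet> z) ^ m * (x \<bullet> x) ^ (i - 1))"
  by (cases i; cases "i - 1") (simp_all add: algebra_simps)
 show ?thesis unfolding A B C zz by (simp only: mult_1_right distrib_right mult.assoc add.assoc)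
qed

text \<open>Coefficients of the Legendre polynomial normalized to leading coefficient 1; the
  recursion cancels the Laplacians of consecutive terms against each other.\<close>

primrec zonal_coeff :: "nat => nat => real" where
 "zonal_coeff l 0 = 1"
| "zonal_coeff l (Suc i) = - zonal_coeff l i * (real (l - 2 * i) * real (l - 2 * i - 1))
  / (4 * real (Suc i) * real (l - 2 * Suc i) + 2 * real (Suc i) * (2 * real (Suc i) + 1))"

text \<open>The Laplacians telescope: a partial sum up to n leaves one term with the factor (l - 2
  n) (l - 2 n - 1), which is 0 at n = l div 2.\<close>

lemma solid_harmonic_zonal:
 assumes z: "z : S2"
 shows "solid_harmonic l (%x. SUM i<=l div 2. zonal_coeff l i * ((x \<bullet> z) ^ (l - 2 * i) * (x \<bullet> x) ^ i))"
proof -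
 let ?T = "%i x. (x \<bullet> z) ^ (l - 2 * i) * (x \<bullet> x) ^ i"
 have lin: "real_polynomial_function (%x. x \<bullet> z)" for z :: "real^3" by (rule real_polynomial_function.intros(1)) (rule bounded_linear_inner_left)
 have "(%x :: real^3. x \<bullet> x) = (%x. SUM j:UNIV. (x \<bullet> axis j 1) * (x \<bullet> axis j 1))" by (rule ext) (subst inner_vec_def, simp add: inner_axis)
 then have sq: "real_polynomial_function (%x :: real^3. x \<bullet> x)" by (auto intro!: real_polynomial_function_sum lin)
 have T: "real_polynomial_function (?T i)" for i
  by (intro real_polynomial_function.intros(4) real_polynomial_function_power lin sq)
 have "(SUM i<=n. zonal_coeff l i * laplacian (?T i) x) = zonal_coeff l n * (real (l - 2 * n) * real (l - 2 * n - 1) * ((x \<bullet> z) ^ (l - 2 * n - 2) * (x \<bullet> x) ^ n))" for n x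
 proof (induction n)
  case 0 then show ?case using laplacian_zonal[OF z, of l 0 x] by simp
 next
  case (Suc n)
  let ?c = "4 * real (Suc n) * real (l - 2 * Suc n) + 2 * real (Suc n) * (2 * real (Suc n) + 1)"
  have "0 < 2 * real (Suc n) * (2 * real (Suc n) + 1)" by simp
  then have "?c > 0" by (intro add_nonneg_pos) auto
  then have "zonal_coeff l (Suc n) * ?c = - zonal_coeff l n * (real (l - 2 * n) * real (l - 2 * n - 1))" unfolding zonal_coeff.simps by simp
  then have K: "zonal_coeff l (Suc n) * (?c * ((x \<bullet> z) ^ (l - 2 * Suc n) * (x \<bullet> x) ^ (Suc n - 1)))
   = - zonal_coeff l n * (real (l - 2 * n) * real (l - 2 * n - 1) * ((x \<bullet> z) ^ (l - 2 * n - 2) * (x \<bullet> x) ^ n))"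
   by (simp only: mult.assoc[symmetric]) simp
  show ?case unfolding sum.atMost_Suc Suc.IH
   unfolding laplacian_zonal[OF z] distrib_left[of "zonal_coeff l (Suc n)"] K by simp
 qed
 from this[where n = "l div 2"] have "(SUM i<=l div 2. zonal_coeff l i * laplacian (?T i) x) = 0" for x
  by (cases "even l") (auto elim!: oddE)
 moreover have "laplacian (%x. SUM i<=l div 2. zonal_coeff l i * ?T i x) x = (SUM i<=l div 2. zonal_coeff l i * laplacian (?T i) x)" for x
  unfolding laplacian_def partial_deriv_sum[OF T] partial_deriv_sum[OF rpf_partial(1)[OF T]] sum_distrib_left by (rule sum.swap)
 moreover have "real_polynomial_function (%x. SUM i<=l div 2. zonal_coeff l i * ?T i x)"
  by (intro real_polynomial_function_sum real_polynomial_function.intros(4) real_polynomial_function.intros(2) T) simp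
 moreover have "(SUM i<=l div 2. zonal_coeff l i * ?T i (t *\<^sub>R x)) = t ^ l * (SUM i<=l div 2. zonal_coeff l i * ?T i x)" for t and x :: "real^3"
  unfolding sum_distrib_left
 proof (rule sum.cong[OF refl])
  fix i assume "i : {..l div 2}"
  then have "t ^ (l - 2 * i) * (t * t) ^ i = t ^ l" by (simp add: power2_eq_square[symmetric] power_mult[symmetric] power_add[symmetric])
  then show "zonal_coeff l i * ?T i (t *\<^sub>R x) = t ^ l * (zonal_coeff l i * ?T i x)"
   by (simp add: power_mult_distrib mult.assoc[symmetric])
 qed
 ultimately show ?thesis unfolding solid_harmonic_def homogeneous_polynomial_def by auto
qed

text \<open>On the sphere the zonal harmonic of degree l is (x . z)^l plus lower powers of the same
  parity. Zonal polynomials are therefore harmonics, and the moment conditions cover the polynomial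
  q of Green's identity.\<close>

lemma zonal_power_harmonic:
 assumes z: "z : S2" shows "l <= s ==> sphere_restrict (%x. (x \<bullet> z) ^ l) : spherical_harmonics s"
proof (induction l rule: less_induct)
 case (less l)
 let ?T = "%x. SUM i<=l div 2. zonal_coeff l i * ((x \<bullet> z) ^ (l - 2 * i) * (x \<bullet> x) ^ i)"
 let ?R = "%i x. zonal_coeff l i * sphere_restrict (%x. (x \<bullet> z) ^ (l - 2 * i)) x"
 have 1: "sphere_restrict ?T : spherical_harmonics s"
  unfolding spherical_harmonics_def using solid_harmonic_zonal[OF z, of l] less.prems by (intro fun_vs.span_base) blast
 have 2: "?R i : spherical_harmonics s" if "i : {1..l div 2}" for i
  using that less.IH[of "l - 2 * i"] less.prems unfolding spherical_harmonics_def by (intro fun_vs.span_scale) auto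
 have "{..l div 2} = insert 0 {1..l div 2}" by auto
 then have "sphere_restrict (%x. (x \<bullet> z) ^ l) = sphere_restrict ?T - (SUM i:{1..l div 2}. ?R i)"
  by (auto simp: fun_eq_iff sphere_restrict_def sum_fun_apply)
 also have "... : spherical_harmonics s"
  using 1 2 unfolding spherical_harmonics_def by (intro fun_vs.span_diff fun_vs.span_sum)
 finally show ?case .
qed

lemma zonal_poly_harmonic:
 assumes z: "z : S2" and q: "degree q <= s"
 shows "sphere_restrict (%x. poly q (x \<bullet> z)) : spherical_harmonics s"
proof -
 have "sphere_restrict (%x. poly q (x \<bullet> z)) = (SUM i<=degree q. (%x. coeff q i * sphere_restrict (%x. (x \<bullet> z) ^ i) x))"
  by (auto simp: fun_eq_iff sphere_restrict_def poly_altdef sum_fun_apply)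
 also have "... : spherical_harmonics s"
  using zonal_power_harmonic[OF z] q unfolding spherical_harmonics_def by (intro fun_vs.span_sum fun_vs.span_scale) auto
 finally show ?thesis .
qed

section \<open>Interpolation\<close>

lemma spherical_harmonics_outside: "p : spherical_harmonics s ==> x \<notin> S2 ==> p x = 0"
 unfolding spherical_harmonics_def
 by (erule fun_vs.span_induct) (auto simp: fun_vs.subspace_def sphere_restrict_def)

lemma subspace_harmonics: "fun_vs.subspace (spherical_harmonics s)"
 unfolding spherical_harmonics_def by (rule fun_vs.subspace_span)

lemma admissibleI:
 assumes g: "green_data s c q" and Xi: "Xi \<subseteq> S2" and p: "p : spherical_harmonics s"
  and m: "ALL r:spherical_harmonics s. (SUM xi:Xi. a xi * r xi) = 0"
 shows "admissible s q Xi a p"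
 unfolding admissible_def
proof (intro conjI ballI)
 fix x :: "real^3" assume x: "x : S2"
 have "(SUM xi:Xi. a xi * sphere_restrict (%y. poly q (y \<bullet> x)) xi) = 0"
  using m zonal_poly_harmonic[OF x, of q s] g by (auto simp: green_data_def)
 moreover have "(SUM xi:Xi. a xi * sphere_restrict (%y. poly q (y \<bullet> x)) xi) = (SUM ze:Xi. a ze * poly q (x \<bullet> ze))"
  using Xi by (intro sum.cong) (auto simp: sphere_restrict_def inner_commute)
 ultimately show "(SUM ze:Xi. a ze * poly q (x \<bullet> ze)) = 0" by simp
qed (use spherical_harmonics_Lop[OF p] in auto)

definition cardinal_basis :: "nat => (real^3) set => (real^3 => real^3 => real) => bool" where
 "cardinal_basis s Z l \<longleftrightarrow> finite Z & Z \<subseteq> S2 & (ALL z:Z. l z : spherical_harmonics s & (ALL y:Z. l z y = (if y = z then 1 else 0)))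
  & (ALL p:spherical_harmonics s. ALL x. p x = (SUM z:Z. p z * l z x))"

text \<open>By unisolvence with zero coefficients, a harmonic is determined by its values on a fine
  finite net. Finite dimension of the harmonics comes out at the same time.\<close>

lemma cardinal_basis_exists:
 assumes s: "s >= 1" obtains Z l where "cardinal_basis s Z l"
proof -
 obtain c q where g: "green_data s c q" using green_data_exists[OF s] by blast
 show ?thesis
 proof (rule pot_zero[OF s g])
  fix H :: real
  assume H: "H > 0" "H <= 1" and un: "unisolvent s q H"
  note pz = un[unfolded unisolvent_def, rule_format]
  have "compact S2" by simp
  then obtain X where X: "X \<subseteq> S2" "finite X" "S2 \<subseteq> (UN x:X. ball x H)"
   by (rule compactE_image[of S2 S2 "%x. ball x H"]) (use H(1) in auto)
  have n: "net H X" unfolding net_def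
  proof (intro conjI ballI)
   fix x assume "x : S2"
   then obtain z where "z : X" "dist z x < H" using X(3) by auto
   then show "EX z:X. norm (x - z) <= H" by (intro bexI[of _ z]) (auto simp: dist_norm norm_minus_commute)
  qed (use X H in auto)
  have uni: "f = 0" if f: "f : spherical_harmonics s" "!!x. x : X ==> f x = 0" for f
  proof -
   have "admissible s q X (%x. 0) f" by (rule admissibleI[OF g X(1) f(1)]) simp
   from pz[OF n order_refl this] have "ALL x:S2. f x = 0" using f(2) by (simp add: pot_def)
   then show ?thesis using spherical_harmonics_outside[OF f(1)] by (auto simp: fun_eq_iff)
  qed
  obtain Z l where "Z \<subseteq> X" "!!z. z : Z ==> l z : spherical_harmonics s" "!!z y. z : Z ==> y : Z ==> l z y = (if y = z then 1 else 0)"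
   "!!f x. f : spherical_harmonics s ==> f x = (SUM z:Z. f z * l z x)"
   by (rule cardinal_functions[OF subspace_harmonics X(2) uni]) (assumption, assumption, rule that)
  then show thesis using X that[of Z l] finite_subset unfolding cardinal_basis_def by blast
 qed
qed

definition interpolates :: "nat => real => bool" where
 "interpolates s H \<longleftrightarrow> (ALL h Xi y. net h Xi --> h <= H --> (EX a p. p : spherical_harmonics s &
  (ALL r:spherical_harmonics s. (SUM xi:Xi. a xi * r xi) = 0) & (ALL xi:Xi. pot s Xi a p xi = y xi)))"

text \<open>The interpolation and moment conditions form a square saddle point system indexed by
  nodes and Z; unisolvence makes it injective, hence solvable.\<close>

lemma interpolation:
 assumes s: "s >= 1" and g: "green_data s c q"
 obtains H where "H > 0" "H <= 1" "interpolates s H"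
proof (rule pot_zero[OF s g], rule cardinal_basis_exists[OF s])
 fix H :: real and Z l
 assume H: "H > 0" "H <= 1" and un: "unisolvent s q H" and cb: "cardinal_basis s Z l"
 note pz = un[unfolded unisolvent_def, rule_format]
 have Z: "finite Z" "Z \<subseteq> S2" and l: "!!z. z : Z ==> l z : spherical_harmonics s" "!!z y. z : Z ==> y : Z ==> l z y = (if y = z then 1 else 0)"
  and rep: "!!p x. p : spherical_harmonics s ==> p x = (SUM z:Z. p z * l z x)"
  using cb by (auto simp: cardinal_basis_def)
 have main: "EX a p. p : spherical_harmonics s & (ALL r:spherical_harmonics s. (SUM xi:Xi. a xi * r xi) = 0) & (ALL xi:Xi. pot s Xi a p xi = y xi)"
  if n: "net h Xi" and h: "h <= H" for h Xi and y :: "real^3 => real"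
 proof -
  have fin: "finite Xi" and Xi: "Xi \<subseteq> S2" using n by (auto simp: net_def)
  let ?I = "Xi <+> Z"
  define M where "M i j = (case i of Inl xi => (case j of Inl ze => surface_spline s xi ze | Inr z => l z xi)
   | Inr z => (case j of Inl ze => l z ze | Inr z' => 0))" for i j :: "(real^3) + (real^3)"
  define P where "P u x = (SUM z:Z. u (Inr z) * l z x)" for u :: "(real^3) + (real^3) => real" and x
  have P: "P u : spherical_harmonics s" for u
  proof -
   have "P u = (SUM z:Z. (%x. u (Inr z) * l z x))" by (simp add: fun_eq_iff P_def sum_fun_apply)
   also have "... : spherical_harmonics s"
    by (intro fun_vs.subspace_sum[OF subspace_harmonics] fun_vs.subspace_scale[OF subspace_harmonics] l(1))
   finally show ?thesis .
  qed
  have row1: "(SUM j:?I. M (Inl xi) j * u j) = pot s Xi (%ze. u (Inl ze)) (P u) xi" for u xi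
   using fin Z(1) by (simp add: sum.Plus M_def pot_def P_def mult.commute)
  have row2: "(SUM j:?I. M (Inr z) j * u j) = (SUM ze:Xi. u (Inl ze) * l z ze)" for u z
   using fin Z(1) by (simp add: sum.Plus M_def mult.commute)
  have mom: "ALL r:spherical_harmonics s. (SUM xi:Xi. a xi * r xi) = 0" if a: "!!z. z : Z ==> (SUM xi:Xi. a xi * l z xi) = 0" for a
  proof
   fix r assume r: "r : spherical_harmonics s"
   have "(SUM xi:Xi. a xi * r xi) = (SUM xi:Xi. SUM z:Z. r z * (a xi * l z xi))"
    by (subst rep[OF r]) (simp add: sum_distrib_left mult_ac)
   also have "... = (SUM z:Z. r z * (SUM xi:Xi. a xi * l z xi))" by (subst sum.swap) (simp add: sum_distrib_left)
   finally show "(SUM xi:Xi. a xi * r xi) = 0" using a by simp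
  qed
  have inj: "ALL j:?I. u j = 0" if u: "!!i. i : ?I ==> (SUM j:?I. M i j * u j) = 0" for u
  proof -
   have "admissible s q Xi (%ze. u (Inl ze)) (P u)" using u row2 by (intro admissibleI[OF g Xi P] mom) (metis InrI)
   moreover have "pot s Xi (%ze. u (Inl ze)) (P u) xi = 0" if "xi : Xi" for xi using u[of "Inl xi"] row1 that by auto
   ultimately have *: "(ALL xi:Xi. u (Inl xi) = 0) & (ALL x:S2. P u x = 0)" by (rule pz[OF n h])
   have "P u z = u (Inr z)" if "z : Z" for z
    using that Z(1) l(2) by (simp add: P_def if_distrib[of "%c. _ * c"] cong: if_cong)
   moreover have "P u z = 0" if "z : Z" for z using * Z(2) that by (meson subsetD)
   ultimately have "u (Inr z) = 0" if "z : Z" for z using that by simp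
   then show ?thesis using * by auto
  qed
  obtain u where u: "!!i. i : ?I ==> (SUM j:?I. M i j * u j) = (case i of Inl xi => y xi | Inr z => 0)"
   by (rule square_system[of ?I M "case_sum y (%z. 0)"]) (use fin Z inj in auto)
  show ?thesis
   using mom[of "%ze. u (Inl ze)"] u[of "Inr _"] u[of "Inl _"] row1 row2 P by (intro exI[of _ "%ze. u (Inl ze)"] exI[of _ "P u"]) auto
 qed
 have "interpolates s H" unfolding interpolates_def by (intro allI impI, rule main)
 then show thesis by (rule that[OF H])
qed

text \<open>On harmonics, evaluation at any point is a combination of evaluations at the nodes
  \<open>pj z\<close>, the same nodes for all points, with uniformly bounded weights. These nodes
  will receive the truncated coefficients.\<close>

definition reproduces :: "nat => (real^3) set => real => real => bool" where
 "reproduces s Z H M \<longleftrightarrow> (ALL h Xi. net h Xi --> h <= H --> (EX pj. pj ` Z \<subseteq> Xi &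
  (ALL x:S2. EX mu. (SUM z:Z. \<bar>mu z\<bar>) <= M & (ALL r:spherical_harmonics s. r x = (SUM z:Z. mu z * r (pj z))))))"

text \<open>The nodes \<open>pj z\<close> are perturbations of \<open>Z\<close>, so that the matrix \<open>l z (pj z')\<close> is close to the identity.\<close>

lemma reproduction:
 assumes cb: "cardinal_basis s Z l"
 obtains H M where "H > 0" "M >= 0" "reproduces s Z H M"
proof -
 have Z: "finite Z" "Z \<subseteq> S2" and l: "!!z. z : Z ==> l z : spherical_harmonics s" "!!z y. z : Z ==> y : Z ==> l z y = (if y = z then 1 else 0)"
  and rep: "!!p x. p : spherical_harmonics s ==> p x = (SUM z:Z. p z * l z x)"
  using cb by (auto simp: cardinal_basis_def)
 have cl: "continuous_on S2 (l z)" if "z : Z" for z using spherical_harmonics_Lop[OF l(1)[OF that]] smooth_continuous by blast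
 have "continuous_on S2 (%x. SUM z:Z. \<bar>l z x\<bar>)" by (intro continuous_on_sum continuous_on_rabs cl)
 then obtain B where B: "B > 0" "!!x. x : S2 ==> \<bar>SUM z:Z. \<bar>l z x\<bar>\<bar> <= B" using bounded_cont_S2 by blast
 \<comment> \<open>Makes the column sums of the matrix \<open>l y (pj z)\<close> minus the identity
   at most 1 / 2, which is what \<open>low\<close> rests on.\<close>
 define e where "e = 1 / (2 * (real (card Z) + 1))"
 have e: "e > 0" by (simp add: e_def)
 have "EX d>0. ALL x:S2. norm (x - z) <= d --> (ALL y:Z. \<bar>l y x - l y z\<bar> <= e)" if z: "z : Z" for z
 proof -
  have "EX d>0. ALL x:S2. norm (x - z) < d --> \<bar>l y x - l y z\<bar> <= e" if y: "y : Z" for y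
   using cl[OF y] z Z(2) e unfolding continuous_on_iff dist_norm real_norm_def by (meson less_imp_le subsetD)
  then obtain d where d: "!!y. y : Z ==> d y > 0" "!!y x. y : Z ==> x : S2 ==> norm (x - z) < d y ==> \<bar>l y x - l y z\<bar> <= e" by metis
  have "Min (d ` Z) > 0" using d(1) Z(1) z by (subst Min_gr_iff) auto
  moreover have "Min (d ` Z) <= d y" if "y : Z" for y using Z(1) that by simp
  ultimately show ?thesis using d(2) by (intro exI[of _ "Min (d ` Z) / 2"]) fastforce
 qed
 then obtain d where d: "!!z. z : Z ==> d z > 0" "!!z x y. z : Z ==> x : S2 ==> norm (x - z) <= d z ==> y : Z ==> \<bar>l y x - l y z\<bar> <= e" by metis
 define H where "H = Min (insert 1 (d ` Z))"
 have H: "H > 0" "!!z. z : Z ==> H <= d z" using d(1) Z(1) by (auto simp: H_def)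
 have main: "EX pj. pj ` Z \<subseteq> Xi & (ALL x:S2. EX mu. (SUM z:Z. \<bar>mu z\<bar>) <= 2 * B & (ALL r:spherical_harmonics s. r x = (SUM z:Z. mu z * r (pj z))))"
  if n: "net h Xi" and h: "h <= H" for h Xi
 proof -
  have "ALL z:Z. EX xi:Xi. norm (z - xi) <= h" using n Z(2) by (auto simp: net_def)
  then obtain pj where pj: "!!z. z : Z ==> pj z : Xi" "!!z. z : Z ==> norm (pj z - z) <= h" by (metis norm_minus_commute)
  have close: "\<bar>l y (pj z) - l y z\<bar> <= e" if "y : Z" "z : Z" for y z
   using d(2)[of z "pj z" y] that pj[OF that(2)] h H(2)[OF that(2)] n by (auto simp: net_def)
  have low: "(SUM z:Z. \<bar>mu z\<bar>) <= 2 * (SUM y:Z. \<bar>SUM z:Z. l y (pj z) * mu z\<bar>)" for mu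
  proof -
   have "\<bar>mu y\<bar> <= \<bar>SUM z:Z. l y (pj z) * mu z\<bar> + (SUM z:Z. e * \<bar>mu z\<bar>)" if y: "y : Z" for y
   proof -
    have "(SUM z:Z. l y z * mu z) = mu y" using l(2)[OF y] y Z(1) by (simp add: if_distrib[of "%c. c * _"] cong: if_cong)
    then have "mu y = (SUM z:Z. l y (pj z) * mu z) - (SUM z:Z. (l y (pj z) - l y z) * mu z)" by (simp add: left_diff_distrib sum_subtractf)
    moreover have "\<bar>SUM z:Z. (l y (pj z) - l y z) * mu z\<bar> <= (SUM z:Z. e * \<bar>mu z\<bar>)"
     by (rule order_trans[OF sum_abs]) (auto simp: abs_mult intro!: sum_mono mult_right_mono close[OF y])
    ultimately show ?thesis by linarith
   qed
   then have "(SUM z:Z. \<bar>mu z\<bar>) <= (SUM y:Z. \<bar>SUM z:Z. l y (pj z) * mu z\<bar> + (SUM z:Z. e * \<bar>mu z\<bar>))" by (intro sum_mono)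
   also have "... = (SUM y:Z. \<bar>SUM z:Z. l y (pj z) * mu z\<bar>) + (real (card Z) * e) * (SUM z:Z. \<bar>mu z\<bar>)"
    by (simp add: sum.distrib sum_distrib_left mult_ac)
   also have "(real (card Z) * e) * (SUM z:Z. \<bar>mu z\<bar>) <= (1 / 2) * (SUM z:Z. \<bar>mu z\<bar>)"
    by (intro mult_right_mono sum_nonneg) (auto simp: e_def field_simps)
   finally show ?thesis by simp
  qed
  have "EX mu. (SUM z:Z. \<bar>mu z\<bar>) <= 2 * B & (ALL r:spherical_harmonics s. r x = (SUM z:Z. mu z * r (pj z)))" if x: "x : S2" for x
  proof -
   have inj: "ALL z:Z. mu z = 0" if "!!y. y : Z ==> (SUM z:Z. l y (pj z) * mu z) = 0" for mu
   proof -
    have "(SUM z:Z. \<bar>mu z\<bar>) <= 0" using low[of mu] that by simp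
    then have "(SUM z:Z. \<bar>mu z\<bar>) = 0" by (intro antisym sum_nonneg) auto
    then show ?thesis using Z(1) by (simp add: sum_nonneg_eq_0_iff)
   qed
   obtain mu where mu: "!!y. y : Z ==> (SUM z:Z. l y (pj z) * mu z) = l y x"
    by (rule square_system[OF Z(1), of "%y z. l y (pj z)" "%y. l y x"]) (use inj in auto)
   have "r x = (SUM z:Z. mu z * r (pj z))" if r: "r : spherical_harmonics s" for r
   proof -
    have "r x = (SUM y:Z. r y * (SUM z:Z. l y (pj z) * mu z))" by (subst rep[OF r]) (simp add: mu)
    also have "... = (SUM z:Z. mu z * (SUM y:Z. r y * l y (pj z)))"
     unfolding sum_distrib_left by (subst sum.swap) (simp only: mult_ac)
    finally show ?thesis by (simp only: rep[OF r, symmetric])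
   qed
   moreover have "(SUM z:Z. \<bar>mu z\<bar>) <= 2 * B" using low[of mu] B(2)[OF x] mu by simp
   ultimately show ?thesis by blast
  qed
  then show ?thesis using pj(1) by (intro exI[of _ pj]) auto
 qed
 have re: "reproduces s Z H (2 * B)" unfolding reproduces_def by (intro allI impI, rule main)
 have "0 <= 2 * B" using B(1) by simp
 then show ?thesis by (rule that[OF H(1) _ re])
qed

section \<open>Packing estimates\<close>

text \<open>The caps are disjoint: a common point would give 1 - ze . ze' <= 4 a <= 2 (ka h)^2,
  below the separation 3 (ka h)^2. A sum over nodes is thereby bounded by an integral.\<close>

lemma cap_sum:
 assumes fin: "finite Xi" and Xi: "Xi \<subseteq> S2" and sp: "sep ka h Xi" and ka: "0 < ka" "0 < h" and a: "0 < a" "a <= (ka * h)^2 / 2" "a <= 2"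
  and Y: "Y \<subseteq> Xi" and g: "integrable sgm g" "!!y. y : S2 ==> 0 <= g y"
  and f: "!!ze. ze : Y ==> 0 <= f ze" "!!ze y. ze : Y ==> y : cap ze a ==> f ze <= g y"
 shows "(SUM ze:Y. f ze) * (area * a / 256) <= (SI x. g x)"
proof -
 have disj: "ze = ze'" if "ze : Y" "ze' : Y" "y : cap ze a" "y : cap ze' a" for ze ze' y
 proof (rule ccontr)
  assume "ze ~= ze'"
  then have far: "3 * (ka * h)^2 <= 1 - ze \<bullet> ze'" using sp that Y unfolding sep_def by blast
  have S: "ze : S2" "ze' : S2" "y : S2" using that Y Xi by (auto simp: cap_def)
  have "norm (ze - ze') <= norm (y - ze) + norm (y - ze')" using norm_triangle_ineq4[of "y - ze'" "y - ze"] by simp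
  then have "(norm (ze - ze'))^2 <= (norm (y - ze) + norm (y - ze'))^2" by (rule power_mono) simp
  also have "... <= 2 * (norm (y - ze))^2 + 2 * (norm (y - ze'))^2"
   using zero_le_power2[of "norm (y - ze) - norm (y - ze')"] by (simp add: power2_eq_square algebra_simps)
  also have "... <= 8 * a" using that(3,4) unfolding S2_norm_diff[OF S(3,1)] S2_norm_diff[OF S(3,2)] by (simp add: cap_def)
  finally have "1 - ze \<bullet> ze' <= 4 * a" unfolding S2_norm_diff[OF S(1,2)] by simp
  moreover have "0 < (ka * h)^2" using ka by simp
  ultimately show False using a(2) far by linarith
 qed
 have fY: "finite Y" using fin Y finite_subset by blast
 have "(SUM ze:Y. f ze) * (area * a / 256) <= (SUM ze:Y. f ze * measure sgm (cap ze a))"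
  unfolding sum_distrib_right using Y Xi a f(1) by (intro sum_mono mult_left_mono cap_lower) auto
 also have "... = (SI x. (SUM ze:Y. f ze * indicat_real (cap ze a) x))"
  by (subst Bochner_Integration.integral_sum) auto
 also have "... <= (SI x. g x)"
 proof (rule integral_mono)
  fix y assume "y : space sgm"
  then have y: "y : S2" by simp
  show "(SUM ze:Y. f ze * indicat_real (cap ze a) y) <= g y"
  proof (cases "EX ze:Y. y : cap ze a")
   case True
   then obtain ze where z: "ze : Y" "y : cap ze a" by blast
   have "(SUM et:Y. f et * indicat_real (cap et a) y) = (SUM et:Y. if et = ze then f ze else 0)"
    using disj z by (intro sum.cong) (auto simp: indicator_def)
   then show ?thesis using f(2)[OF z] z(1) fY by simp
  next
   case False
   then show ?thesis using g(2)[OF y] by simp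
  qed
 qed (use g in auto)
 finally show ?thesis .
qed

text \<open>Caps of size h^2 / 2 cover the sphere and each has measure at most area h^2. This yields
  |ln h| <= ln N, the link between the scale and the number of nodes.\<close>

lemma cover_card:
 assumes "finite Xi" "Xi \<subseteq> S2" "h > 0" "!!x. x : S2 ==> EX xi:Xi. norm (x - xi) <= h"
 shows "1 <= real (card Xi) * h^2"
proof -
 have "x : (UN xi:Xi. cap xi (h^2 / 2))" if x: "x : S2" for x
 proof -
  obtain xi where xi: "xi : Xi" "norm (x - xi) <= h" using assms(4)[OF x] by blast
  then have "(norm (x - xi))^2 <= h^2" by (intro power_mono) auto
  then show ?thesis using xi(1) x assms(2) S2_norm_diff[of x xi] by (auto simp: cap_def intro!: bexI[of _ xi])
 qed
 then have "S2 = (UN xi:Xi. cap xi (h^2 / 2))" by (auto simp: cap_def)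
 then have "area = measure sgm (UN xi:Xi. cap xi (h^2 / 2))" unfolding area_def by (rule arg_cong)
 also have "... <= (SUM xi:Xi. measure sgm (cap xi (h^2 / 2)))"
  using assms(1) by (intro finite_measure.finite_measure_subadditive_finite finite_measure_surface) (simp_all add: image_subset_iff del: sets_surface_measure)
 also have "... <= (SUM xi:Xi. 2 * area * (h^2 / 2))" using assms by (intro sum_mono cap_upper) auto
 finally show ?thesis using area_pos by simp
qed

text \<open>A polynomial envelope of order -4. Up to a factor it is (1 + d - x . z)^(-2) with d =
  h^2 / 2, so its integral is known, and it dominates the exponential tails as well as the
  truncation error.\<close>

definition Vw :: "real => real^3 => real^3 => real" where
 "Vw h xi x = 1 / (1 + (norm (x - xi) / h)^2)^2"

lemma Vw_commute: "Vw h xi x = Vw h x xi" by (simp add: Vw_def norm_minus_commute)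

lemma Vw_pos: "0 < Vw h xi x"
proof -
 have "0 < 1 + (norm (x - xi) / h)^2" by (rule add_pos_nonneg) auto
 then show ?thesis by (simp add: Vw_def)
qed

lemma continuous_Vw: "continuous_on A (Vw h xi)"
proof -
 have "1 + (norm (x - xi) / h)^2 ~= 0" for x using add_pos_nonneg[of 1 "(norm (x - xi) / h)^2"] by simp
 then show ?thesis unfolding Vw_def[abs_def] divide_inverse by (intro continuous_intros) auto
qed

lemma Vw_near:
 assumes h: "h > 0" and xy: "norm (x - y) <= h" shows "Vw h xi x <= 9 * Vw h xi y"
proof -
 let ?s = "norm (x - xi) / h" and ?t = "norm (y - xi) / h"
 have "norm (y - xi) <= norm (x - xi) + norm (x - y)" using norm_triangle_ineq4[of "x - xi" "x - y"] by simp
 then have "?t <= (norm (x - xi) + h) / h" using xy h by (intro divide_right_mono) auto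
 then have "?t <= ?s + 1" using h by (simp add: add_divide_distrib)
 then have "?t^2 <= (?s + 1)^2" using h by (intro power_mono) auto
 moreover have "(s + 1)^2 <= 2 * s^2 + 2" for s :: real using zero_le_power2[of "s - 1"] by (simp add: power2_eq_square algebra_simps)
 note this[of ?s]
 ultimately have "1 + ?t^2 <= 3 * (1 + ?s^2)" using zero_le_power2[of ?s] by (simp only: distrib_left)
 then have "(1 + ?t^2)^2 <= (3 * (1 + ?s^2))^2" by (intro power_mono) auto
 moreover have "(3 * A)^2 = 9 * A^2" for A :: real by (simp add: power2_eq_square)
 ultimately have le: "(1 + ?t^2)^2 <= 9 * (1 + ?s^2)^2" by (simp only:)
 have "0 < (1 + ?t^2)^2" "0 < (1 + ?s^2)^2" by (intro zero_less_power add_pos_nonneg; simp)+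
 with le show ?thesis unfolding Vw_def by (simp only: divide_simps) simp
qed

lemma integral_Vw:
 assumes xi: "xi : S2" and h: "h > 0" shows "(SI x. Vw h xi x) <= area * h^2 / 4"
proof -
 have "(SI x. Vw h xi x) = (SI x. (h ^ 4 / 4) * (1 / (1 + h^2 / 2 - x \<bullet> xi)^2))"
 proof (rule Bochner_Integration.integral_cong[OF refl])
  fix x assume "x : space sgm"
  then have x: "x : S2" by simp
  have eq: "1 + (norm (x - xi) / h)^2 = (1 + h^2 / 2 - x \<bullet> xi) / (h^2 / 2)"
   using h by (simp add: power_divide S2_norm_diff[OF x xi] field_simps)
  show "Vw h xi x = (h ^ 4 / 4) * (1 / (1 + h^2 / 2 - x \<bullet> xi)^2)"
   unfolding Vw_def eq power_divide[of "1 + h^2 / 2 - x \<bullet> xi"] by (simp add: power_divide power_mult[symmetric])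
 qed
 also have "... = (h ^ 4 / 4) * (area / (2 * (h^2 / 2) + (h^2 / 2)^2))" 
  using h by (simp only: integral_mult_right_zero integral_vd_neg2(1)[OF xi, of "h^2 / 2"] half_gt_zero zero_less_power)
 also have "... <= (h ^ 4 / 4) * (area / h^2)" using h area_pos by (intro mult_left_mono divide_left_mono mult_pos_pos add_pos_nonneg) auto
 also have "... = area * h^2 / 4" using h by (simp add: field_simps eval_nat_numeral)
 finally show ?thesis .
qed

text \<open>1152 is 9 * 256 * 2 / 4, from \<open>Vw_near\<close>, \<open>cap_lower\<close>, the cap
  size (ka h)^2 / 2 and \<open>integral_Vw\<close>; likewise 512 is 256 * 2.\<close>

lemma packing:
 assumes fin: "finite Xi" and Xi: "Xi \<subseteq> S2" and sp: "sep ka h Xi" and ka: "0 < ka" "ka <= 1" and h: "0 < h" "h <= 1"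
 shows "x : S2 ==> (SUM xi:Xi. Vw h xi x) <= 1152 / ka^2"
  "x : S2 ==> 0 <= R ==> real (card {ze:Xi. norm (ze - x) <= R}) <= 512 * (R / (ka * h) + 1)^2"
  "real (card Xi) * (ka * h)^2 <= 512"
proof -
 let ?a = "(ka * h)^2 / 2"
 have kh: "0 < ka * h" "ka * h <= h" "ka * h <= 1" using mult_pos_pos[OF ka(1) h(1)] mult_right_mono[OF ka(2), of h] h by linarith+
 have a: "0 < ?a" "?a <= ?a" "?a <= 2" using kh power_le_one[of "ka * h" 2] by auto
 note cs = cap_sum[OF fin Xi sp ka(1) h(1) a]
 have near: "norm (y - xi) <= ka * h" if "xi : Xi" "y : cap xi ?a" for y xi
 proof (rule power2_le_imp_le)
  show "(norm (y - xi))^2 <= (ka * h)^2" using that Xi S2_norm_diff[of y xi] by (auto simp: cap_def)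
 qed (use kh in simp)
 { assume x: "x : S2"
  have "(SUM xi:Xi. Vw h xi x / 9) * (area * ?a / 256) <= (SI y. Vw h x y)"
  proof (rule cs[OF order_refl int_cont[OF continuous_Vw]])
   fix ze y assume "ze : Xi" "y : cap ze ?a"
   from near[OF this] have "norm (ze - y) <= h" using kh by (simp add: norm_minus_commute)
   then show "Vw h ze x / 9 <= Vw h x y" using Vw_near[OF h(1), of ze y x] by (simp add: Vw_commute[of h ze])
  qed (auto intro: less_imp_le[OF Vw_pos])
  also have "... <= area * h^2 / 4" by (rule integral_Vw[OF x h(1)])
  finally have "area * h^2 * ((SUM xi:Xi. Vw h xi x) * ka^2) <= area * h^2 * 1152" by (simp add: sum_divide_distrib[symmetric] power_mult_distrib mult_ac)
  then have "(SUM xi:Xi. Vw h xi x) * ka^2 <= 1152" using area_pos h by simp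
  then show "(SUM xi:Xi. Vw h xi x) <= 1152 / ka^2" using ka by (simp add: field_simps) }
 { assume x: "x : S2" and R: "0 <= R"
  let ?Y = "{ze:Xi. norm (ze - x) <= R}" and ?b = "(R + ka * h)^2 / 2"
  have "(SUM ze:?Y. 1) * (area * ?a / 256) <= (SI y. indicat_real (cap x ?b) y)"
  proof (rule cs)
   fix ze y assume z: "ze : ?Y" "y : cap ze ?a"
   then have "norm (y - x) <= R + ka * h" using near[of ze y] norm_triangle_ineq[of "y - ze" "ze - x"] by auto
   then have "(norm (y - x))^2 <= (R + ka * h)^2" by (intro power_mono) auto
   then show "1 <= indicat_real (cap x ?b) y" using z x S2_norm_diff[of y x] by (auto simp: cap_def indicator_def)
  qed simp_all
  also have "... = measure sgm (cap x ?b)" by simp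
  also have "... <= 2 * area * ?b" using R kh by (intro cap_upper[OF x]) (simp add: add_nonneg_pos)
  finally have "area * (real (card ?Y) * (ka * h)^2) <= area * (512 * (R + ka * h)^2)" by (simp add: mult_ac)
  then have "real (card ?Y) * (ka * h)^2 <= 512 * (R + ka * h)^2" using area_pos by (simp only: mult_le_cancel_left_pos)
  then have "real (card ?Y) <= 512 * (R + ka * h)^2 / (ka * h)^2" using kh(1) by (subst pos_le_divide_eq) auto
  also have "... = 512 * ((R + ka * h) / (ka * h))^2" by (simp add: power_divide)
  also have "(R + ka * h) / (ka * h) = R / (ka * h) + 1" using kh(1) ka h by (simp add: add_divide_distrib)
  finally show "real (card ?Y) <= 512 * (R / (ka * h) + 1)^2" . }
 have "(SUM ze:Xi. 1) * (area * ?a / 256) <= (SI y. 1)" by (rule cs) (auto intro: int_cont)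
 also have "(SI y. 1) = area" by (simp add: area_def)
 finally have "area * (real (card Xi) * (ka * h)^2) <= area * 512" by (simp add: mult_ac)
 then show "real (card Xi) * (ka * h)^2 <= 512" using area_pos by (simp only: mult_le_cancel_left_pos)
qed

section \<open>The localized basis\<close>

abbreviation moments :: "nat => (real^3) set => (real^3 => real) => bool" where
 "moments s Xi a \<equiv> ALL r:spherical_harmonics s. (SUM xi:Xi. a xi * r xi) = 0"

definition kfun :: "nat => (real^3) set => (real^3 => real) => (real^3 => real) => real^3 => real" where
 "kfun s Xi a p = sphere_restrict (%x. SUM ze:Xi. a ze * surface_spline s x ze) + p"

lemma kernel_space_eq: "kernel_space s (surface_spline s) Xi = {kfun s Xi a p | a p. p : spherical_harmonics s & moments s Xi a}"
 by (simp add: kernel_space_def kfun_def)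

lemma kfun_eq: "x : S2 ==> kfun s Xi a p x = pot s Xi a p x"
 by (simp add: kfun_def pot_def sphere_restrict_def)

lemma subspace_kernel_space: "fun_vs.subspace (kernel_space s (surface_spline s) Xi)"
 unfolding fun_vs.subspace_def
proof (intro conjI ballI allI)
 have "(0 :: real^3 => real) = kfun s Xi (%_. 0) 0" by (auto simp: kfun_def sphere_restrict_def fun_eq_iff)
 then show "0 : kernel_space s (surface_spline s) Xi"
  unfolding kernel_space_eq using fun_vs.subspace_0[OF subspace_harmonics, of s] by fastforce
next
 fix f g assume "f : kernel_space s (surface_spline s) Xi" "g : kernel_space s (surface_spline s) Xi"
 then obtain a p b r where f: "f = kfun s Xi a p" "p : spherical_harmonics s" "moments s Xi a"
  and g: "g = kfun s Xi b r" "r : spherical_harmonics s" "moments s Xi b" by (auto simp: kernel_space_eq)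
 have "f + g = kfun s Xi (%ze. a ze + b ze) (p + r)"
  by (auto simp: f g kfun_def sphere_restrict_def fun_eq_iff distrib_right sum.distrib)
 moreover have "moments s Xi (%ze. a ze + b ze)" using f(3) g(3) by (simp add: distrib_right sum.distrib)
 ultimately show "f + g : kernel_space s (surface_spline s) Xi"
  unfolding kernel_space_eq using fun_vs.subspace_add[OF subspace_harmonics f(2) g(2)] by blast
next
 fix c :: real and f assume "f : kernel_space s (surface_spline s) Xi"
 then obtain a p where f: "f = kfun s Xi a p" "p : spherical_harmonics s" "moments s Xi a" by (auto simp: kernel_space_eq)
 have "(%x. c * f x) = kfun s Xi (%ze. c * a ze) (%x. c * p x)"
  by (auto simp: f kfun_def sphere_restrict_def fun_eq_iff distrib_left sum_distrib_left mult.assoc)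
 moreover have "moments s Xi (%ze. c * a ze)" using f(3) by (simp add: mult.assoc sum_distrib_left[symmetric])
 ultimately show "(%x. c * f x) : kernel_space s (surface_spline s) Xi"
  unfolding kernel_space_eq using fun_vs.subspace_scale[OF subspace_harmonics f(2)] by blast
qed

lemma exp_le_Vw:
 assumes nu: "nu > 0"
 obtains C where "C > 0" "!!h x xi. h > 0 ==> exp (- nu * (norm (x - xi) / h)) <= C * Vw h xi x"
proof -
 define m where "m = min 1 (nu / 4)"
 have m: "0 < m" "m <= 1" "m <= nu / 4" using nu by (auto simp: m_def)
 have "exp (- nu * (norm (x - xi) / h)) <= (1 / m ^ 4) * Vw h xi x" if h: "h > 0" for h x and xi :: "real^3"
 proof -
  define t where "t = norm (x - xi) / h"
  have t: "0 <= t" using h by (simp add: t_def)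
  have "m * (1 + t) <= 1 + (nu / 4) * t" using m t mult_right_mono[OF m(3) t] by (simp add: distrib_left)
  also have "... <= exp ((nu / 4) * t)" by (rule exp_ge_add_one_self)
  finally have "(m * (1 + t)) ^ 4 <= exp ((nu / 4) * t) ^ 4" using m t by (intro power_mono) auto
  also have "... = exp (nu * t)" by (simp add: exp_of_nat_mult[symmetric])
  finally have e: "m ^ 4 * (1 + t) ^ 4 <= exp (nu * t)" by (simp add: power_mult_distrib)
  have "(1 + t^2)^2 <= ((1 + t)^2)^2" using t by (intro power_mono) (auto simp: power2_eq_square algebra_simps)
  then have "m ^ 4 * (1 + t^2)^2 <= m ^ 4 * (1 + t) ^ 4" using m by (intro mult_left_mono) (auto simp: power_mult[symmetric])
  then have "m ^ 4 * (1 + t^2)^2 <= exp (nu * t)" using e by linarith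
  moreover have "0 < m ^ 4 * (1 + t^2)^2" using m by (intro mult_pos_pos zero_less_power add_pos_nonneg) auto
  ultimately have "inverse (exp (nu * t)) <= inverse (m ^ 4 * (1 + t^2)^2)" by (rule le_imp_inverse_le)
  then show ?thesis by (simp add: Vw_def t_def exp_minus divide_inverse)
 qed
 then show ?thesis using that[of "1 / m ^ 4"] m by simp
qed

text \<open>Chords are at most 2, so the envelope never falls below a multiple of h^4; a truncation
  error of at most h^5 is then at most 25 h times the envelope.\<close>

lemma h4_le_Vw:
 assumes h: "0 < h" "h <= 1" and "x : S2" "xi : S2" shows "h ^ 4 <= 25 * Vw h xi x"
proof -
 have "norm (x - xi) <= 2" using norm_triangle_ineq4[of x xi] assms by simp
 then have "(norm (x - xi) / h)^2 <= (2 / h)^2" using h by (intro power_mono divide_right_mono) auto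
 then have "(1 + (norm (x - xi) / h)^2)^2 <= (1 + (2 / h)^2)^2" by (intro power_mono) auto
 also have "... <= (5 / h^2)^2"
 proof (rule power_mono)
  have "1 <= 1 / h^2" using h power_le_one[of h 2] by (simp add: le_divide_eq)
  moreover have "5 / h^2 = 1 / h^2 + (2 / h)^2" by (simp add: power_divide add_divide_distrib[symmetric])
  ultimately show "1 + (2 / h)^2 <= 5 / h^2" by simp
 qed simp
 finally have "h ^ 4 * (1 + (norm (x - xi) / h)^2)^2 <= h ^ 4 * (5 / h^2)^2" using h by (intro mult_left_mono) auto
 also have "... = 25" using h by (simp add: power_divide power_mult[symmetric])
 moreover have "0 < (1 + (norm (x - xi) / h)^2)^2" by (intro zero_less_power add_pos_nonneg) auto
 ultimately show ?thesis by (simp add: Vw_def pos_le_divide_eq)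
qed

text \<open>A and p describe the truncated functions for one node set. The family v, indexed by the
  same nodes, spans the kernel space; this turns independence of the truncated functions into the
  basis property.\<close>

definition local_system :: "nat => real => real => real => real => real => real => (real^3) set => bool" where
 "local_system s ka nu ga C ta h Xi \<longleftrightarrow> (EX A p v.
   (ALL xi:Xi. p xi : spherical_harmonics s & moments s Xi (A xi)
     & real (card {ze:Xi. A xi ze ~= 0}) <= ta * (ln (real (card Xi)))^2
     & (ALL x:S2. \<bar>pot s Xi (A xi) (p xi) x\<bar> <= C * exp (- nu * (norm (x - xi) / h)) + h powr (ga * sqrt ta)
      & (ALL ze:Xi. \<bar>pot s Xi (A xi) (p xi) x - cutoff (ka * h) xi x\<bar> <= (C * sqrt (norm (x - ze) / h) + 25 * h) * Vw h xi x)))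
   & kernel_space s (surface_spline s) Xi \<subseteq> fv.span (v ` Xi))"

text \<open>Coefficients at nodes farther than R are reassigned to the nodes \<open>pj z\<close>
  with the reproducing weights of the far node, which leaves every harmonic moment
  unchanged.\<close>

lemma localized_basis:
 assumes s: "s >= 1" and ka: "0 < ka" "ka <= 1"
 obtains nu ga T C where "nu > 0" "ga > 0" "T > 0" "C > 0" "!!ta. ta >= T ==> 2 * real s + 3 <= ga * sqrt ta"
  "!!ta. ta >= T ==> EX H>0. H <= 1 & (ALL h Xi. net h Xi --> h <= H --> sep ka h Xi --> local_system s ka nu ga C ta h Xi)"
proof -
 obtain c q where g: "green_data s c q" using green_data_exists[OF s] by blast
 obtain Z l where cb: "cardinal_basis s Z l" using cardinal_basis_exists[OF s] .
 show ?thesis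
 proof (rule lagrange_decay[OF s g ka], rule interpolation[OF s g], rule pot_zero[OF s g], rule reproduction[OF cb])
  fix nu H1 C1 H2 H3 H4 M :: real
  assume nu: "nu > 0" and H1: "H1 > 0" "H1 <= 1" and C1: "C1 > 0" and H2: "H2 > 0" and H3: "H3 > 0" and H4: "H4 > 0" and M: "M >= 0"
   and le: "lagrange_estimate s q ka nu H1 C1" and ip: "interpolates s H2" and un: "unisolvent s q H3" and re: "reproduces s Z H4 M"
  note decay = le[unfolded lagrange_estimate_def, rule_format] and interp = ip[unfolded interpolates_def, rule_format]
   and zero = un[unfolded unisolvent_def, rule_format] and repro = re[unfolded reproduces_def, rule_format]
  have fZ: "finite Z" using cb by (simp add: cardinal_basis_def)
  obtain C2 where C2: "C2 > 0" "!!h x xi. h > 0 ==> exp (- nu * (norm (x - xi) / h)) <= C2 * Vw h xi x"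
   using exp_le_Vw[OF nu] by metis
  \<comment> \<open>With R = ka sqrt ta h L / 64, where L = - ln h, a far coefficient carries the
    factor exp (- nu R / h) = h^(2 J). Twice J is available so that one half can pay for negative
    powers of h.\<close>
  define ga where "ga = nu * ka / 128"
  \<comment> \<open>4096 = 64^2 makes R / (ka h) at least 1, the second entry leaves room for the
    nodes \<open>pj z\<close>, and the third gives J >= 2 s + 3.\<close>
  define T where "T = Max {4096, 2 * real (card Z), ((2 * real s + 3) / ga)^2}"
  define B where "B = (M + 1) * (9 * 3 ^ s)"
  define E where "E = 512 / ka^2 * C1 * B"
  define C where "C = C1 * C2 + C1"
  have ga: "ga > 0" using nu ka by (simp add: ga_def)
  have T: "4096 <= T" "2 * real (card Z) <= T" "((2 * real s + 3) / ga)^2 <= T" by (auto simp: T_def)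
  have B0: "0 <= B" using M by (simp add: B_def)
  have E0: "0 <= E" unfolding E_def using C1 B0 by simp
  have J: "2 * real s + 3 <= ga * sqrt ta" if "ta >= T" for ta
  proof -
   have "(2 * real s + 3) / ga <= sqrt ta" using T(3) that by (intro real_le_rsqrt) linarith
   then show ?thesis using ga by (simp add: pos_divide_le_eq mult.commute)
  qed
  have main: "local_system s ka nu ga C ta h Xi"
   if ta: "ta >= T" and n: "net h Xi" and hH: "h <= Min {H1, H2, H3, H4, exp (- 1), 1 / (E + 1)}" and sp: "sep ka h Xi" for ta h Xi
  proof -
   have h: "0 < h" "h <= H1" "h <= H2" "h <= H3" "h <= H4" "h <= exp (- 1)" "h <= 1 / (E + 1)" "h <= 1" and fin: "finite Xi" and Xi: "Xi \<subseteq> S2"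
    using n hH H1 by (auto simp: net_def)
   define J where "J = ga * sqrt ta"
   define L where "L = - ln h"
   define R where "R = ka * sqrt ta / 64 * (h * L)"
   have L: "1 <= L" unfolding L_def using h(1,6) ln_mono[of h "exp (- 1)"] by simp
   have J3: "2 * real s + 3 <= J" unfolding J_def by (rule J[OF ta])
   have sqta: "64 <= sqrt ta" using T(1) ta by (intro real_le_rsqrt) simp
   have ta0: "0 <= ta" using T(1) ta by linarith
   have Eh: "E * h <= 1" using h(7) E0 h(1) by (simp add: field_simps)
   obtain al P where P: "!!xi. P xi : spherical_harmonics s" and al: "!!xi. moments s Xi (al xi)"
    and lag: "!!xi et. et : Xi ==> pot s Xi (al xi) (P xi) et = (if et = xi then 1 else 0)"
    using interp[OF n h(3), of "%et. if et = _ then 1 else 0"] by metis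
   have adm: "admissible s q Xi (al xi) (P xi)" for xi by (rule admissibleI[OF g Xi P al])
   note dec = decay[OF n h(2) sp adm _ lag]
   obtain pj where pj: "pj ` Z \<subseteq> Xi" and "ALL x:S2. EX mu. (SUM z:Z. \<bar>mu z\<bar>) <= M & (ALL r:spherical_harmonics s. r x = (SUM z:Z. mu z * r (pj z)))"
    using repro[OF n h(5)] by blast
   then obtain mu where mu: "!!x. x : S2 ==> (SUM z:Z. \<bar>mu x z\<bar>) <= M"
    "!!x r. x : S2 ==> r : spherical_harmonics s ==> r x = (SUM z:Z. mu x z * r (pj z))" by metis
   define far where "far xi = {et:Xi. \<not> norm (et - xi) <= R}" for xi
   define A where "A xi ze = (if norm (ze - xi) <= R then al xi ze else 0) + (SUM et:far xi. SUM z:Z. if pj z = ze then al xi et * mu et z else 0)" for xi ze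
   have ffar: "finite (far xi)" for xi using fin by (simp add: far_def)
   \<comment> \<open>Paired with any F, the new coefficients differ from the old ones by the
     reproduction errors of F at far nodes: 0 for harmonics, bounded for the kernel.\<close>
   have Asum: "(SUM ze:Xi. A xi ze * F ze) = (SUM ze:Xi. al xi ze * F ze) + (SUM et:far xi. al xi et * ((SUM z:Z. mu et z * F (pj z)) - F et))" for xi F
   proof -
    have "(SUM ze:Xi. (if norm (ze - xi) <= R then al xi ze else 0) * F ze) = (SUM ze:Xi. al xi ze * F ze) - (SUM et:far xi. al xi et * F et)"
     using fin by (simp add: far_def sum.inter_filter sum_subtractf[symmetric] if_distrib[of "%t. t * _"] cong: if_cong) (rule sum.cong; simp)
    moreover have "(SUM ze:Xi. (SUM et:far xi. SUM z:Z. if pj z = ze then al xi et * mu et z else 0) * F ze) = (SUM et:far xi. al xi et * (SUM z:Z. mu et z * F (pj z)))"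
    proof -
     have "(SUM ze:Xi. (SUM et:far xi. SUM z:Z. if pj z = ze then al xi et * mu et z else 0) * F ze)
      = (SUM ze:Xi. SUM et:far xi. SUM z:Z. if pj z = ze then al xi et * mu et z * F (pj z) else 0)"
      unfolding sum_distrib_right by (intro sum.cong refl) auto
     also have "... = (SUM et:far xi. SUM z:Z. SUM ze:Xi. if pj z = ze then al xi et * mu et z * F (pj z) else 0)"
      by (subst sum.swap) (intro sum.cong refl sum.swap)
     also have "... = (SUM et:far xi. SUM z:Z. al xi et * mu et z * F (pj z))"
      using pj fin by (intro sum.cong refl) (auto simp: image_subset_iff)
     finally show ?thesis by (simp add: sum_distrib_left mult.assoc)
    qed
    ultimately show ?thesis by (simp add: A_def distrib_right sum.distrib right_diff_distrib sum_subtractf)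
   qed
   have farS: "et : S2" "et : Xi" if "et : far xi" for xi et using that Xi by (auto simp: far_def)
   have momA: "moments s Xi (A xi)" for xi
   proof
    fix r assume r: "r : spherical_harmonics s"
    show "(SUM ze:Xi. A xi ze * r ze) = 0" unfolding Asum using al r mu(2)[OF _ r] farS by simp
   qed
   have hJ: "h powr J <= h ^ 5"
   proof -
    have "h powr J <= h powr (real 5)" using h(1,8) J3 s by (intro powr_mono') auto
    then show ?thesis using h(1) by (simp only: powr_realpow)
   qed
   have trunc: "\<bar>pot s Xi (A xi) (P xi) x - pot s Xi (al xi) (P xi) x\<bar> <= h powr J" if xi: "xi : Xi" and x: "x : S2" for xi x
   proof -
    have co: "\<bar>al xi et\<bar> <= C1 / h ^ (2 * s) * h powr (2 * J)" if et: "et : far xi" for et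
    proof -
     have "R / h <= norm (et - xi) / h" using et h(1) by (intro divide_right_mono) (auto simp: far_def)
     then have "nu * (R / h) <= nu * (norm (et - xi) / h)" using nu by (intro mult_left_mono) auto
     moreover have "nu * (R / h) = - (2 * J * ln h)" using h(1) by (simp add: R_def J_def ga_def L_def)
     ultimately have "exp (- nu * (norm (et - xi) / h)) <= h powr (2 * J)" using h(1) by (simp add: powr_def)
     then have "C1 / h ^ (2 * s) * exp (- nu * (norm (et - xi) / h)) <= C1 / h ^ (2 * s) * h powr (2 * J)"
      using C1 h(1) by (intro mult_left_mono) auto
     then show ?thesis using dec[OF xi _ x farS(2)[OF et]] by fastforce
    qed
    have kb: "\<bar>surface_spline s x y\<bar> <= 9 * 3 ^ s" if "y : S2" for y by (rule surface_spline_bounded[OF s x that])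
    have fb: "\<bar>(SUM z:Z. mu et z * surface_spline s x (pj z)) - surface_spline s x et\<bar> <= B" if et: "et : far xi" for et
    proof -
     have "\<bar>SUM z:Z. mu et z * surface_spline s x (pj z)\<bar> <= (SUM z:Z. \<bar>mu et z\<bar> * (9 * 3 ^ s))"
      using pj Xi by (intro order_trans[OF sum_abs] sum_mono) (auto simp: abs_mult intro!: mult_left_mono kb)
     also have "... = (SUM z:Z. \<bar>mu et z\<bar>) * (9 * 3 ^ s)" by (simp only: sum_distrib_right)
     also have "... <= M * (9 * 3 ^ s)" using mu(1)[OF farS(1)[OF et]] by (intro mult_right_mono) auto
     finally show ?thesis using kb[OF farS(1)[OF et]] unfolding B_def distrib_right by linarith
    qed
    have N: "real (card (far xi)) * (ka * h)^2 <= 512"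
    proof -
     have "card (far xi) <= card Xi" using fin by (intro card_mono) (auto simp: far_def)
     then have "real (card (far xi)) * (ka * h)^2 <= real (card Xi) * (ka * h)^2" by (intro mult_right_mono) auto
     then show ?thesis using packing(3)[OF fin Xi sp ka h(1,8)] by linarith
    qed
    have "pot s Xi (A xi) (P xi) x - pot s Xi (al xi) (P xi) x
     = (SUM et:far xi. al xi et * ((SUM z:Z. mu et z * surface_spline s x (pj z)) - surface_spline s x et))"
     by (simp add: pot_def Asum)
    also have "\<bar>...\<bar> <= (SUM et:far xi. (C1 / h ^ (2 * s) * h powr (2 * J)) * B)"
    proof (intro order_trans[OF sum_abs] sum_mono)
     fix et assume "et : far xi"
     then show "\<bar>al xi et * ((SUM z:Z. mu et z * surface_spline s x (pj z)) - surface_spline s x et)\<bar> <= (C1 / h ^ (2 * s) * h powr (2 * J)) * B"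
      unfolding abs_mult using co fb C1 h(1) by (intro mult_mono) auto
    qed
    also have "... = (real (card (far xi)) * (ka * h)^2) * ((C1 * B) * (h powr (2 * J) / (h ^ (2 * s) * (ka * h)^2)))"
     using h(1) ka by (simp add: field_simps)
    also have "... <= 512 * ((C1 * B) * (h powr (2 * J) / (h ^ (2 * s) * (ka * h)^2)))"
     using C1 B0 h(1) ka by (intro mult_right_mono[OF N] mult_nonneg_nonneg divide_nonneg_pos) auto
    also have "... = E * (h powr (2 * J) / h ^ (2 * s + 2))"
     using h(1) ka by (simp add: E_def power_mult_distrib power_add power2_eq_square mult_ac)
    also have "h powr (2 * J) / h ^ (2 * s + 2) = h powr (2 * J - real (2 * s + 2))"
     using h(1) by (simp only: powr_diff powr_realpow)
    \<comment> \<open>2 J - (2 s + 2) is at least 1 + J by the choice of T; the extra power of h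
      absorbs E.\<close>
    also have "E * ... <= E * h powr (1 + J)"
     using J3 E0 h(1,8) by (intro mult_left_mono powr_mono') auto
    also have "... = (E * h) * h powr J" using h(1) by (simp add: powr_add)
    also have "... <= 1 * h powr J" by (rule mult_right_mono[OF Eh]) simp
    finally show ?thesis by simp
   qed
   \<comment> \<open>Nonzero coefficients sit within R of xi or at the nodes \<open>pj z\<close>;
     each group receives half of ta L^2, and L is at most ln N by \<open>cover_card\<close>.\<close>
   have cardA: "real (card {ze:Xi. A xi ze ~= 0}) <= ta * (ln (real (card Xi)))^2" if xi: "xi : Xi" for xi
   proof -
    let ?N = "{ze:Xi. norm (ze - xi) <= R}"
    have "ze : ?N \<union> pj ` Z" if "ze : Xi" "A xi ze ~= 0" for ze
    proof (rule ccontr)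
     assume "ze \<notin> ?N \<union> pj ` Z"
     then have "\<not> norm (ze - xi) <= R" "!!z. z : Z ==> pj z ~= ze" using that(1) by auto
     then show False using that(2) by (simp add: A_def)
    qed
    then have "card {ze:Xi. A xi ze ~= 0} <= card (?N \<union> pj ` Z)" using fin fZ by (intro card_mono) auto
    also have "... <= card ?N + card Z" by (intro order_trans[OF card_Un_le] add_left_mono card_image_le fZ)
    finally have "real (card {ze:Xi. A xi ze ~= 0}) <= real (card ?N) + real (card Z)" by linarith
    moreover have "real (card ?N) <= ta / 2 * L^2"
    proof -
     have "real (card ?N) <= 512 * (R / (ka * h) + 1)^2"
      using xi Xi ka h(1) L ta0 by (intro packing(2)[OF fin Xi sp ka h(1,8)]) (auto simp: R_def)
     also have "R / (ka * h) + 1 = sqrt ta * L / 64 + 1" using ka h(1) by (simp add: R_def)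
     also have "512 * (sqrt ta * L / 64 + 1)^2 <= 512 * (sqrt ta * L / 32)^2"
     proof (intro mult_left_mono power_mono)
      have "64 * 1 <= sqrt ta * L" using sqta L ta0 by (intro mult_mono) auto
      then show "sqrt ta * L / 64 + 1 <= sqrt ta * L / 32" by linarith
     qed (use ta0 L in auto)
     also have "... = ta / 2 * L^2" using ta0 by (simp add: power_mult_distrib power_divide)
     finally show ?thesis .
    qed
    moreover have "real (card Z) <= ta / 2 * L^2"
    proof -
     have "(ta / 2) * 1 <= ta / 2 * L^2" using ta0 L by (intro mult_left_mono one_le_power) auto
     then show ?thesis using T(2) ta by linarith
    qed
    moreover have "ta * L^2 <= ta * (ln (real (card Xi)))^2"
    proof -
     have c: "1 <= real (card Xi) * h^2" using n by (intro cover_card) (auto simp: net_def)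
     also have "... <= real (card Xi) * h" using h(1,8) by (intro mult_left_mono) (auto simp: power2_eq_square mult_left_le)
     finally have "inverse h <= real (card Xi)" using h(1) by (simp add: field_simps)
     then have "ln (inverse h) <= ln (real (card Xi))" using h(1) by (intro ln_mono) auto
     then have "L <= ln (real (card Xi))" using h(1) by (simp add: L_def ln_inverse)
     then show ?thesis using L ta0 by (intro mult_left_mono power_mono) auto
    qed
    ultimately show ?thesis by linarith
   qed
   have final: "\<bar>pot s Xi (A xi) (P xi) x\<bar> <= C * exp (- nu * (norm (x - xi) / h)) + h powr J
    & \<bar>pot s Xi (A xi) (P xi) x - cutoff (ka * h) xi x\<bar> <= (C * sqrt (norm (x - ze) / h) + 25 * h) * Vw h xi x"
    if xi: "xi : Xi" and x: "x : S2" and ze: "ze : Xi" for xi x ze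
   proof -
    let ?e = "exp (- nu * (norm (x - xi) / h))" and ?V = "Vw h xi x" and ?s = "sqrt (norm (x - ze) / h)"
    note d = dec[OF xi _ x ze] and t = trunc[OF xi x]
    have "C1 * ?e <= C * ?e" using C1 C2(1) by (intro mult_right_mono) (auto simp: C_def)
    moreover have "C1 * ?s * ?e <= C1 * ?s * (C2 * ?V)" using C1 h(1) by (intro mult_left_mono C2(2)) auto
    moreover have "C1 * ?s * (C2 * ?V) <= C * ?s * ?V"
     using C1 h(1) less_imp_le[OF Vw_pos[of h xi x]] mult_right_mono[of "C1 * C2" C "?s * ?V"] by (simp add: C_def mult_ac)
    moreover have "h powr J <= 25 * h * ?V"
    proof -
     have "h * h ^ 4 <= h * (25 * ?V)" using xi Xi x h(1,8) by (intro mult_left_mono h4_le_Vw) auto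
     then show ?thesis using hJ by (simp add: eval_nat_numeral mult_ac)
    qed
    ultimately show ?thesis using d t unfolding distrib_right by (smt (verit))
   qed
   \<comment> \<open>The difference between f and its Lagrange interpolant lies in the kernel space
     and vanishes on the nodes, so unisolvence makes it 0.\<close>
   have span: "kernel_space s (surface_spline s) Xi \<subseteq> fv.span ((%xi. kfun s Xi (al xi) (P xi)) ` Xi)"
   proof
    fix f assume f: "f : kernel_space s (surface_spline s) Xi"
    let ?lg = "%xi. kfun s Xi (al xi) (P xi)"
    have lg: "?lg xi : kernel_space s (surface_spline s) Xi" for xi unfolding kernel_space_eq using P al by blast
    let ?g = "f - (SUM xi:Xi. (%x. f xi * ?lg xi x))"
    have "?g : kernel_space s (surface_spline s) Xi"
     by (intro fun_vs.subspace_diff[OF subspace_kernel_space] fun_vs.subspace_sum[OF subspace_kernel_space] fun_vs.subspace_scale[OF subspace_kernel_space] f lg)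
    then obtain a p where gp: "?g = kfun s Xi a p" "p : spherical_harmonics s" "moments s Xi a" by (auto simp: kernel_space_eq)
    have "pot s Xi a p et = 0" if et: "et : Xi" for et
    proof -
     have "pot s Xi a p et = ?g et" using gp(1) kfun_eq[of et] et Xi by auto
     also have "... = f et - (SUM xi:Xi. if xi = et then f xi else 0)"
      using et Xi by (auto simp: sum_fun_apply kfun_eq lag subset_iff intro!: sum.cong)
     finally show ?thesis using et fin by simp
    qed
    then have ap: "ALL xi:Xi. a xi = 0" "ALL x:S2. p x = 0" using zero[OF n h(4) admissibleI[OF g Xi gp(2,3)]] by auto
    then have "p = 0" using spherical_harmonics_outside[OF gp(2)] by (auto simp: fun_eq_iff)
    then have "?g = 0" unfolding gp(1) using ap by (auto simp: kfun_def sphere_restrict_def fun_eq_iff)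
    have fe: "f = (%x. SUM xi:Xi. f xi * ?lg xi x)"
    proof
     fix x
     have "?g x = 0" using \<open>?g = 0\<close> by (simp only: zero_fun_def)
     then show "f x = (SUM xi:Xi. f xi * ?lg xi x)" by (simp add: sum_fun_apply)
    qed
    show "f : fv.span (?lg ` Xi)" by (subst fe) (rule family_in_span)
   qed
   show ?thesis unfolding local_system_def J_def[symmetric]
   proof (rule exI[of _ A], rule exI[of _ P], rule exI[of _ "%xi. kfun s Xi (al xi) (P xi)"], intro conjI span ballI[where A = Xi] P momA)
    fix xi assume xi: "xi : Xi"
    show "real (card {ze:Xi. A xi ze ~= 0}) <= ta * (ln (real (card Xi)))^2" by (rule cardA[OF xi])
    show "ALL x:S2. \<bar>pot s Xi (A xi) (P xi) x\<bar> <= C * exp (- nu * (norm (x - xi) / h)) + h powr J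
     & (ALL ze:Xi. \<bar>pot s Xi (A xi) (P xi) x - cutoff (ka * h) xi x\<bar> <= (C * sqrt (norm (x - ze) / h) + 25 * h) * Vw h xi x)"
     using final[OF xi _ xi] final[OF xi] by blast
   qed
  qed
  have T0: "T > 0" and C0: "C > 0" using T C1 C2(1) by (auto simp: C_def intro!: add_pos_pos)
  show thesis
  proof (rule that[OF nu ga T0 C0 J])
   fix ta :: real assume ta: "ta >= T"
   let ?H = "Min {H1, H2, H3, H4, exp (- 1), 1 / (E + 1)}"
   have "?H > 0" "?H <= 1" using H1 H2 H3 H4 E0 by (auto intro!: min.coboundedI1)
   then show "EX H>0. H <= 1 & (ALL h Xi. net h Xi --> h <= H --> sep ka h Xi --> local_system s ka nu ga C ta h Xi)"
    using main[OF ta] by (intro exI[of _ ?H] conjI allI impI)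
  qed assumption
 qed
qed

section \<open>Norm equivalence\<close>

text \<open>Jensen's inequality when the total weight is only bounded by W. Dividing by W amounts to
  placing the missing mass at 0; the tangent line at k gives the inequality, and p >= 1 fixes the
  sign of the leftover term.\<close>

lemma powr_sum_le:
 fixes w u :: "'i => real"
 assumes fin: "finite I" and w: "!!i. i : I ==> 0 <= w i" and u: "!!i. i : I ==> 0 <= u i" and p: "p >= 1" and W: "(SUM i:I. w i) <= W" "0 < W"
 shows "(SUM i:I. w i * u i) powr p <= W powr (p - 1) * (SUM i:I. w i * u i powr p)"
proof -
 define k where "k = (SUM i:I. w i * u i) / W"
 have Wk: "(SUM i:I. w i * u i) = W * k" using W by (simp add: k_def)
 have c: "0 <= k" unfolding k_def using w u W by (intro divide_nonneg_pos sum_nonneg mult_nonneg_nonneg) auto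
 have tangent: "c powr p + p * c powr (p - 1) * (x - c) <= x powr p" if x: "0 <= x" and c: "0 < c" for x c :: real
 proof (cases "x = 0")
  case True
  have "c powr p = c powr (p - 1) * c" using c powr_add[of c "p - 1" 1] by simp
  then have "c powr p + p * c powr (p - 1) * (x - c) = (1 - p) * c powr p" using True by (simp add: algebra_simps)
  also have "... <= 0" using p by (intro mult_nonpos_nonneg) auto
  finally show ?thesis using x by (metis order_trans powr_ge_zero)
 next
  case False
  then have "p * c powr (p - 1) * (x - c) <= x powr p - c powr p"
   using x c by (intro convex_on_imp_above_tangent[OF powr_convex[OF p]]) (auto intro!: derivative_eq_intros simp: interior_open at_within_open[of _ "{0<..}"])
  then show ?thesis by simp
 qed
 show ?thesis
 proof (cases "k = 0")
  case True
  then have "(SUM i:I. w i * u i) = 0" using Wk by simp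
  then show ?thesis using w by (simp add: sum_nonneg)
 next
  case False
  have c0: "0 < k" by (rule order_le_neq_trans[OF c not_sym[OF False]])
  have "(SUM i:I. w i * u i) powr p = W powr (p - 1) * (W * k powr p)"
  proof -
   have "(SUM i:I. w i * u i) powr p = (W * k) powr p" unfolding Wk ..
   also have "... = W powr p * k powr p" using W c by (simp only: powr_mult)
   also have "W powr p = W powr (p - 1) * W" using W(2) powr_add[of W "p - 1" 1] by simp
   finally show ?thesis by simp
  qed
  also have "W * k powr p <= (SUM i:I. w i * u i powr p)"
  proof -
   have "(SUM i:I. w i * (k powr p + p * k powr (p - 1) * (u i - k))) <= (SUM i:I. w i * u i powr p)"
    using w u c0 by (intro sum_mono mult_left_mono tangent) auto
   also have "(SUM i:I. w i * (k powr p + p * k powr (p - 1) * (u i - k)))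
    = (SUM i:I. w i) * (k powr p - p * k powr (p - 1) * k) + p * k powr (p - 1) * (SUM i:I. w i * u i)"
    by (simp only: sum_distrib_left sum_distrib_right sum.distrib[symmetric]) (simp add: algebra_simps)
   also note Wk
   finally have *: "(SUM i:I. w i) * (k powr p - p * k powr (p - 1) * k) + p * k powr (p - 1) * (W * k) <= (SUM i:I. w i * u i powr p)" .
   have e: "k powr (p - 1) * k = k powr p" using c0 powr_add[of k "p - 1" 1] by simp
   have "(k powr p - p * (k powr (p - 1) * k)) = - ((p - 1) * k powr p)" unfolding e by (simp add: algebra_simps)
   moreover have "(SUM i:I. w i) * ((p - 1) * k powr p) <= W * ((p - 1) * k powr p)" using W p by (intro mult_right_mono) auto
   moreover have "p * k powr (p - 1) * (W * k) = W * (p * k powr p)" unfolding e[symmetric] by (simp only: mult_ac)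
   ultimately have "W * (p * k powr p) - W * ((p - 1) * k powr p) <= (SUM i:I. w i * u i powr p)" using * by (simp only: mult.assoc mult_minus_right)
   then show ?thesis by (simp add: algebra_simps)
  qed
  finally show ?thesis using mult_left_mono[of _ _ "W powr (p - 1)"] by simp
 qed
qed

text \<open>On a small cap around a node the combination determines that node's coefficient up to ep
  times a sum of envelopes, and B bounds the row and column sums of the envelope matrix. The
  condition on ep makes the error absorbable for all p at once.\<close>

lemma frame_bounds:
 fixes b :: "real^3 => real^3 => real"
 assumes fin: "finite Xi" and ne: "Xi ~= {}" and Xi: "Xi \<subseteq> S2" and sp: "sep ka h Xi" and ka: "0 < ka" "ka <= 1" and h: "0 < h" "h <= 1" and a: "0 < a" "a <= (ka * h)^2 / 2"
  and cont: "ALL xi:Xi. continuous_on S2 (b xi)"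
  and up: "ALL xi:Xi. ALL x:S2. \<bar>b xi x\<bar> <= C * Vw h xi x" and C: "0 <= C"
  and lo: "ALL xi:Xi. ALL ze:Xi. ALL x:cap ze a. (if xi = ze then 1 / 2 <= b xi x + ep * Vw h xi x else \<bar>b xi x\<bar> <= ep * Vw h xi x)"
  and ep: "0 <= ep" "72 * ep * (1152 / ka^2) <= 1"
 defines "S d x \<equiv> SUM xi:Xi. d xi * b xi x" and "B \<equiv> 1152 / ka^2"
 shows "(!!xi. xi : Xi ==> \<bar>d xi\<bar> <= D) ==> x : S2 ==> \<bar>S d x\<bar> <= C * B * D"
  "(!!x. x : S2 ==> \<bar>S d x\<bar> <= D) ==> ze : Xi ==> \<bar>d ze\<bar> <= 4 * D"
  "p >= 1 ==> (SI x. \<bar>S d x\<bar> powr p) <= (C * B) powr p * (area * h^2) * (SUM xi:Xi. \<bar>d xi\<bar> powr p)"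
  "p >= 1 ==> (SUM xi:Xi. \<bar>d xi\<bar> powr p) * (area * a / 256) <= 2 * 4 powr p * (SI x. \<bar>S d x\<bar> powr p)"
proof -
 note cont = cont[rule_format] and up = up[rule_format] and lo = lo[rule_format]
 have B: "1 <= B" using ka power_le_one[of ka 2] by (simp add: B_def)
 have kh: "0 < ka * h" "ka * h <= h" using ka h mult_right_mono[OF ka(2), of h] by auto
 have kh2: "(ka * h)^2 <= h^2" using kh by (intro power_mono) auto
 have a2: "a <= 2" using a(2) kh2 power_le_one[of h 2] h by simp
 have VB: "(SUM xi:Xi. Vw h xi x) <= B" if "x : S2" for x using packing(1)[OF fin Xi sp ka h that] by (simp add: B_def)
 have V0: "0 <= Vw h xi x" for xi x using Vw_pos[of h xi x] by simp
 have Su: "\<bar>S d x\<bar> <= C * (SUM xi:Xi. Vw h xi x * \<bar>d xi\<bar>)" if x: "x : S2" for d x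
 proof -
  have "\<bar>S d x\<bar> <= (SUM xi:Xi. \<bar>d xi\<bar> * (C * Vw h xi x))"
   unfolding S_def by (rule order_trans[OF sum_abs]) (auto simp: abs_mult intro!: sum_mono mult_left_mono up x)
  then show ?thesis by (simp add: sum_distrib_left mult_ac)
 qed
 define T where "T d ze = (SUM xi:Xi. Vw h xi ze * \<bar>d xi\<bar>)" for d ze
 have T0: "0 <= T d ze" for d ze unfolding T_def by (intro sum_nonneg mult_nonneg_nonneg V0) auto
 have TD: "T d x <= B * D" if "!!xi. xi : Xi ==> \<bar>d xi\<bar> <= D" "x : S2" "0 <= D" for d x D
 proof -
  have "T d x <= (SUM xi:Xi. Vw h xi x) * D" unfolding T_def sum_distrib_right using that(1) by (intro sum_mono mult_left_mono V0) auto
  also have "... <= B * D" using VB[OF that(2)] that(3) by (rule mult_right_mono)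
  finally show ?thesis .
 qed
 \<comment> \<open>\<open>Vw_near\<close> moves the envelopes from x to ze at the price of 9, so the
   error term \<open>T d ze\<close> is constant on the cap and can be summed over nodes.\<close>
 have low: "\<bar>d ze\<bar> <= 2 * \<bar>S d x\<bar> + 18 * ep * T d ze" if ze: "ze : Xi" and x: "x : cap ze a" for d ze x
 proof -
  have xS: "x : S2" and xz: "norm (x - ze) <= h"
  proof -
   show xS: "x : S2" using x by (simp add: cap_def)
   show "norm (x - ze) <= h"
   proof (rule power2_le_imp_le)
    show "(norm (x - ze))^2 <= h^2" using x a(2) kh2 S2_norm_diff[OF xS, of ze] ze Xi by (auto simp: cap_def)
   qed (use h in simp)
  qed
  have "S d x = d ze * b ze x + (SUM xi:Xi - {ze}. d xi * b xi x)" unfolding S_def using fin ze by (simp add: sum.remove)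
  then have "\<bar>d ze * b ze x\<bar> <= \<bar>S d x\<bar> + \<bar>SUM xi:Xi - {ze}. d xi * b xi x\<bar>" by linarith
  also have "\<bar>SUM xi:Xi - {ze}. d xi * b xi x\<bar> <= (SUM xi:Xi - {ze}. ep * (Vw h xi x * \<bar>d xi\<bar>))"
  proof (rule order_trans[OF sum_abs], rule sum_mono)
   fix xi assume "xi : Xi - {ze}"
   then have "\<bar>b xi x\<bar> <= ep * Vw h xi x" using lo[of xi ze x] ze x by auto
   then have "\<bar>d xi\<bar> * \<bar>b xi x\<bar> <= \<bar>d xi\<bar> * (ep * Vw h xi x)" by (rule mult_left_mono) simp
   then show "\<bar>d xi * b xi x\<bar> <= ep * (Vw h xi x * \<bar>d xi\<bar>)" by (simp add: abs_mult mult_ac)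
  qed
  finally have 1: "\<bar>d ze * b ze x\<bar> <= \<bar>S d x\<bar> + (SUM xi:Xi - {ze}. ep * (Vw h xi x * \<bar>d xi\<bar>))" by simp
  have "1 / 2 <= b ze x + ep * Vw h ze x" using lo[OF ze ze x] by simp
  then have "\<bar>d ze\<bar> * (1 / 2) <= \<bar>d ze\<bar> * (\<bar>b ze x\<bar> + ep * Vw h ze x)" by (intro mult_left_mono) auto
  then have "\<bar>d ze\<bar> / 2 <= \<bar>d ze * b ze x\<bar> + ep * (Vw h ze x * \<bar>d ze\<bar>)" by (simp add: abs_mult distrib_left mult_ac)
  also have "... <= \<bar>S d x\<bar> + (SUM xi:Xi. ep * (Vw h xi x * \<bar>d xi\<bar>))" using 1 fin ze by (simp add: sum.remove[of Xi ze])
  also have "(SUM xi:Xi. ep * (Vw h xi x * \<bar>d xi\<bar>)) <= (SUM xi:Xi. ep * ((9 * Vw h xi ze) * \<bar>d xi\<bar>))"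
   using ep(1) by (intro sum_mono mult_left_mono mult_right_mono Vw_near[OF h(1) xz]) auto
  also have "... = 9 * ep * T d ze" by (simp add: T_def sum_distrib_left mult_ac)
  finally show ?thesis by linarith
 qed
 { assume d: "!!xi. xi : Xi ==> \<bar>d xi\<bar> <= D" and x: "x : S2"
  then have "0 <= D" using ne by (meson abs_ge_zero all_not_in_conv order_trans)
  then have "T d x <= B * D" by (intro TD d x)
  then show "\<bar>S d x\<bar> <= C * B * D" using Su[OF x, of d] mult_left_mono[of "T d x" "B * D" C] C unfolding T_def by (simp add: mult.assoc) }
 { assume d: "!!x. x : S2 ==> \<bar>S d x\<bar> <= D" and ze: "ze : Xi"
  define m where "m = Max ((%xi. \<bar>d xi\<bar>) ` Xi)"
  have m: "\<bar>d xi\<bar> <= m" if "xi : Xi" for xi unfolding m_def using fin that by simp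
  have "m : (%xi. \<bar>d xi\<bar>) ` Xi" unfolding m_def using fin ze by (intro Max_in) auto
  then obtain et where et: "et : Xi" "m = \<bar>d et\<bar>" by auto
  have etS: "et : S2" using et Xi by auto
  have "et : cap et a" using etS a by (simp add: cap_def)
  from low[OF et(1) this, of d] have "m <= 2 * D + 18 * ep * T d et" using d[OF etS] et(2) by linarith
  also have "18 * ep * T d et <= 18 * ep * (B * m)" using ep(1) et(2) by (intro mult_left_mono TD m etS) auto
  also have "... = (72 * ep * B) * (m / 4)" by simp
  also have "... <= 1 * (m / 4)" using ep(2) et(2) unfolding B_def by (intro mult_right_mono) auto
  finally have "m <= 4 * D" using et(2) by linarith
  then show "\<bar>d ze\<bar> <= 4 * D" using m[OF ze] by linarith }
 { assume p: "p >= 1"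
  have cS: "continuous_on S2 (%x. \<bar>S d x\<bar> powr p)" unfolding S_def using p
   by (intro continuous_on_powr' continuous_on_rabs continuous_on_sum continuous_on_mult_left cont continuous_on_const) auto
  have Bp: "B * B powr (p - 1) = B powr p" using B powr_add[of B 1 "p - 1"] by simp
  have "(SI x. \<bar>S d x\<bar> powr p) <= (SI x. (SUM xi:Xi. (C powr p * B powr (p - 1) * \<bar>d xi\<bar> powr p) * Vw h xi x))"
  proof (rule integral_mono[OF int_cont[OF cS]])
   show "integrable sgm (%x. SUM xi:Xi. (C powr p * B powr (p - 1) * \<bar>d xi\<bar> powr p) * Vw h xi x)"
    by (intro int_cont continuous_on_sum continuous_on_mult_left continuous_Vw)
   fix x assume "x : space sgm"
   then have x: "x : S2" by simp
   have "\<bar>S d x\<bar> powr p <= (C * T d x) powr p" using Su[OF x, of d] p unfolding T_def by (intro powr_mono2) auto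
   also have "... = C powr p * T d x powr p" using C T0 by (simp add: powr_mult)
   also have "... <= C powr p * (B powr (p - 1) * (SUM xi:Xi. Vw h xi x * \<bar>d xi\<bar> powr p))"
    unfolding T_def using B by (intro mult_left_mono powr_sum_le fin V0 p VB x) auto
   finally show "\<bar>S d x\<bar> powr p <= (SUM xi:Xi. (C powr p * B powr (p - 1) * \<bar>d xi\<bar> powr p) * Vw h xi x)"
    by (simp add: sum_distrib_left mult_ac)
  qed
  also have "... = (SUM xi:Xi. (C powr p * B powr (p - 1) * \<bar>d xi\<bar> powr p) * (SI x. Vw h xi x))"
   by (subst Bochner_Integration.integral_sum) (auto intro!: int_cont continuous_on_mult_left continuous_Vw)
  also have "... <= (SUM xi:Xi. (C powr p * B powr (p - 1) * \<bar>d xi\<bar> powr p) * (area * h^2 / 4))"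
   using Xi by (intro sum_mono mult_left_mono integral_Vw h(1)) auto
  also have "... = C powr p * B powr (p - 1) * (area * h^2 / 4) * (SUM xi:Xi. \<bar>d xi\<bar> powr p)" by (simp add: sum_distrib_left mult_ac)
  also have "... <= (C * B) powr p * (area * h^2) * (SUM xi:Xi. \<bar>d xi\<bar> powr p)"
  proof -
   have "B powr (p - 1) <= B powr p" using B by (intro powr_mono) auto
   then have "C powr p * B powr (p - 1) <= (C * B) powr p" using C B by (simp add: powr_mult mult_left_mono)
   moreover have "area * h^2 / 4 <= area * h^2" using area_pos by simp
   ultimately show ?thesis using area_pos by (intro mult_right_mono mult_mono sum_nonneg) auto
  qed
  finally show "(SI x. \<bar>S d x\<bar> powr p) <= (C * B) powr p * (area * h^2) * (SUM xi:Xi. \<bar>d xi\<bar> powr p)" .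
  let ?Q = "SUM xi:Xi. \<bar>d xi\<bar> powr p" and ?m = "area * a / 256"
  have Q0: "0 <= ?Q" by (intro sum_nonneg) auto
  \<comment> \<open>A sum of two terms is at most twice their maximum, so p-th powers separate and
    18 ep becomes 36 ep. Schur's test then bounds the sum of the subtracted powers by half of
    \<open>?Q\<close>.\<close>
  define G where "G ze = \<bar>d ze\<bar> powr p - (36 * ep * T d ze) powr p" for ze
  have "(SUM ze:Xi. max 0 (G ze)) * ?m <= (SI x. 4 powr p * \<bar>S d x\<bar> powr p)"
  proof (rule cap_sum[OF fin Xi sp ka(1) h(1) a a2 order_refl])
   show "integrable sgm (%x. 4 powr p * \<bar>S d x\<bar> powr p)" by (intro int_cont continuous_on_mult_left cS)
   fix ze x assume z: "ze : Xi" "x : cap ze a"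
   let ?u = "2 * \<bar>S d x\<bar>" and ?v = "18 * ep * T d ze"
   have v: "0 <= ?v" using ep(1) T0 by simp
   have "\<bar>d ze\<bar> powr p <= (2 * max ?u ?v) powr p" using low[OF z, of d] p by (intro powr_mono2) auto
   also have "... <= (2 * ?u) powr p + (2 * ?v) powr p" by (cases "?u <= ?v") (auto simp: max_def)
   finally have "G ze <= (4 * \<bar>S d x\<bar>) powr p" by (simp add: G_def mult.assoc)
   then show "max 0 (G ze) <= 4 powr p * \<bar>S d x\<bar> powr p" by (simp add: powr_mult)
  qed auto
  also have "... = 4 powr p * (SI x. \<bar>S d x\<bar> powr p)" by simp
  finally have I: "(SUM ze:Xi. max 0 (G ze)) * ?m <= 4 powr p * (SI x. \<bar>S d x\<bar> powr p)" .
  have "(SUM ze:Xi. (36 * ep * T d ze) powr p) <= ?Q / 2"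
  proof -
   have "(SUM ze:Xi. T d ze powr p) <= (SUM ze:Xi. B powr (p - 1) * (SUM xi:Xi. Vw h xi ze * \<bar>d xi\<bar> powr p))"
    unfolding T_def using B Xi by (intro sum_mono powr_sum_le fin V0 p VB) auto
   also have "... = B powr (p - 1) * (SUM xi:Xi. (SUM ze:Xi. Vw h ze xi) * \<bar>d xi\<bar> powr p)"
    unfolding sum_distrib_left[symmetric] sum_distrib_right by (subst sum.swap) (simp add: Vw_commute)
   also have "... <= B powr (p - 1) * (SUM xi:Xi. B * \<bar>d xi\<bar> powr p)"
    using Xi by (intro mult_left_mono sum_mono mult_right_mono VB) auto
   also have "... = B powr p * ?Q" unfolding Bp[symmetric] by (simp add: sum_distrib_left mult_ac)
   finally have TB: "(SUM ze:Xi. T d ze powr p) <= B powr p * ?Q" .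
   have "(SUM ze:Xi. (36 * ep * T d ze) powr p) = (36 * ep) powr p * (SUM ze:Xi. T d ze powr p)"
    unfolding sum_distrib_left using ep(1) T0 by (simp add: powr_mult)
   also have "... <= (36 * ep) powr p * (B powr p * ?Q)" by (intro mult_left_mono TB) auto
   also have "... = (36 * ep * B) powr p * ?Q" using ep(1) B by (simp add: powr_mult)
   also have "... <= (1 / 2) * ?Q"
   proof (rule mult_right_mono[OF _ Q0])
    have "(36 * ep * B) powr p <= (1 / 2) powr p" using ep B p unfolding B_def by (intro powr_mono2) auto
    also have "... <= (1 / 2) powr 1" using p by (intro powr_mono') auto
    finally show "(36 * ep * B) powr p <= 1 / 2" by simp
   qed
   finally show ?thesis by simp
  qed
  then have "?Q / 2 <= (SUM ze:Xi. G ze)" unfolding G_def sum_subtractf by linarith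
  also have "... <= (SUM ze:Xi. max 0 (G ze))" by (intro sum_mono) auto
  finally have "?Q / 2 * ?m <= (SUM ze:Xi. max 0 (G ze)) * ?m" using area_pos a by (intro mult_right_mono) auto
  then show "?Q * ?m <= 2 * 4 powr p * (SI x. \<bar>S d x\<bar> powr p)" using I by linarith }
qed

section \<open>The main theorem\<close>

text \<open>The chord is 2 sin u with u half the arc; sin u >= u - u^3 / 6 and u <= 2 give sin u >=
  u / 3, whence the factor 3.\<close>

lemma geo_dist_bounds:
 assumes "x : S2" "y : S2"
 shows "0 <= geo_dist x y" "geo_dist x y <= pi" "norm (x - y) <= geo_dist x y" "geo_dist x y <= 3 * norm (x - y)"
proof -
 define u where "u = geo_dist x y / 2"
 have b: "- 1 <= x \<bullet> y" "x \<bullet> y <= 1" by (rule S2_inner_bounds[OF assms])+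
 show 0: "0 <= geo_dist x y" "geo_dist x y <= pi" unfolding geo_dist_def using b arccos_lbound arccos_ubound by auto
 have u: "0 <= u" "u <= pi / 2" using 0 by (auto simp: u_def)
 have s: "0 <= sin u" using u by (intro sin_ge_zero) auto
 have "x \<bullet> y = cos (2 * u)" using b by (simp add: u_def geo_dist_def)
 then have "(norm (x - y))^2 = (2 * sin u)^2" unfolding S2_norm_diff[OF assms] cos_double_sin by (simp add: power_mult_distrib)
 then have n: "norm (x - y) = 2 * sin u" by (rule power2_eq_imp_eq) (use s in auto)
 show "norm (x - y) <= geo_dist x y" using sin_x_le_x[OF u(1)] unfolding n by (simp add: u_def)
 have "\<bar>sin u - (SUM m<3. sin_coeff m * u ^ m)\<bar> <= inverse (fact 3) * \<bar>u\<bar> ^ 3" by (rule Maclaurin_sin_bound)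
 moreover have "(SUM m<3. sin_coeff m * u ^ m) = u" by (simp add: numeral_3_eq_3 sin_coeff_def)
 moreover have "inverse (fact 3) * \<bar>u\<bar> ^ 3 <= 2 / 3 * u"
 proof -
  have "u <= 2" using u(2) pi_less_4 by linarith
  then have "u * u <= 2 * 2" using u(1) by (intro mult_mono) auto
  then have "u * u * u <= 4 * u" using u(1) by (intro mult_right_mono) auto
  then show ?thesis using u(1) by (simp add: fact_numeral power3_eq_cube)
 qed
 ultimately have "u / 3 <= sin u" by linarith
 then show "geo_dist x y <= 3 * norm (x - y)" unfolding n by (simp add: u_def)
qed

text \<open>Chords are shorter than arcs, which gives the covering. A fill distance of 0 would make
  the finite set a net for every positive size, against \<open>cover_card\<close>.\<close>

lemma mesh_net:
 assumes fin: "finite Xi" and ne: "Xi ~= {}" and Xi: "Xi \<subseteq> S2" shows "net (fill_distance Xi) Xi"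
proof -
 let ?h = "fill_distance Xi"
 have inf: "EX xi:Xi. (INF xi\<in>Xi. geo_dist x xi) = geo_dist x xi" for x
 proof -
  have "(INF xi\<in>Xi. geo_dist x xi) = Min (geo_dist x ` Xi)" using fin ne by (simp add: cInf_eq_Min)
  also have "... : geo_dist x ` Xi" using fin ne by (intro Min_in) auto
  finally show ?thesis by auto
 qed
 have "bdd_above ((%x. INF xi\<in>Xi. geo_dist x xi) ` S2)"
 proof (rule bdd_aboveI2)
  fix x :: "real^3" assume x: "x : S2"
  obtain xi where xi: "xi : Xi" "(INF xi\<in>Xi. geo_dist x xi) = geo_dist x xi" using inf by blast
  show "(INF xi\<in>Xi. geo_dist x xi) <= pi" unfolding xi(2) using geo_dist_bounds(2)[OF x] xi(1) Xi by auto
 qed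
 then have up: "(INF xi\<in>Xi. geo_dist x xi) <= ?h" if "x : S2" for x unfolding fill_distance_def using that by (rule cSUP_upper2[OF _ _ order_refl])
 have cov: "EX xi:Xi. norm (x - xi) <= ?h" if x: "x : S2" for x
 proof -
  obtain xi where xi: "xi : Xi" "(INF xi\<in>Xi. geo_dist x xi) = geo_dist x xi" using inf by blast
  have "norm (x - xi) <= geo_dist x xi" using xi(1) Xi by (intro geo_dist_bounds x) auto
  then show ?thesis using xi up[OF x] by (intro bexI[of _ xi]) auto
 qed
 have "0 < ?h"
 proof (rule ccontr)
  assume "\<not> 0 < ?h"
  let ?e = "1 / (real (card Xi) + 1)"
  have e: "0 < ?e" "?e <= 1" by auto
  have "1 <= real (card Xi) * ?e^2"
  proof (rule cover_card[OF fin Xi e(1)])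
   fix x :: "real^3" assume "x : S2"
   then obtain xi where "xi : Xi" "norm (x - xi) <= ?h" using cov by blast
   moreover have "?h <= ?e" using \<open>\<not> 0 < ?h\<close> e(1) by linarith
   ultimately show "EX xi:Xi. norm (x - xi) <= ?e" by (meson order_trans)
  qed
  also have "... <= real (card Xi) * ?e"
  proof (rule mult_left_mono)
   show "?e^2 <= ?e" unfolding power2_eq_square by (rule mult_left_le[OF e(2)]) (use e in linarith)
  qed simp
  also have "... < 1" by simp
  finally show False by simp
 qed
 then show ?thesis unfolding net_def using fin Xi cov by blast
qed

text \<open>Chords between nodes are at least 2 q / 3, so 1 - xi . ze is at least 2 q^2 / 9, which
  exceeds 3 (q / 4)^2.\<close>

lemma mesh_sep:
 assumes fin: "finite Xi" and Xi: "Xi \<subseteq> S2" and c: "1 < card Xi"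
 shows "0 < separation_radius Xi" "!!xi ze. xi : Xi ==> ze : Xi ==> xi ~= ze ==> 3 * (separation_radius Xi / 4)^2 <= 1 - xi \<bullet> ze"
proof -
 let ?D = "{geo_dist xi ze | xi ze. xi : Xi & ze : Xi & xi ~= ze}" and ?q = "separation_radius Xi"
 have "?D \<subseteq> (%(xi, ze). geo_dist xi ze) ` (Xi \<times> Xi)" by auto
 then have fD: "finite ?D" using fin finite_subset by blast
 obtain xi ze where "xi : Xi" "ze : Xi" "xi ~= ze" using c fin by (metis One_nat_def card_le_Suc0_iff_eq not_le)
 then have neD: "?D ~= {}" by blast
 have "0 < d" if dD: "d : ?D" for d
 proof -
  obtain xi ze where d: "d = geo_dist xi ze" "xi : Xi" "ze : Xi" "xi ~= ze" using dD by blast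
  then have "norm (xi - ze) <= d" using Xi by (auto intro: geo_dist_bounds(3))
  moreover have "0 < norm (xi - ze)" using d(4) by simp
  ultimately show ?thesis by linarith
 qed
 then have "0 < Min ?D" using fD neD by (subst Min_gr_iff) auto
 then show q: "0 < ?q" by (simp add: separation_radius_def)
 fix xi ze assume z: "xi : Xi" "ze : Xi" "xi ~= ze"
 then have S: "xi : S2" "ze : S2" using Xi by auto
 have "Min ?D <= geo_dist xi ze" using z by (intro Min_le fD) blast
 then have "2 * ?q <= 3 * norm (xi - ze)" using geo_dist_bounds(4)[OF S] by (simp add: separation_radius_def)
 then have "(2 * ?q)^2 <= (3 * norm (xi - ze))^2" using q by (intro power_mono) auto
 then have "4 * ?q^2 <= 18 * (1 - xi \<bullet> ze)" by (simp only: power_mult_distrib S2_norm_diff[OF S]) simp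
 moreover have "3 / 16 * r <= y" if "4 * r <= 18 * y" "0 <= r" for r y :: real using that by linarith
 ultimately have "3 / 16 * ?q^2 <= 1 - xi \<bullet> ze" using zero_le_power2[of ?q] by blast
 then show "3 * (?q / 4)^2 <= 1 - xi \<bullet> ze" by (simp add: power_divide)
qed

text \<open>From ln y <= y - 1 at y = nu (1 + 3 t) / (3 J). The factor 3 anticipates that the
  geodesic distance is at most three chords.\<close>

lemma exp_le_powr:
 fixes nu J t :: real
 assumes "nu > 0" "J > 0" "t >= 0"
 shows "exp (- nu * t) <= exp (nu / 3 - J - J * ln (nu / (3 * J))) * (1 + 3 * t) powr (- J)"
proof -
 let ?l = "nu / (3 * J)"
 have l: "?l > 0" using assms by simp
 have "ln (?l * (1 + 3 * t)) <= ?l * (1 + 3 * t) - 1" using l assms by (intro ln_le_minus_one mult_pos_pos) auto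
 then have "ln ?l + ln (1 + 3 * t) <= ?l * (1 + 3 * t) - 1" using l assms by (simp only: ln_mult_pos)
 then have "J * (ln ?l + ln (1 + 3 * t)) <= J * (?l * (1 + 3 * t) - 1)" using assms by (intro mult_left_mono) auto
 also have "... = nu / 3 + nu * t - J" using assms by (simp add: field_simps)
 finally have "- nu * t <= (nu / 3 - J - J * ln ?l) + (- J) * ln (1 + 3 * t)" by (simp add: algebra_simps)
 then have "exp (- nu * t) <= exp ((nu / 3 - J - J * ln ?l) + (- J) * ln (1 + 3 * t))" by simp
 then show ?thesis using assms unfolding exp_add by (simp add: powr_def)
qed

text \<open>Since 2 * 4^r is at most 8^r, the r-th root of this factor is at most 8 for every
  r.\<close>

lemma Lp_bounds_finite:
 fixes q mu :: real
 assumes r: "1 <= r" and q: "0 < q" and mu: "0 < mu" and M: "0 <= M" "0 <= C" and S: "0 <= S" and I: "0 <= I"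
  and lo: "S * (mu * q^2) <= 2 * 4 powr r * I" and up: "I <= C powr r * (M * q^2) * S"
 shows "mu powr (1 / r) / 8 * q powr (2 / r) * S powr (1 / r) <= I powr (1 / r)"
  "I powr (1 / r) <= C * M powr (1 / r) * q powr (2 / r) * S powr (1 / r)"
proof -
 have q2: "(q^2) powr (1 / r) = q powr (2 / r)" using q powr_powr[of q 2 "1 / r"] by (simp add: powr_numeral)
 have rr: "(x powr r) powr (1 / r) = x" if "0 <= x" for x using that r by (simp add: powr_powr)
 have "2 * 4 powr r <= 2 powr r * 4 powr r" using r powr_mono[of 1 r 2] by (intro mult_right_mono) auto
 also have "... = 8 powr r" by (simp add: powr_mult[symmetric])
 finally have "S * (mu * q^2) <= 8 powr r * I" using lo mult_right_mono[OF _ I] by fastforce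
 then have "(S * (mu * q^2)) powr (1 / r) <= (8 powr r * I) powr (1 / r)" using r S mu q by (intro powr_mono2) auto
 then have "S powr (1 / r) * (mu powr (1 / r) * q powr (2 / r)) <= 8 * I powr (1 / r)"
  using S mu I by (simp add: powr_mult q2 rr)
 then show "mu powr (1 / r) / 8 * q powr (2 / r) * S powr (1 / r) <= I powr (1 / r)" by (simp add: mult_ac)
 have "I powr (1 / r) <= (C powr r * (M * q^2) * S) powr (1 / r)" using r I by (intro powr_mono2 up) auto
 also have "... = C * M powr (1 / r) * q powr (2 / r) * S powr (1 / r)" using M S by (simp add: powr_mult q2 rr)
 finally show "I powr (1 / r) <= C * M powr (1 / r) * q powr (2 / r) * S powr (1 / r)" .
qed

section \<open>Choice of the constants and assembly\<close>

definition localized :: "nat => (real^3) set => real => real => real => (ennreal => real) => (ennreal => real) => (real^3 => real^3 => real) => bool" where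
 "localized s Xi ta J C c1 c2 b \<longleftrightarrow>
  is_basis_family Xi b (kernel_space s (surface_spline s) Xi) &
  (EX A. ALL xi:Xi. (EX p:spherical_harmonics s. b xi = sphere_restrict (%x. SUM ze:Xi. A xi ze * surface_spline s x ze) + p) &
   real (card {ze:Xi. A xi ze ~= 0}) <= ta * (ln (real (card Xi)))^2) &
  (ALL xi:Xi. ALL x:S2. \<bar>b xi x\<bar> <= C * (1 + geo_dist x xi / fill_distance Xi) powr (- J)) &
  (ALL p>=1. ALL a. c1 p * scale_factor (separation_radius Xi) p * lp_norm p Xi a <= Lp_norm p (%x. SUM xi:Xi. a xi * b xi x) &
   Lp_norm p (%x. SUM xi:Xi. a xi * b xi x) <= c2 p * scale_factor (separation_radius Xi) p * lp_norm p Xi a)"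

lemma localized_exists:
 assumes s: "s >= 1" and rh: "rh > 0"
 shows "EX T ga c1 c2. 0 < T & 0 < ga & (ALL p. 0 < c1 p & c1 p <= c2 p) & (ALL ta>=T. EX H E. 0 < H & 0 < E &
  (ALL Xi. finite Xi & Xi ~= {} & Xi \<subseteq> S2 & fill_distance Xi <= H & fill_distance Xi / separation_radius Xi <= rh -->
   (EX b. localized s Xi ta (ga * sqrt ta) E c1 c2 b)))"
proof -
 \<comment> \<open>The bump radius ka h is then at most q / 8 because h <= rh q; the separation
   \<open>far\<close> that follows makes bumps at distinct nodes disjoint.\<close>
 define ka where "ka = min 1 (1 / (8 * rh))"
 have ka: "0 < ka" "ka <= 1" "ka * rh <= 1 / 8" using assms(2) by (auto simp: ka_def min_def field_simps)
 show ?thesis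
 proof (rule localized_basis[OF assms(1) ka(1,2)])
  fix nu ga T C :: real
  assume nu: "nu > 0" and ga: "ga > 0" and T: "T > 0" and C: "C > 0" and J: "!!ta. ta >= T ==> 2 * real s + 3 <= ga * sqrt ta"
   and lb: "!!ta. ta >= T ==> EX H>0. H <= 1 & (ALL h Xi. net h Xi --> h <= H --> sep ka h Xi --> local_system s ka nu ga C ta h Xi)"
  obtain th0 where th0: "th0 > 0" "!!r z x. 0 < r ==> z : S2 ==> x : S2 ==> 1 - x \<bullet> z <= th0 * r^2 ==> 1 / 2 <= cutoff r z x"
   using cutoff_ge_half by blast
  define ep where "ep = 1 / (72 * (1152 / ka^2))"
  \<comment> \<open>On caps of size th (ka h)^2 the bump stays above 1 / 2 by \<open>th0\<close>,
    and 1 / 2 makes the caps disjoint. The fourth power arises because sqrt (|x - ze| / h) is at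
    most the fourth root of 2 th there.\<close>
  define th where "th = min (min th0 (1 / 2)) ((ep / (2 * C)) ^ 4 / 2)"
  \<comment> \<open>25 comes from the truncation term with h <= 1, and 100 from the bump: it lives
    within 3 h of its node, where the envelope is at least 1 / (1 + 9)^2.\<close>
  define C3 where "C3 = C + 125"
  define B where "B = 1152 / ka^2"
  \<comment> \<open>area th ka^2 / 256 is the lower bound of a cap's measure divided by h^2; 8192
    converts h^2 into q^2.\<close>
  define mu where "mu = area * th * ka^2 / 256 / 8192"
  define c1 where "c1 p = (if p = top then 1 / 4 else mu powr (1 / enn2real p) / 8)" for p :: ennreal
  \<comment> \<open>The maximum gives \<open>c1 p <= c2 p\<close> without comparing mu with the
    other constants.\<close>
  define c2 where "c2 p = max (c1 p) (if p = top then C3 * B else C3 * B * (area * rh^2) powr (1 / enn2real p))" for p :: ennreal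
  have ep: "0 < ep" "72 * ep * B <= 1" using ka by (simp_all add: ep_def B_def)
  have th: "0 < th" "th <= th0" "th <= 1 / 2" "2 * th <= (ep / (2 * C)) ^ 4" using th0 ep C by (auto simp: th_def min_def)
  have mu: "0 < mu" using th ka area_pos by (simp add: mu_def)
  have c12: "0 < c1 p & c1 p <= c2 p" for p using mu by (auto simp: c1_def c2_def)
  have "EX H E. 0 < H & 0 < E &
  (ALL Xi. finite Xi & Xi ~= {} & Xi \<subseteq> S2 & fill_distance Xi <= H & fill_distance Xi / separation_radius Xi <= rh -->
   (EX b. localized s Xi ta (ga * sqrt ta) E c1 c2 b))" if ta: "T <= ta" for ta
  proof -
   obtain H0 where H0: "H0 > 0" "H0 <= 1" and lb': "!!h Xi. net h Xi ==> h <= H0 ==> sep ka h Xi ==> local_system s ka nu ga C ta h Xi" using lb[OF ta] by blast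
   define J where "J = ga * sqrt ta"
   have J0: "0 < J" using J[OF ta] by (simp add: J_def)
   \<comment> \<open>5 powr J covers the truncation error h powr J, because h plus a geodesic
     distance is at most 1 + pi < 5.\<close>
   define E where "E = C * exp (nu / 3 - J - J * ln (nu / (3 * J))) + 5 powr J"
   \<comment> \<open>ep / 50 makes the truncation term 25 h at most ep / 2. The bound 1 / 2 forces
     at least four nodes through \<open>cover_card\<close>, so the separation radius is a minimum
     over a nonempty set.\<close>
   define H where "H = min H0 (min (ep / 50) (1 / 2))"
   have H: "0 < H" using H0 ep by (simp add: H_def)
   have E: "0 < E" unfolding E_def using C by (intro add_pos_pos) auto
   have "EX b. localized s Xi ta (ga * sqrt ta) E c1 c2 b"
    if fin: "finite Xi" and ne: "Xi ~= {}" and Xi: "Xi \<subseteq> S2" and hH: "fill_distance Xi <= H"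
     and mesh: "fill_distance Xi / separation_radius Xi <= rh" for Xi
   proof -
    define h q where "h = fill_distance Xi" and "q = separation_radius Xi"
    have n: "net h Xi" unfolding h_def by (rule mesh_net[OF fin ne Xi])
    have h: "0 < h" "h <= H0" "h <= ep / 50" "h <= 1 / 2" "h <= 1" using n hH by (auto simp: net_def h_def H_def)
    have N: "1 <= real (card Xi) * h^2" using n by (intro cover_card) (auto simp: net_def)
    have "h^2 <= (1 / 2)^2" using h by (intro power_mono) auto
    then have "real (card Xi) * h^2 <= real (card Xi) * (1 / 2)^2" by (intro mult_left_mono) auto
    then have "1 < card Xi" using N by (simp add: power2_eq_square)
    note ms = mesh_sep[OF fin Xi this, folded q_def]
    have q: "0 < q" by (rule ms(1))
    have hq: "h <= rh * q" using mesh q unfolding h_def[symmetric] q_def[symmetric] by (simp add: pos_divide_le_eq)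
    have "ka * h <= ka * (rh * q)" using hq ka(1) by (intro mult_left_mono) auto
    also have "... <= (1 / 8) * q" using mult_right_mono[OF ka(3), of q] q by (simp add: mult_ac)
    finally have "2 * (ka * h) <= q / 4" by simp
    then have "(2 * (ka * h))^2 <= (q / 4)^2" using ka h by (intro power_mono) auto
    then have far: "12 * (ka * h)^2 <= 1 - xi \<bullet> ze" if "xi : Xi" "ze : Xi" "xi ~= ze" for xi ze
     using ms(2)[OF that] by (simp only: power_mult_distrib[of 2]) simp
    have sp: "sep ka h Xi" unfolding sep_def
    proof (intro ballI impI)
     fix xi ze assume "xi : Xi" "ze : Xi" "xi ~= ze"
     from far[OF this] show "3 * (ka * h)^2 <= 1 - xi \<bullet> ze" using zero_le_power2[of "ka * h"] by linarith
    qed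
    \<comment> \<open>The separation radius cannot be much larger than the fill distance: disjoint
      caps give N q^2 <= 8192, covering gives N h^2 >= 1. The lower norm bound can therefore be
      stated with q.\<close>
    have q2: "q^2 <= 8192 * h^2"
    proof -
     let ?a = "(q / 4)^2 / 2"
     obtain xi ze where z: "xi : Xi" "ze : Xi" "xi ~= ze" using \<open>1 < card Xi\<close> fin by (metis One_nat_def card_le_Suc0_iff_eq not_le)
     then have "3 * (q / 4)^2 <= 2" using order_trans[OF ms(2)[OF z] v_le] Xi by auto
     then have a: "?a <= 2" by simp
     have kq: "q / (4 * h) * h = q / 4" using h by simp
     have "(SUM ze:Xi. 1) * (area * ?a / 256) <= (SI y. 1)"
     proof (rule cap_sum[OF fin Xi _ _ h(1) _ _ a order_refl, where ka = "q / (4 * h)"])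
      show "sep (q / (4 * h)) h Xi" unfolding sep_def kq using ms(2) by blast
     qed (use q h in \<open>auto simp: kq intro: int_cont\<close>)
     also have "(SI y. 1) = area" by (simp add: area_def)
     finally have "area * (real (card Xi) * q^2) <= area * 8192" by (simp add: power_divide mult_ac)
     then have "real (card Xi) * q^2 <= 8192" using area_pos by simp
     then have "(real (card Xi) * q^2) * h^2 <= 8192 * h^2" by (rule mult_right_mono) simp
     moreover have "1 * q^2 <= (real (card Xi) * h^2) * q^2" by (rule mult_right_mono[OF N]) simp
     ultimately show ?thesis by (simp add: mult_ac)
    qed
    obtain A p v where p: "!!xi. xi : Xi ==> p xi : spherical_harmonics s" and mom: "!!xi. xi : Xi ==> moments s Xi (A xi)"
     and cA: "!!xi. xi : Xi ==> real (card {ze:Xi. A xi ze ~= 0}) <= ta * (ln (real (card Xi)))^2"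
     and dec: "!!xi x. xi : Xi ==> x : S2 ==> \<bar>pot s Xi (A xi) (p xi) x\<bar> <= C * exp (- nu * (norm (x - xi) / h)) + h powr J"
     and err: "!!xi x ze. xi : Xi ==> x : S2 ==> ze : Xi ==> \<bar>pot s Xi (A xi) (p xi) x - cutoff (ka * h) xi x\<bar> <= (C * sqrt (norm (x - ze) / h) + 25 * h) * Vw h xi x"
     and span: "kernel_space s (surface_spline s) Xi \<subseteq> fv.span (v ` Xi)"
     using lb'[OF n h(2) sp] unfolding local_system_def J_def by blast
    define b where "b xi = kfun s Xi (A xi) (p xi)" for xi
    have bx: "b xi x = pot s Xi (A xi) (p xi) x" if "x : S2" for xi x using that by (simp add: b_def kfun_eq)
    have bk: "b xi : kernel_space s (surface_spline s) Xi" if "xi : Xi" for xi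
     unfolding kernel_space_eq b_def using p[OF that] mom[OF that] by blast
    have kh: "0 < ka * h" "ka * h <= h" using ka h mult_right_mono[OF ka(2), of h] by auto
    have kh2: "(ka * h)^2 <= h^2" using kh by (intro power_mono) auto
    let ?a = "th * (ka * h)^2"
    have a: "0 < ?a" "?a <= (ka * h)^2 / 2"
     using mult_pos_pos[OF th(1) zero_less_power[OF kh(1), of 2]] mult_right_mono[OF th(3), of "(ka * h)^2"] by simp_all
    have V0: "0 <= Vw h xi x" for xi x using Vw_pos[of h xi x] by simp
    have cont: "continuous_on S2 (b xi)" if "xi : Xi" for xi
     using continuous_pot[OF s Xi] spherical_harmonics_Lop[OF p[OF that]] by (subst continuous_on_cong[OF refl bx]) auto
    have up: "\<bar>b xi x\<bar> <= C3 * Vw h xi x" if xi: "xi : Xi" and x: "x : S2" for xi x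
    proof -
     have xiS: "xi : S2" using xi Xi by auto
     obtain ze where ze: "ze : Xi" "norm (x - ze) <= h" using n x by (auto simp: net_def)
     have "C * sqrt (norm (x - ze) / h) <= C * 1" using ze(2) h C by (intro mult_left_mono) auto
     then have "(C * sqrt (norm (x - ze) / h) + 25 * h) * Vw h xi x <= (C + 25) * Vw h xi x" using h by (intro mult_right_mono V0) auto
     moreover have "cutoff (ka * h) xi x <= 100 * Vw h xi x"
     proof (cases "3 * (ka * h)^2 <= 1 - x \<bullet> xi")
      case True then show ?thesis using cutoff_zero[OF kh(1) xiS x] V0[of xi x] by simp
     next
      case False
      then have "norm (x - xi) <= 3 * (ka * h)" using kh by (intro norm_le_of_cap[OF x xiS]) auto
      then have "norm (x - xi) <= 3 * h" using kh(2) by linarith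
      then have "norm (x - xi) / h <= 3" using h(1) by (simp add: pos_divide_le_eq)
      then have "(norm (x - xi) / h)^2 <= 3^2" using h by (intro power_mono) auto
      then have "(1 + (norm (x - xi) / h)^2)^2 <= 10^2" by (intro power_mono) auto
      moreover have "0 < (1 + (norm (x - xi) / h)^2)^2" by (intro zero_less_power add_pos_nonneg) auto
      ultimately have "1 <= 100 * Vw h xi x" by (simp add: Vw_def le_divide_eq)
      then show ?thesis using cutoff_le_1[OF xiS x, of "ka * h"] by linarith
     qed
     ultimately show ?thesis using err[OF xi x ze(1)] cutoff_nonneg[of "ka * h" xi x] bx[OF x, of xi] unfolding C3_def distrib_right by linarith
    qed
    \<comment> \<open>The error estimate is used with the node ze whose cap contains x, also when xi
      is another node; this gives the small factor ep off the diagonal.\<close>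
    have lo: "if xi = ze then 1 / 2 <= b xi x + ep * Vw h xi x else \<bar>b xi x\<bar> <= ep * Vw h xi x"
     if xi: "xi : Xi" and ze: "ze : Xi" and x: "x : cap ze ?a" for xi ze x
    proof -
     have S: "x : S2" "xi : S2" "ze : S2" and v: "1 - x \<bullet> ze <= ?a" using xi ze Xi x by (auto simp: cap_def)
     let ?y = "norm (x - ze) / h"
     have "(norm (x - ze))^2 <= 2 * ?a" using v unfolding S2_norm_diff[OF S(1,3)] by simp
     also have "... <= 2 * (th * h^2)" using th(1) kh2 by (intro mult_left_mono) auto
     finally have "?y^2 <= 2 * th" using h by (simp add: power_divide pos_divide_le_eq)
     also have "... <= ((ep / (2 * C))^2)^2" using th(4) by (simp add: power_mult[symmetric])
     finally have "?y <= (ep / (2 * C))^2" by (rule power2_le_imp_le) simp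
     then have "sqrt ?y <= ep / (2 * C)" using ep C by (intro real_le_lsqrt) auto
     then have "C * sqrt ?y <= ep / 2" using C by (simp add: pos_le_divide_eq mult_ac)
     then have "(C * sqrt ?y + 25 * h) * Vw h xi x <= ep * Vw h xi x" using h(3) by (intro mult_right_mono V0) auto
     then have e: "\<bar>b xi x - cutoff (ka * h) xi x\<bar> <= ep * Vw h xi x" using err[OF xi S(1) ze] bx[OF S(1), of xi] by linarith
     show ?thesis
     proof (cases "xi = ze")
      case True
      have "?a <= th0 * (ka * h)^2" by (intro mult_right_mono th) simp
      then have "1 / 2 <= cutoff (ka * h) xi x" using v True S by (intro th0(2) kh) auto
      then show ?thesis using e True by auto
     next
      case False
      have "4 * (ka * h) <= norm (xi - ze)"
      proof (rule power2_le_imp_le)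
       have "24 * (ka * h)^2 <= (norm (xi - ze))^2" using far[OF xi ze False] unfolding S2_norm_diff[OF S(2,3)] by simp
       moreover have "(4 * (ka * h))^2 = 16 * (ka * h)^2" by (simp only: power_mult_distrib[of 4]) simp
       ultimately show "(4 * (ka * h))^2 <= (norm (xi - ze))^2" using zero_le_power2[of "ka * h"] by linarith
      qed simp
      moreover have "norm (x - ze) <= ka * h"
       by (rule power2_le_imp_le) (use v a kh S2_norm_diff[OF S(1,3)] in auto)
      moreover have "norm (xi - ze) <= norm (x - ze) + norm (x - xi)" using norm_triangle_ineq4[of "x - ze" "x - xi"] by simp
      ultimately have "3 * (ka * h) <= norm (x - xi)" by linarith
      then have "(3 * (ka * h))^2 <= (norm (x - xi))^2" using kh by (intro power_mono) auto
      moreover have "(3 * (ka * h))^2 = 9 * (ka * h)^2" by (simp only: power_mult_distrib[of 3]) simp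
      moreover have "3 * z <= y" if "9 * z <= 2 * y" "0 <= z" for z y :: real using that by linarith
      ultimately have "3 * (ka * h)^2 <= 1 - x \<bullet> xi" unfolding S2_norm_diff[OF S(1,2)] using zero_le_power2[of "ka * h"] by metis
      then have "cutoff (ka * h) xi x = 0" by (rule cutoff_zero[OF kh(1) S(2,1)])
      then show ?thesis using e False by simp
     qed
    qed
    have C30: "0 <= C3" using C by (simp add: C3_def)
    have "ALL xi:Xi. continuous_on S2 (b xi)" "ALL xi:Xi. ALL x:S2. \<bar>b xi x\<bar> <= C3 * Vw h xi x"
     and lo': "ALL xi:Xi. ALL ze:Xi. ALL x:cap ze ?a. if xi = ze then 1 / 2 <= b xi x + ep * Vw h xi x else \<bar>b xi x\<bar> <= ep * Vw h xi x"
     by (intro ballI cont up lo; assumption)+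
    note fb = frame_bounds[OF fin ne Xi sp ka(1,2) h(1,5) a this(1,2) C30 lo' less_imp_le[OF ep(1)] ep(2)[unfolded B_def], folded B_def]
    have indep: "ALL xi:Xi. u xi = 0" if "!!x. (SUM xi:Xi. u xi * b xi x) = 0" for u
     using fb(2)[of u 0] that by simp
    have "is_basis_family Xi b (kernel_space s (surface_spline s) Xi)"
     unfolding is_basis_family_def
    proof (intro conjI)
     have bs: "b xi : fv.span (v ` Xi)" if "xi : Xi" for xi using bk[OF that] span by blast
     show "inj_on b Xi" by (rule family_spans(1)[OF fin _ bs]) (rule indep)
     show "fun_vs.independent (b ` Xi)" by (rule family_spans(2)[OF fin _ bs]) (rule indep)
     have "fv.span (v ` Xi) \<subseteq> fv.span (b ` Xi)" by (rule family_spans(3)[OF fin _ bs]) (rule indep)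
     moreover have "fun_vs.span (b ` Xi) \<subseteq> kernel_space s (surface_spline s) Xi" using bk by (intro fun_vs.span_minimal subspace_kernel_space) auto
     ultimately show "fun_vs.span (b ` Xi) = kernel_space s (surface_spline s) Xi" using span by blast
    qed
    moreover have "ALL xi:Xi. (EX p:spherical_harmonics s. b xi = sphere_restrict (%x. SUM ze:Xi. A xi ze * surface_spline s x ze) + p) &
     real (card {ze:Xi. A xi ze ~= 0}) <= ta * (ln (real (card Xi)))^2" using p cA by (auto simp: b_def kfun_def)
    moreover have "\<bar>b xi x\<bar> <= E * (1 + geo_dist x xi / h) powr (- J)" if xi: "xi : Xi" and x: "x : S2" for xi x
    proof -
     have xiS: "xi : S2" using xi Xi by auto
     let ?t = "norm (x - xi) / h" and ?g = "1 + geo_dist x xi / h" and ?K = "exp (nu / 3 - J - J * ln (nu / (3 * J)))"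
     note gd = geo_dist_bounds[OF x xiS]
     have g0: "1 <= ?g" using gd(1) h by simp
     have "geo_dist x xi / h <= 3 * norm (x - xi) / h" using gd(4) h by (intro divide_right_mono) auto
     then have "(1 + 3 * ?t) powr (- J) <= ?g powr (- J)" using g0 J0 by (intro powr_mono2') auto
     then have K: "?K * (1 + 3 * ?t) powr (- J) <= ?K * ?g powr (- J)" by (rule mult_left_mono) simp
     have "0 <= ?t" using h by simp
     from order_trans[OF exp_le_powr[OF nu J0 this] K] have "exp (- nu * ?t) <= ?K * ?g powr (- J)" .
     then have "C * exp (- nu * ?t) <= C * (?K * ?g powr (- J))" using C by (intro mult_left_mono) auto
     moreover have "h powr J <= 5 powr J * ?g powr (- J)"
     proof -
      have "h * ?g <= 5" using gd(2) pi_less_4 h by (simp add: distrib_left)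
      then have "(h * ?g) powr J <= 5 powr J" using g0 h J0 by (intro powr_mono2) auto
      then have "h powr J * ?g powr J * ?g powr (- J) <= 5 powr J * ?g powr (- J)" using g0 h by (intro mult_right_mono) (auto simp: powr_mult)
      then show ?thesis using g0 by (simp add: mult.assoc powr_add[symmetric])
     qed
     ultimately show ?thesis using dec[OF xi x] bx[OF x, of xi] unfolding E_def distrib_right mult.assoc by linarith
    qed
    moreover have "c1 r * scale_factor q r * lp_norm r Xi d <= Lp_norm r (%x. SUM xi:Xi. d xi * b xi x) &
     Lp_norm r (%x. SUM xi:Xi. d xi * b xi x) <= c2 r * scale_factor q r * lp_norm r Xi d" if r: "1 <= r" for r :: ennreal and d
    proof (cases "r = top")
     case True
     let ?S = "%x. \<bar>SUM xi:Xi. d xi * b xi x\<bar>" and ?l = "SUP xi\<in>Xi. \<bar>d xi\<bar>"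
     have dl: "\<bar>d xi\<bar> <= ?l" if "xi : Xi" for xi using that fin by (intro cSUP_upper) auto
     have Su: "?S x <= C3 * B * ?l" if "x : S2" for x by (rule fb(1)[OF _ that]) (rule dl)
     have SL: "?S x <= (SUP x\<in>S2. ?S x)" if "x : S2" for x using that Su by (intro cSUP_upper bdd_aboveI2) auto
     have "\<bar>d xi\<bar> <= 4 * (SUP x\<in>S2. ?S x)" if "xi : Xi" for xi by (rule fb(2)[OF _ that]) (rule SL)
     then have "?l <= 4 * (SUP x\<in>S2. ?S x)" using ne by (intro cSUP_least) auto
     moreover have "(SUP x\<in>S2. ?S x) <= C3 * B * ?l" using Su ne Xi by (intro cSUP_least) auto
     moreover have "C3 * B * ?l <= c2 r * ?l"
      using ne dl by (intro mult_right_mono) (auto simp: c2_def True intro: order_trans[OF abs_ge_zero])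
     ultimately show ?thesis using True by (simp add: c1_def scale_factor_def lp_norm_def Lp_norm_def)
    next
     case False
     define t where "t = enn2real r"
     have t: "1 <= t" using enn2real_mono[OF r] False unfolding t_def by (simp add: top.not_eq_extremum)
     let ?I = "(SI x. \<bar>SUM xi:Xi. d xi * b xi x\<bar> powr t)" and ?S = "SUM xi:Xi. \<bar>d xi\<bar> powr t"
     have S0: "0 <= ?S" and I0: "0 <= ?I" by (auto intro!: sum_nonneg Bochner_Integration.integral_nonneg)
     have "mu * q^2 <= mu * (8192 * h^2)" using q2 mu by (intro mult_left_mono) auto
     also have "... = area * ?a / 256" by (simp add: mu_def power_mult_distrib)
     finally have "?S * (mu * q^2) <= ?S * (area * ?a / 256)" by (rule mult_left_mono[OF _ S0])
     then have lo': "?S * (mu * q^2) <= 2 * 4 powr t * ?I" using fb(4)[OF t, of d] by linarith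
     have "h^2 <= rh^2 * q^2" using power_mono[OF hq, of 2] h by (simp add: power_mult_distrib)
     then have "area * h^2 <= area * rh^2 * q^2" using area_pos by (simp add: mult.assoc)
     then have "(C3 * B) powr t * (area * h^2) * ?S <= (C3 * B) powr t * (area * rh^2 * q^2) * ?S"
      by (intro mult_right_mono mult_left_mono S0) auto
     then have up': "?I <= (C3 * B) powr t * (area * rh^2 * q^2) * ?S" using fb(3)[OF t, of d] by linarith
     have M: "0 <= area * rh^2" "0 <= C3 * B" using area_pos C30 by (auto simp: B_def)
     note L = Lp_bounds_finite[OF t q mu M S0 I0 lo' up']
     have "C3 * B * (area * rh^2) powr (1 / t) * q powr (2 / t) * ?S powr (1 / t) <= c2 r * q powr (2 / t) * ?S powr (1 / t)"
      using False by (intro mult_right_mono) (auto simp: c2_def t_def)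
     then show ?thesis using L False by (simp add: c1_def scale_factor_def lp_norm_def Lp_norm_def t_def[symmetric])
    qed
    ultimately show ?thesis unfolding localized_def J_def[symmetric] h_def[symmetric] q_def[symmetric] by blast
   qed
   then show ?thesis using H E by blast
  qed
  then show ?thesis using T ga c12 by blast
 qed
qed

theorem mainTheorem1:
  fixes s :: nat and \<rho> :: real
  assumes "s \<ge> 1" and "\<rho> > 0"
  shows "\<exists>\<tau>0 \<gamma>1 \<gamma>2 :: real. 0 < \<tau>0 \<and> 0 < \<gamma>1 \<and> \<gamma>1 \<le> \<gamma>2 \<and>
    (\<forall>\<tau>\<ge>\<tau>0. \<exists>(J::real) (H::real) (C::real) (c1 :: ennreal \<Rightarrow> real) (c2 :: ennreal \<Rightarrow> real).
      \<gamma>1 * sqrt \<tau> \<le> J \<and> J \<le> \<gamma>2 * sqrt \<tau> \<and> 0 < H \<and> 0 < C \<and>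
      (\<forall>p\<ge>1. 0 < c1 p \<and> c1 p \<le> c2 p) \<and>
      (\<forall>\<Xi> :: (real^3) set.
        finite \<Xi> \<and> \<Xi> \<noteq> {} \<and> \<Xi> \<subseteq> S2 \<and> fill_distance \<Xi> \<le> H \<and>
        fill_distance \<Xi> / separation_radius \<Xi> \<le> \<rho> \<longrightarrow>
        (\<exists>b :: real^3 \<Rightarrow> real^3 \<Rightarrow> real.
          is_basis_family \<Xi> b (kernel_space s (surface_spline s) \<Xi>) \<and>
          (\<exists>A :: real^3 \<Rightarrow> real^3 \<Rightarrow> real. \<forall>\<xi>\<in>\<Xi>.
             (\<exists>p\<in>spherical_harmonics s.
                b \<xi> = sphere_restrict (\<lambda>x. \<Sum>\<zeta>\<in>\<Xi>. A \<xi> \<zeta> * surface_spline s x \<zeta>) + p) \<and>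
             real (card {\<zeta>\<in>\<Xi>. A \<xi> \<zeta> \<noteq> 0}) \<le> \<tau> * (ln (real (card \<Xi>)))\<^sup>2) \<and>
          (\<forall>\<xi>\<in>\<Xi>. \<forall>x\<in>S2.
             \<bar>b \<xi> x\<bar> \<le> C * (1 + geo_dist x \<xi> / fill_distance \<Xi>) powr (- J)) \<and>
          (\<forall>p\<ge>1. \<forall>a :: real^3 \<Rightarrow> real.
             c1 p * scale_factor (separation_radius \<Xi>) p * lp_norm p \<Xi> a
               \<le> Lp_norm p (\<lambda>x. \<Sum>\<xi>\<in>\<Xi>. a \<xi> * b \<xi> x) \<and>
             Lp_norm p (\<lambda>x. \<Sum>\<xi>\<in>\<Xi>. a \<xi> * b \<xi> x)
               \<le> c2 p * scale_factor (separation_radius \<Xi>) p * lp_norm p \<Xi> a))))"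
proof -
 obtain T \<gamma> c1 c2 where T: "0 < T" "0 < \<gamma>" "!!p. 0 < c1 p & c1 p <= c2 p" and ex: "!!\<tau>. T <= \<tau> ==> EX H E. 0 < H & 0 < E &
  (ALL \<Xi>. finite \<Xi> & \<Xi> ~= {} & \<Xi> \<subseteq> S2 & fill_distance \<Xi> <= H & fill_distance \<Xi> / separation_radius \<Xi> <= \<rho> -->
   (EX b. localized s \<Xi> \<tau> (\<gamma> * sqrt \<tau>) E c1 c2 b))"
  using localized_exists[OF assms] by blast
 show ?thesis
 \<comment> \<open>J is exactly \<gamma> sqrt \<tau>, so one number serves for both bounds;
   \<open>c1\<close> and \<open>c2\<close> were fixed before \<tau>.\<close>
 proof (rule exI[of _ T], rule exI[of _ \<gamma>], rule exI[of _ \<gamma>], intro conjI T(1,2) order_refl, intro allI impI, goal_cases)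
  case (1 \<tau>)
  then obtain H E where HE: "0 < H" "0 < E" and b: "ALL \<Xi>. finite \<Xi> & \<Xi> ~= {} & \<Xi> \<subseteq> S2 & fill_distance \<Xi> <= H & fill_distance \<Xi> / separation_radius \<Xi> <= \<rho> -->
   (EX b. localized s \<Xi> \<tau> (\<gamma> * sqrt \<tau>) E c1 c2 b)" using ex by blast
  show ?case
   by (rule exI[of _ "\<gamma> * sqrt \<tau>"], rule exI[of _ H], rule exI[of _ E], rule exI[of _ c1], rule exI[of _ c2], intro conjI order_refl HE)
    (simp add: T(3), rule b[unfolded localized_def])
 qed
qed

end
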